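(* (a) Let $k\ge 3$ be a fixed integer and let $p=p(n)\in(0,1)$ satisfy $\frac{1}{p(1-p)}=o(n^{1/2})$ as $n\to\infty$. Then $u_k(n,p)=O\big(\max\{D(n,p),\,p(1-p)\}\,n^{k-2}\big)$, i.e. there is a constant $C>0$ such that for all sufficiently large $n$ there exists a graph $G$ on $n$ vertices with $u_k(G,p)\le C\max\{D(n,p),p(1-p)\}n^{k-2}$. (b) Let $k\ge 4$ be a fixed integer and let $p=p(n)\in(0,1)$. Then $u_k(n,p)=\Omega\big(\max\{D(n,p),\,p(1-p)\}\,n^{k-2}\big)$, i.e. there is a constant $c>0$ such that for all sufficiently large $n$ every graph $G$ on $n$ vertices satisfies $u_k(G,p)\ge c\max\{D(n,p),p(1-p)\}n^{k-2}$.
   Context: For graphs $F,G$, $N(F,G)$ denotes the number of induced subgraphs of $G$ isomorphic to $F$. $\mathcal{G}(n,p)$ is the Erdős–Rényi random graph on $n$ vertices with edge probability $p$; for a $k$-vertex graph $F$ with $k\le n$, $\mathbb{E}[N(F,\mathcal{G}(n,p))]=\frac{n(n-1)\cdots(n-k+1)}{|\mathrm{Aut}(F)|}p^{e(F)}(1-p)^{\binom k2-e(F)}$. For a graph $G$ on $n$ vertices, $u_k(G,p):=\max\{N(F,G)-\mathbb{E}[N(F,\mathcal{G}(n,p))] : F \text{ a graph with } v(F)=k\}$, and $u_k(n,p):=\min\{u_k(G,p): v(G)=n\}$. $D(n,p)$ denotes the distance from $p\binom n2$ to the nearest integer. Asymptotic notation is as $n\to\infty$ with $k$ fixed; constants depend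 only on $k$. *)

theory Defs
  imports
    "HOL-Probability.Probability"
    "HOL-Probability.Product_PMF"
    "HOL-Library.Ramsey"
    "HOL-Library.Landau_Symbols"
begin

section \<open>Finite simple graphs\<close>

type_synonym 'a graph = "'a set \<times> 'a set set"

abbreviation verts :: "'a graph \<Rightarrow> 'a set" where "verts G \<equiv> fst G"

abbreviation edges :: "'a graph \<Rightarrow> 'a set set" where "edges G \<equiv> snd G"

definition simple_graph :: "'a graph \<Rightarrow> bool" where
  "simple_graph G \<longleftrightarrow> finite (verts G) \<and> edges G \<subseteq> [verts G]\<^bsup>2\<^esup>"

definition graph_iso :: "'a graph \<Rightarrow> 'b graph \<Rightarrow> bool" where
  "graph_iso F G \<longleftrightarrow> (\<exists>f. bij_betw f (verts F) (verts G) \<and> edges G = (image f) ` edges F)"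

definition induced_subgraph :: "'a graph \<Rightarrow> 'a set \<Rightarrow> 'a graph" where
  "induced_subgraph G S = (S, {e \<in> edges G. e \<subseteq> S})"

definition num_induced :: "'b graph \<Rightarrow> 'a graph \<Rightarrow> nat" where
  "num_induced F G = card {S. S \<subseteq> verts G \<and> graph_iso (induced_subgraph G S) F}"


section \<open>The random graph\<close>

definition erdos_renyi :: "nat \<Rightarrow> real \<Rightarrow> nat graph pmf" where
  "erdos_renyi n p =
     map_pmf (\<lambda>b. ({..<n}, {e \<in> [{..<n}]\<^bsup>2\<^esup>. b e}))
       (Pi_pmf ([{..<n}]\<^bsup>2\<^esup>) False (\<lambda>_. bernoulli_pmf p))"

definition expected_num_induced :: "'b graph \<Rightarrow> nat \<Rightarrow> real \<Rightarrow> real" where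
  "expected_num_induced F n p =
     measure_pmf.expectation (erdos_renyi n p) (\<lambda>G. real (num_induced F G))"


section \<open>The quantities \<open>u\<^sub>k\<close> and \<open>D\<close>\<close>

text \<open>
  Graphs with vertices in the natural numbers represent all isomorphism types of finite graphs.
  There are infinitely many of them on \<open>k\<close> vertices, but the maximum and the minimum below range
  over finite nonempty sets of values; see the lemmas that follow.
\<close>

definition deviations :: "nat \<Rightarrow> 'a graph \<Rightarrow> real \<Rightarrow> real set" where
  "deviations k G p =
     {real (num_induced F G) - expected_num_induced F (card (verts G)) p
       | F :: nat graph. simple_graph F \<and> card (verts F) = k}"

definition u_graph :: "nat \<Rightarrow> 'a graph \<Rightarrow> real \<Rightarrow> real" where
  "u_graph k G p = Max (deviations k G p)"

definition u_min :: "nat \<Rightarrow> nat \<Rightarrow> real \<Rightarrow> real" where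
  "u_min k n p =
     Min {u_graph k G p | G :: nat graph. simple_graph G \<and> card (verts G) = n}"

definition int_dist :: "nat \<Rightarrow> real \<Rightarrow> real" where
  "int_dist n p =
     \<bar>p * real (n choose 2) - of_int (round (p * real (n choose 2)))\<bar>"


section \<open>The extrema are attained\<close>

lemma graph_iso_trans:
  assumes "graph_iso F G" "graph_iso G H" shows "graph_iso F H"
proof -
  obtain f g where fg: "bij_betw f (verts F) (verts G)" "edges G = (image f) ` edges F"
      "bij_betw g (verts G) (verts H)" "edges H = (image g) ` edges G"
    using assms by (auto simp: graph_iso_def)
  have "bij_betw (g \<circ> f) (verts F) (verts H)"
    by (rule bij_betw_trans[OF fg(1,3)])
  moreover have "edges H = (image (g \<circ> f)) ` edges F"
    by (simp only: fg(2,4) image_image comp_def)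
  ultimately show ?thesis by (auto simp: graph_iso_def)
qed

lemma graph_iso_sym:
  assumes "simple_graph F" "graph_iso F G" shows "graph_iso G F"
proof -
  obtain f where f: "bij_betw f (verts F) (verts G)" "edges G = (image f) ` edges F"
    using assms by (auto simp: graph_iso_def)
  let ?g = "inv_into (verts F) f"
  have "?g ` f ` e = e" if "e \<in> edges F" for e
  proof -
    have "e \<subseteq> verts F" using assms(1) that by (auto simp: simple_graph_def nsets_def)
    then show ?thesis using f(1) by (meson bij_betw_def inv_into_image_cancel)
  qed
  then have "(image ?g) ` edges G = edges F"
    by (simp add: f(2) image_image)
  moreover have "bij_betw ?g (verts G) (verts F)" using f(1) by (rule bij_betw_inv_into)
  ultimately show ?thesis unfolding graph_iso_def by metis
qed

lemma num_induced_cong_iso: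
  assumes "simple_graph F" "graph_iso F F'"
  shows "num_induced F (G :: 'c graph) = num_induced F' G"
proof -
  have "graph_iso H F \<longleftrightarrow> graph_iso H F'" for H :: "'c graph"
    using assms graph_iso_trans[of H F F'] graph_iso_trans[of H F' F] graph_iso_sym[of F F'] by blast
  then show ?thesis by (simp add: num_induced_def)
qed

lemma ex_iso_canonical:
  assumes "simple_graph F" "card (verts F) = k"
  obtains F' :: "nat graph" where "simple_graph F'" "verts F' = {..<k}" "graph_iso F F'"
proof -
  have fin: "finite (verts F)" and E: "edges F \<subseteq> [verts F]\<^bsup>2\<^esup>"
    using assms(1) by (auto simp: simple_graph_def)
  obtain f where f: "bij_betw f (verts F) {..<k}"
    using ex_bij_betw_finite_nat[OF fin] assms(2) by (auto simp: atLeast0LessThan)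
  let ?F = "({..<k}, (image f) ` edges F)"
  have "f ` e \<in> [{..<k}]\<^bsup>2\<^esup>" if "e \<in> edges F" for e
  proof -
    have e: "e \<subseteq> verts F" "finite e" "card e = 2" using E that by (auto simp: nsets_def)
    have "card (f ` e) = 2" "f ` e \<subseteq> {..<k}"
      using e f by (auto simp: bij_betw_def card_image inj_on_subset)
    then show ?thesis using e by (auto simp: nsets_def)
  qed
  then have "simple_graph ?F" by (auto simp: simple_graph_def)
  moreover have "graph_iso F ?F" using f by (auto simp: graph_iso_def)
  ultimately show ?thesis using that by auto
qed

lemma finite_canonical: "finite {F :: nat graph. simple_graph F \<and> verts F = {..<k}}"
proof (rule finite_subset)
  show "{F :: nat graph. simple_graph F \<and> verts F = {..<k}} \<subseteq> {{..<k}} \<times> Pow ([{..<k}]\<^bsup>2\<^esup>)"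
    by (auto simp: simple_graph_def)
  show "finite ({{..<k}} \<times> Pow ([{..<k}]\<^bsup>2\<^esup>))"
    by (simp add: finite_imp_finite_nsets)
qed

lemma deviations_eq_image:
  "deviations k G p =
     (\<lambda>F. real (num_induced F G) - expected_num_induced F (card (verts G)) p) `
       {F :: nat graph. simple_graph F \<and> verts F = {..<k}}" (is "_ = ?d ` ?A")
proof
  show "deviations k G p \<subseteq> ?d ` ?A"
  proof
    fix x assume "x \<in> deviations k G p"
    then obtain F :: "nat graph" where F: "simple_graph F" "card (verts F) = k" "x = ?d F"
      by (auto simp: deviations_def)
    obtain F' :: "nat graph" where F': "simple_graph F'" "verts F' = {..<k}" "graph_iso F F'"
      using ex_iso_canonical[OF F(1,2)] .
    have "?d F = ?d F'"
      unfolding expected_num_induced_def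
      by (simp add: num_induced_cong_iso[OF F(1) F'(3), where ?'c = 'a]
          num_induced_cong_iso[OF F(1) F'(3), where ?'c = nat])
    then show "x \<in> ?d ` ?A" using F(3) F'(1,2) by auto
  qed
  show "?d ` ?A \<subseteq> deviations k G p"
    unfolding deviations_def by force
qed

lemma deviations_finite: "finite (deviations k G p)"
  by (simp add: deviations_eq_image finite_canonical)

lemma deviations_nonempty: "deviations k G p \<noteq> {}"
proof -
  have "({..<k}, {}) \<in> {F :: nat graph. simple_graph F \<and> verts F = {..<k}}"
    by (simp add: simple_graph_def)
  then show ?thesis unfolding deviations_eq_image by blast
qed

lemma u_graph_values_finite:
  "finite {u_graph k G p | G :: nat graph. simple_graph G \<and> card (verts G) = n}"
proof (rule finite_subset)
  let ?A = "{F :: nat graph. simple_graph F \<and> verts F = {..<k}}"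
  let ?B = "(\<lambda>(m, F). real m - expected_num_induced F n p) ` ({..2 ^ n} \<times> ?A)"
  show "finite ?B" by (simp add: finite_canonical)
  show "{u_graph k G p | G :: nat graph. simple_graph G \<and> card (verts G) = n} \<subseteq> ?B"
  proof
    fix x assume "x \<in> {u_graph k G p | G :: nat graph. simple_graph G \<and> card (verts G) = n}"
    then obtain G :: "nat graph"
      where G: "simple_graph G" "card (verts G) = n" "x = u_graph k G p" by auto
    have fin: "finite (verts G)" using G(1) by (simp add: simple_graph_def)
    have "x \<in> deviations k G p"
      using Max_in[OF deviations_finite deviations_nonempty] G(3) by (simp add: u_graph_def)
    then obtain F where F: "F \<in> ?A" "x = real (num_induced F G) - expected_num_induced F n p"
      using G(2) by (auto simp: deviations_eq_image)
    have "num_induced F G \<le> card (Pow (verts G))"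
      unfolding num_induced_def by (rule card_mono) (use fin in auto)
    then have "num_induced F G \<in> {..2 ^ n}" using G(2) fin by (simp add: card_Pow)
    with F show "x \<in> ?B" by (intro image_eqI[of _ _ "(num_induced F G, F)"]) auto
  qed
qed

lemma u_graph_values_nonempty:
  "{u_graph k G p | G :: nat graph. simple_graph G \<and> card (verts G) = n} \<noteq> {}"
proof -
  have "simple_graph ({..<n}, {}) \<and> card (verts ({..<n}, {})) = n"
    by (simp add: simple_graph_def)
  then show ?thesis by blast
qed

end

theory Submission
  imports Defs
begin

text \<open>
  Write \<open>\<alpha>\<close> for the centred indicator of the edges of \<open>G\<close>. The deviation of every induced count is a
  bounded combination of the sums \<open>X\<^sub>H\<close> of \<open>\<Prod>e\<in>H. \<alpha> (\<phi> ` e)\<close> over injections \<open>\<phi>\<close> of the vertices into \<open>G\<close>,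
  and conversely. The lower bound follows from the identity
  \<open>X\<^bsub>2K2\<^esub> = X\<^bsub>K2\<^esub>\<^sup>2 - 4 X\<^bsub>P3\<^esub> - 2 \<Sum>\<alpha>\<^sup>2\<close>, whose last sum is essentially \<open>p (1 - p) n (n - 1)\<close>, together with
  \<open>\<bar>X\<^bsub>K2\<^esub>\<bar> \<ge> 2 D\<close>.

  For the upper bound, a random graph has all \<open>X\<^sub>H\<close> with at least four vertices small enough, but \<open>X\<^bsub>K2\<^esub>\<close>,
  \<open>X\<^bsub>P3\<^esub>\<close> and \<open>X\<^bsub>K3\<^esub>\<close> are too large. They are corrected on a sparse set of reserved pairs, organised in
  disjoint complete bipartite blocks. A first group of blocks fixes the number of edges. In a second
  group, switching the edges of a vertex pair changes degrees but not the number of edges; in a third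
  group, switching a four-cycle changes triangles but not degrees. A single switch changes the target
  by little while all switches together outweigh the initial error, so a discrete intermediate value
  argument brings \<open>X\<^bsub>P3\<^esub>\<close> and \<open>X\<^bsub>K3\<^esub>\<close> to the order of a single switch.
\<close>

section \<open>Sums over injections\<close>

definition injections :: "'i set \<Rightarrow> 'a set \<Rightarrow> ('i \<Rightarrow> 'a) set" where
  "injections I V = {\<phi> \<in> I \<rightarrow>\<^sub>E V. inj_on \<phi> I}"

lemma finite_injections: "finite I \<Longrightarrow> finite V \<Longrightarrow> finite (injections I V)"
  unfolding injections_def by (rule finite_subset[of _ "I \<rightarrow>\<^sub>E V"]) (auto simp: finite_PiE)

lemma injections_empty [simp]: "injections {} V = {\<lambda>_. undefined}"
  by (auto simp: injections_def)

lemma restrict_injections: "\<phi> \<in> injections U V \<Longrightarrow> W \<subseteq> U \<Longrightarrow> restrict \<phi> W \<in> injections W V"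
  by (auto simp: injections_def inj_on_def)

lemma inj_on_image_injections:
  assumes "\<phi> \<in> injections I V" "H \<subseteq> Pow I" shows "inj_on (image \<phi>) H"
  using assms inj_on_image_Pow inj_on_subset unfolding injections_def by blast

lemma image_pair_injections:
  assumes "\<phi> \<in> injections I V" "e \<in> [I]\<^bsup>2\<^esup>" shows "\<phi> ` e \<in> [V]\<^bsup>2\<^esup>"
proof -
  have "e \<subseteq> I" "card e = 2" "finite e" "inj_on \<phi> I" "\<phi> \<in> I \<rightarrow> V"
    using assms by (auto simp: injections_def nsets_def)
  then show ?thesis by (auto simp: nsets_def card_image inj_on_subset)
qed

lemma sum_injections_insert:
  fixes g :: "('i \<Rightarrow> 'a) \<Rightarrow> 'b::comm_monoid_add"
  assumes "x \<notin> I" "finite I" "finite V"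
  shows "(\<Sum>\<phi>\<in>injections (insert x I) V. g \<phi>)
       = (\<Sum>\<phi>\<in>injections I V. \<Sum>v\<in>V - \<phi> ` I. g (\<phi>(x := v)))"
proof -
  have "(\<Sum>\<phi>\<in>injections I V. \<Sum>v\<in>V - \<phi> ` I. g (\<phi>(x := v)))
      = (\<Sum>(\<phi>, v)\<in>(SIGMA \<phi>:injections I V. V - \<phi> ` I). g (\<phi>(x := v)))"
    by (subst sum.Sigma) (use assms in \<open>auto simp: finite_injections\<close>)
  also have "\<dots> = (\<Sum>\<phi>\<in>injections (insert x I) V. g \<phi>)"
  proof (rule sum.reindex_bij_witness[where i = "\<lambda>\<phi>. (\<phi>(x := undefined), \<phi> x)"
        and j = "\<lambda>(\<phi>, v). \<phi>(x := v)"], goal_cases)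
    case (1 a)
    then show ?case using assms(1)
      by (auto simp: injections_def PiE_def extensional_def fun_eq_iff)
  next
    case (2 a)
    then obtain \<phi> v where a: "a = (\<phi>, v)" "\<phi> \<in> injections I V" "v \<in> V" "v \<notin> \<phi> ` I" by auto
    then have "inj_on (\<phi>(x := v)) (insert x I)"
      using assms(1) by (auto simp: injections_def inj_on_def)
    then show ?case using a assms(1)
      by (auto simp: injections_def PiE_def extensional_def)
  next
    case (3 \<phi>)
    then show ?case by simp
  next
    case (4 \<phi>)
    then have "\<phi> x \<notin> \<phi>(x := undefined) ` I" "inj_on (\<phi>(x := undefined)) I"
      using assms(1) by (auto simp: injections_def inj_on_def)
    then show ?case using 4 assms(1)
      by (auto simp: injections_def PiE_def extensional_def)
  next
    case (5 a) then show ?case by auto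
  qed
  finally show ?thesis by simp
qed

definition extension_count :: "nat \<Rightarrow> nat \<Rightarrow> nat \<Rightarrow> real" where
  "extension_count n h d = (\<Prod>i<d. real (n - h - i))"

lemma extension_count_le: "extension_count n h d \<le> real n ^ d"
proof -
  have "extension_count n h d \<le> (\<Prod>i<d. real n)"
    unfolding extension_count_def by (intro prod_mono) auto
  then show ?thesis by simp
qed

lemma extension_count_nonneg: "0 \<le> extension_count n h d"
  unfolding extension_count_def by (intro prod_nonneg) auto

lemma extension_count_ge:
  assumes "h + d \<le> k" shows "real (n - k) ^ d \<le> extension_count n h d"
proof -
  have "(\<Prod>i<d. real (n - k)) \<le> extension_count n h d"
    unfolding extension_count_def using assms by (intro prod_mono) auto
  then show ?thesis by simp
qed

lemma sum_injections_restrict: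
  fixes f :: "('i \<Rightarrow> 'a) \<Rightarrow> real"
  assumes "finite D" "finite U" "U \<inter> D = {}" "finite V"
  shows "(\<Sum>\<phi>\<in>injections (U \<union> D) V. f (restrict \<phi> U))
       = extension_count (card V) (card U) (card D) * (\<Sum>\<psi>\<in>injections U V. f \<psi>)"
  using assms
proof (induction D rule: finite_induct)
  case empty
  have "restrict \<phi> U = \<phi>" if "\<phi> \<in> injections U V" for \<phi>
    using that by (auto simp: injections_def PiE_def extensional_restrict)
  then show ?case by (simp add: extension_count_def)
next
  case (insert x D)
  have "(\<Sum>\<phi>\<in>injections (U \<union> insert x D) V. f (restrict \<phi> U))
      = (\<Sum>\<phi>\<in>injections (U \<union> D) V. \<Sum>v\<in>V - \<phi> ` (U \<union> D). f (restrict (\<phi>(x := v)) U))"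
    using sum_injections_insert[of x "U \<union> D" V "\<lambda>\<phi>. f (restrict \<phi> U)"] insert by simp
  also have "\<dots> = (\<Sum>\<phi>\<in>injections (U \<union> D) V. real (card V - card U - card D) * f (restrict \<phi> U))"
  proof (rule sum.cong[OF refl])
    fix \<phi> assume \<phi>: "\<phi> \<in> injections (U \<union> D) V"
    have "restrict (\<phi>(x := v)) U = restrict \<phi> U" for v
      using insert by (auto simp: restrict_def fun_eq_iff)
    moreover have "card (V - \<phi> ` (U \<union> D)) = card V - card U - card D"
    proof -
      have "\<phi> ` (U \<union> D) \<subseteq> V" "card (\<phi> ` (U \<union> D)) = card (U \<union> D)"
        using \<phi> by (auto simp: injections_def card_image)
      moreover have "card (U \<union> D) = card U + card D"
        using insert by (intro card_Un_disjoint) auto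
      ultimately show ?thesis using insert by (simp add: card_Diff_subset finite_subset)
    qed
    ultimately show "(\<Sum>v\<in>V - \<phi> ` (U \<union> D). f (restrict (\<phi>(x := v)) U))
        = real (card V - card U - card D) * f (restrict \<phi> U)" by simp
  qed
  also have "\<dots> = extension_count (card V) (card U) (card (insert x D)) * (\<Sum>\<psi>\<in>injections U V. f \<psi>)"
    unfolding sum_distrib_left[symmetric]
    using insert.IH[OF insert.prems(1)] insert by (simp add: extension_count_def restrict_def)
  finally show ?case .
qed

lemma card_injections:
  "finite K \<Longrightarrow> finite V \<Longrightarrow> real (card (injections K V)) = extension_count (card V) 0 (card K)"
  using sum_injections_restrict[of K "{}" V "\<lambda>_. 1"] by simp

definition inj_sum :: "'a set \<Rightarrow> ('a set \<Rightarrow> real) \<Rightarrow> 'i set \<Rightarrow> 'i set set \<Rightarrow> real" where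
  "inj_sum V \<alpha> I H = (\<Sum>\<phi>\<in>injections I V. \<Prod>e\<in>H. \<alpha> (\<phi> ` e))"

lemma inj_sum_support:
  assumes "finite K" "finite V" "\<Union>H \<subseteq> K"
  shows "inj_sum V \<alpha> K H
       = extension_count (card V) (card (\<Union>H)) (card K - card (\<Union>H)) * inj_sum V \<alpha> (\<Union>H) H"
proof -
  let ?U = "\<Union>H"
  have K: "K = ?U \<union> (K - ?U)" using assms by auto
  have finite_U: "finite ?U" using assms finite_subset by blast
  have "inj_sum V \<alpha> K H = (\<Sum>\<phi>\<in>injections (?U \<union> (K - ?U)) V. \<Prod>e\<in>H. \<alpha> (restrict \<phi> ?U ` e))"
    unfolding inj_sum_def K[symmetric]
  proof (intro sum.cong prod.cong refl arg_cong[where f = \<alpha>])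
    fix \<phi> e assume "e \<in> H"
    then show "\<phi> ` e = restrict \<phi> ?U ` e" by (intro image_cong) auto
  qed
  also have "\<dots> = extension_count (card V) (card ?U) (card (K - ?U)) * inj_sum V \<alpha> ?U H"
    unfolding inj_sum_def
    by (subst sum_injections_restrict[where f = "\<lambda>\<phi>. \<Prod>e\<in>H. \<alpha> (\<phi> ` e)"])
       (use assms finite_U in auto)
  finally show ?thesis using assms finite_U by (simp add: card_Diff_subset)
qed

section \<open>Embeddings and induced subgraphs\<close>

definition pullback :: "'a graph \<Rightarrow> 'i set \<Rightarrow> ('i \<Rightarrow> 'a) \<Rightarrow> 'i set set" where
  "pullback G K \<phi> = {e \<in> [K]\<^bsup>2\<^esup>. \<phi> ` e \<in> edges G}"

definition embeddings :: "'i set \<Rightarrow> 'i set set \<Rightarrow> 'a graph \<Rightarrow> ('i \<Rightarrow> 'a) set" where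
  "embeddings K F G = {\<phi> \<in> injections K (verts G). pullback G K \<phi> = F}"

abbreviation automorphisms :: "'i set \<Rightarrow> 'i set set \<Rightarrow> ('i \<Rightarrow> 'i) set" where
  "automorphisms K F \<equiv> embeddings K F (K, F)"

lemma pullback_subset: "pullback G K \<phi> \<subseteq> [K]\<^bsup>2\<^esup>"
  by (auto simp: pullback_def)

lemma pullback_cong:
  assumes "\<And>x. x \<in> K \<Longrightarrow> \<phi> x = \<psi> x" shows "pullback G K \<phi> = pullback G K \<psi>"
proof -
  have "\<phi> ` e = \<psi> ` e" if "e \<in> [K]\<^bsup>2\<^esup>" for e
    using that assms by (intro image_cong) (auto simp: nsets_def)
  then show ?thesis by (auto simp: pullback_def)
qed

lemma edges_induced_eq_image_pullback:
  assumes G: "simple_graph G" and \<phi>: "inj_on \<phi> K"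
  shows "edges (induced_subgraph G (\<phi> ` K)) = image \<phi> ` pullback G K \<phi>"
proof
  show "edges (induced_subgraph G (\<phi> ` K)) \<subseteq> image \<phi> ` pullback G K \<phi>"
  proof
    fix e assume "e \<in> edges (induced_subgraph G (\<phi> ` K))"
    then have e: "e \<in> edges G" "e \<subseteq> \<phi> ` K" by (auto simp: induced_subgraph_def)
    then obtain d where d: "d \<subseteq> K" "e = \<phi> ` d" by (meson subset_imageE)
    have "card e = 2" using G e(1) by (auto simp: simple_graph_def nsets_def)
    then have "card d = 2" using \<phi> d by (metis card_image inj_on_subset)
    then have "d \<in> [K]\<^bsup>2\<^esup>" using d(1) by (auto simp: nsets_def intro: card_ge_0_finite)
    then show "e \<in> image \<phi> ` pullback G K \<phi>" using e d by (auto simp: pullback_def)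
  qed
  show "image \<phi> ` pullback G K \<phi> \<subseteq> edges (induced_subgraph G (\<phi> ` K))"
    by (auto simp: pullback_def induced_subgraph_def nsets_def)
qed

lemma graph_iso_induced_iff:
  assumes G: "simple_graph G" and F: "F \<subseteq> [K]\<^bsup>2\<^esup>" and K: "finite K" and S: "S \<subseteq> verts G"
  shows "graph_iso (induced_subgraph G S) (K, F) \<longleftrightarrow> (\<exists>\<phi>\<in>embeddings K F G. \<phi> ` K = S)"
proof -
  have F_eq_iff: "edges (induced_subgraph G S) = image f ` F \<longleftrightarrow> pullback G K f = F"
    if f: "bij_betw f K S" for f
  proof -
    have "edges (induced_subgraph G S) = image f ` pullback G K f"
      using f edges_induced_eq_image_pullback[OF G, of f K] by (auto simp: bij_betw_def)
    moreover have "inj_on (image f) (Pow K)" using f by (simp add: bij_betw_def inj_on_image_Pow)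
    moreover have "F \<subseteq> Pow K" "pullback G K f \<subseteq> Pow K" using F by (auto simp: pullback_def nsets_def)
    ultimately show ?thesis by (metis inj_on_image_eq_iff)
  qed
  have "simple_graph (induced_subgraph G S)"
    using G S finite_subset by (auto simp: simple_graph_def induced_subgraph_def nsets_def)
  moreover have "simple_graph (K, F)" using K F by (simp add: simple_graph_def)
  ultimately have "graph_iso (induced_subgraph G S) (K, F) \<longleftrightarrow> graph_iso (K, F) (induced_subgraph G S)"
    using graph_iso_sym[of "induced_subgraph G S" "(K, F)"] graph_iso_sym[of "(K, F)" "induced_subgraph G S"]
    by blast
  also have "\<dots> \<longleftrightarrow> (\<exists>f. bij_betw f K S \<and> pullback G K f = F)"
    using F_eq_iff by (simp add: graph_iso_def induced_subgraph_def cong: conj_cong)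
  also have "\<dots> \<longleftrightarrow> (\<exists>\<phi>\<in>embeddings K F G. \<phi> ` K = S)"
  proof
    assume "\<exists>f. bij_betw f K S \<and> pullback G K f = F"
    then obtain f where f: "bij_betw f K S" "pullback G K f = F" by blast
    then have "restrict f K \<in> embeddings K F G" "restrict f K ` K = S"
      using S pullback_cong[of K "restrict f K" f G]
      by (auto simp: embeddings_def injections_def bij_betw_def)
    then show "\<exists>\<phi>\<in>embeddings K F G. \<phi> ` K = S" by blast
  qed (auto simp: embeddings_def injections_def bij_betw_def)
  finally show ?thesis .
qed

lemma pullback_comp:
  assumes "\<pi> \<in> injections K K"
  shows "pullback G K (\<phi> \<circ> \<pi>) = pullback (K, pullback G K \<phi>) K \<pi>"
  using image_pair_injections[OF assms] by (auto simp: pullback_def image_comp)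

lemma compose_embedding_automorphism:
  assumes K: "finite K" and \<phi>\<^sub>0: "\<phi>\<^sub>0 \<in> embeddings K F G" and \<pi>: "\<pi> \<in> automorphisms K F"
  shows "compose K \<phi>\<^sub>0 \<pi> \<in> embeddings K F G" "compose K \<phi>\<^sub>0 \<pi> ` K = \<phi>\<^sub>0 ` K"
proof -
  have inj: "inj_on \<phi>\<^sub>0 K" and sub: "\<phi>\<^sub>0 ` K \<subseteq> verts G" and F: "pullback G K \<phi>\<^sub>0 = F"
    using \<phi>\<^sub>0 by (auto simp: embeddings_def injections_def)
  have i: "\<pi> \<in> injections K K" and "pullback (K, F) K \<pi> = F" using \<pi> by (auto simp: embeddings_def)
  then have im: "\<pi> ` K = K" using K endo_inj_surj[of K \<pi>] by (auto simp: injections_def)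
  have "pullback G K (compose K \<phi>\<^sub>0 \<pi>) = pullback G K (\<phi>\<^sub>0 \<circ> \<pi>)"
    by (rule pullback_cong) (simp add: compose_def)
  also have "\<dots> = pullback (K, F) K \<pi>" using pullback_comp[OF i, of G \<phi>\<^sub>0] F by (simp only:)
  also have "\<dots> = F" by fact
  finally have "pullback G K (compose K \<phi>\<^sub>0 \<pi>) = F" .
  moreover have "inj_on (compose K \<phi>\<^sub>0 \<pi>) K"
    using i im inj by (intro inj_on_compose) (auto simp: injections_def bij_betw_def)
  moreover show "compose K \<phi>\<^sub>0 \<pi> ` K = \<phi>\<^sub>0 ` K" using im by (force simp: compose_def)
  ultimately show "compose K \<phi>\<^sub>0 \<pi> \<in> embeddings K F G"
    using sub compose_extensional[of K \<phi>\<^sub>0 \<pi>] by (auto simp: embeddings_def injections_def PiE_def)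
qed

lemma compose_inv_embedding:
  assumes \<phi>\<^sub>0: "\<phi>\<^sub>0 \<in> embeddings K F G" and \<phi>: "\<phi> \<in> embeddings K F G" "\<phi> ` K = \<phi>\<^sub>0 ` K"
  shows "compose K (inv_into K \<phi>\<^sub>0) \<phi> \<in> automorphisms K F"
    and "compose K \<phi>\<^sub>0 (compose K (inv_into K \<phi>\<^sub>0) \<phi>) = \<phi>"
proof -
  let ?\<pi> = "compose K (inv_into K \<phi>\<^sub>0) \<phi>"
  have F: "pullback G K \<phi>\<^sub>0 = F" using \<phi>\<^sub>0 by (auto simp: embeddings_def)
  have \<phi>': "\<phi> \<in> extensional K" "inj_on \<phi> K" "pullback G K \<phi> = F"
    using \<phi> by (auto simp: embeddings_def injections_def PiE_def)
  have inverse: "\<phi>\<^sub>0 (?\<pi> x) = \<phi> x" if "x \<in> K" for x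
  proof -
    have "\<phi> x \<in> \<phi>\<^sub>0 ` K" using that by (simp flip: \<phi>(2))
    then show ?thesis using that by (simp add: compose_def f_inv_into_f)
  qed
  show "compose K \<phi>\<^sub>0 ?\<pi> = \<phi>"
    by (rule extensionalityI[OF compose_extensional \<phi>'(1)]) (simp only: compose_eq[of _ K \<phi>\<^sub>0] inverse)
  have "inj_on ?\<pi> K"
    using \<phi>' \<phi>(2) by (intro inj_on_compose[of _ _ "\<phi>\<^sub>0 ` K"]) (simp_all add: bij_betw_def inj_on_inv_into)
  moreover have "?\<pi> ` K \<subseteq> K" using \<phi>(2) by (auto simp: compose_def intro!: inv_into_into)
  ultimately have i: "?\<pi> \<in> injections K K"
    using compose_extensional[of K "inv_into K \<phi>\<^sub>0" \<phi>] by (auto simp: injections_def PiE_def)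
  have "pullback (K, F) K ?\<pi> = pullback G K (\<phi>\<^sub>0 \<circ> ?\<pi>)" using pullback_comp[OF i, of G \<phi>\<^sub>0] F by (simp only:)
  also have "\<dots> = pullback G K \<phi>" by (rule pullback_cong) (simp add: inverse)
  finally show "?\<pi> \<in> automorphisms K F" using i \<phi>'(3) by (simp add: embeddings_def)
qed

lemma card_embeddings_onto:
  assumes K: "finite K" and \<phi>\<^sub>0: "\<phi>\<^sub>0 \<in> embeddings K F G"
  shows "card {\<phi> \<in> embeddings K F G. \<phi> ` K = \<phi>\<^sub>0 ` K} = card (automorphisms K F)"
proof -
  let ?\<psi> = "inv_into K \<phi>\<^sub>0" and ?onto = "{\<phi> \<in> embeddings K F G. \<phi> ` K = \<phi>\<^sub>0 ` K}"
  have inj: "inj_on \<phi>\<^sub>0 K" using \<phi>\<^sub>0 by (auto simp: embeddings_def injections_def)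
  have "bij_betw (compose K \<phi>\<^sub>0) (automorphisms K F) ?onto"
  proof (rule bij_betw_byWitness[where f' = "compose K ?\<psi>"])
    show "\<forall>\<pi>\<in>automorphisms K F. compose K ?\<psi> (compose K \<phi>\<^sub>0 \<pi>) = \<pi>"
    proof
      fix \<pi> assume "\<pi> \<in> automorphisms K F"
      then have \<pi>: "\<pi> \<in> extensional K" "\<pi> \<in> K \<rightarrow> K" by (auto simp: embeddings_def injections_def PiE_def)
      show "compose K ?\<psi> (compose K \<phi>\<^sub>0 \<pi>) = \<pi>"
      proof (rule extensionalityI[OF compose_extensional \<pi>(1)])
        fix x assume "x \<in> K"
        then show "compose K ?\<psi> (compose K \<phi>\<^sub>0 \<pi>) x = \<pi> x"
          using inj funcset_mem[OF \<pi>(2)] by (simp add: compose_def)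
      qed
    qed
    show "\<forall>\<phi>\<in>?onto. compose K \<phi>\<^sub>0 (compose K ?\<psi> \<phi>) = \<phi>" "compose K ?\<psi> ` ?onto \<subseteq> automorphisms K F"
      using compose_inv_embedding[OF \<phi>\<^sub>0] by auto
    show "compose K \<phi>\<^sub>0 ` automorphisms K F \<subseteq> ?onto"
      using compose_embedding_automorphism[OF K \<phi>\<^sub>0] by (intro image_subsetI CollectI conjI)
  qed
  from bij_betw_same_card[OF this] show ?thesis by (rule sym)
qed

lemma finite_embeddings: "finite K \<Longrightarrow> finite (verts G) \<Longrightarrow> finite (embeddings K F G)"
  unfolding embeddings_def by (simp add: finite_injections)

lemma card_embeddings:
  assumes G: "simple_graph G" and K: "finite K" and F: "F \<subseteq> [K]\<^bsup>2\<^esup>"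
  shows "card (embeddings K F G) = card (automorphisms K F) * num_induced (K, F) G"
proof -
  define copies where "copies = {S. S \<subseteq> verts G \<and> graph_iso (induced_subgraph G S) (K, F)}"
  have V: "finite (verts G)" using G by (simp add: simple_graph_def)
  have "finite copies" unfolding copies_def using V by auto
  have copies: "S \<in> copies \<longleftrightarrow> (\<exists>\<phi>\<in>embeddings K F G. \<phi> ` K = S)" for S
    using graph_iso_induced_iff[OF G F K, of S] by (auto simp: copies_def embeddings_def injections_def)
  have "(\<lambda>\<phi>. \<phi> ` K) ` embeddings K F G \<subseteq> copies" using copies by auto
  then have "card (embeddings K F G) = (\<Sum>S\<in>copies. card {\<phi> \<in> embeddings K F G. \<phi> ` K = S})"
    using sum.group[OF finite_embeddings[OF K V] \<open>finite copies\<close>, where g = "\<lambda>\<phi>. \<phi> ` K"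
      and h = "\<lambda>_. 1::nat", of F]
    by simp
  also have "\<dots> = (\<Sum>S\<in>copies. card (automorphisms K F))"
  proof (rule sum.cong[OF refl])
    fix S assume "S \<in> copies"
    then obtain \<phi>\<^sub>0 where "\<phi>\<^sub>0 \<in> embeddings K F G" "\<phi>\<^sub>0 ` K = S" using copies by auto
    then show "card {\<phi> \<in> embeddings K F G. \<phi> ` K = S} = card (automorphisms K F)"
      using card_embeddings_onto[OF K] by blast
  qed
  also have "\<dots> = card (automorphisms K F) * num_induced (K, F) G"
    by (simp add: copies_def num_induced_def)
  finally show ?thesis .
qed

lemma card_automorphisms_pos:
  assumes K: "finite K" and F: "F \<subseteq> [K]\<^bsup>2\<^esup>"
  shows "1 \<le> card (automorphisms K F)"
proof -
  have "pullback (K, F) K (restrict id K) = pullback (K, F) K id" by (rule pullback_cong) simp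
  also have "\<dots> = F" using F by (auto simp: pullback_def)
  finally have "restrict id K \<in> automorphisms K F"
    by (auto simp: embeddings_def injections_def inj_on_def)
  then show ?thesis
    using finite_embeddings[OF K, of "(K, F)"] K card_gt_0_iff[of "automorphisms K F"] by (auto simp: Suc_le_eq)
qed

lemma card_automorphisms_le: "finite K \<Longrightarrow> card (automorphisms K F) \<le> card (injections K K)"
  unfolding embeddings_def by (intro card_mono) (auto simp: finite_injections)

lemma card_embeddings_sum:
  assumes "finite K" "finite (verts G)"
  shows "real (card (embeddings K F G))
       = (\<Sum>\<phi>\<in>injections K (verts G). of_bool (pullback G K \<phi> = F))"
proof -
  have "embeddings K F G = injections K (verts G) \<inter> {\<phi>. pullback G K \<phi> = F}"
    by (auto simp: embeddings_def)
  then show ?thesis using finite_injections[OF assms]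
    by (simp add: sum.If_cases of_bool_def)
qed

section \<open>Random subsets of a finite set\<close>

definition random_subset :: "'e set \<Rightarrow> real \<Rightarrow> 'e set pmf" where
  "random_subset P \<pi> = map_pmf (\<lambda>b. {e \<in> P. b e}) (Pi_pmf P False (\<lambda>_. bernoulli_pmf \<pi>))"

lemma set_random_subset: "set_pmf (random_subset P \<pi>) \<subseteq> Pow P"
  by (auto simp: random_subset_def)

lemma erdos_renyi_eq_random_subset:
  "erdos_renyi n p = map_pmf (Pair {..<n}) (random_subset ([{..<n}]\<^bsup>2\<^esup>) p)"
  by (simp add: erdos_renyi_def random_subset_def map_pmf_comp)

lemma random_subset_Un:
  assumes "finite A" "finite B" "A \<inter> B = {}"
  shows "random_subset (A \<union> B) \<pi> = map_pmf (\<lambda>(S, T). S \<union> T) (pair_pmf (random_subset A \<pi>) (random_subset B \<pi>))"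
proof -
  have "random_subset (A \<union> B) \<pi> = map_pmf (\<lambda>(f, g). {e \<in> A. f e} \<union> {e \<in> B. g e})
      (pair_pmf (Pi_pmf A False (\<lambda>_. bernoulli_pmf \<pi>)) (Pi_pmf B False (\<lambda>_. bernoulli_pmf \<pi>)))"
    unfolding random_subset_def Pi_pmf_union[OF assms] map_pmf_comp
    by (intro map_pmf_cong refl) (use assms(3) in auto)
  also have "\<dots> = map_pmf (\<lambda>(S, T). S \<union> T) (pair_pmf (random_subset A \<pi>) (random_subset B \<pi>))"
    unfolding random_subset_def map_pair[symmetric] map_pmf_comp by (simp add: case_prod_unfold)
  finally show ?thesis .
qed

lemma expectation_pair_pmf_mult:
  fixes f :: "'a \<Rightarrow> real" and g :: "'b \<Rightarrow> real"
  assumes "finite (set_pmf p)" "finite (set_pmf q)"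
  shows "measure_pmf.expectation (pair_pmf p q) (\<lambda>(x, y). f x * g y)
       = measure_pmf.expectation p f * measure_pmf.expectation q g"
proof -
  have "measure_pmf.expectation (pair_pmf p q) (\<lambda>(x, y). f x * g y)
      = (\<Sum>(x, y)\<in>set_pmf p \<times> set_pmf q. (pmf p x * f x) * (pmf q y * g y))"
    using assms by (subst integral_measure_pmf[of "set_pmf p \<times> set_pmf q"])
      (auto simp: pmf_pair mult_ac intro!: sum.cong)
  also have "\<dots> = (\<Sum>x\<in>set_pmf p. pmf p x * f x) * (\<Sum>y\<in>set_pmf q. pmf q y * g y)"
    by (simp add: sum_product sum.cartesian_product)
  also have "\<dots> = measure_pmf.expectation p f * measure_pmf.expectation q g"
    using assms by (simp add: integral_measure_pmf[of "set_pmf p"] integral_measure_pmf[of "set_pmf q"])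
  finally show ?thesis .
qed

definition depends_on :: "('e set \<Rightarrow> 'b) \<Rightarrow> 'e set \<Rightarrow> bool" where
  "depends_on f A \<longleftrightarrow> (\<forall>S. f S = f (S \<inter> A))"

lemma depends_onD: "depends_on f A \<Longrightarrow> S \<inter> A = T \<inter> A \<Longrightarrow> f S = f T"
  unfolding depends_on_def by metis

lemma depends_on_mono: "depends_on f A \<Longrightarrow> A \<subseteq> B \<Longrightarrow> depends_on f B"
  unfolding depends_on_def by (metis inf.absorb_iff2 inf_assoc)

lemma depends_on_comp: "depends_on f A \<Longrightarrow> depends_on (\<lambda>S. g (f S)) A"
  unfolding depends_on_def by metis

lemma depends_on_comp2: "depends_on f A \<Longrightarrow> depends_on f' A \<Longrightarrow> depends_on (\<lambda>S. g (f S) (f' S)) A"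
  unfolding depends_on_def by metis

lemma depends_on_sum:
  "(\<And>w. w \<in> W \<Longrightarrow> depends_on (f w) A) \<Longrightarrow> depends_on (\<lambda>S. \<Sum>w\<in>W. f w S) A"
  unfolding depends_on_def by (intro allI sum.cong refl) blast

lemma depends_on_prod_mem: "depends_on (\<lambda>S. \<Prod>e\<in>T. h e (e \<in> S)) T"
  unfolding depends_on_def by (intro allI prod.cong refl) auto

locale bernoulli_set =
  fixes P :: "'e set" and \<pi> :: real
  assumes finite_P: "finite P" and prob_01: "0 \<le> \<pi>" "\<pi> \<le> 1"
begin

abbreviation E :: "('e set \<Rightarrow> real) \<Rightarrow> real" where
  "E \<equiv> measure_pmf.expectation (random_subset P \<pi>)"

lemma finite_set_random_subset: "finite (set_pmf (random_subset P \<pi>))"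
  using set_random_subset finite_P by (metis finite_Pow_iff finite_subset)

lemma integrable_random_subset [simp]: "integrable (measure_pmf (random_subset P \<pi>)) (f :: 'e set \<Rightarrow> real)"
  by (rule integrable_measure_pmf_finite[OF finite_set_random_subset])

lemma E_const [simp]: "E (\<lambda>_. c) = c"
  by simp

lemma E_add: "E (\<lambda>S. f S + g S) = E f + E g"
  by simp

lemma E_diff: "E (\<lambda>S. f S - g S) = E f - E g"
  by simp

lemma E_cmult: "E (\<lambda>S. c * f S) = c * E f"
  by simp

lemma E_cdiv: "E (\<lambda>S. f S / c) = E f / c"
  by simp

lemma E_sum: "E (\<lambda>S. \<Sum>i\<in>I. f i S) = (\<Sum>i\<in>I. E (f i))"
  by (rule Bochner_Integration.integral_sum) simp

lemma E_mono: "(\<And>S. S \<subseteq> P \<Longrightarrow> f S \<le> g S) \<Longrightarrow> E f \<le> E g"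
  using set_random_subset[of P \<pi>] by (intro integral_mono_AE AE_pmfI) auto

lemma E_cong: "(\<And>S. S \<subseteq> P \<Longrightarrow> f S = g S) \<Longrightarrow> E f = E g"
  by (intro antisym E_mono) auto

lemma E_nonneg: "(\<And>S. S \<subseteq> P \<Longrightarrow> 0 \<le> f S) \<Longrightarrow> 0 \<le> E f"
  using E_mono[of "\<lambda>_. 0" f] by simp

lemma E_less_imp_ex:
  assumes "E f < c" shows "\<exists>S\<subseteq>P. f S < c"
proof (rule ccontr)
  assume "\<not> ?thesis"
  then have "E (\<lambda>_. c) \<le> E f" by (intro E_mono) auto
  then show False using assms by simp
qed

lemma E_abs_le:
  assumes "E (\<lambda>S. (f S)\<^sup>2) \<le> c\<^sup>2" "0 \<le> c" shows "E (\<lambda>S. \<bar>f S\<bar>) \<le> c"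
proof -
  have "(E (\<lambda>S. \<bar>f S\<bar>))\<^sup>2 \<le> E (\<lambda>S. (f S)\<^sup>2)"
    using measure_pmf.variance_positive[of "random_subset P \<pi>" "\<lambda>S. \<bar>f S\<bar>"]
    by (subst (asm) measure_pmf.variance_eq) simp_all
  from this assms(1) have "(E (\<lambda>S. \<bar>f S\<bar>))\<^sup>2 \<le> c\<^sup>2" by (rule order_trans)
  then show ?thesis using assms(2) by (rule power2_le_imp_le)
qed

lemma E_mult_indep:
  assumes f: "depends_on f A" and g: "depends_on g B" and AB: "A \<inter> B = {}"
  shows "E (\<lambda>S. f S * g S) = E f * E g"
proof -
  let ?A = "P \<inter> A" and ?B = "P - A"
  let ?p = "random_subset ?A \<pi>" and ?q = "random_subset ?B \<pi>"
  have fin: "finite (set_pmf ?p)" "finite (set_pmf ?q)"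
    using set_random_subset finite_P by (metis finite_Int finite_Diff finite_Pow_iff finite_subset)+
  have "random_subset (?A \<union> ?B) \<pi> = map_pmf (\<lambda>(S, T). S \<union> T) (pair_pmf ?p ?q)"
    using finite_P by (intro random_subset_Un) auto
  moreover have "?A \<union> ?B = P" by auto
  ultimately have pair: "random_subset P \<pi> = map_pmf (\<lambda>(S, T). S \<union> T) (pair_pmf ?p ?q)" by simp
  have split: "E (\<lambda>S. h S * k S) = measure_pmf.expectation ?p h * measure_pmf.expectation ?q k"
    if "depends_on h A" "depends_on k B" for h k
  proof -
    have "E (\<lambda>S. h S * k S) = measure_pmf.expectation (pair_pmf ?p ?q) (\<lambda>(S, T). h (S \<union> T) * k (S \<union> T))"
      unfolding pair by (simp add: case_prod_unfold)
    also have "\<dots> = measure_pmf.expectation (pair_pmf ?p ?q) (\<lambda>(S, T). h S * k T)"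
    proof (rule integral_cong_AE)
      show "AE x in pair_pmf ?p ?q. (case x of (S, T) \<Rightarrow> h (S \<union> T) * k (S \<union> T)) = (case x of (S, T) \<Rightarrow> h S * k T)"
      proof (rule AE_pmfI, clarify)
        fix S T assume "(S, T) \<in> set_pmf (pair_pmf ?p ?q)"
        then have "S \<subseteq> ?A" "T \<subseteq> ?B" using set_random_subset by fastforce+
        then have "h (S \<union> T) = h S" "k (S \<union> T) = k T"
          using AB by (auto intro!: depends_onD[OF that(1)] depends_onD[OF that(2)])
        then show "h (S \<union> T) * k (S \<union> T) = h S * k T" by simp
      qed
    qed simp_all
    also have "\<dots> = measure_pmf.expectation ?p h * measure_pmf.expectation ?q k"
      by (rule expectation_pair_pmf_mult[OF fin])
    finally show ?thesis .
  qed
  have "depends_on (\<lambda>_. 1::real) C" for C :: "'e set" by (simp add: depends_on_def)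
  then have "E f = measure_pmf.expectation ?p f" "E g = measure_pmf.expectation ?q g"
    using split[OF f, of "\<lambda>_. 1"] split[OF _ g, of "\<lambda>_. 1"] by simp_all
  then show ?thesis using split[OF f g] by simp
qed

lemma E_mem:
  assumes "e \<in> P" shows "E (\<lambda>S. h (e \<in> S)) = \<pi> * h True + (1 - \<pi>) * h False"
proof -
  have "E (\<lambda>S. h (e \<in> S))
    = measure_pmf.expectation (map_pmf (\<lambda>b. b e) (Pi_pmf P False (\<lambda>_. bernoulli_pmf \<pi>))) h"
    using assms by (simp add: random_subset_def)
  also have "\<dots> = measure_pmf.expectation (bernoulli_pmf \<pi>) h"
    using assms finite_P by (simp add: Pi_pmf_component)
  finally show ?thesis using prob_01 by simp
qed

lemma E_prod_mem:
  assumes "finite T" shows "E (\<lambda>S. \<Prod>e\<in>T. h e (e \<in> S)) = (\<Prod>e\<in>T. E (\<lambda>S. h e (e \<in> S)))"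
  using assms
proof (induction T rule: finite_induct)
  case (insert x T)
  have "E (\<lambda>S. \<Prod>e\<in>insert x T. h e (e \<in> S)) = E (\<lambda>S. h x (x \<in> S) * (\<Prod>e\<in>T. h e (e \<in> S)))"
    using insert.hyps by simp
  also have "\<dots> = E (\<lambda>S. h x (x \<in> S)) * E (\<lambda>S. \<Prod>e\<in>T. h e (e \<in> S))"
    using insert.hyps depends_on_prod_mem[of h "{x}"]
    by (intro E_mult_indep[OF _ depends_on_prod_mem, of _ "{x}"]) auto
  finally show ?case using insert by simp
qed simp

end

section \<open>Deviations and centred subgraph sums\<close>

definition pattern_prob :: "'i set \<Rightarrow> 'i set set \<Rightarrow> real \<Rightarrow> real" where
  "pattern_prob K F p = (\<Prod>e\<in>[K]\<^bsup>2\<^esup>. if e \<in> F then p else 1 - p)"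

definition labelled_deviation :: "'i set \<Rightarrow> 'i set set \<Rightarrow> 'a graph \<Rightarrow> real \<Rightarrow> real" where
  "labelled_deviation K F G p
     = real (card (embeddings K F G)) - real (card (injections K (verts G))) * pattern_prob K F p"

lemma prod_of_bool:
  assumes "finite A" shows "(\<Prod>x\<in>A. of_bool (Q x)) = (of_bool (\<forall>x\<in>A. Q x) :: 'b::comm_semiring_1)"
  using assms by (induction rule: finite_induct) auto

lemma pullback_eq_iff:
  "F \<subseteq> [K]\<^bsup>2\<^esup> \<Longrightarrow> pullback G K \<phi> = F \<longleftrightarrow> (\<forall>e\<in>[K]\<^bsup>2\<^esup>. e \<in> F \<longleftrightarrow> \<phi> ` e \<in> edges G)"
  by (auto simp: pullback_def)

lemma expectation_pullback_eq:
  assumes V: "finite V" and K: "finite K" and F: "F \<subseteq> [K]\<^bsup>2\<^esup>" and p: "0 \<le> p" "p \<le> 1"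
    and \<phi>: "\<phi> \<in> injections K V"
  shows "measure_pmf.expectation (random_subset ([V]\<^bsup>2\<^esup>) p) (\<lambda>S. of_bool (pullback (V, S) K \<phi> = F))
       = pattern_prob K F p"
proof -
  interpret bernoulli_set "[V]\<^bsup>2\<^esup>" p using V p by unfold_locales (auto simp: finite_imp_finite_nsets)
  define h :: "'a set \<Rightarrow> bool \<Rightarrow> real" where "h e v = of_bool (e \<in> image \<phi> ` F \<longleftrightarrow> v)" for e v
  have "[K]\<^bsup>2\<^esup> \<subseteq> Pow K" by (auto simp: nsets_def)
  then have inj: "inj_on (image \<phi>) ([K]\<^bsup>2\<^esup>)" by (rule inj_on_image_injections[OF \<phi>])
  have mem: "\<phi> ` e \<in> image \<phi> ` F \<longleftrightarrow> e \<in> F" if "e \<in> [K]\<^bsup>2\<^esup>" for e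
    using inj_on_image_mem_iff[OF inj that F] .
  have fin: "finite ([K]\<^bsup>2\<^esup>)" using K by (rule finite_imp_finite_nsets)
  have "of_bool (pullback (V, S) K \<phi> = F) = (\<Prod>e\<in>image \<phi> ` [K]\<^bsup>2\<^esup>. h e (e \<in> S))" for S
    using mem by (simp add: prod.reindex[OF inj] h_def prod_of_bool[OF fin] pullback_eq_iff[OF F])
  then have "E (\<lambda>S. of_bool (pullback (V, S) K \<phi> = F)) = E (\<lambda>S. \<Prod>e\<in>image \<phi> ` [K]\<^bsup>2\<^esup>. h e (e \<in> S))" by simp
  also have "\<dots> = (\<Prod>e\<in>[K]\<^bsup>2\<^esup>. E (\<lambda>S. h (\<phi> ` e) (\<phi> ` e \<in> S)))"
    unfolding E_prod_mem[OF finite_imageI[OF fin]] by (simp add: prod.reindex[OF inj])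
  also have "\<dots> = pattern_prob K F p"
    unfolding pattern_prob_def
  proof (rule prod.cong[OF refl])
    fix e assume e: "e \<in> [K]\<^bsup>2\<^esup>"
    show "E (\<lambda>S. h (\<phi> ` e) (\<phi> ` e \<in> S)) = (if e \<in> F then p else 1 - p)"
      unfolding E_mem[OF image_pair_injections[OF \<phi> e], of "h (\<phi> ` e)"] by (simp add: h_def mem[OF e])
  qed
  finally show ?thesis .
qed

lemma expectation_card_embeddings:
  assumes K: "finite K" and F: "F \<subseteq> [K]\<^bsup>2\<^esup>" and p: "0 \<le> p" "p \<le> 1"
  shows "measure_pmf.expectation (erdos_renyi n p) (\<lambda>G. real (card (embeddings K F G)))
       = real (card (injections K {..<n})) * pattern_prob K F p"
proof -
  interpret bernoulli_set "[{..<n}]\<^bsup>2\<^esup>" p using p by unfold_locales (auto simp: finite_imp_finite_nsets)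
  have "measure_pmf.expectation (erdos_renyi n p) (\<lambda>G. real (card (embeddings K F G)))
      = E (\<lambda>S. \<Sum>\<phi>\<in>injections K {..<n}. of_bool (pullback ({..<n}, S) K \<phi> = F))"
    unfolding erdos_renyi_eq_random_subset using card_embeddings_sum[OF K, of "({..<n}, S)" for S] by simp
  also have "\<dots> = (\<Sum>\<phi>\<in>injections K {..<n}. pattern_prob K F p)"
    unfolding E_sum by (intro sum.cong refl expectation_pullback_eq assms) simp
  finally show ?thesis by simp
qed

lemma labelled_deviation_eq:
  fixes K :: "nat set"
  assumes G: "simple_graph G" and K: "finite K" and F: "F \<subseteq> [K]\<^bsup>2\<^esup>" and p: "0 \<le> p" "p \<le> 1"
  shows "labelled_deviation K F G p = real (card (automorphisms K F))
           * (real (num_induced (K, F) G) - expected_num_induced (K, F) (card (verts G)) p)"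
proof -
  let ?n = "card (verts G)"
  have V: "finite (verts G)" using G by (simp add: simple_graph_def)
  have "measure_pmf.expectation (erdos_renyi ?n p) (\<lambda>G. real (card (embeddings K F G)))
      = measure_pmf.expectation (erdos_renyi ?n p)
          (\<lambda>G. real (card (automorphisms K F)) * real (num_induced (K, F) G))"
  proof (intro integral_cong_AE AE_pmfI)
    fix G assume "G \<in> set_pmf (erdos_renyi ?n p)"
    then have "simple_graph G" by (auto simp: erdos_renyi_def simple_graph_def)
    then show "real (card (embeddings K F G)) = real (card (automorphisms K F)) * real (num_induced (K, F) G)"
      by (simp add: card_embeddings[OF _ K F])
  qed simp_all
  then have "real (card (automorphisms K F)) * expected_num_induced (K, F) ?n p
      = real (card (injections K {..<?n})) * pattern_prob K F p"
    unfolding expected_num_induced_def by (simp add: expectation_card_embeddings[OF K F p])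
  moreover have "card (injections K {..<?n}) = card (injections K (verts G))"
    using card_injections[OF K, of "{..<?n}"] card_injections[OF K V] by simp
  ultimately show ?thesis
    unfolding labelled_deviation_def using card_embeddings[OF G K F] by (simp add: algebra_simps)
qed

definition centered :: "'a graph \<Rightarrow> real \<Rightarrow> 'a set \<Rightarrow> real" where
  "centered G p e = (if e \<in> [verts G]\<^bsup>2\<^esup> then of_bool (e \<in> edges G) - p else 0)"

lemma centered_singleton [simp]: "centered G p {i} = 0"
  by (auto simp: centered_def nsets_def)

lemma centered_pullback:
  assumes "\<phi> \<in> injections K (verts G)" "e \<in> [K]\<^bsup>2\<^esup>"
  shows "centered G p (\<phi> ` e) = of_bool (e \<in> pullback G K \<phi>) - p"
  using image_pair_injections[OF assms] assms(2) by (simp add: centered_def pullback_def)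

text \<open>Both directions of the translation rest on \<open>1[e \<in> F] = \<plusminus>\<alpha> e + x e\<close>, where \<open>\<alpha>\<close> is the centred
  indicator and \<open>x e\<close> is the probability that \<open>e\<close> agrees with \<open>F\<close>.\<close>

lemma abs_labelled_deviation_le:
  assumes K: "finite K" and V: "finite (verts G)" and F: "F \<subseteq> [K]\<^bsup>2\<^esup>" and p: "0 \<le> p" "p \<le> 1"
  shows "\<bar>labelled_deviation K F G p\<bar> \<le> (\<Sum>H\<in>Pow ([K]\<^bsup>2\<^esup>) - {{}}. \<bar>inj_sum (verts G) (centered G p) K H\<bar>)"
proof -
  let ?Q = "[K]\<^bsup>2\<^esup>" and ?I = "injections K (verts G)"
  define x where "x e = (if e \<in> F then p else 1 - p)" for e
  define sgn :: "'a set \<Rightarrow> real" where "sgn e = (if e \<in> F then 1 else -1)" for e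
  have fin: "finite ?Q" using K by (simp add: finite_imp_finite_nsets)
  have indicator: "of_bool (pullback G K \<phi> = F) = (\<Prod>e\<in>?Q. sgn e * centered G p (\<phi> ` e) + x e)"
    if \<phi>: "\<phi> \<in> ?I" for \<phi>
  proof -
    have "(\<Prod>e\<in>?Q. sgn e * centered G p (\<phi> ` e) + x e) = (\<Prod>e\<in>?Q. of_bool (e \<in> F \<longleftrightarrow> e \<in> pullback G K \<phi>))"
      by (rule prod.cong) (auto simp: centered_pullback[OF \<phi>] sgn_def x_def)
    then show ?thesis using pullback_subset[of G K \<phi>] F
      unfolding prod_of_bool[OF fin] by (simp add: set_eq_iff) blast
  qed
  have "labelled_deviation K F G p = (\<Sum>\<phi>\<in>?I. (\<Prod>e\<in>?Q. sgn e * centered G p (\<phi> ` e) + x e) - (\<Prod>e\<in>?Q. x e))"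
    unfolding labelled_deviation_def card_embeddings_sum[OF K V] pattern_prob_def
    by (simp add: indicator sum_subtractf x_def)
  also have "\<dots> = (\<Sum>\<phi>\<in>?I. \<Sum>H\<in>Pow ?Q - {{}}. (\<Prod>e\<in>H. sgn e * centered G p (\<phi> ` e)) * (\<Prod>e\<in>?Q - H. x e))"
    using fin by (intro sum.cong refl) (simp add: prod_add sum_diff1)
  also have "\<dots> = (\<Sum>H\<in>Pow ?Q - {{}}. (\<Prod>e\<in>H. sgn e) * (\<Prod>e\<in>?Q - H. x e) * inj_sum (verts G) (centered G p) K H)"
    unfolding inj_sum_def by (subst sum.swap) (simp add: prod.distrib sum_distrib_left mult_ac)
  finally have "\<bar>labelled_deviation K F G p\<bar> \<le> (\<Sum>H\<in>Pow ?Q - {{}}.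
      \<bar>(\<Prod>e\<in>H. sgn e) * (\<Prod>e\<in>?Q - H. x e) * inj_sum (verts G) (centered G p) K H\<bar>)"
    by (simp add: sum_abs)
  also have "\<dots> \<le> (\<Sum>H\<in>Pow ?Q - {{}}. \<bar>inj_sum (verts G) (centered G p) K H\<bar>)"
  proof (rule sum_mono)
    fix H
    have "\<bar>\<Prod>e\<in>H. sgn e\<bar> = 1" by (auto simp: abs_prod sgn_def intro!: prod.neutral)
    moreover have "\<bar>\<Prod>e\<in>?Q - H. x e\<bar> \<le> 1"
      unfolding abs_prod using p by (intro prod_le_1) (auto simp: x_def)
    ultimately show "\<bar>(\<Prod>e\<in>H. sgn e) * (\<Prod>e\<in>?Q - H. x e) * inj_sum (verts G) (centered G p) K H\<bar>
        \<le> \<bar>inj_sum (verts G) (centered G p) K H\<bar>"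
      by (simp add: abs_mult mult_left_le_one_le)
  qed
  finally show ?thesis .
qed

lemma sum_Pow_prod_if:
  assumes "finite Q"
  shows "(\<Sum>F\<in>Pow Q. \<Prod>e\<in>Q. if e \<in> F then f e else g e) = (\<Prod>e\<in>Q. f e + g e :: 'b::comm_semiring_1)"
proof -
  have "(\<Prod>e\<in>Q. if e \<in> F then f e else g e) = (\<Prod>e\<in>F. f e) * (\<Prod>e\<in>Q - F. g e)" if "F \<in> Pow Q" for F
    using assms that by (subst prod.subset_diff[of F]) (auto simp: mult.commute)
  then show ?thesis by (simp add: prod_add[OF assms])
qed

lemma sum_pattern_prob: "finite K \<Longrightarrow> (\<Sum>F\<in>Pow ([K]\<^bsup>2\<^esup>). pattern_prob K F p) = 1"
  unfolding pattern_prob_def by (subst sum_Pow_prod_if) (auto simp: finite_imp_finite_nsets)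

lemma sum_centered_monomial_pattern_prob:
  assumes K: "finite K" and H: "H \<subseteq> [K]\<^bsup>2\<^esup>" "H \<noteq> {}"
  shows "(\<Sum>F\<in>Pow ([K]\<^bsup>2\<^esup>). (\<Prod>e\<in>H. of_bool (e \<in> F) - p) * pattern_prob K F p) = 0"
proof -
  let ?Q = "[K]\<^bsup>2\<^esup>"
  let ?f = "\<lambda>e. (if e \<in> H then 1 - p else 1) * p" and ?g = "\<lambda>e. (if e \<in> H then - p else 1) * (1 - p)"
  have fin: "finite ?Q" using K by (simp add: finite_imp_finite_nsets)
  have "(\<Prod>e\<in>H. of_bool (e \<in> F) - p) * pattern_prob K F p = (\<Prod>e\<in>?Q. if e \<in> F then ?f e else ?g e)" for F
  proof -
    have "(\<Prod>e\<in>H. of_bool (e \<in> F) - p) = (\<Prod>e\<in>?Q. if e \<in> H then of_bool (e \<in> F) - p else 1)"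
      using H fin by (intro prod.mono_neutral_cong_left) auto
    then have "(\<Prod>e\<in>H. of_bool (e \<in> F) - p) * pattern_prob K F p
        = (\<Prod>e\<in>?Q. (if e \<in> H then of_bool (e \<in> F) - p else 1) * (if e \<in> F then p else 1 - p))"
      by (simp only: pattern_prob_def prod.distrib)
    also have "\<dots> = (\<Prod>e\<in>?Q. if e \<in> F then ?f e else ?g e)" by (rule prod.cong) auto
    finally show ?thesis .
  qed
  then have "(\<Sum>F\<in>Pow ?Q. (\<Prod>e\<in>H. of_bool (e \<in> F) - p) * pattern_prob K F p)
      = (\<Sum>F\<in>Pow ?Q. \<Prod>e\<in>?Q. if e \<in> F then ?f e else ?g e)" by simp
  also have "\<dots> = (\<Prod>e\<in>?Q. ?f e + ?g e)" by (rule sum_Pow_prod_if[OF fin])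
  also have "\<dots> = 0"
  proof -
    obtain e where "e \<in> H" using H by auto
    then show ?thesis using H fin by (intro prod_zero) (auto intro!: bexI[of _ e] simp: algebra_simps)
  qed
  finally show ?thesis .
qed

lemma sum_card_embeddings:
  assumes K: "finite K" and V: "finite (verts G)"
  shows "(\<Sum>F\<in>Pow ([K]\<^bsup>2\<^esup>). w F * real (card (embeddings K F G)))
       = (\<Sum>\<phi>\<in>injections K (verts G). w (pullback G K \<phi>))"
proof -
  have "(\<Sum>F\<in>Pow ([K]\<^bsup>2\<^esup>). w F * real (card (embeddings K F G)))
      = (\<Sum>\<phi>\<in>injections K (verts G). \<Sum>F\<in>Pow ([K]\<^bsup>2\<^esup>). w F * of_bool (pullback G K \<phi> = F))"
    unfolding card_embeddings_sum[OF assms] sum_distrib_left by (rule sum.swap)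
  also have "\<dots> = (\<Sum>\<phi>\<in>injections K (verts G). w (pullback G K \<phi>))"
  proof (rule sum.cong[OF refl])
    fix \<phi>
    show "(\<Sum>F\<in>Pow ([K]\<^bsup>2\<^esup>). w F * of_bool (pullback G K \<phi> = F)) = w (pullback G K \<phi>)"
      using pullback_subset[of G K \<phi>] finite_imp_finite_nsets[OF K, of 2]
      by (simp add: of_bool_def if_distrib[of "(*) _"] sum.delta cong: if_cong)
  qed
  finally show ?thesis .
qed

lemma inj_sum_eq_sum_labelled_deviation:
  assumes K: "finite K" and V: "finite (verts G)" and H: "H \<subseteq> [K]\<^bsup>2\<^esup>" "H \<noteq> {}"
  shows "inj_sum (verts G) (centered G p) K H
       = (\<Sum>F\<in>Pow ([K]\<^bsup>2\<^esup>). (\<Prod>e\<in>H. of_bool (e \<in> F) - p) * labelled_deviation K F G p)"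
proof -
  let ?w = "\<lambda>F. \<Prod>e\<in>H. of_bool (e \<in> F) - p" and ?I = "injections K (verts G)"
  have "(\<Sum>F\<in>Pow ([K]\<^bsup>2\<^esup>). ?w F * labelled_deviation K F G p)
      = (\<Sum>F\<in>Pow ([K]\<^bsup>2\<^esup>). ?w F * real (card (embeddings K F G)))
        - real (card ?I) * (\<Sum>F\<in>Pow ([K]\<^bsup>2\<^esup>). ?w F * pattern_prob K F p)"
    unfolding labelled_deviation_def by (simp add: sum_subtractf sum_distrib_left algebra_simps)
  also have "\<dots> = (\<Sum>\<phi>\<in>?I. ?w (pullback G K \<phi>))"
    by (simp add: sum_card_embeddings[OF K V] sum_centered_monomial_pattern_prob[OF K H])
  also have "\<dots> = inj_sum (verts G) (centered G p) K H"
    unfolding inj_sum_def by (intro sum.cong prod.cong refl) (use H in \<open>auto simp: centered_pullback\<close>)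
  finally show ?thesis by simp
qed

lemma sum_labelled_deviation:
  assumes K: "finite K" and V: "finite (verts G)"
  shows "(\<Sum>F\<in>Pow ([K]\<^bsup>2\<^esup>). labelled_deviation K F G p) = 0"
  using sum_card_embeddings[OF K V, of "\<lambda>_. 1"] sum_pattern_prob[OF K, of p]
  unfolding labelled_deviation_def sum_subtractf sum_distrib_left[symmetric] by simp

lemma deviation_le_u_graph:
  assumes "F \<subseteq> [{..<k}]\<^bsup>2\<^esup>"
  shows "real (num_induced ({..<k}, F) G) - expected_num_induced ({..<k}, F) (card (verts G)) p
     \<le> u_graph k G p"
  unfolding u_graph_def
proof (rule Max_ge[OF deviations_finite])
  show "real (num_induced ({..<k}, F) G) - expected_num_induced ({..<k}, F) (card (verts G)) p
      \<in> deviations k G p"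
    unfolding deviations_eq_image using assms
    by (intro image_eqI[of _ _ "({..<k}, F)"]) (auto simp: simple_graph_def)
qed

lemma u_graph_le:
  assumes G: "simple_graph G" and p: "0 \<le> p" "p \<le> 1"
    and Z: "\<And>F. F \<subseteq> [{..<k}]\<^bsup>2\<^esup> \<Longrightarrow> \<bar>labelled_deviation {..<k} F G p\<bar> \<le> Z"
  shows "u_graph k G p \<le> Z"
  unfolding u_graph_def
proof (rule Max.boundedI[OF deviations_finite deviations_nonempty])
  fix d assume "d \<in> deviations k G p"
  then obtain F where F: "F \<subseteq> [{..<k}]\<^bsup>2\<^esup>"
    and d: "d = real (num_induced ({..<k}, F) G) - expected_num_induced ({..<k}, F) (card (verts G)) p"
    unfolding deviations_eq_image by (auto simp: simple_graph_def)
  have "1 * \<bar>d\<bar> \<le> real (card (automorphisms {..<k} F)) * \<bar>d\<bar>"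
    using card_automorphisms_pos[OF _ F] by (intro mult_right_mono) auto
  also have "\<dots> = \<bar>labelled_deviation {..<k} F G p\<bar>"
    using labelled_deviation_eq[OF G _ F p] by (simp add: d abs_mult)
  also have "\<dots> \<le> Z" using Z[OF F] .
  finally show "d \<le> Z" by simp
qed

lemma labelled_deviation_le_u_graph:
  assumes "simple_graph G" "0 \<le> p" "p \<le> 1" "F \<subseteq> [{..<k}]\<^bsup>2\<^esup>"
  shows "labelled_deviation {..<k} F G p \<le> real (card (automorphisms {..<k} F)) * u_graph k G p"
  using assms labelled_deviation_eq[of G "{..<k}" F p] deviation_le_u_graph[of F k G p]
  by (auto intro!: mult_left_mono)

lemma u_graph_nonneg:
  assumes G: "simple_graph G" and p: "0 \<le> p" "p \<le> 1"
  shows "0 \<le> u_graph k G p"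
proof (rule ccontr)
  let ?Q = "[{..<k}]\<^bsup>2\<^esup>"
  assume neg: "\<not> 0 \<le> u_graph k G p"
  have "labelled_deviation {..<k} F G p < 0" if "F \<in> Pow ?Q" for F
  proof -
    have "0 < real (card (automorphisms {..<k} F))" using card_automorphisms_pos[of "{..<k}" F] that by simp
    then have "real (card (automorphisms {..<k} F)) * u_graph k G p < 0" using neg by (simp add: mult_pos_neg)
    then show ?thesis using labelled_deviation_le_u_graph[OF G p, of F k] that by simp
  qed
  then have "(\<Sum>F\<in>Pow ?Q. labelled_deviation {..<k} F G p) < (\<Sum>F\<in>Pow ?Q. 0)"
    by (intro sum_strict_mono) (auto simp: finite_imp_finite_nsets)
  then show False using sum_labelled_deviation[of "{..<k}" G p] G by (simp add: simple_graph_def)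
qed

text \<open>All labelled deviations are bounded above by a multiple of \<open>u\<^sub>k\<close>; as they sum to zero, none of
  them can be very negative.\<close>

lemma abs_labelled_deviation_le_u_graph:
  assumes G: "simple_graph G" and p: "0 \<le> p" "p \<le> 1" and F: "F \<subseteq> [{..<k}]\<^bsup>2\<^esup>"
  shows "\<bar>labelled_deviation {..<k} F G p\<bar>
    \<le> 2 ^ (k choose 2) * (real (card (injections {..<k} {..<k})) * u_graph k G p)"
proof -
  let ?Q = "[{..<k}]\<^bsup>2\<^esup>" and ?W = "real (card (injections {..<k} {..<k})) * u_graph k G p"
  let ?dev = "\<lambda>F. labelled_deviation {..<k} F G p"
  have V: "finite (verts G)" using G by (simp add: simple_graph_def)
  have fin: "finite ?Q" by (simp add: finite_imp_finite_nsets)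
  have W: "0 \<le> ?W" using u_graph_nonneg[OF G p, of k] by simp
  have dev_le: "?dev F' \<le> ?W" if "F' \<in> Pow ?Q" for F'
  proof -
    have "?dev F' \<le> real (card (automorphisms {..<k} F')) * u_graph k G p"
      using labelled_deviation_le_u_graph[OF G p] that by simp
    also have "\<dots> \<le> ?W"
      using card_automorphisms_le[of "{..<k}" F'] u_graph_nonneg[OF G p] by (intro mult_right_mono) auto
    finally show ?thesis .
  qed
  have "- ?dev F = (\<Sum>F'\<in>Pow ?Q - {F}. ?dev F')"
    using sum_labelled_deviation[of "{..<k}" G p] V F fin by (simp add: sum_diff1)
  also have "\<dots> \<le> (\<Sum>F'\<in>Pow ?Q - {F}. ?W)" by (intro sum_mono dev_le) auto
  also have "\<dots> \<le> (\<Sum>F'\<in>Pow ?Q. ?W)" using W fin by (intro sum_mono2) auto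
  also have "\<dots> = 2 ^ (k choose 2) * ?W" using fin by (simp add: card_Pow card_nsets)
  finally have "- ?dev F \<le> 2 ^ (k choose 2) * ?W" .
  moreover have "1 * ?W \<le> 2 ^ (k choose 2) * ?W" using W by (intro mult_right_mono) auto
  ultimately show ?thesis using dev_le[of F] F by auto
qed

definition inj_sum_const :: "nat \<Rightarrow> real" where
  "inj_sum_const k = (2 ^ (k choose 2))\<^sup>2 * real (card (injections {..<k} {..<k}))"

lemma inj_sum_const_pos: "0 < inj_sum_const k"
proof -
  have "1 \<le> card (injections {..<k} {..<k})"
    using card_automorphisms_pos[of "{..<k}" "{}"] card_automorphisms_le[of "{..<k}" "{}"] by simp
  then show ?thesis unfolding inj_sum_const_def by simp
qed

lemma abs_inj_sum_le_u_graph: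
  assumes G: "simple_graph G" and p: "0 \<le> p" "p \<le> 1" and H: "H \<subseteq> [{..<k}]\<^bsup>2\<^esup>" "H \<noteq> {}"
  shows "\<bar>inj_sum (verts G) (centered G p) {..<k} H\<bar> \<le> inj_sum_const k * u_graph k G p"
proof -
  let ?Q = "[{..<k}]\<^bsup>2\<^esup>" and ?W = "real (card (injections {..<k} {..<k})) * u_graph k G p"
  have V: "finite (verts G)" using G by (simp add: simple_graph_def)
  have "\<bar>inj_sum (verts G) (centered G p) {..<k} H\<bar>
      \<le> (\<Sum>F\<in>Pow ?Q. \<bar>(\<Prod>e\<in>H. of_bool (e \<in> F) - p) * labelled_deviation {..<k} F G p\<bar>)"
    using inj_sum_eq_sum_labelled_deviation[OF _ V H] by (simp add: sum_abs)
  also have "\<dots> \<le> (\<Sum>F\<in>Pow ?Q. 2 ^ (k choose 2) * ?W)"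
  proof (rule sum_mono)
    fix F assume F: "F \<in> Pow ?Q"
    have "\<bar>\<Prod>e\<in>H. of_bool (e \<in> F) - p\<bar> \<le> 1"
      unfolding abs_prod using p by (intro prod_le_1) (auto simp: of_bool_def)
    then have "\<bar>(\<Prod>e\<in>H. of_bool (e \<in> F) - p) * labelled_deviation {..<k} F G p\<bar>
        \<le> 1 * \<bar>labelled_deviation {..<k} F G p\<bar>"
      unfolding abs_mult by (intro mult_right_mono) auto
    then show "\<bar>(\<Prod>e\<in>H. of_bool (e \<in> F) - p) * labelled_deviation {..<k} F G p\<bar> \<le> 2 ^ (k choose 2) * ?W"
      using abs_labelled_deviation_le_u_graph[OF G p, of F k] F by simp
  qed
  also have "\<dots> = inj_sum_const k * u_graph k G p"
    by (simp add: inj_sum_const_def power2_eq_square card_Pow card_nsets finite_imp_finite_nsets)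
  finally show ?thesis .
qed

section \<open>Small supports and the lower bound\<close>

definition wdeg :: "'a set \<Rightarrow> ('a set \<Rightarrow> real) \<Rightarrow> 'a \<Rightarrow> real" where
  "wdeg V \<alpha> i = (\<Sum>w\<in>V. \<alpha> {i, w})"

definition triangle_sum ::
  "'a set \<Rightarrow> ('a set \<Rightarrow> real) \<Rightarrow> ('a set \<Rightarrow> real) \<Rightarrow> ('a set \<Rightarrow> real) \<Rightarrow> real" where
  "triangle_sum V f g h = (\<Sum>i\<in>V. \<Sum>j\<in>V. \<Sum>k\<in>V. f {i, j} * g {j, k} * h {i, k})"

lemma sum_ordered_pairs_distinct:
  fixes f :: "'a set \<Rightarrow> real"
  assumes "finite V"
  shows "(\<Sum>i\<in>V. \<Sum>j\<in>V - {i}. f {i, j}) = 2 * (\<Sum>e\<in>[V]\<^bsup>2\<^esup>. f e)"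
  using assms
proof (induction V rule: finite_induct)
  case empty
  have "[{}::'a set]\<^bsup>2\<^esup> = {}" by (auto simp: nsets_def)
  then show ?case by simp
next
  case (insert x V)
  have nsets_insert: "[insert x V]\<^bsup>2\<^esup> = [V]\<^bsup>2\<^esup> \<union> (\<lambda>v. {x, v}) ` V"
    using insert(2) unfolding nsets_2_eq by auto
  have "(\<lambda>v. {x, v}) ` V \<inter> [V]\<^bsup>2\<^esup> = {}" using insert(2) by (auto simp: nsets_def)
  moreover have "inj_on (\<lambda>v. {x, v}) V" using insert(2) by (auto simp: inj_on_def doubleton_eq_iff)
  ultimately have unordered: "(\<Sum>e\<in>[insert x V]\<^bsup>2\<^esup>. f e) = (\<Sum>e\<in>[V]\<^bsup>2\<^esup>. f e) + (\<Sum>v\<in>V. f {x, v})"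
    unfolding nsets_insert using insert(1)
    by (subst sum.union_disjoint) (auto simp: finite_imp_finite_nsets sum.reindex)
  have "(\<Sum>i\<in>V. \<Sum>j\<in>insert x V - {i}. f {i, j}) = (\<Sum>i\<in>V. (\<Sum>j\<in>V - {i}. f {i, j}) + f {x, i})"
  proof (rule sum.cong[OF refl])
    fix i assume "i \<in> V"
    then have "insert x V - {i} = insert x (V - {i})" using insert(2) by auto
    then show "(\<Sum>j\<in>insert x V - {i}. f {i, j}) = (\<Sum>j\<in>V - {i}. f {i, j}) + f {x, i}"
      using insert(1,2) by (simp add: insert_commute)
  qed
  moreover have "insert x V - {x} = V" using insert(2) by auto
  ultimately have "(\<Sum>i\<in>insert x V. \<Sum>j\<in>insert x V - {i}. f {i, j})
      = (\<Sum>v\<in>V. f {x, v}) + ((\<Sum>i\<in>V. \<Sum>j\<in>V - {i}. f {i, j}) + (\<Sum>v\<in>V. f {x, v}))"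
    using insert(1,2) by (simp add: sum.distrib)
  then show ?case using insert.IH unordered by simp
qed

lemma sum_ordered_pairs:
  fixes f :: "'a set \<Rightarrow> real"
  assumes "finite V" "\<And>i. f {i} = 0"
  shows "(\<Sum>i\<in>V. \<Sum>j\<in>V. f {i, j}) = 2 * (\<Sum>e\<in>[V]\<^bsup>2\<^esup>. f e)"
proof -
  have "(\<Sum>i\<in>V. \<Sum>j\<in>V. f {i, j}) = (\<Sum>i\<in>V. \<Sum>j\<in>V - {i}. f {i, j})"
    using assms by (intro sum.cong refl sum.mono_neutral_right) auto
  then show ?thesis using sum_ordered_pairs_distinct[OF assms(1), of f] by simp
qed

lemma sum_wdeg: "finite V \<Longrightarrow> (\<And>i. \<alpha> {i} = 0) \<Longrightarrow> (\<Sum>i\<in>V. wdeg V \<alpha> i) = 2 * (\<Sum>e\<in>[V]\<^bsup>2\<^esup>. \<alpha> e)"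
  unfolding wdeg_def by (rule sum_ordered_pairs)

lemma real_choose_two: "real (n choose 2) = real n * (real n - 1) / 2"
  by (cases n) (auto simp: choose_two real_of_nat_div algebra_simps)

context
  fixes V :: "'a set" and \<alpha> :: "'a set \<Rightarrow> real"
  assumes V: "finite V" and singleton_zero: "\<And>i. \<alpha> {i} = 0"
begin

lemma sum_minus_self: "v \<in> V \<Longrightarrow> (\<Sum>w\<in>V - {v}. \<alpha> {v, w}) = wdeg V \<alpha> v"
  using V singleton_zero by (simp add: wdeg_def sum_diff1)

lemma sum_minus_two:
  assumes "v \<in> V" "u \<in> V" "u \<noteq> v"
  shows "(\<Sum>w\<in>V - {u, v}. \<alpha> {v, w}) = wdeg V \<alpha> v - \<alpha> {u, v}"
proof -
  have "V - {u, v} = V - {v} - {u}" by auto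
  then have "(\<Sum>w\<in>V - {u, v}. \<alpha> {v, w}) = (\<Sum>w\<in>V - {v}. \<alpha> {v, w}) - \<alpha> {v, u}"
    using V assms by (simp add: sum_diff1)
  then show ?thesis using sum_minus_self[OF assms(1)] by (simp add: insert_commute)
qed

lemma sum_minus_three:
  assumes "v \<in> V" "u \<in> V" "u \<noteq> v" "w \<in> V - {u, v}"
  shows "(\<Sum>s\<in>V - {w, u, v}. \<alpha> {w, s}) = wdeg V \<alpha> w - \<alpha> {u, w} - \<alpha> {v, w}"
proof -
  have "V - {w, u, v} = V - {u, w} - {v}" by auto
  then have "(\<Sum>s\<in>V - {w, u, v}. \<alpha> {w, s}) = (\<Sum>s\<in>V - {u, w}. \<alpha> {w, s}) - \<alpha> {w, v}"
    using V assms by (auto simp: sum_diff1)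
  moreover have "(\<Sum>s\<in>V - {u, w}. \<alpha> {w, s}) = wdeg V \<alpha> w - \<alpha> {u, w}"
    using assms by (intro sum_minus_two) auto
  ultimately show ?thesis by (simp add: insert_commute[of w v])
qed

lemma sum_disjoint_edges:
  assumes "v \<in> V" "u \<in> V" "u \<noteq> v"
  shows "(\<Sum>w\<in>V - {u, v}. \<Sum>s\<in>V - {w, u, v}. \<alpha> {w, s})
       = (\<Sum>i\<in>V. wdeg V \<alpha> i) - 2 * wdeg V \<alpha> u - 2 * wdeg V \<alpha> v + 2 * \<alpha> {u, v}"
proof -
  have "V - {u, v} = V - {u} - {v}" by auto
  then have "(\<Sum>w\<in>V - {u, v}. wdeg V \<alpha> w) = (\<Sum>i\<in>V. wdeg V \<alpha> i) - wdeg V \<alpha> u - wdeg V \<alpha> v"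
    using V assms by (simp add: sum_diff1)
  moreover have "(\<Sum>w\<in>V - {u, v}. \<alpha> {v, w}) = wdeg V \<alpha> v - \<alpha> {u, v}" by (rule sum_minus_two[OF assms])
  moreover have "(\<Sum>w\<in>V - {u, v}. \<alpha> {u, w}) = wdeg V \<alpha> u - \<alpha> {u, v}"
    using sum_minus_two[of u v] assms by (simp add: insert_commute)
  moreover have "(\<Sum>w\<in>V - {u, v}. \<Sum>s\<in>V - {w, u, v}. \<alpha> {w, s})
      = (\<Sum>w\<in>V - {u, v}. wdeg V \<alpha> w - \<alpha> {u, w} - \<alpha> {v, w})"
    by (intro sum.cong refl sum_minus_three assms)
  ultimately show ?thesis by (simp add: sum_subtractf)
qed

lemma inj_sum_edge:
  assumes "x \<noteq> y"
  shows "inj_sum V \<alpha> {x, y} {{x, y}} = (\<Sum>i\<in>V. wdeg V \<alpha> i)"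
proof -
  have "inj_sum V \<alpha> {x, y} {{x, y}} = (\<Sum>v\<in>V. \<Sum>w\<in>V - {v}. \<alpha> {w, v})"
    unfolding inj_sum_def using assms V by (simp add: sum_injections_insert)
  also have "\<dots> = (\<Sum>v\<in>V. wdeg V \<alpha> v)"
    by (intro sum.cong refl) (simp add: insert_commute sum_minus_self[symmetric])
  finally show ?thesis .
qed

lemma inj_sum_path:
  assumes "x \<noteq> y" "y \<noteq> z" "x \<noteq> z"
  shows "inj_sum V \<alpha> {x, y, z} {{x, y}, {y, z}}
       = (\<Sum>i\<in>V. (wdeg V \<alpha> i)\<^sup>2) - (\<Sum>i\<in>V. \<Sum>j\<in>V. (\<alpha> {i, j})\<^sup>2)"
proof -
  have distinct_edges: "{x, y} \<noteq> {y, z}" using assms by (auto simp: doubleton_eq_iff)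
  have reorder: "{x, y, z} = {z, x, y}" by auto
  have "inj_sum V \<alpha> {x, y, z} {{x, y}, {y, z}}
      = (\<Sum>v\<in>V. \<Sum>u\<in>V - {v}. \<Sum>w\<in>V - {u, v}. \<alpha> {u, v} * \<alpha> {v, w})"
    unfolding inj_sum_def reorder using assms V distinct_edges by (simp add: sum_injections_insert)
  also have "\<dots> = (\<Sum>v\<in>V. \<Sum>u\<in>V - {v}. \<alpha> {v, u} * (wdeg V \<alpha> v - \<alpha> {v, u}))"
  proof (intro sum.cong refl)
    fix v u assume "v \<in> V" "u \<in> V - {v}"
    then show "(\<Sum>w\<in>V - {u, v}. \<alpha> {u, v} * \<alpha> {v, w}) = \<alpha> {v, u} * (wdeg V \<alpha> v - \<alpha> {v, u})"
      using sum_minus_two[of v u] by (simp add: sum_distrib_left[symmetric] insert_commute[of u v])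
  qed
  also have "\<dots> = (\<Sum>v\<in>V. \<Sum>u\<in>V. \<alpha> {v, u} * (wdeg V \<alpha> v - \<alpha> {v, u}))"
    by (intro sum.cong refl sum.mono_neutral_left) (use V singleton_zero in auto)
  also have "\<dots> = (\<Sum>v\<in>V. (wdeg V \<alpha> v)\<^sup>2 - (\<Sum>u\<in>V. (\<alpha> {v, u})\<^sup>2))"
    by (intro sum.cong refl)
      (simp add: wdeg_def algebra_simps sum_subtractf sum_distrib_left power2_eq_square)
  finally show ?thesis by (simp add: sum_subtractf)
qed

lemma inj_sum_triangle:
  assumes "x \<noteq> y" "y \<noteq> z" "x \<noteq> z"
  shows "inj_sum V \<alpha> {x, y, z} {{x, y}, {y, z}, {x, z}} = triangle_sum V \<alpha> \<alpha> \<alpha>"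
proof -
  have distinct_edges: "{x, y} \<noteq> {y, z}" "{x, y} \<noteq> {x, z}" "{y, z} \<noteq> {x, z}"
    using assms by (auto simp: doubleton_eq_iff)
  have reorder: "{x, y, z} = {z, y, x}" by auto
  have "inj_sum V \<alpha> {x, y, z} {{x, y}, {y, z}, {x, z}}
      = (\<Sum>i\<in>V. \<Sum>j\<in>V - {i}. \<Sum>k\<in>V - {j, i}. \<alpha> {i, j} * \<alpha> {j, k} * \<alpha> {i, k})"
    unfolding inj_sum_def reorder using assms V distinct_edges by (simp add: sum_injections_insert mult_ac)
  also have "\<dots> = (\<Sum>i\<in>V. \<Sum>j\<in>V - {i}. \<Sum>k\<in>V. \<alpha> {i, j} * \<alpha> {j, k} * \<alpha> {i, k})"
    by (intro sum.cong refl sum.mono_neutral_left) (use V singleton_zero in auto)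
  also have "\<dots> = triangle_sum V \<alpha> \<alpha> \<alpha>"
    unfolding triangle_sum_def by (intro sum.cong refl sum.mono_neutral_left) (use V singleton_zero in auto)
  finally show ?thesis .
qed

lemma inj_sum_matching:
  assumes "distinct [x, y, z, t]"
  shows "inj_sum V \<alpha> {x, y, z, t} {{x, y}, {z, t}}
       = (\<Sum>i\<in>V. wdeg V \<alpha> i)\<^sup>2 - 4 * (\<Sum>i\<in>V. (wdeg V \<alpha> i)\<^sup>2) + 2 * (\<Sum>i\<in>V. \<Sum>j\<in>V. (\<alpha> {i, j})\<^sup>2)"
proof -
  let ?d = "wdeg V \<alpha>"
  let ?X = "\<Sum>i\<in>V. ?d i"
  have distinct_edges: "{x, y} \<noteq> {z, t}" using assms by (auto simp: doubleton_eq_iff)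
  have reorder: "{x, y, z, t} = {t, z, y, x}" by auto
  have distinct_verts: "t \<noteq> z" "t \<noteq> y" "t \<noteq> x" "z \<noteq> y" "z \<noteq> x" "y \<noteq> x"
    "x \<noteq> y" "x \<noteq> z" "x \<noteq> t" "y \<noteq> z" "y \<noteq> t" "z \<noteq> t" using assms by auto
  have "inj_sum V \<alpha> {x, y, z, t} {{x, y}, {z, t}}
      = (\<Sum>v\<in>V. \<Sum>u\<in>V - {v}. \<Sum>w\<in>V - {u, v}. \<Sum>s\<in>V - {w, u, v}. \<alpha> {v, u} * \<alpha> {w, s})"
    unfolding inj_sum_def reorder using distinct_verts V distinct_edges by (simp add: sum_injections_insert)
  also have "\<dots> = (\<Sum>v\<in>V. \<Sum>u\<in>V - {v}. \<alpha> {v, u} * (?X - 2 * ?d u - 2 * ?d v + 2 * \<alpha> {v, u}))"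
  proof (intro sum.cong refl)
    fix v u assume "v \<in> V" "u \<in> V - {v}"
    then show "(\<Sum>w\<in>V - {u, v}. \<Sum>s\<in>V - {w, u, v}. \<alpha> {v, u} * \<alpha> {w, s})
        = \<alpha> {v, u} * (?X - 2 * ?d u - 2 * ?d v + 2 * \<alpha> {v, u})"
      using sum_disjoint_edges[of v u] by (simp add: sum_distrib_left[symmetric] insert_commute)
  qed
  also have "\<dots> = (\<Sum>v\<in>V. \<Sum>u\<in>V. \<alpha> {v, u} * (?X - 2 * ?d u - 2 * ?d v + 2 * \<alpha> {v, u}))"
    by (intro sum.cong refl sum.mono_neutral_left) (use V singleton_zero in auto)
  also have "\<dots> = (\<Sum>v\<in>V. \<Sum>u\<in>V. ?X * \<alpha> {v, u}) - 2 * (\<Sum>v\<in>V. \<Sum>u\<in>V. ?d u * \<alpha> {v, u})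
      - 2 * (\<Sum>v\<in>V. \<Sum>u\<in>V. ?d v * \<alpha> {v, u}) + 2 * (\<Sum>i\<in>V. \<Sum>j\<in>V. (\<alpha> {i, j})\<^sup>2)"
    by (simp add: algebra_simps sum.distrib sum_subtractf sum_distrib_left power2_eq_square)
  also have "(\<Sum>v\<in>V. \<Sum>u\<in>V. ?X * \<alpha> {v, u}) = ?X\<^sup>2"
    by (simp add: sum_distrib_left[symmetric] wdeg_def[symmetric] power2_eq_square)
  also have "(\<Sum>v\<in>V. \<Sum>u\<in>V. ?d v * \<alpha> {v, u}) = (\<Sum>i\<in>V. (?d i)\<^sup>2)"
    by (simp add: sum_distrib_left[symmetric] wdeg_def[symmetric] power2_eq_square)
  also have "(\<Sum>v\<in>V. \<Sum>u\<in>V. ?d u * \<alpha> {v, u}) = (\<Sum>i\<in>V. (?d i)\<^sup>2)"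
    by (subst sum.swap) (simp add: sum_distrib_left[symmetric] insert_commute[of _ _ "{}"]
        wdeg_def[symmetric] power2_eq_square)
  finally show ?thesis by simp
qed

end

lemma sum_centered:
  assumes "simple_graph G"
  shows "(\<Sum>e\<in>[verts G]\<^bsup>2\<^esup>. centered G p e) = real (card (edges G)) - p * real (card (verts G) choose 2)"
proof -
  have V: "finite (verts G)" and E: "edges G \<subseteq> [verts G]\<^bsup>2\<^esup>" using assms by (auto simp: simple_graph_def)
  have "(\<Sum>e\<in>[verts G]\<^bsup>2\<^esup>. centered G p e) = (\<Sum>e\<in>[verts G]\<^bsup>2\<^esup>. of_bool (e \<in> edges G)) - (\<Sum>e\<in>[verts G]\<^bsup>2\<^esup>. p)"
    by (simp add: centered_def sum_subtractf)
  also have "(\<Sum>e\<in>[verts G]\<^bsup>2\<^esup>. of_bool (e \<in> edges G)) = real (card (edges G))"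
    using E V by (simp add: of_bool_def sum.If_cases finite_imp_finite_nsets Int_absorb1)
  finally show ?thesis by (simp add: card_nsets)
qed

lemma sum_wdeg_centered:
  "simple_graph G \<Longrightarrow> (\<Sum>i\<in>verts G. wdeg (verts G) (centered G p) i)
     = 2 * (real (card (edges G)) - p * real (card (verts G) choose 2))"
  by (simp add: sum_wdeg sum_centered simple_graph_def)

lemma centered_sq: "e \<in> [verts G]\<^bsup>2\<^esup> \<Longrightarrow> (centered G p e)\<^sup>2 = (1 - 2 * p) * centered G p e + p * (1 - p)"
  by (auto simp: centered_def of_bool_def power2_eq_square algebra_simps)

lemma sum_centered_sq:
  assumes "simple_graph G"
  shows "(\<Sum>i\<in>verts G. \<Sum>j\<in>verts G. (centered G p {i, j})\<^sup>2)
       = (1 - 2 * p) * (\<Sum>i\<in>verts G. wdeg (verts G) (centered G p) i)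
         + p * (1 - p) * real (card (verts G)) * (real (card (verts G)) - 1)"
proof -
  let ?\<alpha> = "centered G p"
  have V: "finite (verts G)" using assms by (auto simp: simple_graph_def)
  have "(\<Sum>i\<in>verts G. \<Sum>j\<in>verts G. (?\<alpha> {i, j})\<^sup>2) = 2 * (\<Sum>e\<in>[verts G]\<^bsup>2\<^esup>. (?\<alpha> e)\<^sup>2)"
    by (rule sum_ordered_pairs[OF V]) simp
  also have "(\<Sum>e\<in>[verts G]\<^bsup>2\<^esup>. (?\<alpha> e)\<^sup>2) = (\<Sum>e\<in>[verts G]\<^bsup>2\<^esup>. (1 - 2 * p) * ?\<alpha> e + p * (1 - p))"
    by (intro sum.cong refl centered_sq)
  also have "\<dots> = (1 - 2 * p) * (\<Sum>e\<in>[verts G]\<^bsup>2\<^esup>. ?\<alpha> e) + p * (1 - p) * real (card (verts G) choose 2)"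
    by (simp add: sum.distrib sum_distrib_left card_nsets mult.commute)
  finally show ?thesis by (simp add: sum_wdeg[OF V] real_choose_two field_simps)
qed

text \<open>The left hand side comes from the diagonal terms \<open>\<alpha>\<^sup>2\<close> of \<open>X\<^bsub>K2\<^esub>\<^sup>2\<close>; it is large for every graph.\<close>

lemma matching_path_identity:
  fixes p :: real
  assumes G: "simple_graph G"
  defines "n \<equiv> real (card (verts G))" and "X \<equiv> (\<Sum>i\<in>verts G. wdeg (verts G) (centered G p) i)"
  shows "2 * (p * (1 - p)) * n * (n - 1) = X\<^sup>2
     - 4 * inj_sum (verts G) (centered G p) {0, 1, 2 :: nat} {{0, 1}, {1, 2}}
     - inj_sum (verts G) (centered G p) {0, 1, 2, 3 :: nat} {{0, 1}, {2, 3}} - 2 * (1 - 2 * p) * X"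
proof -
  have V: "finite (verts G)" using G by (simp add: simple_graph_def)
  note path = inj_sum_path[OF V, of "centered G p" "0::nat" 1 2]
  note matching = inj_sum_matching[OF V, of "centered G p" "0::nat" 1 2 3]
  show ?thesis
    using path matching sum_centered_sq[OF G, of p] by (simp add: X_def n_def algebra_simps)
qed

lemma large_sum_of_identity:
  fixes X Y Z n p q :: real
  assumes identity: "2 * q * n * (n - 1) = X\<^sup>2 - 4 * Y - Z - 2 * (1 - 2 * p) * X"
    and q: "0 < q" "q \<le> 1" and p: "0 \<le> p" "p \<le> 1" and n: "8 \<le> n"
  shows "q / 10 \<le> \<bar>X\<bar> \<or> q / 10 * n \<le> \<bar>Y\<bar> \<or> q / 10 * n\<^sup>2 \<le> \<bar>Z\<bar>"
proof (rule ccontr)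
  assume "\<not> ?thesis"
  then have small: "\<bar>X\<bar> < q / 10" "\<bar>Y\<bar> < q / 10 * n" "\<bar>Z\<bar> < q / 10 * n\<^sup>2" by auto
  have "\<bar>X\<bar> * \<bar>X\<bar> \<le> 1 * \<bar>X\<bar>" using small(1) q by (intro mult_right_mono) auto
  then have X_sq_le: "X\<^sup>2 \<le> q" using small(1) q by (simp add: power2_eq_square abs_mult[symmetric])
  have "\<bar>1 - 2 * p\<bar> * \<bar>X\<bar> \<le> 1 * \<bar>X\<bar>" using p by (intro mult_right_mono) auto
  then have "\<bar>(1 - 2 * p) * X\<bar> \<le> q / 10" using small(1) by (simp add: abs_mult)
  then have "2 * q * n * (n - 1) \<le> q + 4 * (q / 10 * n) + q / 10 * n\<^sup>2 + q"
    using identity X_sq_le small(2,3) q(1) by linarith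
  also have "\<dots> = q * (2 + 4 / 10 * n + n\<^sup>2 / 10)" by (simp add: field_simps)
  finally have "q * (2 * n * (n - 1)) \<le> q * (2 + 4 / 10 * n + n\<^sup>2 / 10)" by (simp only: mult_ac)
  then have "2 * n * (n - 1) \<le> 2 + 4 / 10 * n + n\<^sup>2 / 10" using q(1) by simp
  moreover have "8 * n \<le> n\<^sup>2" using n by (simp add: power2_eq_square)
  moreover have "2 * n * (n - 1) = 2 * n\<^sup>2 - 2 * n" by (simp add: power2_eq_square algebra_simps)
  ultimately show False using n by linarith
qed

lemma inj_sum_support_le_u_graph:
  assumes G: "simple_graph G" and p: "0 \<le> p" "p \<le> 1" and n: "2 * k \<le> card (verts G)"
    and H: "H \<subseteq> [{..<k}]\<^bsup>2\<^esup>" "H \<noteq> {}" and U: "U = \<Union>H"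
  shows "\<bar>inj_sum (verts G) (centered G p) U H\<bar> * real (card (verts G)) ^ (k - card U)
    \<le> 2 ^ k * (inj_sum_const k * u_graph k G p)"
proof -
  let ?V = "verts G" and ?\<alpha> = "centered G p" and ?n = "card (verts G)" and ?h = "card U"
  have V: "finite ?V" using G by (simp add: simple_graph_def)
  have sub: "U \<subseteq> {..<k}" using H(1) U by (auto simp: nsets_def)
  have "?h \<le> k" using card_mono[OF _ sub] by simp
  have "(real ?n / 2) ^ (k - ?h) \<le> real (?n - k) ^ (k - ?h)"
    using n by (intro power_mono) (auto simp: of_nat_diff)
  also have "\<dots> \<le> extension_count ?n ?h (k - ?h)" using \<open>?h \<le> k\<close> by (intro extension_count_ge) auto
  finally have extensions: "(real ?n / 2) ^ (k - ?h) \<le> extension_count ?n ?h (k - ?h)" .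
  have "\<bar>inj_sum ?V ?\<alpha> U H\<bar> * real ?n ^ (k - ?h)
      = 2 ^ (k - ?h) * ((real ?n / 2) ^ (k - ?h) * \<bar>inj_sum ?V ?\<alpha> U H\<bar>)"
    by (simp add: power_divide)
  also have "\<dots> \<le> 2 ^ (k - ?h) * (extension_count ?n ?h (k - ?h) * \<bar>inj_sum ?V ?\<alpha> U H\<bar>)"
    using extensions by (intro mult_left_mono mult_right_mono) auto
  also have "extension_count ?n ?h (k - ?h) * \<bar>inj_sum ?V ?\<alpha> U H\<bar> = \<bar>inj_sum ?V ?\<alpha> {..<k} H\<bar>"
    using inj_sum_support[of "{..<k}" ?V H ?\<alpha>] V sub by (simp add: U abs_mult extension_count_nonneg)
  also have "2 ^ (k - ?h) * \<bar>inj_sum ?V ?\<alpha> {..<k} H\<bar> \<le> 2 ^ k * \<bar>inj_sum ?V ?\<alpha> {..<k} H\<bar>"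
    by (intro mult_right_mono power_increasing) auto
  also have "\<dots> \<le> 2 ^ k * (inj_sum_const k * u_graph k G p)"
    using abs_inj_sum_le_u_graph[OF G p H] by (intro mult_left_mono) auto
  finally show ?thesis .
qed

lemma int_dist_le_card_edges: "int_dist n p \<le> \<bar>real m - p * real (n choose 2)\<bar>"
  using round_diff_minimal[of "p * real (n choose 2)" "int m"] by (simp add: int_dist_def abs_minus_commute)

lemma weighted_cases_le:
  fixes n q W :: real
  assumes k: "4 \<le> k" and large: "q \<le> \<bar>X\<bar> \<or> q * n \<le> \<bar>Y\<bar> \<or> q * n\<^sup>2 \<le> \<bar>Z\<bar>" and n: "0 \<le> n"
    and bounds: "\<bar>X\<bar> * n ^ (k - 2) \<le> W" "\<bar>Y\<bar> * n ^ (k - 3) \<le> W" "\<bar>Z\<bar> * n ^ (k - 4) \<le> W"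
  shows "q * n ^ (k - 2) \<le> W"
proof -
  have powers: "n * n ^ (k - 3) = n ^ (k - 2)" "n\<^sup>2 * n ^ (k - 4) = n ^ (k - 2)"
    using k by (simp_all flip: power_Suc power_add add: Suc_diff_Suc numeral_eq_Suc)
  from large show ?thesis
  proof (elim disjE)
    assume "q \<le> \<bar>X\<bar>"
    from mult_right_mono[OF this, of "n ^ (k - 2)"] show ?thesis using bounds(1) n by simp
  next
    assume "q * n \<le> \<bar>Y\<bar>"
    from mult_right_mono[OF this, of "n ^ (k - 3)"] show ?thesis
      using bounds(2) n unfolding mult.assoc powers by simp
  next
    assume "q * n\<^sup>2 \<le> \<bar>Z\<bar>"
    from mult_right_mono[OF this, of "n ^ (k - 4)"] show ?thesis
      using bounds(3) n unfolding mult.assoc powers by simp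
  qed
qed

lemma u_graph_lower_bound:
  assumes k: "4 \<le> k" and n: "2 * k \<le> card (verts G)" and G: "simple_graph G" and p: "0 < p" "p < 1"
  shows "max (int_dist (card (verts G)) p) (p * (1 - p)) * real (card (verts G)) ^ (k - 2)
    \<le> 10 * 2 ^ k * inj_sum_const k * u_graph k G p"
proof -
  let ?V = "verts G" and ?\<alpha> = "centered G p" and ?n = "real (card (verts G))" and ?q = "p * (1 - p)"
  define W where "W = 2 ^ k * (inj_sum_const k * u_graph k G p)"
  define X where "X = (\<Sum>i\<in>?V. wdeg ?V ?\<alpha> i)"
  define Y where "Y = inj_sum ?V ?\<alpha> {0, 1, 2::nat} {{0, 1}, {1, 2}}"
  define Z where "Z = inj_sum ?V ?\<alpha> {0, 1, 2, 3::nat} {{0, 1}, {2, 3}}"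
  have V: "finite ?V" using G by (simp add: simple_graph_def)
  have W: "0 \<le> W" unfolding W_def using inj_sum_const_pos[of k] u_graph_nonneg[OF G, of p k] p by simp
  have le_W: "\<bar>inj_sum ?V ?\<alpha> U H\<bar> * ?n ^ (k - h) \<le> W"
    if "H \<subseteq> [{..<k}]\<^bsup>2\<^esup>" "H \<noteq> {}" "U = \<Union>H" "card U = h" for U H h
    unfolding W_def using inj_sum_support_le_u_graph[OF G _ _ n that(1-3)] p that(4) by simp
  have "X = inj_sum ?V ?\<alpha> {0, 1::nat} {{0, 1}}" unfolding X_def by (simp add: inj_sum_edge[OF V])
  then have X: "\<bar>X\<bar> * ?n ^ (k - 2) \<le> W"
    using k by (simp only:) (rule le_W; auto simp: nsets_def)
  have Y: "\<bar>Y\<bar> * ?n ^ (k - 3) \<le> W"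
    unfolding Y_def using k by (intro le_W) (auto simp: nsets_def)
  have Z: "\<bar>Z\<bar> * ?n ^ (k - 4) \<le> W"
    unfolding Z_def using k by (intro le_W) (auto simp: nsets_def)
  have dist: "int_dist (card ?V) p * ?n ^ (k - 2) \<le> 10 * W"
  proof -
    have "int_dist (card ?V) p \<le> \<bar>X\<bar>"
      using int_dist_le_card_edges[of "card ?V" p "card (edges G)"] sum_wdeg_centered[OF G, of p]
      by (simp add: X_def abs_mult)
    then have "int_dist (card ?V) p * ?n ^ (k - 2) \<le> \<bar>X\<bar> * ?n ^ (k - 2)" by (rule mult_right_mono) simp
    then show ?thesis using X W by linarith
  qed
  have variance: "?q * ?n ^ (k - 2) \<le> 10 * W"
  proof -
    have "?q / 10 \<le> \<bar>X\<bar> \<or> ?q / 10 * ?n \<le> \<bar>Y\<bar> \<or> ?q / 10 * ?n\<^sup>2 \<le> \<bar>Z\<bar>"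
      using matching_path_identity[OF G, of p] p n k
      by (intro large_sum_of_identity[where p = p]) (auto simp: X_def Y_def Z_def mult_le_one)
    then show ?thesis using weighted_cases_le[OF k, of "?q / 10" X ?n Y Z W] X Y Z by simp
  qed
  show ?thesis using dist variance unfolding W_def by (simp add: max_def)
qed

lemma u_min_lower_bound:
  assumes k: "4 \<le> k"
  shows "\<exists>c>0. \<forall>n\<ge>2 * k. \<forall>p. 0 < p \<and> p < 1 \<longrightarrow>
     c * max (int_dist n p) (p * (1 - p)) * real n ^ (k - 2) \<le> u_min k n p"
proof -
  define c where "c = 1 / (10 * 2 ^ k * inj_sum_const k)"
  have c: "0 < c" using inj_sum_const_pos[of k] by (simp add: c_def)
  have "c * max (int_dist n p) (p * (1 - p)) * real n ^ (k - 2) \<le> u_min k n p"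
    if n: "2 * k \<le> n" and p: "0 < p" "p < 1" for n p
  proof -
    have "u_min k n p \<in> {u_graph k G p | G :: nat graph. simple_graph G \<and> card (verts G) = n}"
      unfolding u_min_def by (rule Min_in[OF u_graph_values_finite u_graph_values_nonempty])
    then obtain G :: "nat graph" where G: "simple_graph G" "card (verts G) = n" "u_min k n p = u_graph k G p"
      by auto
    have "max (int_dist n p) (p * (1 - p)) * real n ^ (k - 2) \<le> u_graph k G p / c"
      using u_graph_lower_bound[OF k _ G(1) p] G(2) n by (simp add: c_def mult_ac)
    then show ?thesis using c G(3) by (simp add: pos_le_divide_eq mult_ac)
  qed
  then show ?thesis using c by blast
qed

section \<open>Second and fourth moments\<close>

context bernoulli_set
begin

abbreviation var :: real where "var \<equiv> \<pi> * (1 - \<pi>)"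

definition noise :: "'e set \<Rightarrow> 'e \<Rightarrow> real" where
  "noise S e = (if e \<in> P then of_bool (e \<in> S) - \<pi> else 0)"

lemma var_nonneg: "0 \<le> var" using prob_01 by simp

lemma abs_noise_le: "\<bar>noise S e\<bar> \<le> 1"
  using prob_01 by (auto simp: noise_def of_bool_def)

lemma depends_on_noise: "e \<in> A \<Longrightarrow> depends_on (\<lambda>S. noise S e) A"
  by (auto simp: depends_on_def noise_def)

lemma E_noise_monomials:
  assumes fin: "finite T" "finite T'"
  shows "E (\<lambda>S. (\<Prod>e\<in>T. noise S e) * (\<Prod>e\<in>T'. noise S e)) = (if T = T' \<and> T \<subseteq> P then var ^ card T else 0)"
proof (cases "T \<subseteq> P \<and> T' \<subseteq> P")
  case False
  then obtain e where "e \<in> T \<union> T'" "e \<notin> P" by auto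
  then have "(\<Prod>e\<in>T. noise S e) * (\<Prod>e\<in>T'. noise S e) = 0" for S
    using fin by (auto simp: noise_def)
  then have "E (\<lambda>S. (\<Prod>e\<in>T. noise S e) * (\<Prod>e\<in>T'. noise S e)) = 0" by (simp only: E_const)
  then show ?thesis using False by auto
next
  case True
  define h where "h e v = (if e \<in> T then of_bool v - \<pi> else 1) * (if e \<in> T' then of_bool v - \<pi> else 1)" for e v
  have "(\<Prod>e\<in>T. noise S e) * (\<Prod>e\<in>T'. noise S e) = (\<Prod>e\<in>T \<union> T'. h e (e \<in> S))" for S
  proof -
    have "(\<Prod>e\<in>A. noise S e) = (\<Prod>e\<in>T \<union> T'. if e \<in> A then of_bool (e \<in> S) - \<pi> else 1)"
      if "A \<subseteq> T \<union> T'" for A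
      using that fin True by (intro prod.mono_neutral_cong_left) (auto simp: noise_def)
    then show ?thesis by (simp add: h_def prod.distrib)
  qed
  then have "E (\<lambda>S. (\<Prod>e\<in>T. noise S e) * (\<Prod>e\<in>T'. noise S e)) = (\<Prod>e\<in>T \<union> T'. E (\<lambda>S. h e (e \<in> S)))"
    using E_prod_mem[of "T \<union> T'" h] fin by simp
  also have "\<dots> = (\<Prod>e\<in>T \<union> T'. \<pi> * h e True + (1 - \<pi>) * h e False)"
    using True by (intro prod.cong refl E_mem) auto
  also have "\<dots> = (if T = T' then var ^ card T else 0)"
  proof (cases "T = T'")
    case True
    then have "(\<Prod>e\<in>T \<union> T'. \<pi> * h e True + (1 - \<pi>) * h e False) = (\<Prod>e\<in>T. var)"
      by (intro prod.cong) (auto simp: h_def algebra_simps)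
    then show ?thesis using True by simp
  next
    case False
    then obtain e where "e \<in> T \<union> T'" "\<not> (e \<in> T \<and> e \<in> T')" by auto
    then have "(\<Prod>e\<in>T \<union> T'. \<pi> * h e True + (1 - \<pi>) * h e False) = 0"
      using fin by (intro prod_zero) (auto intro!: bexI[of _ e] simp: h_def algebra_simps)
    then show ?thesis using False by simp
  qed
  finally show ?thesis using True by simp
qed

lemma E_noise: "E (\<lambda>S. noise S e) = 0"
  using E_noise_monomials[of "{e}" "{}"] by simp

lemma E_noise_sq: "E (\<lambda>S. (noise S e)\<^sup>2) = (if e \<in> P then var else 0)"
  using E_noise_monomials[of "{e}" "{e}"] by (simp add: power2_eq_square)

lemma E_noise_mult: "e \<noteq> e' \<Longrightarrow> E (\<lambda>S. noise S e * noise S e') = 0"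
  using E_noise_monomials[of "{e}" "{e'}"] by simp

text \<open>Distinct monomials in the noise are orthogonal, so only coinciding ones contribute.\<close>

lemma second_moment_le:
  fixes w :: "'i \<Rightarrow> real"
  assumes fin: "finite \<Phi>" and T: "\<And>\<phi>. \<phi> \<in> \<Phi> \<Longrightarrow> finite (T \<phi>) \<and> card (T \<phi>) = m"
    and multiplicity: "\<And>\<phi>. \<phi> \<in> \<Phi> \<Longrightarrow> real (card {\<psi> \<in> \<Phi>. T \<psi> = T \<phi>}) \<le> M"
  shows "E (\<lambda>S. (\<Sum>\<phi>\<in>\<Phi>. w \<phi> * (\<Prod>e\<in>T \<phi>. noise S e))\<^sup>2) \<le> M * var ^ m * (\<Sum>\<phi>\<in>\<Phi>. (w \<phi>)\<^sup>2)"
proof -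
  have v: "0 \<le> var ^ m" using var_nonneg by simp
  have "E (\<lambda>S. (\<Sum>\<phi>\<in>\<Phi>. w \<phi> * (\<Prod>e\<in>T \<phi>. noise S e))\<^sup>2)
      = E (\<lambda>S. \<Sum>\<phi>\<in>\<Phi>. \<Sum>\<psi>\<in>\<Phi>. (w \<phi> * w \<psi>) * ((\<Prod>e\<in>T \<phi>. noise S e) * (\<Prod>e\<in>T \<psi>. noise S e)))"
    by (simp add: power2_eq_square sum_product mult_ac)
  also have "\<dots> = (\<Sum>\<phi>\<in>\<Phi>. \<Sum>\<psi>\<in>\<Phi>. (w \<phi> * w \<psi>) * (if T \<phi> = T \<psi> \<and> T \<phi> \<subseteq> P then var ^ card (T \<phi>) else 0))"
    unfolding E_sum E_cmult using T by (simp add: E_noise_monomials)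
  also have "\<dots> \<le> (\<Sum>\<phi>\<in>\<Phi>. \<Sum>\<psi>\<in>\<Phi>. if T \<psi> = T \<phi> then var ^ m * (((w \<phi>)\<^sup>2 + (w \<psi>)\<^sup>2) / 2) else 0)"
  proof (intro sum_mono)
    fix \<phi> \<psi> assume "\<phi> \<in> \<Phi>" "\<psi> \<in> \<Phi>"
    have "w \<phi> * w \<psi> \<le> ((w \<phi>)\<^sup>2 + (w \<psi>)\<^sup>2) / 2"
      using sum_squares_bound[of "w \<phi>" "w \<psi>"] by simp
    from mult_left_mono[OF this v]
    have "w \<phi> * w \<psi> * var ^ m \<le> var ^ m * (((w \<phi>)\<^sup>2 + (w \<psi>)\<^sup>2) / 2)"
      by (simp only: mult.commute)
    moreover have "0 \<le> var ^ m * (((w \<phi>)\<^sup>2 + (w \<psi>)\<^sup>2) / 2)" using v by simp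
    ultimately show "(w \<phi> * w \<psi>) * (if T \<phi> = T \<psi> \<and> T \<phi> \<subseteq> P then var ^ card (T \<phi>) else 0)
        \<le> (if T \<psi> = T \<phi> then var ^ m * (((w \<phi>)\<^sup>2 + (w \<psi>)\<^sup>2) / 2) else 0)"
      using T[OF \<open>\<phi> \<in> \<Phi>\<close>] by auto
  qed
  also have "\<dots> = (\<Sum>\<phi>\<in>\<Phi>. \<Sum>\<psi>\<in>\<Phi>. if T \<psi> = T \<phi> then var ^ m * ((w \<phi>)\<^sup>2 / 2) else 0)
      + (\<Sum>\<phi>\<in>\<Phi>. \<Sum>\<psi>\<in>\<Phi>. if T \<psi> = T \<phi> then var ^ m * ((w \<psi>)\<^sup>2 / 2) else 0)"
    by (simp add: sum.distrib[symmetric] add_divide_distrib distrib_left if_distrib cong: if_cong)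
  also have "(\<Sum>\<phi>\<in>\<Phi>. \<Sum>\<psi>\<in>\<Phi>. if T \<psi> = T \<phi> then var ^ m * ((w \<psi>)\<^sup>2 / 2) else 0)
      = (\<Sum>\<phi>\<in>\<Phi>. \<Sum>\<psi>\<in>\<Phi>. if T \<psi> = T \<phi> then var ^ m * ((w \<phi>)\<^sup>2 / 2) else 0)"
    by (subst sum.swap) (simp add: eq_commute)
  also have "(\<Sum>\<phi>\<in>\<Phi>. \<Sum>\<psi>\<in>\<Phi>. if T \<psi> = T \<phi> then var ^ m * ((w \<phi>)\<^sup>2 / 2) else 0)
      + (\<Sum>\<phi>\<in>\<Phi>. \<Sum>\<psi>\<in>\<Phi>. if T \<psi> = T \<phi> then var ^ m * ((w \<phi>)\<^sup>2 / 2) else 0)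
      = (\<Sum>\<phi>\<in>\<Phi>. real (card {\<psi> \<in> \<Phi>. T \<psi> = T \<phi>}) * (var ^ m * (w \<phi>)\<^sup>2))"
    using fin by (simp add: sum.distrib[symmetric] sum.inter_filter[symmetric] mult_ac)
  also have "\<dots> \<le> (\<Sum>\<phi>\<in>\<Phi>. M * (var ^ m * (w \<phi>)\<^sup>2))"
    using v by (intro sum_mono mult_right_mono multiplicity) auto
  finally show ?thesis by (simp add: sum_distrib_left mult_ac)
qed

lemma moments_add_indep:
  assumes dep: "depends_on X A" "depends_on Z B" "A \<inter> B = {}" and mean: "E X = 0" "E Z = 0"
  shows "E (\<lambda>S. (X S + Z S)\<^sup>2) = E (\<lambda>S. (X S)\<^sup>2) + E (\<lambda>S. (Z S)\<^sup>2)"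
    and "E (\<lambda>S. (X S + Z S) ^ 4)
       = E (\<lambda>S. (X S) ^ 4) + 6 * (E (\<lambda>S. (X S)\<^sup>2) * E (\<lambda>S. (Z S)\<^sup>2)) + E (\<lambda>S. (Z S) ^ 4)"
proof -
  have indep: "E (\<lambda>S. g (X S) * h (Z S)) = E (\<lambda>S. g (X S)) * E (\<lambda>S. h (Z S))" for g h :: "real \<Rightarrow> real"
    by (rule E_mult_indep[OF depends_on_comp[OF dep(1)] depends_on_comp[OF dep(2)] dep(3)])
  have "E (\<lambda>S. (X S + Z S)\<^sup>2) = E (\<lambda>S. (X S)\<^sup>2 + 2 * (X S * Z S) + (Z S)\<^sup>2)"
    by (intro E_cong) (simp add: power2_sum)
  also have "\<dots> = E (\<lambda>S. (X S)\<^sup>2) + E (\<lambda>S. (Z S)\<^sup>2)"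
    using indep[of "\<lambda>x. x" "\<lambda>x. x"] mean by simp
  finally show "E (\<lambda>S. (X S + Z S)\<^sup>2) = E (\<lambda>S. (X S)\<^sup>2) + E (\<lambda>S. (Z S)\<^sup>2)" .
  have "E (\<lambda>S. (X S + Z S) ^ 4) = E (\<lambda>S. (X S) ^ 4 + 4 * ((X S) ^ 3 * Z S)
      + 6 * ((X S)\<^sup>2 * (Z S)\<^sup>2) + 4 * (X S * (Z S) ^ 3) + (Z S) ^ 4)"
    by (intro E_cong) (simp add: eval_nat_numeral algebra_simps)
  also have "\<dots> = E (\<lambda>S. (X S) ^ 4) + 6 * (E (\<lambda>S. (X S)\<^sup>2) * E (\<lambda>S. (Z S)\<^sup>2)) + E (\<lambda>S. (Z S) ^ 4)"
    using indep[of "\<lambda>x. x ^ 3" "\<lambda>x. x"] indep[of "\<lambda>x. x" "\<lambda>x. x ^ 3"] indep[of "\<lambda>x. x\<^sup>2" "\<lambda>x. x\<^sup>2"] mean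
    by (simp add: E_add E_cmult)
  finally show "E (\<lambda>S. (X S + Z S) ^ 4)
      = E (\<lambda>S. (X S) ^ 4) + 6 * (E (\<lambda>S. (X S)\<^sup>2) * E (\<lambda>S. (Z S)\<^sup>2)) + E (\<lambda>S. (Z S) ^ 4)" .
qed

lemma moments_indep_sum:
  assumes "finite W" and "\<And>w. w \<in> W \<Longrightarrow> depends_on (f w) (A w)"
    and "\<And>w w'. w \<in> W \<Longrightarrow> w' \<in> W \<Longrightarrow> w \<noteq> w' \<Longrightarrow> A w \<inter> A w' = {}"
    and "\<And>w. w \<in> W \<Longrightarrow> E (f w) = 0" and "\<And>w S. w \<in> W \<Longrightarrow> \<bar>f w S\<bar> \<le> 1"
  shows "E (\<lambda>S. (\<Sum>w\<in>W. f w S)\<^sup>2) = (\<Sum>w\<in>W. E (\<lambda>S. (f w S)\<^sup>2))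
    \<and> E (\<lambda>S. (\<Sum>w\<in>W. f w S) ^ 4) \<le> 3 * (\<Sum>w\<in>W. E (\<lambda>S. (f w S)\<^sup>2))\<^sup>2 + (\<Sum>w\<in>W. E (\<lambda>S. (f w S)\<^sup>2))"
  using assms
proof (induction W rule: finite_induct)
  case empty
  then show ?case by simp
next
  case (insert x W)
  let ?X = "f x" and ?Z = "\<lambda>S. \<Sum>w\<in>W. f w S"
  let ?a = "E (\<lambda>S. (?X S)\<^sup>2)" and ?b = "\<Sum>w\<in>W. E (\<lambda>S. (f w S)\<^sup>2)"
  have IH: "E (\<lambda>S. (?Z S)\<^sup>2) = ?b" "E (\<lambda>S. (?Z S) ^ 4) \<le> 3 * ?b\<^sup>2 + ?b"
    using insert.IH insert.prems by auto
  have "depends_on ?X (A x)" using insert.prems(1) by simp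
  moreover have "depends_on ?Z (\<Union>w\<in>W. A w)"
    by (rule depends_on_sum, rule depends_on_mono) (use insert.prems(1) in auto)
  moreover have "A x \<inter> (\<Union>w\<in>W. A w) = {}" using insert.prems(2)[of x] insert.hyps by auto
  moreover have "E ?X = 0" "E ?Z = 0" using insert.prems(3) by (simp_all add: E_sum)
  ultimately have moments: "E (\<lambda>S. (?X S + ?Z S)\<^sup>2) = ?a + ?b"
    "E (\<lambda>S. (?X S + ?Z S) ^ 4) = E (\<lambda>S. (?X S) ^ 4) + 6 * (?a * ?b) + E (\<lambda>S. (?Z S) ^ 4)"
    using moments_add_indep[of ?X "A x" ?Z] IH(1) by simp_all
  have "E (\<lambda>S. (?X S) ^ 4) \<le> ?a"
  proof (rule E_mono)
    fix S
    have "(?X S)\<^sup>2 \<le> 1" using insert.prems(4)[of x S] by (simp add: abs_square_le_1)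
    then have "(?X S)\<^sup>2 * (?X S)\<^sup>2 \<le> 1 * (?X S)\<^sup>2" by (intro mult_right_mono) auto
    then show "(?X S) ^ 4 \<le> (?X S)\<^sup>2" by (simp add: power_add[symmetric])
  qed
  then have "E (\<lambda>S. (?X S + ?Z S) ^ 4) \<le> ?a + 6 * (?a * ?b) + (3 * ?b\<^sup>2 + ?b)"
    unfolding moments(2) using IH(2) by linarith
  also have "\<dots> \<le> 3 * (?a + ?b)\<^sup>2 + (?a + ?b)"
    by (simp add: power2_sum algebra_simps)
  finally show ?case using moments(1) insert.hyps by simp
qed

end

lemma abs_ge_quadratic_minus_quartic:
  fixes z l :: real
  assumes "0 < l" shows "z\<^sup>2 / l - z ^ 4 / (4 * l ^ 3) \<le> \<bar>z\<bar>"
proof -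
  define y where "y = \<bar>z\<bar> / l"
  have y: "0 \<le> y" "\<bar>z\<bar> = l * y" using assms by (simp_all add: y_def)
  have "y - y\<^sup>2 + y ^ 4 / 4 = y * ((y - 6 / 5)\<^sup>2 * (y + 12 / 5) / 4 + 17 / 125 + 2 / 25 * y)"
    by (simp add: eval_nat_numeral field_simps)
  also have "0 \<le> \<dots>" using y(1) by (intro mult_nonneg_nonneg add_nonneg_nonneg) auto
  finally have "l * (y\<^sup>2 - y ^ 4 / 4) \<le> l * y" using assms by (intro mult_left_mono) auto
  moreover have "z\<^sup>2 = (l * y)\<^sup>2" "z ^ 4 = (l * y) ^ 4"
    unfolding y(2)[symmetric] by simp_all
  moreover have "(l * y)\<^sup>2 / l = l * y\<^sup>2" "(l * y) ^ 4 / (4 * l ^ 3) = l * (y ^ 4 / 4)"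
    using assms by (simp_all add: eval_nat_numeral field_simps)
  ultimately show ?thesis using y(2) by (simp only: right_diff_distrib)
qed

context bernoulli_set
begin

lemma E_abs_ge:
  assumes m: "E (\<lambda>S. (f S)\<^sup>2) = m" "1 \<le> m" and fourth: "E (\<lambda>S. f S ^ 4) \<le> 3 * m\<^sup>2 + m"
  shows "3 / 8 * sqrt m \<le> E (\<lambda>S. \<bar>f S\<bar>)"
proof -
  define l where "l = 2 * sqrt m"
  have l: "0 < l" "l\<^sup>2 = 4 * m" using m by (auto simp: l_def power_mult_distrib)
  have "m * 1 \<le> m * m" using m by (intro mult_left_mono) auto
  then have "E (\<lambda>S. f S ^ 4) \<le> 4 * m\<^sup>2" using fourth by (simp add: power2_eq_square)
  then have "E (\<lambda>S. f S ^ 4) / (4 * l ^ 3) \<le> 4 * m\<^sup>2 / (4 * l ^ 3)"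
    using l by (intro divide_right_mono) auto
  also have "\<dots> = l / 16"
  proof -
    have "4 * m\<^sup>2 = l ^ 3 * l / 4" using l(2) by (simp add: power2_eq_square eval_nat_numeral)
    then show ?thesis using l(1) by (simp add: field_simps)
  qed
  finally have "m / l - l / 16 \<le> m / l - E (\<lambda>S. f S ^ 4) / (4 * l ^ 3)" by simp
  also have "\<dots> = E (\<lambda>S. (f S)\<^sup>2 / l - f S ^ 4 / (4 * l ^ 3))"
    by (simp only: E_diff E_cdiv m)
  also have "\<dots> \<le> E (\<lambda>S. \<bar>f S\<bar>)" using l(1) by (intro E_mono abs_ge_quadratic_minus_quartic)
  finally have "m / l - l / 16 \<le> E (\<lambda>S. \<bar>f S\<bar>)" .
  moreover have "m / l - l / 16 = 3 / 8 * sqrt m"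
    using m by (simp add: l_def real_div_sqrt field_simps)
  ultimately show ?thesis by simp
qed

lemma E_abs_mult_le:
  assumes "E (\<lambda>S. (f S)\<^sup>2) \<le> m" "E (\<lambda>S. (g S)\<^sup>2) \<le> m"
  shows "E (\<lambda>S. \<bar>f S\<bar> * \<bar>g S\<bar>) \<le> m"
proof -
  have "E (\<lambda>S. \<bar>f S\<bar> * \<bar>g S\<bar>) \<le> E (\<lambda>S. (f S)\<^sup>2 / 2 + (g S)\<^sup>2 / 2)"
  proof (rule E_mono)
    fix S show "\<bar>f S\<bar> * \<bar>g S\<bar> \<le> (f S)\<^sup>2 / 2 + (g S)\<^sup>2 / 2"
      using sum_squares_bound[of "\<bar>f S\<bar>" "\<bar>g S\<bar>"] by simp
  qed
  also have "\<dots> \<le> m" using assms by simp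
  finally show ?thesis .
qed

lemma E_sum_abs_sq_le:
  fixes X :: "'i \<Rightarrow> 'e set \<Rightarrow> real"
  assumes T: "finite T" and m: "\<And>i. i \<in> T \<Longrightarrow> E (\<lambda>S. (X i S)\<^sup>2) \<le> m" "0 \<le> m" and r: "0 \<le> r"
    and far: "\<And>i j. i \<in> T \<Longrightarrow> j \<in> T \<Longrightarrow> (i, j) \<notin> near \<Longrightarrow>
       E (\<lambda>S. \<bar>X i S\<bar> * \<bar>X j S\<bar>) \<le> (E (\<lambda>S. \<bar>X i S\<bar>) + r) * (E (\<lambda>S. \<bar>X j S\<bar>) + r)"
    and near: "\<And>i. i \<in> T \<Longrightarrow> real (card {j \<in> T. (i, j) \<in> near}) \<le> N"
  shows "E (\<lambda>S. (\<Sum>i\<in>T. \<bar>X i S\<bar>)\<^sup>2)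
    \<le> (E (\<lambda>S. \<Sum>i\<in>T. \<bar>X i S\<bar>) + real (card T) * r)\<^sup>2 + real (card T) * (N * m)"
proof -
  let ?\<nu> = "\<lambda>i. E (\<lambda>S. \<bar>X i S\<bar>)"
  have product: "E (\<lambda>S. \<bar>X i S\<bar> * \<bar>X j S\<bar>) \<le> (?\<nu> i + r) * (?\<nu> j + r) + (if (i, j) \<in> near then m else 0)"
    if ij: "i \<in> T" "j \<in> T" for i j
  proof (cases "(i, j) \<in> near")
    case True
    have "0 \<le> (?\<nu> i + r) * (?\<nu> j + r)" using r by (intro mult_nonneg_nonneg add_nonneg_nonneg E_nonneg) auto
    then show ?thesis using E_abs_mult_le[OF m(1)[OF ij(1)] m(1)[OF ij(2)]] True by simp
  qed (use far[OF ij] in simp)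
  have "E (\<lambda>S. (\<Sum>i\<in>T. \<bar>X i S\<bar>)\<^sup>2) = (\<Sum>i\<in>T. \<Sum>j\<in>T. E (\<lambda>S. \<bar>X i S\<bar> * \<bar>X j S\<bar>))"
    by (simp add: power2_eq_square sum_product E_sum)
  also have "\<dots> \<le> (\<Sum>i\<in>T. \<Sum>j\<in>T. (?\<nu> i + r) * (?\<nu> j + r) + (if (i, j) \<in> near then m else 0))"
    by (intro sum_mono product)
  also have "\<dots> = (\<Sum>i\<in>T. \<Sum>j\<in>T. (?\<nu> i + r) * (?\<nu> j + r)) + (\<Sum>i\<in>T. real (card {j \<in> T. (i, j) \<in> near}) * m)"
    using T by (simp add: sum.distrib sum.inter_filter[symmetric])
  also have "(\<Sum>i\<in>T. \<Sum>j\<in>T. (?\<nu> i + r) * (?\<nu> j + r)) = (E (\<lambda>S. \<Sum>i\<in>T. \<bar>X i S\<bar>) + real (card T) * r)\<^sup>2"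
    unfolding sum_product[symmetric] by (simp add: power2_eq_square sum.distrib E_sum)
  also have "(\<Sum>i\<in>T. real (card {j \<in> T. (i, j) \<in> near}) * m) \<le> real (card T) * (N * m)"
    using sum_mono[of T "\<lambda>i. real (card {j \<in> T. (i, j) \<in> near}) * m" "\<lambda>_. N * m"] near m(2)
    by (simp add: mult_right_mono)
  finally show ?thesis by simp
qed

text \<open>Chebyshev's argument; the relation \<open>near\<close> collects the pairs that are not assumed to be almost
  independent.\<close>

lemma sum_abs_concentrated:
  fixes X :: "'i \<Rightarrow> 'e set \<Rightarrow> real"
  assumes T: "finite T" "T \<noteq> {}" and m: "\<And>i. i \<in> T \<Longrightarrow> E (\<lambda>S. (X i S)\<^sup>2) \<le> m" and r: "0 \<le> r"
    and far: "\<And>i j. i \<in> T \<Longrightarrow> j \<in> T \<Longrightarrow> (i, j) \<notin> near \<Longrightarrow>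
       E (\<lambda>S. \<bar>X i S\<bar> * \<bar>X j S\<bar>) \<le> (E (\<lambda>S. \<bar>X i S\<bar>) + r) * (E (\<lambda>S. \<bar>X j S\<bar>) + r)"
    and near: "\<And>i. i \<in> T \<Longrightarrow> real (card {j \<in> T. (i, j) \<in> near}) \<le> N"
    and \<mu>: "\<And>i. i \<in> T \<Longrightarrow> \<mu> \<le> E (\<lambda>S. \<bar>X i S\<bar>)" "0 < \<mu>"
  shows "E (\<lambda>S. ((\<Sum>i\<in>T. \<bar>X i S\<bar>) / E (\<lambda>S. \<Sum>i\<in>T. \<bar>X i S\<bar>) - 1)\<^sup>2)
      \<le> 2 * (r / \<mu>) + (r / \<mu>)\<^sup>2 + N * m / (real (card T) * \<mu>\<^sup>2)"
proof -
  let ?Y = "\<lambda>S. \<Sum>i\<in>T. \<bar>X i S\<bar>" and ?t = "real (card T)"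
  define y where "y = E ?Y"
  have t: "0 < ?t" using T by (simp add: card_gt_0_iff)
  have "?t * \<mu> \<le> y"
    unfolding y_def E_sum using sum_mono[of T "\<lambda>_. \<mu>" "\<lambda>i. E (\<lambda>S. \<bar>X i S\<bar>)"] \<mu>(1) by simp
  then have y: "?t * \<mu> \<le> y" "0 < y" using mult_pos_pos[OF t \<mu>(2)] by linarith+
  obtain i\<^sub>0 where i\<^sub>0: "i\<^sub>0 \<in> T" using T(2) by auto
  have "0 \<le> E (\<lambda>S. (X i\<^sub>0 S)\<^sup>2)" by (intro E_nonneg) auto
  then have m_nonneg: "0 \<le> m" using m[OF i\<^sub>0] by linarith
  have N: "0 \<le> N" using near[OF i\<^sub>0] of_nat_0_le_iff order_trans by blast
  have ratio: "?t * r / y \<le> r / \<mu>"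
  proof -
    have "?t * r / y \<le> ?t * r / (?t * \<mu>)"
      using y t \<mu>(2) r by (intro divide_left_mono mult_pos_pos) auto
    then show ?thesis using t by simp
  qed
  have near_part: "?t * (N * m) / y\<^sup>2 \<le> N * m / (?t * \<mu>\<^sup>2)"
  proof -
    have "?t * (N * m) / y\<^sup>2 \<le> ?t * (N * m) / (?t * \<mu>)\<^sup>2"
      using y t \<mu>(2) m_nonneg N by (intro divide_left_mono power_mono mult_pos_pos zero_less_power) auto
    also have "\<dots> = N * m / (?t * \<mu>\<^sup>2)" using t by (simp add: power2_eq_square field_simps)
    finally show ?thesis .
  qed
  have "E (\<lambda>S. (?Y S / y - 1)\<^sup>2) = E (\<lambda>S. (1 / y\<^sup>2) * (?Y S)\<^sup>2 - (2 / y) * ?Y S + 1)"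
    using y(2) by (intro E_cong) (simp add: power2_eq_square field_simps)
  also have "\<dots> = E (\<lambda>S. (?Y S)\<^sup>2) / y\<^sup>2 - 1"
    using y(2) by (simp only: E_add E_diff E_cmult E_const y_def[symmetric]) (simp add: field_simps)
  also have "\<dots> \<le> ((y + ?t * r)\<^sup>2 + ?t * (N * m)) / y\<^sup>2 - 1"
    unfolding y_def using m m_nonneg r far near
    by (intro diff_right_mono divide_right_mono E_sum_abs_sq_le[OF T(1), where near = near]) auto
  also have "\<dots> = 2 * (?t * r / y) + (?t * r / y)\<^sup>2 + ?t * (N * m) / y\<^sup>2"
    using y(2) by (simp add: power2_eq_square field_simps)
  also have "\<dots> \<le> 2 * (r / \<mu>) + (r / \<mu>)\<^sup>2 + N * m / (?t * \<mu>\<^sup>2)"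
    using ratio near_part power_mono[OF ratio, of 2] r y(2) by simp
  finally show ?thesis by (simp add: y_def)
qed

lemma ex_all_le_of_sum_E_less_1:
  assumes fs: "\<And>f w S. (f, w) \<in> set fs \<Longrightarrow> 0 < w \<and> 0 \<le> f S" and total: "(\<Sum>(f, w)\<leftarrow>fs. E f / w) < 1"
  shows "\<exists>S\<subseteq>P. \<forall>(f, w)\<in>set fs. f S \<le> w"
proof -
  have "E (\<lambda>S. \<Sum>(f, w)\<leftarrow>fs. f S / w) = (\<Sum>(f, w)\<leftarrow>fs. E f / w)"
    by (induction fs) (auto simp: case_prod_unfold)
  then have "E (\<lambda>S. \<Sum>(f, w)\<leftarrow>fs. f S / w) < 1" using total by simp
  from E_less_imp_ex[OF this] obtain S where S: "S \<subseteq> P" "(\<Sum>(f, w)\<leftarrow>fs. f S / w) < 1" by blast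
  have "f S \<le> w" if mem: "(f, w) \<in> set fs" for f w
  proof -
    from split_list[OF mem] obtain gs hs where split: "fs = gs @ (f, w) # hs" by blast
    have "0 \<le> (case x of (f, w) \<Rightarrow> f S / w)" if "x \<in> set fs" for x
      using fs[of "fst x" "snd x" S] that by (simp add: case_prod_unfold)
    then have "0 \<le> (\<Sum>(f, w)\<leftarrow>gs. f S / w)" "0 \<le> (\<Sum>(f, w)\<leftarrow>hs. f S / w)"
      unfolding split by (intro sum_list_nonneg; auto)+
    then have "f S / w < 1" using S(2) unfolding split by simp
    then show ?thesis using fs[OF mem] by (simp add: divide_less_eq)
  qed
  then show ?thesis using S(1) by blast
qed

end

section \<open>Sums over injections of a perturbed random function\<close>

lemma sum_PiE_insert:
  fixes g :: "('i \<Rightarrow> 'a) \<Rightarrow> 'b::comm_monoid_add"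
  assumes "u \<notin> U"
  shows "(\<Sum>\<psi>\<in>insert u U \<rightarrow>\<^sub>E V. g \<psi>) = (\<Sum>\<psi>\<in>U \<rightarrow>\<^sub>E V. \<Sum>v\<in>V. g (\<psi>(u := v)))"
proof -
  have "(\<Sum>\<psi>\<in>insert u U \<rightarrow>\<^sub>E V. g \<psi>) = (\<Sum>(v, \<psi>)\<in>V \<times> (U \<rightarrow>\<^sub>E V). g (\<psi>(u := v)))"
    unfolding PiE_insert_eq using inj_combinator[OF assms, of "\<lambda>_. V"]
    by (subst sum.reindex) (auto simp: case_prod_unfold)
  also have "\<dots> = (\<Sum>v\<in>V. \<Sum>\<psi>\<in>U \<rightarrow>\<^sub>E V. g (\<psi>(u := v)))"
    by (simp add: sum.cartesian_product)
  also have "\<dots> = (\<Sum>\<psi>\<in>U \<rightarrow>\<^sub>E V. \<Sum>v\<in>V. g (\<psi>(u := v)))" by (rule sum.swap)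
  finally show ?thesis .
qed

lemma prod_le_mult_prod_subset:
  fixes f :: "'b \<Rightarrow> real"
  assumes f: "\<And>x. 0 \<le> f x" "\<And>x. f x \<le> 1" and A: "finite A" "B \<subseteq> A" "a \<in> A - B"
  shows "prod f A \<le> f a * prod f B"
proof -
  have "prod f A = prod f (A - insert a B) * prod f (insert a B)"
    using A by (intro prod.subset_diff) auto
  also have "\<dots> \<le> 1 * prod f (insert a B)"
    using f by (intro mult_right_mono prod_le_1 prod_nonneg) auto
  also have "\<dots> = f a * prod f B" using A finite_subset[of B A] by simp
  finally show ?thesis .
qed

text \<open>If every vertex is needed to cover some other vertex, then \<open>J\<close> is a perfect matching.\<close>

lemma ex_isolated_edge:
  assumes J: "J \<noteq> {}" "\<And>e. e \<in> J \<Longrightarrow> card e = 2"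
    and needed: "\<And>u. u \<in> \<Union>J \<Longrightarrow> \<Union>{e \<in> J. u \<notin> e} \<noteq> \<Union>J - {u}"
  shows "\<exists>u v. u \<noteq> v \<and> {u, v} \<in> J \<and> (\<forall>e\<in>J. u \<in> e \<or> v \<in> e \<longrightarrow> e = {u, v})"
proof -
  have leaf: "\<exists>v\<in>\<Union>J. v \<noteq> u \<and> (\<forall>e\<in>J. v \<in> e \<longrightarrow> e = {u, v})" if u: "u \<in> \<Union>J" for u
  proof -
    obtain v where v: "v \<in> \<Union>J" "v \<noteq> u" "v \<notin> \<Union>{e \<in> J. u \<notin> e}" using needed[OF u] by auto
    have "e = {u, v}" if "e \<in> J" "v \<in> e" for e
    proof -
      have "u \<in> e" using v that by auto
      then show ?thesis using J(2)[OF that(1)] that v(2) by (auto simp: card_2_iff)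
    qed
    then show ?thesis using v by auto
  qed
  obtain e where "e \<in> J" using J(1) by blast
  then have "e \<noteq> {}" using J(2)[of e] by auto
  then obtain u where "u \<in> \<Union>J" using \<open>e \<in> J\<close> by auto
  then obtain v where v: "v \<in> \<Union>J" "v \<noteq> u" "\<And>e. e \<in> J \<Longrightarrow> v \<in> e \<Longrightarrow> e = {u, v}"
    using leaf by blast
  obtain w where w: "w \<in> \<Union>J" "w \<noteq> v" "\<And>e. e \<in> J \<Longrightarrow> w \<in> e \<Longrightarrow> e = {v, w}"
    using leaf[OF v(1)] by blast
  obtain e where "e \<in> J" "w \<in> e" using w(1) by blast
  then have "{v, w} \<in> J" using w(3) by blast
  then have "{v, w} = {u, v}" using v(3) by blast
  then have "w = u" using w(2) by (auto simp: doubleton_eq_iff)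
  then have "e = {u, v}" if "e \<in> J" "u \<in> e" for e using w(3) that by (simp add: insert_commute)
  then have "\<forall>e\<in>J. u \<in> e \<or> v \<in> e \<longrightarrow> e = {u, v}" using v(3) by blast
  moreover have "{u, v} \<in> J" using \<open>{v, w} \<in> J\<close> \<open>{v, w} = {u, v}\<close> by simp
  ultimately show ?thesis using v(2)[symmetric] by blast
qed

definition hom_sum :: "'a set \<Rightarrow> ('a set \<Rightarrow> real) \<Rightarrow> 'i set set \<Rightarrow> real" where
  "hom_sum V \<rho> J = (\<Sum>\<psi>\<in>\<Union>J \<rightarrow>\<^sub>E V. \<Prod>e\<in>J. \<rho> (\<psi> ` e))"

context
  fixes V :: "'a set" and \<rho> :: "'a set \<Rightarrow> real" and \<Delta> :: real
  assumes \<rho>: "\<And>e. 0 \<le> \<rho> e" "\<And>e. \<rho> e \<le> 1"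
    and max_degree: "\<And>i. i \<in> V \<Longrightarrow> wdeg V \<rho> i \<le> \<Delta>"
    and degree_sum: "(\<Sum>i\<in>V. wdeg V \<rho> i) \<le> \<Delta>\<^sup>2" and \<Delta>: "0 \<le> \<Delta>"
begin

lemma prod_image_nonneg: "0 \<le> (\<Prod>e\<in>J. \<rho> (\<psi> ` e))" for \<psi> :: "'i \<Rightarrow> 'a"
  by (intro prod_nonneg) (use \<rho> in auto)

lemma hom_sum_remove_vertex:
  fixes J :: "'i set set"
  assumes J: "finite J" "\<And>e. e \<in> J \<Longrightarrow> card e = 2" and u: "u \<in> \<Union>J"
    and U: "\<Union>{e \<in> J. u \<notin> e} = \<Union>J - {u}"
  shows "hom_sum V \<rho> J \<le> \<Delta> * hom_sum V \<rho> {e \<in> J. u \<notin> e}"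
proof -
  define J' where "J' = {e \<in> J. u \<notin> e}"
  have union_J: "\<Union>J = insert u (\<Union>J')" "u \<notin> \<Union>J'" using U u by (auto simp: J'_def)
  obtain d where "d \<in> J" "u \<in> d" using u by auto
  then obtain t where t: "d = {u, t}" "t \<noteq> u" using J(2)[of d] by (auto simp: card_2_iff)
  have "t \<in> \<Union>J'" using t \<open>d \<in> J\<close> union_J by auto
  have "hom_sum V \<rho> J = (\<Sum>\<psi>\<in>\<Union>J' \<rightarrow>\<^sub>E V. \<Sum>v\<in>V. \<Prod>e\<in>J. \<rho> ((\<psi>(u := v)) ` e))"
    unfolding hom_sum_def union_J(1) by (rule sum_PiE_insert[OF union_J(2)])
  also have "\<dots> \<le> (\<Sum>\<psi>\<in>\<Union>J' \<rightarrow>\<^sub>E V. \<Sum>v\<in>V. \<rho> {\<psi> t, v} * (\<Prod>e\<in>J'. \<rho> (\<psi> ` e)))"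
  proof (intro sum_mono)
    fix \<psi> :: "'i \<Rightarrow> 'a" and v
    have "(\<psi>(u := v)) ` d = {\<psi> t, v}" using t by auto
    moreover have "(\<psi>(u := v)) ` e = \<psi> ` e" if "e \<in> J'" for e
      using that by (intro image_cong) (auto simp: J'_def)
    moreover have "(\<Prod>e\<in>J. \<rho> ((\<psi>(u := v)) ` e)) \<le> \<rho> ((\<psi>(u := v)) ` d) * (\<Prod>e\<in>J'. \<rho> ((\<psi>(u := v)) ` e))"
      using \<rho> J(1) \<open>d \<in> J\<close> \<open>u \<in> d\<close> by (intro prod_le_mult_prod_subset) (auto simp: J'_def)
    ultimately show "(\<Prod>e\<in>J. \<rho> ((\<psi>(u := v)) ` e)) \<le> \<rho> {\<psi> t, v} * (\<Prod>e\<in>J'. \<rho> (\<psi> ` e))"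
      by simp
  qed
  also have "\<dots> = (\<Sum>\<psi>\<in>\<Union>J' \<rightarrow>\<^sub>E V. wdeg V \<rho> (\<psi> t) * (\<Prod>e\<in>J'. \<rho> (\<psi> ` e)))"
    by (simp add: wdeg_def sum_distrib_right)
  also have "\<dots> \<le> (\<Sum>\<psi>\<in>\<Union>J' \<rightarrow>\<^sub>E V. \<Delta> * (\<Prod>e\<in>J'. \<rho> (\<psi> ` e)))"
    using \<open>t \<in> \<Union>J'\<close> by (intro sum_mono mult_right_mono max_degree prod_image_nonneg) auto
  also have "\<dots> = \<Delta> * hom_sum V \<rho> J'" by (simp add: hom_sum_def sum_distrib_left)
  finally show ?thesis by (simp add: J'_def)
qed

lemma hom_sum_remove_isolated_edge:
  fixes J :: "'i set set"
  assumes J: "finite J" "{u, v} \<in> J" and uv: "u \<noteq> v"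
    and isolated: "\<And>e. e \<in> J \<Longrightarrow> u \<in> e \<or> v \<in> e \<Longrightarrow> e = {u, v}"
  shows "hom_sum V \<rho> J \<le> \<Delta>\<^sup>2 * hom_sum V \<rho> (J - {{u, v}})"
proof -
  define J' where "J' = J - {{u, v}}"
  have notin: "u \<notin> e" "v \<notin> e" if "e \<in> J'" for e using that isolated by (auto simp: J'_def)
  have U: "\<Union>J = insert u (insert v (\<Union>J'))" using J(2) by (auto simp: J'_def)
  have new: "u \<notin> insert v (\<Union>J')" "v \<notin> \<Union>J'" using notin uv by auto
  have "hom_sum V \<rho> J
      = (\<Sum>\<psi>\<in>\<Union>J' \<rightarrow>\<^sub>E V. \<Sum>y\<in>V. \<Sum>x\<in>V. \<Prod>e\<in>J. \<rho> ((\<psi>(v := y, u := x)) ` e))"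
    unfolding hom_sum_def U by (simp only: sum_PiE_insert[OF new(1)] sum_PiE_insert[OF new(2)])
  also have "\<dots> \<le> (\<Sum>\<psi>\<in>\<Union>J' \<rightarrow>\<^sub>E V. \<Sum>y\<in>V. \<Sum>x\<in>V. \<rho> {y, x} * (\<Prod>e\<in>J'. \<rho> (\<psi> ` e)))"
  proof (intro sum_mono)
    fix \<psi> :: "'i \<Rightarrow> 'a" and y x
    let ?\<psi> = "\<psi>(v := y, u := x)"
    have "?\<psi> ` {u, v} = {y, x}" using uv by auto
    moreover have "?\<psi> ` e = \<psi> ` e" if "e \<in> J'" for e
      using notin[OF that] by (intro image_cong) auto
    moreover have "(\<Prod>e\<in>J. \<rho> (?\<psi> ` e)) \<le> \<rho> (?\<psi> ` {u, v}) * (\<Prod>e\<in>J'. \<rho> (?\<psi> ` e))"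
      using \<rho> J by (intro prod_le_mult_prod_subset) (auto simp: J'_def)
    ultimately show "(\<Prod>e\<in>J. \<rho> (?\<psi> ` e)) \<le> \<rho> {y, x} * (\<Prod>e\<in>J'. \<rho> (\<psi> ` e))" by simp
  qed
  also have "\<dots> = (\<Sum>i\<in>V. wdeg V \<rho> i) * hom_sum V \<rho> J'"
    by (simp only: wdeg_def hom_sum_def sum_distrib_right[symmetric] sum_distrib_left[symmetric])
  also have "\<dots> \<le> \<Delta>\<^sup>2 * hom_sum V \<rho> J'"
    unfolding hom_sum_def by (intro mult_right_mono degree_sum sum_nonneg prod_image_nonneg)
  finally show ?thesis by (simp add: J'_def)
qed

lemma hom_sum_le:
  "finite J \<Longrightarrow> (\<And>e. e \<in> J \<Longrightarrow> card e = 2) \<Longrightarrow> hom_sum V \<rho> J \<le> \<Delta> ^ card (\<Union>J)" for J :: "'i set set"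
proof (induction "card (\<Union>J)" arbitrary: J rule: less_induct)
  case less
  have "finite e" if "e \<in> J" for e using less.prems(2)[OF that] by (simp add: card_ge_0_finite)
  then have fin: "finite (\<Union>J)" using less.prems(1) by auto
  show ?case
  proof (cases "\<exists>u\<in>\<Union>J. \<Union>{e \<in> J. u \<notin> e} = \<Union>J - {u}")
    case True
    then obtain u where u: "u \<in> \<Union>J" "\<Union>{e \<in> J. u \<notin> e} = \<Union>J - {u}" by auto
    have card: "card (\<Union>J) = Suc (card (\<Union>{e \<in> J. u \<notin> e}))"
      using card.remove[OF fin u(1)] u(2) by simp
    have "hom_sum V \<rho> J \<le> \<Delta> * hom_sum V \<rho> {e \<in> J. u \<notin> e}"
      using less.prems by (intro hom_sum_remove_vertex u)
    also have "\<dots> \<le> \<Delta> * \<Delta> ^ card (\<Union>{e \<in> J. u \<notin> e})"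
      using less.prems card \<Delta> by (intro mult_left_mono less.hyps) auto
    finally show ?thesis by (simp add: card)
  next
    case False
    then have needed: "\<Union>{e \<in> J. u \<notin> e} \<noteq> \<Union>J - {u}" if "u \<in> \<Union>J" for u
      using bexI[of "\<lambda>u. \<Union>{e \<in> J. u \<notin> e} = \<Union>J - {u}", OF _ that] by blast
    show ?thesis
    proof (cases "J = {}")
      case True
      then show ?thesis by (simp add: hom_sum_def)
    next
      case nonempty: False
      obtain u v where uv: "u \<noteq> v" "{u, v} \<in> J" "\<And>e. e \<in> J \<Longrightarrow> u \<in> e \<or> v \<in> e \<Longrightarrow> e = {u, v}"
        using ex_isolated_edge[OF nonempty less.prems(2) needed] by blast
      define J' where "J' = J - {{u, v}}"
      have "u \<notin> e" "v \<notin> e" if "e \<in> J'" for e using that uv(3)[of e] by (auto simp: J'_def)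
      then have "u \<notin> insert v (\<Union>J')" "v \<notin> \<Union>J'" using uv(1) by auto
      moreover have "\<Union>J = insert u (insert v (\<Union>J'))" using uv(2) by (auto simp: J'_def)
      ultimately have card: "card (\<Union>J) = Suc (Suc (card (\<Union>J')))" using fin by simp
      have "hom_sum V \<rho> J \<le> \<Delta>\<^sup>2 * hom_sum V \<rho> J'"
        unfolding J'_def using less.prems(1) uv by (intro hom_sum_remove_isolated_edge)
      also have "\<dots> \<le> \<Delta>\<^sup>2 * \<Delta> ^ card (\<Union>J')"
        using less.prems card by (intro mult_left_mono less.hyps) (auto simp: J'_def)
      finally show ?thesis by (simp add: card power2_eq_square)
    qed
  qed
qed

end

definition extensions :: "'a set \<Rightarrow> 'i set \<Rightarrow> 'i set \<Rightarrow> ('i \<Rightarrow> 'a) \<Rightarrow> ('i \<Rightarrow> 'a) set" where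
  "extensions V U W \<psi> = {\<phi> \<in> injections U V. restrict \<phi> W = \<psi>}"

lemma card_extensions_le:
  assumes U: "finite U" and V: "finite V" and W: "W \<subseteq> U"
  shows "card (extensions V U W \<psi>) \<le> card V ^ (card U - card W)"
proof -
  have "card (extensions V U W \<psi>) \<le> card ((U - W) \<rightarrow>\<^sub>E V)"
  proof (rule card_inj_on_le[where f = "\<lambda>\<phi>. restrict \<phi> (U - W)"])
    show "inj_on (\<lambda>\<phi>. restrict \<phi> (U - W)) (extensions V U W \<psi>)"
    proof (rule inj_onI)
      fix \<phi> \<phi>' assume ext: "\<phi> \<in> extensions V U W \<psi>" "\<phi>' \<in> extensions V U W \<psi>"
        and outside: "restrict \<phi> (U - W) = restrict \<phi>' (U - W)"
      have inside: "restrict \<phi> W = restrict \<phi>' W" using ext by (simp add: extensions_def)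
      have "\<phi> \<in> extensional U" "\<phi>' \<in> extensional U"
        using ext by (auto simp: extensions_def injections_def PiE_def)
      then show "\<phi> = \<phi>'"
      proof (rule extensionalityI)
        fix x assume "x \<in> U"
        then show "\<phi> x = \<phi>' x"
          using fun_cong[OF inside, of x] fun_cong[OF outside, of x] by (cases "x \<in> W") simp_all
      qed
    qed
    show "(\<lambda>\<phi>. restrict \<phi> (U - W)) ` extensions V U W \<psi> \<subseteq> (U - W) \<rightarrow>\<^sub>E V"
      by (auto simp: extensions_def injections_def)
    show "finite ((U - W) \<rightarrow>\<^sub>E V)" using U V by (intro finite_PiE) auto
  qed
  also have "\<dots> = card V ^ (card U - card W)"
    using U W finite_subset[OF W U] by (simp add: card_funcsetE card_Diff_subset)
  finally show ?thesis .
qed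

lemma card_extensions_same_images_le:
  assumes U: "finite U" and H: "\<Union>H \<subseteq> U" "U - W \<subseteq> \<Union>H" and \<phi>: "\<phi> \<in> extensions V U W \<psi>"
  shows "card {\<phi>' \<in> extensions V U W \<psi>. image \<phi>' ` H = image \<phi> ` H} \<le> card U ^ card U"
proof -
  have "{\<phi>' \<in> extensions V U W \<psi>. image \<phi>' ` H = image \<phi> ` H} \<subseteq> U \<rightarrow>\<^sub>E \<phi> ` U"
  proof
    fix \<phi>' assume "\<phi>' \<in> {\<phi>' \<in> extensions V U W \<psi>. image \<phi>' ` H = image \<phi> ` H}"
    then have \<phi>': "\<phi>' \<in> extensional U" "restrict \<phi>' W = \<psi>" "image \<phi>' ` H = image \<phi> ` H"
      by (auto simp: extensions_def injections_def PiE_def)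
    have "\<phi>' x \<in> \<phi> ` U" if x: "x \<in> U" for x
    proof (cases "x \<in> W")
      case True
      have "restrict \<phi>' W x = restrict \<phi> W x" using \<phi> \<phi>'(2) by (simp add: extensions_def)
      then show ?thesis using True x by simp
    next
      case False
      then obtain e where e: "e \<in> H" "x \<in> e" using H(2) x by blast
      then have "\<phi>' ` e \<in> image \<phi> ` H" unfolding \<phi>'(3)[symmetric] by blast
      then obtain d where "d \<in> H" "\<phi>' ` e = \<phi> ` d" by blast
      then show ?thesis using e(2) H(1) by blast
    qed
    then show "\<phi>' \<in> U \<rightarrow>\<^sub>E \<phi> ` U" using \<phi>'(1) by (simp add: PiE_def Pi_def)
  qed
  then have "card {\<phi>' \<in> extensions V U W \<psi>. image \<phi>' ` H = image \<phi> ` H} \<le> card (U \<rightarrow>\<^sub>E \<phi> ` U)"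
    using U by (intro card_mono finite_PiE) auto
  also have "\<dots> = card (\<phi> ` U) ^ card U" using U by (simp add: card_funcsetE)
  also have "\<dots> \<le> card U ^ card U" using U by (intro power_mono card_image_le) auto
  finally show ?thesis .
qed

definition envelope_sum ::
  "'a set \<Rightarrow> ('a set \<Rightarrow> real) \<Rightarrow> ('a set \<Rightarrow> real) \<Rightarrow> 'i set set \<Rightarrow> 'i set set \<Rightarrow> real" where
  "envelope_sum V \<rho> b H J = (\<Sum>\<psi>\<in>injections (\<Union>J) V. (\<Prod>e\<in>J. \<rho> (\<psi> ` e)) *
     \<bar>\<Sum>\<phi>\<in>extensions V (\<Union>H) (\<Union>J) \<psi>. \<Prod>e\<in>H - J. b (\<phi> ` e)\<bar>)"

lemma envelope_sum_nonneg: "(\<And>e. 0 \<le> \<rho> e) \<Longrightarrow> 0 \<le> envelope_sum V \<rho> b H J"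
  unfolding envelope_sum_def by (intro sum_nonneg mult_nonneg_nonneg prod_nonneg) auto

lemma abs_inj_sum_le_envelope_sum:
  assumes V: "finite V" and H: "finite H" "\<And>e. e \<in> H \<Longrightarrow> finite e" and r: "\<And>e. \<bar>r e\<bar> \<le> \<rho> e"
  shows "\<bar>inj_sum V (\<lambda>e. b e + r e) (\<Union>H) H\<bar> \<le> (\<Sum>J\<in>Pow H. envelope_sum V \<rho> b H J)"
proof -
  let ?U = "\<Union>H"
  let ?term = "\<lambda>J \<phi>. (\<Prod>e\<in>J. r (\<phi> ` e)) * (\<Prod>e\<in>H - J. b (\<phi> ` e))"
  have fin: "finite (injections W V)" if "W \<subseteq> ?U" for W
    using finite_subset[OF that] H V by (intro finite_injections) auto
  have "inj_sum V (\<lambda>e. b e + r e) ?U H = (\<Sum>\<phi>\<in>injections ?U V. \<Sum>J\<in>Pow H. ?term J \<phi>)"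
    unfolding inj_sum_def using H(1) by (simp add: prod_add[symmetric] add.commute)
  also have "\<dots> = (\<Sum>J\<in>Pow H. \<Sum>\<phi>\<in>injections ?U V. ?term J \<phi>)" by (rule sum.swap)
  finally have "\<bar>inj_sum V (\<lambda>e. b e + r e) ?U H\<bar> \<le> (\<Sum>J\<in>Pow H. \<bar>\<Sum>\<phi>\<in>injections ?U V. ?term J \<phi>\<bar>)"
    by (simp add: sum_abs)
  also have "\<dots> \<le> (\<Sum>J\<in>Pow H. envelope_sum V \<rho> b H J)"
  proof (rule sum_mono)
    fix J assume "J \<in> Pow H"
    then have sub: "\<Union>J \<subseteq> ?U" by auto
    have "(\<Sum>\<phi>\<in>injections ?U V. ?term J \<phi>)
        = (\<Sum>\<psi>\<in>injections (\<Union>J) V. \<Sum>\<phi>\<in>extensions V ?U (\<Union>J) \<psi>. ?term J \<phi>)"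
      unfolding extensions_def by (rule sum.group[symmetric]) (use fin sub restrict_injections in auto)
    also have "\<dots> = (\<Sum>\<psi>\<in>injections (\<Union>J) V. (\<Prod>e\<in>J. r (\<psi> ` e)) *
        (\<Sum>\<phi>\<in>extensions V ?U (\<Union>J) \<psi>. \<Prod>e\<in>H - J. b (\<phi> ` e)))"
      unfolding sum_distrib_left
    proof (intro sum.cong refl arg_cong2[where f = "(*)"] prod.cong arg_cong[where f = r])
      fix \<psi> \<phi> e assume "\<phi> \<in> extensions V ?U (\<Union>J) \<psi>" "e \<in> J"
      then show "\<phi> ` e = \<psi> ` e" by (intro image_cong) (auto simp: extensions_def)
    qed
    finally have "\<bar>\<Sum>\<phi>\<in>injections ?U V. ?term J \<phi>\<bar>
        \<le> (\<Sum>\<psi>\<in>injections (\<Union>J) V. \<bar>(\<Prod>e\<in>J. r (\<psi> ` e)) *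
        (\<Sum>\<phi>\<in>extensions V ?U (\<Union>J) \<psi>. \<Prod>e\<in>H - J. b (\<phi> ` e))\<bar>)"
      by (simp add: sum_abs)
    also have "\<dots> \<le> envelope_sum V \<rho> b H J"
      unfolding envelope_sum_def abs_mult abs_prod
      by (intro sum_mono mult_right_mono prod_mono) (use r in auto)
    finally show "\<bar>\<Sum>\<phi>\<in>injections ?U V. ?term J \<phi>\<bar> \<le> envelope_sum V \<rho> b H J" .
  qed
  finally show ?thesis .
qed

locale bernoulli_graph = bernoulli_set P \<pi> for P :: "'a set set" and \<pi>
begin

lemma second_moment_extensions_le:
  fixes H :: "'i set set"
  assumes U: "finite U" and V: "finite V" and W: "W \<subseteq> U"
    and H: "finite H" "\<Union>H \<subseteq> U" "U - W \<subseteq> \<Union>H"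
  shows "E (\<lambda>S. (\<Sum>\<phi>\<in>extensions V U W \<psi>. \<Prod>e\<in>H. noise S (\<phi> ` e))\<^sup>2)
    \<le> real (card U) ^ card U * var ^ card H * real (card V) ^ (card U - card W)"
proof -
  let ?\<Phi> = "extensions V U W \<psi>"
  have fin: "finite ?\<Phi>" unfolding extensions_def using finite_injections[OF U V] by auto
  have inj: "inj_on (image \<phi>) H" if "\<phi> \<in> ?\<Phi>" for \<phi>
    using that H(2) by (intro inj_on_image_injections[of \<phi> U V]) (auto simp: extensions_def)
  have "(\<Sum>\<phi>\<in>?\<Phi>. \<Prod>e\<in>H. noise S (\<phi> ` e)) = (\<Sum>\<phi>\<in>?\<Phi>. 1 * (\<Prod>e\<in>image \<phi> ` H. noise S e))" for S
    by (intro sum.cong refl) (simp add: prod.reindex[OF inj])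
  then have "E (\<lambda>S. (\<Sum>\<phi>\<in>?\<Phi>. \<Prod>e\<in>H. noise S (\<phi> ` e))\<^sup>2)
      = E (\<lambda>S. (\<Sum>\<phi>\<in>?\<Phi>. 1 * (\<Prod>e\<in>image \<phi> ` H. noise S e))\<^sup>2)" by (simp only:)
  also have "\<dots> \<le> real (card U) ^ card U * var ^ card H * (\<Sum>\<phi>\<in>?\<Phi>. 1\<^sup>2)"
  proof (rule second_moment_le[OF fin])
    fix \<phi> assume "\<phi> \<in> ?\<Phi>"
    then show "finite (image \<phi> ` H) \<and> card (image \<phi> ` H) = card H" using inj H(1) by (simp add: card_image)
    show "real (card {\<phi>' \<in> ?\<Phi>. image \<phi>' ` H = image \<phi> ` H}) \<le> real (card U) ^ card U"
      using card_extensions_same_images_le[OF U H(2,3) \<open>\<phi> \<in> ?\<Phi>\<close>] by (simp flip: of_nat_power)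
  qed
  also have "(\<Sum>\<phi>\<in>?\<Phi>. 1\<^sup>2) \<le> real (card V) ^ (card U - card W)"
    using card_extensions_le[OF U V W, of \<psi>] by (simp flip: of_nat_power)
  finally show ?thesis using var_nonneg by (simp add: mult_left_mono)
qed

lemma E_envelope_sum_le:
  fixes H J :: "'i set set"
  assumes V: "finite V" and \<rho>: "\<And>e. 0 \<le> \<rho> e" "\<And>e. \<rho> e \<le> 1"
    and deg: "\<And>i. i \<in> V \<Longrightarrow> wdeg V \<rho> i \<le> \<Delta>" and degree_sum: "(\<Sum>i\<in>V. wdeg V \<rho> i) \<le> \<Delta>\<^sup>2" and \<Delta>: "0 \<le> \<Delta>"
    and H: "finite H" "\<And>e. e \<in> H \<Longrightarrow> card e = 2" and J: "J \<subseteq> H"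
  defines "h \<equiv> card (\<Union>H)"
  shows "E (\<lambda>S. envelope_sum V \<rho> (noise S) H J)
    \<le> \<Delta> ^ card (\<Union>J) * sqrt (real h ^ h * var ^ card (H - J) * real (card V) ^ (h - card (\<Union>J)))"
    (is "_ \<le> _ * ?c")
proof -
  let ?U = "\<Union>H" and ?W = "\<Union>J"
  have "finite e" if "e \<in> H" for e using H(2)[OF that] by (simp add: card_ge_0_finite)
  then have U: "finite ?U" using H(1) by auto
  have W: "?W \<subseteq> ?U" "finite ?W" using J U finite_subset[of ?W ?U] by auto
  have fin: "finite J" "finite (H - J)" using J H(1) finite_subset by auto
  have c: "0 \<le> ?c" using var_nonneg by simp
  have inner: "E (\<lambda>S. \<bar>\<Sum>\<phi>\<in>extensions V ?U ?W \<psi>. \<Prod>e\<in>H - J. noise S (\<phi> ` e)\<bar>) \<le> ?c" for \<psi>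
    using second_moment_extensions_le[OF U V W(1) fin(2), of \<psi>] var_nonneg
    by (intro E_abs_le[OF _ c]) (auto simp: h_def)
  have "E (\<lambda>S. envelope_sum V \<rho> (noise S) H J) \<le> (\<Sum>\<psi>\<in>injections ?W V. (\<Prod>e\<in>J. \<rho> (\<psi> ` e)) * ?c)"
    unfolding envelope_sum_def E_sum E_cmult
    using inner \<rho> by (intro sum_mono mult_left_mono prod_nonneg) auto
  also have "\<dots> \<le> (\<Sum>\<psi>\<in>?W \<rightarrow>\<^sub>E V. (\<Prod>e\<in>J. \<rho> (\<psi> ` e)) * ?c)"
    using \<rho> c W V by (intro sum_mono2 mult_nonneg_nonneg prod_nonneg finite_PiE)
      (auto simp: injections_def)
  also have "\<dots> = hom_sum V \<rho> J * ?c" by (simp add: hom_sum_def sum_distrib_right)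
  also have "\<dots> \<le> \<Delta> ^ card ?W * ?c"
    using J H by (intro mult_right_mono c hom_sum_le \<rho> deg degree_sum \<Delta> fin(1)) auto
  finally show ?thesis .
qed

lemma var_power_le:
  assumes y: "0 < y" "y \<le> 1" and v: "var \<le> 2 * y ^ 4" and m: "d \<le> 2 * m" "m \<le> M"
  shows "var ^ m \<le> 2 ^ M * (y ^ d)\<^sup>2"
proof -
  have "var ^ m \<le> (2 * y ^ 4) ^ m" using v var_nonneg by (intro power_mono) auto
  also have "\<dots> = 2 ^ m * y ^ (4 * m)" by (simp add: power_mult_distrib power_mult)
  also have "\<dots> \<le> 2 ^ M * y ^ (d * 2)"
  proof (rule mult_mono)
    show "(2::real) ^ m \<le> 2 ^ M" using m(2) by (rule power_increasing) simp
    show "y ^ (4 * m) \<le> y ^ (d * 2)" using y m(1) by (intro power_decreasing) auto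
  qed (use y in auto)
  finally show ?thesis by (simp add: power_mult)
qed

lemma card_Union_Diff_le:
  assumes H: "finite H" "\<And>e. e \<in> H \<Longrightarrow> card e = 2" and J: "J \<subseteq> H"
  shows "card (\<Union>H) - card (\<Union>J) \<le> 2 * card (H - J)"
proof -
  have fin: "finite e" if "e \<in> H" for e using H(2)[OF that] by (simp add: card_ge_0_finite)
  have sub: "\<Union>J \<subseteq> \<Union>H" using J by auto
  have "finite (\<Union>J)" by (rule finite_subset[OF sub]) (use H(1) fin in auto)
  then have "card (\<Union>H) - card (\<Union>J) = card (\<Union>H - \<Union>J)" using sub by (simp add: card_Diff_subset)
  also have "\<dots> \<le> card (\<Union>(H - J))" using H(1) fin by (intro card_mono) auto
  also have "\<dots> \<le> (\<Sum>e\<in>H - J. card e)" using H(1) by (intro card_Union_le_sum_card)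
  also have "\<dots> = 2 * card (H - J)" using H by simp
  finally show ?thesis .
qed

lemma E_envelope_sum_le_scaled:
  fixes V :: "'a set"
  defines "s \<equiv> sqrt (real (card V))"
  assumes V: "finite V" "1 \<le> card V" and \<rho>: "\<And>e. 0 \<le> \<rho> e" "\<And>e. \<rho> e \<le> 1"
    and y: "0 < y" "y \<le> 1" and L: "1 \<le> L" and v: "var \<le> 2 * y ^ 4"
    and deg: "\<And>i. i \<in> V \<Longrightarrow> wdeg V \<rho> i \<le> L * s * y"
    and degree_sum: "(\<Sum>i\<in>V. wdeg V \<rho> i) \<le> (L * s * y)\<^sup>2"
    and H: "finite H" "\<And>e. e \<in> H \<Longrightarrow> card e = 2" "4 \<le> card (\<Union>H)" and J: "J \<subseteq> H"
  shows "E (\<lambda>S. envelope_sum V \<rho> (noise S) H J)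
    \<le> L ^ card (\<Union>H) * sqrt (real (card (\<Union>H)) ^ card (\<Union>H) * 2 ^ card H)
        * (y ^ 4 * real (card V) ^ (card (\<Union>H) - 2))"
proof -
  define h w where "h = card (\<Union>H)" and "w = card (\<Union>J)"
  let ?B = "sqrt (real h ^ h * 2 ^ card H)"
  have s: "1 \<le> s" "s\<^sup>2 = real (card V)" using V(2) by (simp_all add: s_def)
  have "finite e" if "e \<in> H" for e using H(2)[OF that] by (simp add: card_ge_0_finite)
  then have w_le_h: "w \<le> h" unfolding w_def h_def using J H(1) by (intro card_mono) auto
  have "var ^ card (H - J) \<le> 2 ^ card H * (y ^ (h - w))\<^sup>2"
    unfolding h_def w_def using H(1) by (intro var_power_le y v card_Union_Diff_le H J card_mono) auto
  then have "real h ^ h * var ^ card (H - J) * real (card V) ^ (h - w)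
      \<le> real h ^ h * (2 ^ card H * (y ^ (h - w))\<^sup>2) * real (card V) ^ (h - w)"
    by (intro mult_right_mono mult_left_mono) auto
  also have "\<dots> = (?B * (y * s) ^ (h - w))\<^sup>2"
    unfolding s(2)[symmetric] by (simp add: power_mult_distrib power_mult[symmetric] mult.commute)
  finally have root: "sqrt (real h ^ h * var ^ card (H - J) * real (card V) ^ (h - w)) \<le> ?B * (y * s) ^ (h - w)"
    using y s by (intro real_le_lsqrt) auto
  have "(y * s) ^ h \<le> y ^ 4 * s ^ (2 * (h - 2))"
    unfolding power_mult_distrib using y s H(3)
    by (intro mult_mono power_decreasing power_increasing) (auto simp: h_def)
  then have power_h: "(y * s) ^ h \<le> y ^ 4 * real (card V) ^ (h - 2)" by (simp add: power_mult s(2))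
  have "E (\<lambda>S. envelope_sum V \<rho> (noise S) H J)
      \<le> (L * s * y) ^ w * sqrt (real h ^ h * var ^ card (H - J) * real (card V) ^ (h - w))"
    unfolding w_def h_def using L y s by (intro E_envelope_sum_le[OF V(1) \<rho> deg degree_sum _ H(1,2) J]) auto
  also have "\<dots> \<le> (L * s * y) ^ w * (?B * (y * s) ^ (h - w))"
    using root L s y by (intro mult_left_mono) auto
  also have "\<dots> = L ^ w * ?B * (y * s) ^ h"
  proof -
    have "(y * s) ^ h = (y * s) ^ w * (y * s) ^ (h - w)" using w_le_h by (simp add: power_add[symmetric])
    then show ?thesis by (simp add: power_mult_distrib mult_ac)
  qed
  also have "\<dots> \<le> L ^ h * ?B * (y ^ 4 * real (card V) ^ (h - 2))"
    using power_h L y s w_le_h by (intro mult_mono mult_nonneg_nonneg power_increasing) auto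
  finally show ?thesis by (simp add: h_def)
qed

end

section \<open>Degree and triangle sums\<close>

definition pair_wdeg :: "'a set \<Rightarrow> ('a set \<Rightarrow> real) \<Rightarrow> 'a set \<Rightarrow> real" where
  "pair_wdeg V b e = (\<Sum>i\<in>e. wdeg V b i)"

definition codegree :: "'a set \<Rightarrow> ('a set \<Rightarrow> real) \<Rightarrow> 'a set \<Rightarrow> real" where
  "codegree V b e = (\<Sum>k\<in>V. \<Prod>i\<in>e. b {i, k})"

lemma codegree_pair: "u \<noteq> v \<Longrightarrow> codegree V b {u, v} = (\<Sum>k\<in>V. b {u, k} * b {v, k})"
  by (simp add: codegree_def)

lemma abs_wdeg_le: "(\<And>e. \<bar>r e\<bar> \<le> \<rho> e) \<Longrightarrow> \<bar>wdeg V r i\<bar> \<le> wdeg V \<rho> i"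
  unfolding wdeg_def by (intro order_trans[OF sum_abs] sum_mono)

lemma wdeg_add: "wdeg V (\<lambda>e. f e + g e) i = wdeg V f i + wdeg V g i"
  by (simp add: wdeg_def sum.distrib)

lemma sum_wdeg_mult:
  assumes V: "finite V" and r: "\<And>i. r {i} = 0"
  shows "(\<Sum>i\<in>V. wdeg V r i * w i) = (\<Sum>e\<in>[V]\<^bsup>2\<^esup>. r e * (\<Sum>i\<in>e. w i))"
proof -
  have first: "(\<Sum>i\<in>V. wdeg V r i * w i) = (\<Sum>i\<in>V. \<Sum>j\<in>V. r {i, j} * w i)"
    by (simp add: wdeg_def sum_distrib_right)
  also have "\<dots> = (\<Sum>i\<in>V. \<Sum>j\<in>V. r {i, j} * w j)"
    by (subst sum.swap) (simp add: insert_commute)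
  finally have "2 * (\<Sum>i\<in>V. wdeg V r i * w i) = (\<Sum>i\<in>V. \<Sum>j\<in>V. r {i, j} * w i + r {i, j} * w j)"
    unfolding sum.distrib using first by simp
  also have "\<dots> = (\<Sum>i\<in>V. \<Sum>j\<in>V. r {i, j} * (\<Sum>k\<in>{i, j}. w k))"
  proof (intro sum.cong refl)
    fix i j show "r {i, j} * w i + r {i, j} * w j = r {i, j} * (\<Sum>k\<in>{i, j}. w k)"
      using r[of i] by (cases "i = j") (auto simp: distrib_left)
  qed
  also have "\<dots> = 2 * (\<Sum>e\<in>[V]\<^bsup>2\<^esup>. r e * (\<Sum>i\<in>e. w i))"
    using sum_ordered_pairs[OF V, of "\<lambda>e. r e * (\<Sum>i\<in>e. w i)"] r by simp
  finally show ?thesis by simp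
qed

lemma wdeg_eq_sum_pairs:
  assumes V: "finite V" and i: "i \<in> V" and r: "\<And>i. r {i} = 0"
  shows "wdeg V r i = (\<Sum>e\<in>[V]\<^bsup>2\<^esup>. r e * (\<Sum>j\<in>e. of_bool (j = i)))"
proof -
  have "wdeg V r i = (\<Sum>j\<in>V. wdeg V r j * of_bool (j = i))"
    using V i by (simp add: of_bool_def if_distrib[of "(*) _"] cong: if_cong)
  then show ?thesis using sum_wdeg_mult[where r = r, OF V r] by simp
qed

lemma wdeg_of_bool:
  assumes "finite V" "\<And>i. {i} \<notin> R" shows "wdeg V (\<lambda>e. of_bool (e \<in> R)) i = real (card {w \<in> V. {i, w} \<in> R})"
  using assms by (simp add: wdeg_def of_bool_def sum.inter_filter[symmetric])

lemma sum_pairs_sum: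
  fixes w :: "'a \<Rightarrow> real"
  assumes V: "finite V"
  shows "(\<Sum>e\<in>[V]\<^bsup>2\<^esup>. \<Sum>i\<in>e. w i) = (real (card V) - 1) * (\<Sum>i\<in>V. w i)"
proof -
  let ?r = "\<lambda>e. of_bool (e \<in> [V]\<^bsup>2\<^esup>) :: real"
  have deg: "wdeg V ?r i = real (card V) - 1" if i: "i \<in> V" for i
  proof -
    have "{w \<in> V. {i, w} \<in> [V]\<^bsup>2\<^esup>} = V - {i}" using i by (auto simp: nsets_def)
    moreover have "{j} \<notin> [V]\<^bsup>2\<^esup>" for j by (simp add: nsets_def)
    ultimately have "wdeg V ?r i = real (card (V - {i}))" using wdeg_of_bool[OF V] by simp
    also have "\<dots> = real (card V) - 1"
      using V i card_gt_0_iff[of V] by (auto simp: of_nat_diff Suc_le_eq)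
    finally show ?thesis .
  qed
  have "(\<Sum>e\<in>[V]\<^bsup>2\<^esup>. \<Sum>i\<in>e. w i) = (\<Sum>e\<in>[V]\<^bsup>2\<^esup>. ?r e * (\<Sum>i\<in>e. w i))" by (intro sum.cong) auto
  also have "\<dots> = (\<Sum>i\<in>V. wdeg V ?r i * w i)"
    by (rule sum_wdeg_mult[symmetric, OF V]) (auto simp: nsets_def)
  also have "\<dots> = (real (card V) - 1) * (\<Sum>i\<in>V. w i)"
    unfolding sum_distrib_left by (intro sum.cong refl) (simp add: deg)
  finally show ?thesis .
qed

lemma triangle_sum_swap12: "triangle_sum V f g h = triangle_sum V g f h"
proof -
  have "triangle_sum V f g h = (\<Sum>k\<in>V. \<Sum>j\<in>V. \<Sum>i\<in>V. f {i, j} * g {j, k} * h {i, k})"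
    unfolding triangle_sum_def by (subst sum.swap, subst (2) sum.swap, subst sum.swap) simp
  then show ?thesis unfolding triangle_sum_def by (simp add: insert_commute mult_ac)
qed

lemma triangle_sum_swap13: "triangle_sum V f g h = triangle_sum V h g f"
proof -
  have "triangle_sum V f g h = (\<Sum>i\<in>V. \<Sum>k\<in>V. \<Sum>j\<in>V. f {i, j} * g {j, k} * h {i, k})"
    unfolding triangle_sum_def by (intro sum.cong refl sum.swap)
  then show ?thesis unfolding triangle_sum_def by (simp add: insert_commute mult_ac)
qed

lemma triangle_sum_add:
  "triangle_sum V (\<lambda>e. f e + f' e) g h = triangle_sum V f g h + triangle_sum V f' g h"
  "triangle_sum V f (\<lambda>e. g e + g' e) h = triangle_sum V f g h + triangle_sum V f g' h"
  "triangle_sum V f g (\<lambda>e. h e + h' e) = triangle_sum V f g h + triangle_sum V f g h'"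
  unfolding triangle_sum_def by (simp_all add: distrib_right distrib_left sum.distrib)

lemma abs_triangle_sum_le:
  assumes f: "\<And>e. \<bar>f e\<bar> \<le> \<rho> e" and g: "\<And>e. \<bar>g e\<bar> \<le> \<rho> e" and h: "\<And>e. \<bar>h e\<bar> \<le> 1"
  shows "\<bar>triangle_sum V f g h\<bar> \<le> (\<Sum>j\<in>V. (wdeg V \<rho> j)\<^sup>2)"
proof -
  have \<rho>: "0 \<le> \<rho> e" for e using f[of e] by linarith
  have "\<bar>triangle_sum V f g h\<bar> \<le> (\<Sum>i\<in>V. \<Sum>j\<in>V. \<Sum>k\<in>V. \<bar>f {i, j} * g {j, k} * h {i, k}\<bar>)"
    unfolding triangle_sum_def by (intro order_trans[OF sum_abs] sum_mono order_refl)
  also have "\<dots> \<le> (\<Sum>i\<in>V. \<Sum>j\<in>V. \<Sum>k\<in>V. \<rho> {i, j} * \<rho> {j, k})"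
  proof (intro sum_mono)
    fix i j k
    have "\<bar>f {i, j}\<bar> * \<bar>g {j, k}\<bar> * \<bar>h {i, k}\<bar> \<le> \<rho> {i, j} * \<rho> {j, k} * 1"
      by (intro mult_mono f g h mult_nonneg_nonneg \<rho>) auto
    then show "\<bar>f {i, j} * g {j, k} * h {i, k}\<bar> \<le> \<rho> {i, j} * \<rho> {j, k}" by (simp add: abs_mult)
  qed
  also have "\<dots> = (\<Sum>j\<in>V. (wdeg V \<rho> j)\<^sup>2)"
    by (subst sum.swap) (simp add: wdeg_def power2_eq_square sum_product insert_commute)
  finally show ?thesis .
qed

lemma triangle_sum_perturb:
  assumes r: "\<And>e. \<bar>r e\<bar> \<le> \<rho> e" "\<And>e. \<bar>r e\<bar> \<le> 1" and b: "\<And>e. \<bar>b e\<bar> \<le> 1"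
  shows "\<bar>triangle_sum V (\<lambda>e. b e + r e) (\<lambda>e. b e + r e) (\<lambda>e. b e + r e)
       - triangle_sum V b b b - 3 * triangle_sum V r b b\<bar> \<le> 4 * (\<Sum>j\<in>V. (wdeg V \<rho> j)\<^sup>2)"
proof -
  have symmetric: "triangle_sum V b r b = triangle_sum V r b b" "triangle_sum V b b r = triangle_sum V r b b"
    "triangle_sum V r b r = triangle_sum V r r b" "triangle_sum V b r r = triangle_sum V r r b"
    using triangle_sum_swap12[of V b r b] triangle_sum_swap13[of V b b r] triangle_sum_swap13[of V b r r]
      triangle_sum_swap12[of V b r r] by auto
  have "triangle_sum V (\<lambda>e. b e + r e) (\<lambda>e. b e + r e) (\<lambda>e. b e + r e)
      - triangle_sum V b b b - 3 * triangle_sum V r b b = 3 * triangle_sum V r r b + triangle_sum V r r r"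
    unfolding triangle_sum_add symmetric by simp
  moreover have "\<bar>triangle_sum V r r b\<bar> \<le> (\<Sum>j\<in>V. (wdeg V \<rho> j)\<^sup>2)"
    "\<bar>triangle_sum V r r r\<bar> \<le> (\<Sum>j\<in>V. (wdeg V \<rho> j)\<^sup>2)"
    by (intro abs_triangle_sum_le r b)+
  ultimately show ?thesis by linarith
qed

lemma triangle_sum_eq_sum_codegree:
  assumes V: "finite V" and r: "\<And>i. r {i} = 0"
  shows "triangle_sum V r b b = 2 * (\<Sum>e\<in>[V]\<^bsup>2\<^esup>. r e * codegree V b e)"
proof -
  have "triangle_sum V r b b = (\<Sum>i\<in>V. \<Sum>j\<in>V. r {i, j} * codegree V b {i, j})"
    unfolding triangle_sum_def
  proof (intro sum.cong refl)
    fix i j show "(\<Sum>k\<in>V. r {i, j} * b {j, k} * b {i, k}) = r {i, j} * codegree V b {i, j}"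
      using r[of i] by (cases "i = j") (auto simp: codegree_pair sum_distrib_left mult_ac)
  qed
  then show ?thesis using sum_ordered_pairs[OF V, of "\<lambda>e. r e * codegree V b e"] r by simp
qed

lemma sum_wdeg_sq:
  assumes V: "finite V"
  shows "(\<Sum>i\<in>V. (wdeg V b i)\<^sup>2) = (\<Sum>i\<in>V. \<Sum>j\<in>V. (b {i, j})\<^sup>2) + 2 * (\<Sum>e\<in>[V]\<^bsup>2\<^esup>. codegree V b e)"
proof -
  have "(\<Sum>k\<in>V. (wdeg V b k)\<^sup>2) = (\<Sum>k\<in>V. \<Sum>i\<in>V. \<Sum>j\<in>V. b {i, k} * b {j, k})"
    by (simp add: wdeg_def power2_eq_square sum_product insert_commute)
  also have "\<dots> = (\<Sum>i\<in>V. \<Sum>k\<in>V. \<Sum>j\<in>V. b {i, k} * b {j, k})" by (rule sum.swap)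
  also have "\<dots> = (\<Sum>i\<in>V. \<Sum>j\<in>V. \<Sum>k\<in>V. b {i, k} * b {j, k})" by (intro sum.cong refl sum.swap)
  also have "\<dots> = (\<Sum>i\<in>V. (\<Sum>k\<in>V. (b {i, k})\<^sup>2) + (\<Sum>j\<in>V - {i}. codegree V b {i, j}))"
  proof (intro sum.cong refl)
    fix i assume "i \<in> V"
    then have "(\<Sum>j\<in>V. \<Sum>k\<in>V. b {i, k} * b {j, k})
        = (\<Sum>k\<in>V. (b {i, k})\<^sup>2) + (\<Sum>j\<in>V - {i}. \<Sum>k\<in>V. b {i, k} * b {j, k})"
      by (subst sum.remove[OF V]) (simp_all add: power2_eq_square)
    also have "(\<Sum>j\<in>V - {i}. \<Sum>k\<in>V. b {i, k} * b {j, k}) = (\<Sum>j\<in>V - {i}. codegree V b {i, j})"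
      by (intro sum.cong refl codegree_pair[symmetric]) auto
    finally show "(\<Sum>j\<in>V. \<Sum>k\<in>V. b {i, k} * b {j, k})
        = (\<Sum>k\<in>V. (b {i, k})\<^sup>2) + (\<Sum>j\<in>V - {i}. codegree V b {i, j})" .
  qed
  also have "\<dots> = (\<Sum>i\<in>V. \<Sum>j\<in>V. (b {i, j})\<^sup>2) + 2 * (\<Sum>e\<in>[V]\<^bsup>2\<^esup>. codegree V b e)"
    by (simp add: sum.distrib sum_ordered_pairs_distinct[OF V])
  finally show ?thesis .
qed

section \<open>Reserved blocks of vertex pairs\<close>

text \<open>Block \<open>B\<close> is the complete bipartite graph between its left vertices \<open>vert (B, False, x, \<sigma>)\<close> and its
  right vertices \<open>vert (B, True, y, \<tau>)\<close>. The first \<open>l1\<close> blocks serve to adjust the number of edges, the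
  next \<open>l2\<close> blocks the degrees and the last \<open>l3\<close> blocks the number of triangles.\<close>

locale gadget_graph =
  fixes V :: "'a set" and vert :: "nat \<times> bool \<times> nat \<times> bool \<Rightarrow> 'a" and c l1 l2 l3 :: nat
  assumes finite_V: "finite V" and c_pos: "1 \<le> c"
    and vert_in_V: "vert ` ({..<l1 + l2 + l3} \<times> UNIV \<times> {..<c} \<times> UNIV) \<subseteq> V"
    and inj_vert: "inj_on vert ({..<l1 + l2 + l3} \<times> UNIV \<times> {..<c} \<times> UNIV)"
begin

abbreviation l :: nat where "l \<equiv> l1 + l2 + l3"

abbreviation left :: "nat \<Rightarrow> nat \<Rightarrow> bool \<Rightarrow> 'a" where "left B x \<sigma> \<equiv> vert (B, False, x, \<sigma>)"

abbreviation right :: "nat \<Rightarrow> nat \<Rightarrow> bool \<Rightarrow> 'a" where "right B y \<tau> \<equiv> vert (B, True, y, \<tau>)"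

lemma vert_mem: "B < l \<Longrightarrow> x < c \<Longrightarrow> vert (B, side, x, \<sigma>) \<in> V"
  using vert_in_V by auto

lemma vert_eq_iff:
  "B < l \<Longrightarrow> x < c \<Longrightarrow> B' < l \<Longrightarrow> x' < c \<Longrightarrow>
     vert (B, side, x, \<sigma>) = vert (B', side', x', \<sigma>') \<longleftrightarrow> B = B' \<and> side = side' \<and> x = x' \<and> \<sigma> = \<sigma>'"
  using inj_on_eq_iff[OF inj_vert, of "(B, side, x, \<sigma>)" "(B', side', x', \<sigma>')"] by auto

fun block_pair :: "nat \<times> nat \<times> bool \<times> nat \<times> bool \<Rightarrow> 'a set" where
  "block_pair (B, x, \<sigma>, y, \<tau>) = {left B x \<sigma>, right B y \<tau>}"

definition block_indices :: "nat \<Rightarrow> nat \<Rightarrow> (nat \<times> nat \<times> bool \<times> nat \<times> bool) set" where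
  "block_indices a b = {a..<b} \<times> {..<c} \<times> UNIV \<times> {..<c} \<times> UNIV"

definition edge_group :: "'a set set" where "edge_group = block_pair ` block_indices 0 l1"
definition degree_group :: "'a set set" where "degree_group = block_pair ` block_indices l1 (l1 + l2)"
definition triangle_group :: "'a set set" where "triangle_group = block_pair ` block_indices (l1 + l2) l"
definition reserved :: "'a set set" where "reserved = block_pair ` block_indices 0 l"
definition free_pairs :: "'a set set" where "free_pairs = [V]\<^bsup>2\<^esup> - reserved"

lemma block_indices_subset: "b \<le> l \<Longrightarrow> block_indices a b \<subseteq> block_indices 0 l"
  by (auto simp: block_indices_def)

lemma inj_block_pair: "inj_on block_pair (block_indices 0 l)"
proof (rule inj_onI)
  fix s t assume st: "s \<in> block_indices 0 l" "t \<in> block_indices 0 l" "block_pair s = block_pair t"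
  obtain B x \<sigma> y \<tau> B' x' \<sigma>' y' \<tau>' where s: "s = (B, x, \<sigma>, y, \<tau>)" and t: "t = (B', x', \<sigma>', y', \<tau>')"
    by (cases s, cases t) auto
  have "B < l" "x < c" "y < c" "B' < l" "x' < c" "y' < c" using st s t by (auto simp: block_indices_def)
  moreover have "{left B x \<sigma>, right B y \<tau>} = {left B' x' \<sigma>', right B' y' \<tau>'}" using st s t by simp
  ultimately show "s = t" unfolding s t doubleton_eq_iff by (auto simp: vert_eq_iff)
qed

lemma card_block_pairs: "b \<le> l \<Longrightarrow> card (block_pair ` block_indices a b) = 4 * c\<^sup>2 * (b - a)"
  by (subst card_image[OF inj_on_subset[OF inj_block_pair block_indices_subset]])
    (simp_all add: block_indices_def card_cartesian_product power2_eq_square)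

lemma card_groups:
  "card reserved = 4 * c\<^sup>2 * l" "card edge_group = 4 * c\<^sup>2 * l1"
  "card degree_group = 4 * c\<^sup>2 * l2" "card triangle_group = 4 * c\<^sup>2 * l3"
  unfolding reserved_def edge_group_def degree_group_def triangle_group_def by (simp_all add: card_block_pairs)

lemma reserved_subset: "reserved \<subseteq> [V]\<^bsup>2\<^esup>"
proof
  fix e assume "e \<in> reserved"
  then obtain B x \<sigma> y \<tau> where "e = {left B x \<sigma>, right B y \<tau>}" "B < l" "x < c" "y < c"
    by (auto simp: reserved_def block_indices_def)
  then show "e \<in> [V]\<^bsup>2\<^esup>" by (simp add: nsets_def vert_mem vert_eq_iff)
qed

lemma finite_pairs: "finite ([V]\<^bsup>2\<^esup>)"
  using finite_V by (rule finite_imp_finite_nsets)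

lemma finite_reserved: "finite reserved"
  using reserved_subset finite_pairs by (rule finite_subset)

lemma finite_free_pairs: "finite free_pairs"
  using finite_pairs by (simp add: free_pairs_def)

lemma free_reserved: "free_pairs \<union> reserved = [V]\<^bsup>2\<^esup>" "free_pairs \<inter> reserved = {}"
  using reserved_subset by (auto simp: free_pairs_def)

lemma singleton_notin: "{i} \<notin> free_pairs" "{i} \<notin> reserved"
proof -
  have "{i} \<notin> [V]\<^bsup>2\<^esup>" by (simp add: nsets_def)
  then show "{i} \<notin> free_pairs" "{i} \<notin> reserved" using free_reserved(1) by auto
qed

lemma reserved_split: "reserved = edge_group \<union> degree_group \<union> triangle_group"
proof -
  have "block_indices 0 l = block_indices 0 l1 \<union> block_indices l1 (l1 + l2) \<union> block_indices (l1 + l2) l"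
    by (auto simp: block_indices_def)
  then show ?thesis
    by (simp add: reserved_def edge_group_def degree_group_def triangle_group_def image_Un)
qed

lemma groups_subset: "edge_group \<subseteq> [V]\<^bsup>2\<^esup>" "degree_group \<subseteq> [V]\<^bsup>2\<^esup>" "triangle_group \<subseteq> [V]\<^bsup>2\<^esup>"
  using reserved_subset reserved_split by auto

lemma groups_disjoint:
  "edge_group \<inter> degree_group = {}" "edge_group \<inter> triangle_group = {}" "degree_group \<inter> triangle_group = {}"
proof -
  have disjoint: "block_pair ` X \<inter> block_pair ` Y = {}"
    if "X \<subseteq> block_indices 0 l" "Y \<subseteq> block_indices 0 l" "X \<inter> Y = {}" for X Y
    using inj_on_image_Int[OF inj_block_pair that(1,2)] that(3) by simp
  show "edge_group \<inter> degree_group = {}" "edge_group \<inter> triangle_group = {}" "degree_group \<inter> triangle_group = {}"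
    unfolding edge_group_def degree_group_def triangle_group_def
    by (intro disjoint block_indices_subset; auto simp: block_indices_def)+
qed

lemma sum_pairs_split: "(\<Sum>e\<in>[V]\<^bsup>2\<^esup>. f e) = (\<Sum>e\<in>free_pairs. f e) + (\<Sum>e\<in>reserved. (f e :: real))"
  unfolding free_reserved(1)[symmetric]
  using free_reserved(2) finite_free_pairs finite_reserved by (intro sum.union_disjoint)

lemma sum_reserved_split:
  "(\<Sum>e\<in>reserved. f e) = (\<Sum>e\<in>edge_group. f e) + (\<Sum>e\<in>degree_group. f e) + (\<Sum>e\<in>triangle_group. (f e :: real))"
proof -
  have "finite (edge_group \<union> degree_group \<union> triangle_group)" using finite_reserved reserved_split by simp
  then show ?thesis unfolding reserved_split using groups_disjoint by (subst sum.union_disjoint, auto)+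
qed

lemma card_groups_add:
  "real (card edge_group) + real (card degree_group) + real (card triangle_group) = real (card reserved)"
  using sum_reserved_split[of "\<lambda>_. 1"] by simp

lemma card_free_reserved:
  "real (card free_pairs) + real (card reserved) = real (card V) * (real (card V) - 1) / 2"
  using sum_pairs_split[of "\<lambda>_. 1"] finite_V by (simp add: card_nsets real_choose_two)

lemma sum_block_pairs:
  assumes "b \<le> l"
  shows "(\<Sum>e\<in>block_pair ` block_indices a b. f e :: real) = (\<Sum>B\<in>{a..<b}. \<Sum>x<c. \<Sum>y<c.
     f (block_pair (B, x, False, y, False)) + f (block_pair (B, x, True, y, True))
     + f (block_pair (B, x, False, y, True)) + f (block_pair (B, x, True, y, False)))"
proof -
  have "(\<Sum>e\<in>block_pair ` block_indices a b. f e) = (\<Sum>t\<in>block_indices a b. f (block_pair t))"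
    by (subst sum.reindex[OF inj_on_subset[OF inj_block_pair block_indices_subset[OF assms]]]) simp
  also have "\<dots> = (\<Sum>B\<in>{a..<b}. \<Sum>x<c. \<Sum>\<sigma>\<in>UNIV. \<Sum>y<c. \<Sum>\<tau>\<in>UNIV. f (block_pair (B, x, \<sigma>, y, \<tau>)))"
    unfolding block_indices_def by (simp add: sum.cartesian_product case_prod_unfold del: block_pair.simps)
  also have "\<dots> = (\<Sum>B\<in>{a..<b}. \<Sum>x<c. \<Sum>y<c. \<Sum>\<sigma>\<in>UNIV. \<Sum>\<tau>\<in>UNIV. f (block_pair (B, x, \<sigma>, y, \<tau>)))"
    by (intro sum.cong refl sum.swap)
  finally show ?thesis by (simp add: UNIV_bool add_ac)
qed

lemma card_reserved_neighbours_le: "card {w \<in> V. {i, w} \<in> reserved} \<le> 2 * c"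
proof (cases "\<exists>B side x \<sigma>. i = vert (B, side, x, \<sigma>) \<and> B < l \<and> x < c")
  case True
  then obtain B side x \<sigma> where i: "i = vert (B, side, x, \<sigma>)" "B < l" "x < c" by blast
  have "{w \<in> V. {i, w} \<in> reserved} \<subseteq> (\<lambda>(y, \<tau>). vert (B, \<not> side, y, \<tau>)) ` ({..<c} \<times> UNIV)"
  proof
    fix w assume "w \<in> {w \<in> V. {i, w} \<in> reserved}"
    then obtain B' x' \<sigma>' y' \<tau>' where "{i, w} = {left B' x' \<sigma>', right B' y' \<tau>'}" "B' < l" "x' < c" "y' < c"
      by (auto simp: reserved_def block_indices_def)
    then show "w \<in> (\<lambda>(y, \<tau>). vert (B, \<not> side, y, \<tau>)) ` ({..<c} \<times> UNIV)"
      using i by (auto simp: doubleton_eq_iff vert_eq_iff)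
  qed
  then have "card {w \<in> V. {i, w} \<in> reserved} \<le> card ((\<lambda>(y, \<tau>). vert (B, \<not> side, y, \<tau>)) ` ({..<c} \<times> UNIV))"
    by (intro card_mono) auto
  also have "\<dots> \<le> card ({..<c} \<times> (UNIV :: bool set))" by (rule card_image_le) simp
  finally show ?thesis by (simp add: card_cartesian_product mult.commute)
next
  case False
  have "{i, w} \<notin> reserved" for w
  proof
    assume "{i, w} \<in> reserved"
    then obtain B x \<sigma> y \<tau> where "{i, w} = {left B x \<sigma>, right B y \<tau>}" "B < l" "x < c" "y < c"
      by (auto simp: reserved_def block_indices_def)
    then show False using False by (auto simp: doubleton_eq_iff)
  qed
  then show ?thesis by simp
qed

lemma wdeg_reserved_le: "wdeg V (\<lambda>e. of_bool (e \<in> reserved)) i \<le> 2 * real c"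
  using card_reserved_neighbours_le[of i] finite_V singleton_notin(2)
  by (simp add: wdeg_of_bool flip: of_nat_mult)

section \<open>Switches\<close>

text \<open>The twins \<open>left B x False\<close> and \<open>left B x True\<close> are joined to complementary halves of the block. A
  switch at \<open>(B, x)\<close> in the degree group exchanges their roles; a switch at \<open>(B, x, y)\<close> in the triangle
  group exchanges the two perfect matchings between two pairs of twins.\<close>

definition degree_switches :: "(nat \<times> nat) set" where
  "degree_switches = {l1..<l1 + l2} \<times> {..<c}"

definition triangle_switches :: "(nat \<times> nat \<times> nat) set" where
  "triangle_switches = {l1 + l2..<l} \<times> {..<c} \<times> {..<c}"

definition degree_config :: "(nat \<times> nat) set \<Rightarrow> 'a set set" where
  "degree_config X = block_pair ` {(B, x, \<sigma>, y, \<tau>) \<in> block_indices l1 (l1 + l2). (\<not> \<sigma>) = ((B, x) \<in> X)}"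

definition triangle_config :: "(nat \<times> nat \<times> nat) set \<Rightarrow> 'a set set" where
  "triangle_config Y = block_pair ` {(B, x, \<sigma>, y, \<tau>) \<in> block_indices (l1 + l2) l. (\<sigma> = \<tau>) = ((B, x, y) \<in> Y)}"

definition configuration :: "'a set set \<Rightarrow> (nat \<times> nat) set \<Rightarrow> (nat \<times> nat \<times> nat) set \<Rightarrow> 'a set set" where
  "configuration F X Y = F \<union> degree_config X \<union> triangle_config Y"

definition switch_sign :: "'t set \<Rightarrow> 't \<Rightarrow> real" where
  "switch_sign X t = (if t \<in> X then 1 else - 1)"

fun degree_effect :: "('a set \<Rightarrow> real) \<Rightarrow> nat \<times> nat \<Rightarrow> real" where
  "degree_effect f (B, x) = (\<Sum>y<c. f (block_pair (B, x, False, y, False)) - f (block_pair (B, x, True, y, True))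
     + f (block_pair (B, x, False, y, True)) - f (block_pair (B, x, True, y, False)))"

fun triangle_effect :: "('a set \<Rightarrow> real) \<Rightarrow> nat \<times> nat \<times> nat \<Rightarrow> real" where
  "triangle_effect f (B, x, y) = f (block_pair (B, x, False, y, False)) + f (block_pair (B, x, True, y, True))
     - f (block_pair (B, x, False, y, True)) - f (block_pair (B, x, True, y, False))"

lemma finite_switches: "finite degree_switches" "finite triangle_switches"
  by (auto simp: degree_switches_def triangle_switches_def)

lemma card_switches: "card degree_switches = l2 * c" "card triangle_switches = l3 * c\<^sup>2"
  by (simp_all add: degree_switches_def triangle_switches_def card_cartesian_product power2_eq_square)

lemma degree_config_subset: "degree_config X \<subseteq> degree_group"
  unfolding degree_config_def degree_group_def by auto

lemma triangle_config_subset: "triangle_config Y \<subseteq> triangle_group"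
  unfolding triangle_config_def triangle_group_def by auto

lemma block_pair_mem_image:
  assumes "t \<in> block_indices 0 l" "X \<subseteq> block_indices 0 l"
  shows "block_pair t \<in> block_pair ` X \<longleftrightarrow> t \<in> X"
  using inj_on_image_mem_iff[OF inj_block_pair assms] .

lemma sum_degree_group:
  "(\<Sum>e\<in>degree_group. (of_bool (e \<in> degree_config X) - 1 / 2) * f e)
     = 1 / 2 * (\<Sum>t\<in>degree_switches. switch_sign X t * degree_effect f t)"
proof -
  have mem: "block_pair (B, x, \<sigma>, y, \<tau>) \<in> degree_config X \<longleftrightarrow> (\<not> \<sigma>) = ((B, x) \<in> X)"
    if "B \<in> {l1..<l1 + l2}" "x < c" "y < c" for B x \<sigma> y \<tau>
    unfolding degree_config_def using that
    by (subst block_pair_mem_image) (auto simp: block_indices_def)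
  have "(\<Sum>e\<in>degree_group. (of_bool (e \<in> degree_config X) - 1 / 2) * f e)
      = (\<Sum>B\<in>{l1..<l1 + l2}. \<Sum>x<c. 1 / 2 * (switch_sign X (B, x) * degree_effect f (B, x)))"
    unfolding degree_group_def degree_effect.simps sum_distrib_left
    by (subst sum_block_pairs, simp, intro sum.cong refl)
      (simp add: mem switch_sign_def algebra_simps del: block_pair.simps)
  then show ?thesis
    unfolding degree_switches_def sum_distrib_left
    by (simp add: sum.cartesian_product case_prod_unfold del: degree_effect.simps)
qed

lemma sum_triangle_group:
  "(\<Sum>e\<in>triangle_group. (of_bool (e \<in> triangle_config Y) - 1 / 2) * f e)
     = 1 / 2 * (\<Sum>t\<in>triangle_switches. switch_sign Y t * triangle_effect f t)"
proof -
  have mem: "block_pair (B, x, \<sigma>, y, \<tau>) \<in> triangle_config Y \<longleftrightarrow> (\<sigma> = \<tau>) = ((B, x, y) \<in> Y)"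
    if "B \<in> {l1 + l2..<l}" "x < c" "y < c" for B x \<sigma> y \<tau>
    unfolding triangle_config_def using that
    by (subst block_pair_mem_image) (auto simp: block_indices_def)
  have "(\<Sum>e\<in>triangle_group. (of_bool (e \<in> triangle_config Y) - 1 / 2) * f e)
      = (\<Sum>B\<in>{l1 + l2..<l}. \<Sum>x<c. \<Sum>y<c. 1 / 2 * (switch_sign Y (B, x, y) * triangle_effect f (B, x, y)))"
    unfolding triangle_group_def triangle_effect.simps
    by (subst sum_block_pairs, simp, intro sum.cong refl)
      (simp add: mem switch_sign_def algebra_simps del: block_pair.simps)
  then show ?thesis
    unfolding triangle_switches_def sum_distrib_left
    by (simp add: sum.cartesian_product case_prod_unfold del: triangle_effect.simps)
qed

lemma configuration_Int:
  assumes "F \<subseteq> edge_group"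
  shows "configuration F X Y \<subseteq> reserved" "e \<in> edge_group \<Longrightarrow> e \<in> configuration F X Y \<longleftrightarrow> e \<in> F"
    "e \<in> degree_group \<Longrightarrow> e \<in> configuration F X Y \<longleftrightarrow> e \<in> degree_config X"
    "e \<in> triangle_group \<Longrightarrow> e \<in> configuration F X Y \<longleftrightarrow> e \<in> triangle_config Y"
  using assms degree_config_subset[of X] triangle_config_subset[of Y] groups_disjoint reserved_split
  unfolding configuration_def by blast+

lemma sum_configuration:
  assumes "F \<subseteq> edge_group"
  shows "(\<Sum>e\<in>reserved. (of_bool (e \<in> configuration F X Y) - 1 / 2) * f e)
     = (\<Sum>e\<in>edge_group. (of_bool (e \<in> F) - 1 / 2) * f e)
       + 1 / 2 * (\<Sum>t\<in>degree_switches. switch_sign X t * degree_effect f t)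
       + 1 / 2 * (\<Sum>t\<in>triangle_switches. switch_sign Y t * triangle_effect f t)"
  unfolding sum_reserved_split sum_degree_group[symmetric] sum_triangle_group[symmetric]
  using configuration_Int[OF assms] by simp

lemma sum_configuration_diff:
  assumes F: "F \<subseteq> edge_group"
  shows "(\<Sum>e\<in>[V]\<^bsup>2\<^esup>. (of_bool (e \<in> configuration F X' Y') - of_bool (e \<in> configuration F X Y)) * f e)
     = 1 / 2 * (\<Sum>t\<in>degree_switches. (switch_sign X' t - switch_sign X t) * degree_effect f t)
       + 1 / 2 * (\<Sum>t\<in>triangle_switches. (switch_sign Y' t - switch_sign Y t) * triangle_effect f t)"
proof -
  have "e \<notin> configuration F X Y" if "e \<notin> reserved" for e X Y
    using that configuration_Int(1)[OF F] by blast
  then have "(\<Sum>e\<in>[V]\<^bsup>2\<^esup>. (of_bool (e \<in> configuration F X' Y') - of_bool (e \<in> configuration F X Y)) * f e)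
      = (\<Sum>e\<in>reserved. (of_bool (e \<in> configuration F X' Y') - of_bool (e \<in> configuration F X Y)) * f e)"
    using finite_pairs reserved_subset by (intro sum.mono_neutral_right) auto
  also have "\<dots> = (\<Sum>e\<in>reserved. (of_bool (e \<in> configuration F X' Y') - 1 / 2) * f e)
      - (\<Sum>e\<in>reserved. (of_bool (e \<in> configuration F X Y) - 1 / 2) * f e)"
    unfolding sum_subtractf[symmetric] by (intro sum.cong refl) (simp add: algebra_simps)
  finally show ?thesis
    unfolding sum_configuration[OF F] by (simp add: sum_subtractf algebra_simps)
qed

lemma sum_switch_sign_insert:
  assumes "finite T" "t \<in> T - X"
  shows "1 / 2 * (\<Sum>s\<in>T. (switch_sign (insert t X) s - switch_sign X s) * h s) = h t"
proof -
  have "(\<Sum>s\<in>T. (switch_sign (insert t X) s - switch_sign X s) * h s) = (\<Sum>s\<in>T. if s = t then 2 * h s else 0)"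
    using assms by (intro sum.cong) (auto simp: switch_sign_def)
  then show ?thesis using assms by simp
qed

lemma sum_triangle_switch:
  assumes "F \<subseteq> edge_group" "t \<in> triangle_switches - Y"
  shows "(\<Sum>e\<in>[V]\<^bsup>2\<^esup>. (of_bool (e \<in> configuration F X (insert t Y)) - of_bool (e \<in> configuration F X Y)) * f e)
     = triangle_effect f t"
  unfolding sum_configuration_diff[OF assms(1)] sum_switch_sign_insert[OF finite_switches(2) assms(2)] by simp

lemma degree_effect_vertex_sum:
  assumes "(B, x) \<in> degree_switches"
  shows "degree_effect (\<lambda>e. \<Sum>i\<in>e. w i) (B, x) = 2 * real c * (w (left B x False) - w (left B x True))"
proof -
  have "B < l" "x < c" using assms by (auto simp: degree_switches_def)
  then have "degree_effect (\<lambda>e. \<Sum>i\<in>e. w i) (B, x) = (\<Sum>y<c. 2 * (w (left B x False) - w (left B x True)))"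
    unfolding degree_effect.simps by (intro sum.cong refl) (simp add: vert_eq_iff)
  then show ?thesis by simp
qed

lemma triangle_effect_vertex_sum:
  "t \<in> triangle_switches \<Longrightarrow> triangle_effect (\<lambda>e. \<Sum>i\<in>e. w i) t = 0"
  by (auto simp: triangle_switches_def vert_eq_iff)

lemma card_configuration:
  assumes F: "F \<subseteq> edge_group"
  shows "real (card (configuration F X Y))
    = real (card F) + 2 * (real c)\<^sup>2 * real l2 + 2 * (real c)\<^sup>2 * real l3"
proof -
  have fin: "finite edge_group" using finite_reserved reserved_split by simp
  have card: "(\<Sum>e\<in>A. of_bool (e \<in> C) - 1 / 2) = real (card C) - real (card A) / 2" if "C \<subseteq> A" "finite A"
    for A C :: "'a set set"
    using that by (simp add: sum_subtractf of_bool_def sum.If_cases Int_absorb1)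
  have "degree_effect (\<lambda>_. 1) t = 0" "triangle_effect (\<lambda>_. 1) s = 0" for t s
    by (cases t, simp) (cases s, simp)
  then have "real (card (configuration F X Y)) - real (card reserved) / 2
    = real (card F) - real (card edge_group) / 2"
    using sum_configuration[OF F, of X Y "\<lambda>_. 1"] card[OF configuration_Int(1)[OF F] finite_reserved]
      card[OF F fin]
    by simp
  then show ?thesis using card_groups by (simp add: field_simps)
qed

end

section \<open>Configurations of the reserved pairs\<close>

lemma abs_sum_of_bool_minus_half_le:
  "\<bar>\<Sum>e\<in>A. (of_bool (e \<in> F) - 1 / 2) * f e\<bar> \<le> 1 / 2 * (\<Sum>e\<in>A. \<bar>f e :: real\<bar>)"
proof -
  have "\<bar>\<Sum>e\<in>A. (of_bool (e \<in> F) - 1 / 2) * f e\<bar> \<le> (\<Sum>e\<in>A. \<bar>(of_bool (e \<in> F) - 1 / 2) * f e\<bar>)"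
    by (rule sum_abs)
  also have "\<dots> = (\<Sum>e\<in>A. 1 / 2 * \<bar>f e\<bar>)" by (intro sum.cong) (auto simp: abs_mult of_bool_def)
  finally show ?thesis by (simp add: sum_distrib_left)
qed

lemma abs_half_minus_mult_le: "0 \<le> q \<Longrightarrow> q \<le> 1 \<Longrightarrow> \<bar>(1 / 2 - q) * z\<bar> \<le> 1 / 2 * \<bar>z :: real\<bar>"
  unfolding abs_mult by (intro mult_right_mono) (auto simp: abs_if)

lemma abs_add_mono: "\<bar>a\<bar> \<le> A \<Longrightarrow> \<bar>b\<bar> \<le> B \<Longrightarrow> \<bar>a + b :: real\<bar> \<le> A + B"
  by linarith

lemma abs_numeral_mult_mono: "\<bar>a\<bar> \<le> A \<Longrightarrow> \<bar>numeral n * a :: real\<bar> \<le> numeral n * A"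
  by (simp add: abs_mult)

lemma mult_one_minus_le_quarter: "p * (1 - p) \<le> 1 / 4" for p :: real
  using zero_le_power2[of "p - 1 / 2"] by (simp add: algebra_simps power2_eq_square)

text \<open>The free pairs get density \<open>\<pi>\<close> and the reserved pairs density \<open>1/2\<close>, with overall mean \<open>p\<close>.\<close>

locale gadget_density = gadget_graph V vert c l1 l2 l3
  for V :: "'a set" and vert c l1 l2 l3 +
  fixes p \<pi> :: real
  assumes p_01: "0 \<le> p" "p \<le> 1" and density_01: "0 \<le> \<pi>" "\<pi> \<le> 1"
    and balanced: "(\<pi> - p) * real (card free_pairs) + (1 / 2 - p) * real (card reserved) = 0"
    and density_close: "real (card V) * \<bar>\<pi> - p\<bar> \<le> real c"
begin

definition perturbation :: "'a set set \<Rightarrow> 'a set \<Rightarrow> real" where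
  "perturbation F e = (if e \<in> free_pairs then \<pi> - p else if e \<in> reserved then of_bool (e \<in> F) - p else 0)"

definition envelope :: "'a set \<Rightarrow> real" where
  "envelope e = (if e \<in> free_pairs then \<bar>\<pi> - p\<bar> else if e \<in> reserved then 1 else 0)"

lemma perturbation_singleton: "perturbation F {i} = 0"
  using singleton_notin by (simp add: perturbation_def)

lemma envelope_01: "0 \<le> envelope e" "envelope e \<le> 1"
  using p_01 density_01 by (auto simp: envelope_def)

lemma abs_perturbation_le: "\<bar>perturbation F e\<bar> \<le> envelope e"
  using p_01 by (auto simp: perturbation_def envelope_def of_bool_def)

lemma wdeg_envelope_nonneg: "0 \<le> wdeg V envelope i"
  unfolding wdeg_def by (intro sum_nonneg envelope_01)

lemma wdeg_envelope_le: "wdeg V envelope i \<le> 3 * real c"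
proof -
  have "wdeg V envelope i \<le> wdeg V (\<lambda>e. \<bar>\<pi> - p\<bar> + of_bool (e \<in> reserved)) i"
    unfolding wdeg_def by (intro sum_mono) (auto simp: envelope_def)
  also have "\<dots> = real (card V) * \<bar>\<pi> - p\<bar> + wdeg V (\<lambda>e. of_bool (e \<in> reserved)) i"
    unfolding wdeg_add by (simp add: wdeg_def)
  also have "\<dots> \<le> real c + 2 * real c" by (intro add_mono density_close wdeg_reserved_le)
  finally show ?thesis by simp
qed

lemma abs_density_diff_card_le: "\<bar>(\<pi> - p) * real (card free_pairs)\<bar> \<le> real (card reserved) / 2"
proof -
  have "(\<pi> - p) * real (card free_pairs) = - ((1 / 2 - p) * real (card reserved))" using balanced by linarith
  then show ?thesis using abs_half_minus_mult_le[OF p_01, of "real (card reserved)"] by simp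
qed

lemma sum_wdeg_envelope_le: "(\<Sum>i\<in>V. wdeg V envelope i) \<le> 3 * real (card reserved)"
proof -
  have "(\<Sum>i\<in>V. wdeg V envelope i) = 2 * (\<Sum>e\<in>[V]\<^bsup>2\<^esup>. envelope e)"
    using singleton_notin by (intro sum_wdeg finite_V) (simp add: envelope_def)
  also have "(\<Sum>e\<in>[V]\<^bsup>2\<^esup>. envelope e) = \<bar>\<pi> - p\<bar> * real (card free_pairs) + real (card reserved)"
  proof -
    have "(\<Sum>e\<in>free_pairs. envelope e) = (\<Sum>e\<in>free_pairs. \<bar>\<pi> - p\<bar>)"
      by (intro sum.cong) (auto simp: envelope_def)
    moreover have "(\<Sum>e\<in>reserved. envelope e) = (\<Sum>e\<in>reserved. 1)"
      using free_reserved(2) by (intro sum.cong) (auto simp: envelope_def)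
    ultimately show ?thesis unfolding sum_pairs_split by simp
  qed
  finally show ?thesis using abs_density_diff_card_le by (simp add: abs_mult)
qed

lemma sum_wdeg_envelope_sq_le: "(\<Sum>i\<in>V. (wdeg V envelope i)\<^sup>2) \<le> 9 * (real c * real (card reserved))"
proof -
  have "(\<Sum>i\<in>V. (wdeg V envelope i)\<^sup>2) \<le> (\<Sum>i\<in>V. 3 * real c * wdeg V envelope i)"
    unfolding power2_eq_square by (intro sum_mono mult_right_mono wdeg_envelope_le wdeg_envelope_nonneg)
  also have "\<dots> \<le> 3 * real c * (3 * real (card reserved))"
    unfolding sum_distrib_left[symmetric] by (intro mult_left_mono sum_wdeg_envelope_le) auto
  finally show ?thesis by simp
qed

lemma sum_wdeg_perturbation_sq_le:
  "\<bar>\<Sum>i\<in>V. (wdeg V (perturbation F) i)\<^sup>2\<bar> \<le> 9 * (real c * real (card reserved))"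
proof -
  have "(\<Sum>i\<in>V. (wdeg V (perturbation F) i)\<^sup>2) \<le> (\<Sum>i\<in>V. (wdeg V envelope i)\<^sup>2)"
    using abs_wdeg_le[OF abs_perturbation_le]
    by (intro sum_mono power2_le_iff_abs_le[THEN iffD2] wdeg_envelope_nonneg)
  then show ?thesis using sum_wdeg_envelope_sq_le by (simp add: sum_nonneg)
qed

lemma sum_perturbation_mult:
  assumes F: "F \<subseteq> edge_group"
  shows "(\<Sum>e\<in>[V]\<^bsup>2\<^esup>. perturbation (configuration F X Y) e * f e)
     = (\<pi> - p) * (\<Sum>e\<in>[V]\<^bsup>2\<^esup>. f e) + (1 / 2 - \<pi>) * (\<Sum>e\<in>reserved. f e)
       + (\<Sum>e\<in>edge_group. (of_bool (e \<in> F) - 1 / 2) * f e)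
       + 1 / 2 * (\<Sum>t\<in>degree_switches. switch_sign X t * degree_effect f t)
       + 1 / 2 * (\<Sum>t\<in>triangle_switches. switch_sign Y t * triangle_effect f t)"
proof -
  let ?F = "configuration F X Y"
  have "(\<Sum>e\<in>free_pairs. perturbation ?F e * f e) = (\<pi> - p) * (\<Sum>e\<in>free_pairs. f e)"
    unfolding sum_distrib_left by (intro sum.cong) (auto simp: perturbation_def)
  moreover have "(\<Sum>e\<in>reserved. perturbation ?F e * f e)
      = (\<Sum>e\<in>reserved. (of_bool (e \<in> ?F) - 1 / 2) * f e + (1 / 2 - p) * f e)"
    using free_reserved(2) by (intro sum.cong) (auto simp: perturbation_def algebra_simps)
  ultimately show ?thesis
    unfolding sum_pairs_split sum.distrib sum_distrib_left[symmetric] sum_configuration[OF F]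
    by (simp add: algebra_simps)
qed

lemma abs_variance_diff_le:
  "\<bar>2 * (\<pi> * (1 - \<pi>) * real (card free_pairs)) - p * (1 - p) * real (card V) * (real (card V) - 1)\<bar>
     \<le> 2 * real (card reserved)"
proof -
  let ?P = "real (card free_pairs)" and ?R = "real (card reserved)"
  have "real (card V) * (real (card V) - 1) = 2 * ?P + 2 * ?R" using card_free_reserved by simp
  then have "p * (1 - p) * real (card V) * (real (card V) - 1) = p * (1 - p) * (2 * ?P + 2 * ?R)"
    by (simp only: mult.assoc)
  then have "2 * (\<pi> * (1 - \<pi>) * ?P) - p * (1 - p) * real (card V) * (real (card V) - 1)
      = 2 * ((1 - \<pi> - p) * ((\<pi> - p) * ?P)) - 2 * (p * (1 - p) * ?R)"
    by (simp add: algebra_simps)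
  moreover have "\<bar>(1 - \<pi> - p) * ((\<pi> - p) * ?P)\<bar> \<le> 1 * (?R / 2)"
    unfolding abs_mult[of "1 - \<pi> - p"] using p_01 density_01 abs_density_diff_card_le
    by (intro mult_mono) auto
  moreover have "\<bar>p * (1 - p) * ?R\<bar> \<le> 1 / 4 * ?R"
    using mult_right_mono[OF mult_one_minus_le_quarter, of ?R] p_01 by (simp add: abs_mult)
  ultimately show ?thesis by linarith
qed

fun twin_wdeg_diff :: "('a set \<Rightarrow> real) \<Rightarrow> nat \<times> nat \<Rightarrow> real" where
  "twin_wdeg_diff b (B, x) = wdeg V b (left B x False) - wdeg V b (left B x True)"

fun twin_codegree_diff :: "('a set \<Rightarrow> real) \<Rightarrow> nat \<times> nat \<times> nat \<Rightarrow> real" where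
  "twin_codegree_diff b (B, x, y) = (\<Sum>k\<in>V. (b {left B x False, k} - b {left B x True, k})
      * (b {right B y False, k} - b {right B y True, k}))"

lemma degree_effect_pair_wdeg:
  "t \<in> degree_switches \<Longrightarrow> degree_effect (pair_wdeg V b) t = 2 * real c * twin_wdeg_diff b t"
  unfolding pair_wdeg_def[abs_def] by (cases t) (simp only: degree_effect_vertex_sum twin_wdeg_diff.simps)

lemma triangle_effect_codegree:
  "t \<in> triangle_switches \<Longrightarrow> triangle_effect (codegree V b) t = twin_codegree_diff b t"
  by (auto simp: triangle_switches_def codegree_pair vert_eq_iff algebra_simps sum.distrib sum_subtractf)

end

locale gadget_noise = gadget_density V vert c l1 l2 l3 p \<pi>
  for V :: "'a set" and vert c l1 l2 l3 p \<pi> +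
  fixes b :: "'a set \<Rightarrow> real"
  assumes noise_outside: "\<And>e. e \<notin> free_pairs \<Longrightarrow> b e = 0" and abs_noise_le_1: "\<And>e. \<bar>b e\<bar> \<le> 1"
    and noise_sq: "\<And>e. e \<in> free_pairs \<Longrightarrow> (b e)\<^sup>2 = (1 - 2 * \<pi>) * b e + \<pi> * (1 - \<pi>)"
begin

definition alpha :: "'a set set \<Rightarrow> 'a set \<Rightarrow> real" where
  "alpha F e = b e + perturbation F e"

lemma noise_singleton: "b {i} = 0"
  using noise_outside singleton_notin by auto

lemma abs_alpha_le: "\<bar>alpha F e\<bar> \<le> 1"
proof (cases "e \<in> free_pairs")
  case True
  have "(b e + \<pi>) * (b e + \<pi> - 1) = 0" using noise_sq[OF True] by (simp add: power2_eq_square algebra_simps)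
  then have "b e + \<pi> = 0 \<or> b e + \<pi> = 1" by auto
  then show ?thesis using p_01 True by (auto simp: alpha_def perturbation_def)
next
  case False
  then show ?thesis
    using order_trans[OF abs_perturbation_le envelope_01(2)] noise_outside by (simp add: alpha_def)
qed

lemma wdeg_alpha: "wdeg V (alpha F) i = wdeg V b i + wdeg V (perturbation F) i"
  unfolding alpha_def[abs_def] by (rule wdeg_add)

lemma sum_pairs_noise: "(\<And>e. b e = 0 \<Longrightarrow> f e = 0) \<Longrightarrow> (\<Sum>e\<in>[V]\<^bsup>2\<^esup>. f e) = (\<Sum>e\<in>free_pairs. (f e :: real))"
  using noise_outside free_reserved finite_pairs by (intro sum.mono_neutral_right) auto

lemma sum_wdeg_noise: "(\<Sum>i\<in>V. wdeg V b i) = 2 * (\<Sum>e\<in>free_pairs. b e)"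
  using sum_wdeg[OF finite_V, of b] noise_singleton sum_pairs_noise[of b] by simp

lemma sum_noise_sq:
  "(\<Sum>i\<in>V. \<Sum>j\<in>V. (b {i, j})\<^sup>2)
     = 2 * ((1 - 2 * \<pi>) * (\<Sum>e\<in>free_pairs. b e) + \<pi> * (1 - \<pi>) * real (card free_pairs))"
proof -
  have "(\<Sum>i\<in>V. \<Sum>j\<in>V. (b {i, j})\<^sup>2) = 2 * (\<Sum>e\<in>free_pairs. (b e)\<^sup>2)"
    using sum_ordered_pairs[OF finite_V, of "\<lambda>e. (b e)\<^sup>2"] noise_singleton sum_pairs_noise[of "\<lambda>e. (b e)\<^sup>2"]
    by simp
  then show ?thesis by (simp add: noise_sq sum.distrib sum_distrib_left)
qed

definition degree_error :: real where
  "degree_error = \<bar>2 * (\<Sum>e\<in>[V]\<^bsup>2\<^esup>. codegree V b e)\<bar> + 2 * \<bar>\<Sum>e\<in>free_pairs. b e\<bar> + 2 * real (card reserved)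
     + 4 * (real c * \<bar>\<Sum>e\<in>free_pairs. b e\<bar>) + \<bar>\<Sum>e\<in>reserved. pair_wdeg V b e\<bar>
     + (\<Sum>e\<in>edge_group. \<bar>pair_wdeg V b e\<bar>) + 9 * (real c * real (card reserved))"

definition triangle_error :: real where
  "triangle_error = \<bar>triangle_sum V b b b\<bar> + 3 * (\<bar>\<pi> - p\<bar> * \<bar>2 * (\<Sum>e\<in>[V]\<^bsup>2\<^esup>. codegree V b e)\<bar>)
     + 3 * \<bar>\<Sum>e\<in>reserved. codegree V b e\<bar>
     + 3 * ((\<Sum>e\<in>edge_group. \<bar>codegree V b e\<bar>) + (\<Sum>e\<in>degree_group. \<bar>codegree V b e\<bar>))
     + 36 * (real c * real (card reserved))"

lemma sum_wdeg_perturbation_mult: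
  assumes F: "F \<subseteq> edge_group"
  shows "(\<Sum>i\<in>V. wdeg V (perturbation (configuration F X Y)) i * wdeg V b i)
     = (\<pi> - p) * (real (card V) - 1) * (2 * (\<Sum>e\<in>free_pairs. b e))
       + (1 / 2 - \<pi>) * (\<Sum>e\<in>reserved. pair_wdeg V b e)
       + (\<Sum>e\<in>edge_group. (of_bool (e \<in> F) - 1 / 2) * pair_wdeg V b e)
       + real c * (\<Sum>t\<in>degree_switches. switch_sign X t * twin_wdeg_diff b t)"
proof -
  have "(\<Sum>i\<in>V. wdeg V (perturbation (configuration F X Y)) i * wdeg V b i)
      = (\<Sum>e\<in>[V]\<^bsup>2\<^esup>. perturbation (configuration F X Y) e * pair_wdeg V b e)"
    unfolding pair_wdeg_def using perturbation_singleton by (rule sum_wdeg_mult[OF finite_V])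
  moreover have "(\<Sum>e\<in>[V]\<^bsup>2\<^esup>. pair_wdeg V b e) = (real (card V) - 1) * (2 * (\<Sum>e\<in>free_pairs. b e))"
    unfolding pair_wdeg_def sum_pairs_sum[OF finite_V] sum_wdeg_noise ..
  moreover have "(\<Sum>t\<in>degree_switches. switch_sign X t * degree_effect (pair_wdeg V b) t)
      = 2 * real c * (\<Sum>t\<in>degree_switches. switch_sign X t * twin_wdeg_diff b t)"
    unfolding sum_distrib_left by (intro sum.cong refl) (simp add: degree_effect_pair_wdeg)
  moreover have "(\<Sum>t\<in>triangle_switches. switch_sign Y t * triangle_effect (pair_wdeg V b) t) = 0"
    unfolding pair_wdeg_def[abs_def] using triangle_effect_vertex_sum by (intro sum.neutral) simp
  ultimately show ?thesis unfolding sum_perturbation_mult[OF F] by (simp add: mult.assoc)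
qed

lemma abs_density_diff_sum_noise_le:
  "\<bar>(\<pi> - p) * (real (card V) - 1) * (\<Sum>e\<in>free_pairs. b e)\<bar> \<le> real c * \<bar>\<Sum>e\<in>free_pairs. b e\<bar>"
proof (cases "card V = 0")
  case True
  then have "[V]\<^bsup>2\<^esup> = {}" using finite_V by (auto simp: nsets_def)
  then have "free_pairs = {}" using free_reserved(1) by blast
  then show ?thesis by simp
next
  case False
  have "\<bar>(\<pi> - p) * (real (card V) - 1)\<bar> \<le> \<bar>\<pi> - p\<bar> * real (card V)"
    unfolding abs_mult using False by (intro mult_left_mono) (auto simp: abs_if)
  also have "\<dots> \<le> real c" using density_close by (simp add: mult.commute)
  finally show ?thesis unfolding abs_mult[of "(\<pi> - p) * (real (card V) - 1)"] by (intro mult_right_mono) auto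
qed

lemma sum_wdeg_alpha_sq_close:
  assumes F: "F \<subseteq> edge_group"
  shows "\<bar>(\<Sum>i\<in>V. (wdeg V (alpha (configuration F X Y)) i)\<^sup>2) - p * (1 - p) * real (card V) * (real (card V) - 1)
     - 2 * real c * (\<Sum>t\<in>degree_switches. switch_sign X t * twin_wdeg_diff b t)\<bar> \<le> degree_error"
proof -
  define F' where "F' = configuration F X Y"
  define Z where "Z = (\<Sum>e\<in>free_pairs. b e)"
  define codeg where "codeg = 2 * (\<Sum>e\<in>[V]\<^bsup>2\<^esup>. codegree V b e)"
  define reserved_part where "reserved_part = (1 / 2 - \<pi>) * (\<Sum>e\<in>reserved. pair_wdeg V b e)"
  define edge_part where "edge_part = (\<Sum>e\<in>edge_group. (of_bool (e \<in> F) - 1 / 2) * pair_wdeg V b e)"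
  define sq_part where "sq_part = (\<Sum>i\<in>V. (wdeg V (perturbation F') i)\<^sup>2)"
  have "(\<Sum>i\<in>V. (wdeg V (alpha F') i)\<^sup>2) = (\<Sum>i\<in>V. (wdeg V b i)\<^sup>2)
      + 2 * (\<Sum>i\<in>V. wdeg V (perturbation F') i * wdeg V b i) + sq_part"
    by (simp add: wdeg_alpha power2_sum sum.distrib sum_distrib_left sq_part_def mult_ac)
  then have expand: "(\<Sum>i\<in>V. (wdeg V (alpha F') i)\<^sup>2) - p * (1 - p) * real (card V) * (real (card V) - 1)
      - 2 * real c * (\<Sum>t\<in>degree_switches. switch_sign X t * twin_wdeg_diff b t)
      = codeg + 2 * ((1 - 2 * \<pi>) * Z)
        + (2 * (\<pi> * (1 - \<pi>) * real (card free_pairs)) - p * (1 - p) * real (card V) * (real (card V) - 1))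
        + 4 * ((\<pi> - p) * (real (card V) - 1) * Z) + 2 * reserved_part + 2 * edge_part + sq_part"
    unfolding sum_wdeg_sq[OF finite_V] sum_noise_sq F'_def sum_wdeg_perturbation_mult[OF F]
      codeg_def Z_def reserved_part_def edge_part_def by (simp add: algebra_simps)
  have "\<bar>(\<Sum>i\<in>V. (wdeg V (alpha F') i)\<^sup>2) - p * (1 - p) * real (card V) * (real (card V) - 1)
      - 2 * real c * (\<Sum>t\<in>degree_switches. switch_sign X t * twin_wdeg_diff b t)\<bar>
      \<le> \<bar>codeg\<bar> + 2 * (1 * \<bar>Z\<bar>) + 2 * real (card reserved) + 4 * (real c * \<bar>Z\<bar>)
      + 2 * (1 / 2 * \<bar>\<Sum>e\<in>reserved. pair_wdeg V b e\<bar>) + 2 * (1 / 2 * (\<Sum>e\<in>edge_group. \<bar>pair_wdeg V b e\<bar>))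
      + 9 * (real c * real (card reserved))"
    unfolding expand
  proof (intro abs_add_mono abs_numeral_mult_mono order_refl abs_variance_diff_le)
    show "\<bar>(1 - 2 * \<pi>) * Z\<bar> \<le> 1 * \<bar>Z\<bar>"
      unfolding abs_mult using density_01 by (intro mult_right_mono) auto
    show "\<bar>(\<pi> - p) * (real (card V) - 1) * Z\<bar> \<le> real c * \<bar>Z\<bar>"
      unfolding Z_def by (rule abs_density_diff_sum_noise_le)
    show "\<bar>reserved_part\<bar> \<le> 1 / 2 * \<bar>\<Sum>e\<in>reserved. pair_wdeg V b e\<bar>"
      unfolding reserved_part_def by (rule abs_half_minus_mult_le[OF density_01])
    show "\<bar>edge_part\<bar> \<le> 1 / 2 * (\<Sum>e\<in>edge_group. \<bar>pair_wdeg V b e\<bar>)"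
      unfolding edge_part_def by (rule abs_sum_of_bool_minus_half_le)
    show "\<bar>sq_part\<bar> \<le> 9 * (real c * real (card reserved))"
      unfolding sq_part_def by (rule sum_wdeg_perturbation_sq_le)
  qed
  also have "\<dots> = degree_error" by (simp add: degree_error_def codeg_def Z_def)
  finally show ?thesis unfolding F'_def .
qed

lemma triangle_sum_perturbation:
  assumes F: "F \<subseteq> edge_group"
  shows "triangle_sum V (perturbation (configuration F X Y)) b b
     = (\<pi> - p) * (2 * (\<Sum>e\<in>[V]\<^bsup>2\<^esup>. codegree V b e)) + 2 * ((1 / 2 - \<pi>) * (\<Sum>e\<in>reserved. codegree V b e))
       + 2 * (\<Sum>e\<in>edge_group. (of_bool (e \<in> F) - 1 / 2) * codegree V b e)
       + 2 * (\<Sum>e\<in>degree_group. (of_bool (e \<in> degree_config X) - 1 / 2) * codegree V b e)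
       + (\<Sum>t\<in>triangle_switches. switch_sign Y t * twin_codegree_diff b t)"
proof -
  have "(\<Sum>t\<in>triangle_switches. switch_sign Y t * triangle_effect (codegree V b) t)
      = (\<Sum>t\<in>triangle_switches. switch_sign Y t * twin_codegree_diff b t)"
    by (intro sum.cong refl) (simp add: triangle_effect_codegree)
  moreover have "triangle_sum V (perturbation (configuration F X Y)) b b
      = 2 * (\<Sum>e\<in>[V]\<^bsup>2\<^esup>. perturbation (configuration F X Y) e * codegree V b e)"
    using perturbation_singleton by (rule triangle_sum_eq_sum_codegree[OF finite_V])
  ultimately show ?thesis
    unfolding sum_perturbation_mult[OF F] sum_degree_group by (simp add: algebra_simps)
qed

lemma triangle_sum_alpha_close:
  fixes X Y
  assumes F: "F \<subseteq> edge_group"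
  defines "F' \<equiv> configuration F X Y"
  shows "\<bar>triangle_sum V (alpha F') (alpha F') (alpha F')
     - 3 * (\<Sum>t\<in>triangle_switches. switch_sign Y t * twin_codegree_diff b t)\<bar> \<le> triangle_error"
proof -
  define codeg where "codeg = 2 * (\<Sum>e\<in>[V]\<^bsup>2\<^esup>. codegree V b e)"
  define reserved_part where "reserved_part = (1 / 2 - \<pi>) * (\<Sum>e\<in>reserved. codegree V b e)"
  define edge_part where "edge_part = (\<Sum>e\<in>edge_group. (of_bool (e \<in> F) - 1 / 2) * codegree V b e)"
  define degree_part where
    "degree_part = (\<Sum>e\<in>degree_group. (of_bool (e \<in> degree_config X) - 1 / 2) * codegree V b e)"
  let ?remainder = "triangle_sum V (alpha F') (alpha F') (alpha F') - triangle_sum V b b b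
      - 3 * triangle_sum V (perturbation F') b b"
  have expand: "triangle_sum V (alpha F') (alpha F') (alpha F')
      - 3 * (\<Sum>t\<in>triangle_switches. switch_sign Y t * twin_codegree_diff b t)
      = triangle_sum V b b b + 3 * ((\<pi> - p) * codeg) + 6 * reserved_part + 6 * edge_part + 6 * degree_part
        + ?remainder"
    unfolding F'_def triangle_sum_perturbation[OF F] codeg_def reserved_part_def edge_part_def degree_part_def
    by (simp add: algebra_simps)
  have "\<bar>triangle_sum V (alpha F') (alpha F') (alpha F')
      - 3 * (\<Sum>t\<in>triangle_switches. switch_sign Y t * twin_codegree_diff b t)\<bar>
      \<le> \<bar>triangle_sum V b b b\<bar> + 3 * (\<bar>\<pi> - p\<bar> * \<bar>codeg\<bar>)
      + 6 * (1 / 2 * \<bar>\<Sum>e\<in>reserved. codegree V b e\<bar>) + 6 * (1 / 2 * (\<Sum>e\<in>edge_group. \<bar>codegree V b e\<bar>))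
      + 6 * (1 / 2 * (\<Sum>e\<in>degree_group. \<bar>codegree V b e\<bar>)) + 36 * (real c * real (card reserved))"
    unfolding expand
  proof (intro abs_add_mono abs_numeral_mult_mono order_refl)
    show "\<bar>(\<pi> - p) * codeg\<bar> \<le> \<bar>\<pi> - p\<bar> * \<bar>codeg\<bar>" by (simp add: abs_mult)
    show "\<bar>reserved_part\<bar> \<le> 1 / 2 * \<bar>\<Sum>e\<in>reserved. codegree V b e\<bar>"
      unfolding reserved_part_def by (rule abs_half_minus_mult_le[OF density_01])
    show "\<bar>edge_part\<bar> \<le> 1 / 2 * (\<Sum>e\<in>edge_group. \<bar>codegree V b e\<bar>)"
      "\<bar>degree_part\<bar> \<le> 1 / 2 * (\<Sum>e\<in>degree_group. \<bar>codegree V b e\<bar>)"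
      unfolding edge_part_def degree_part_def by (rule abs_sum_of_bool_minus_half_le)+
    show "\<bar>?remainder\<bar> \<le> 36 * (real c * real (card reserved))"
      using triangle_sum_perturb[of "perturbation F'" envelope b V, OF abs_perturbation_le
          order_trans[OF abs_perturbation_le envelope_01(2)] abs_noise_le_1] sum_wdeg_envelope_sq_le
      unfolding alpha_def[abs_def] by linarith
  qed
  also have "\<dots> = triangle_error" by (simp add: triangle_error_def codeg_def)
  finally show ?thesis .
qed

section \<open>The effect of a switch\<close>

lemma alpha_diff:
  assumes "F \<subseteq> reserved" "F' \<subseteq> reserved"
  shows "alpha F' e = alpha F e + (of_bool (e \<in> F') - of_bool (e \<in> F))"
  using assms free_reserved(2) by (auto simp: alpha_def perturbation_def)

lemma wdeg_alpha_configuration_diff: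
  assumes F: "F \<subseteq> edge_group" and i: "i \<in> V"
  shows "wdeg V (alpha (configuration F X' Y')) i
     = wdeg V (alpha (configuration F X Y)) i
       + 1 / 2 * (\<Sum>t\<in>degree_switches. (switch_sign X' t - switch_sign X t)
           * degree_effect (\<lambda>e. \<Sum>j\<in>e. of_bool (j = i)) t)"
proof -
  let ?F = "configuration F X Y" and ?F' = "configuration F X' Y'"
  have sub: "?F \<subseteq> reserved" "?F' \<subseteq> reserved" using configuration_Int(1)[OF F] by auto
  have "{j} \<notin> ?F" "{j} \<notin> ?F'" for j using sub singleton_notin(2) by blast+
  then have "wdeg V (\<lambda>e. of_bool (e \<in> ?F') - of_bool (e \<in> ?F)) i
      = (\<Sum>e\<in>[V]\<^bsup>2\<^esup>. (of_bool (e \<in> ?F') - of_bool (e \<in> ?F)) * (\<Sum>j\<in>e. of_bool (j = i)))"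
    by (intro wdeg_eq_sum_pairs[OF finite_V i]) simp
  also have "\<dots> = 1 / 2 * (\<Sum>t\<in>degree_switches. (switch_sign X' t - switch_sign X t)
      * degree_effect (\<lambda>e. \<Sum>j\<in>e. of_bool (j = i)) t)"
    unfolding sum_configuration_diff[OF F] using triangle_effect_vertex_sum by simp
  finally show ?thesis unfolding alpha_diff[OF sub, abs_def] wdeg_add by simp
qed

lemma wdeg_alpha_triangle_config:
  "F \<subseteq> edge_group \<Longrightarrow> i \<in> V \<Longrightarrow>
     wdeg V (alpha (configuration F X Y')) i = wdeg V (alpha (configuration F X Y)) i"
  using wdeg_alpha_configuration_diff[of F i X Y' X Y] by simp

lemma wdeg_alpha_degree_switch:
  assumes F: "F \<subseteq> edge_group" and i: "i \<in> V" and t: "(B, x) \<in> degree_switches - X"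
  shows "wdeg V (alpha (configuration F (insert (B, x) X) Y)) i = wdeg V (alpha (configuration F X Y)) i
     + 2 * real c * (of_bool (left B x False = i) - of_bool (left B x True = i))"
proof -
  have "degree_effect (\<lambda>e. \<Sum>j\<in>e. of_bool (j = i)) (B, x)
      = 2 * real c * (of_bool (left B x False = i) - of_bool (left B x True = i))"
    using t by (intro degree_effect_vertex_sum) simp
  then show ?thesis
    using wdeg_alpha_configuration_diff[OF F i, of "insert (B, x) X" Y X Y]
    unfolding sum_switch_sign_insert[OF finite_switches(1) t] by (simp only:)
qed

lemma sum_wdeg_alpha_sq_switch:
  assumes F: "F \<subseteq> edge_group" and t: "t \<in> degree_switches - X" and M: "\<bar>twin_wdeg_diff b t\<bar> \<le> M"
  shows "\<bar>(\<Sum>i\<in>V. (wdeg V (alpha (configuration F (insert t X) Y)) i)\<^sup>2)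
     - (\<Sum>i\<in>V. (wdeg V (alpha (configuration F X Y)) i)\<^sup>2)\<bar>
     \<le> 4 * real c * (M + 6 * real c) + 8 * (real c)\<^sup>2"
proof -
  obtain B x where Bx: "t = (B, x)" by (cases t) auto
  have bounds: "B < l" "x < c" using t Bx by (auto simp: degree_switches_def)
  let ?F = "configuration F X Y"
  let ?u = "left B x False" and ?v = "left B x True" and ?d = "wdeg V (alpha ?F)"
  have uv: "?u \<in> V" "?v \<in> V" "?u \<noteq> ?v" using bounds by (simp_all add: vert_mem vert_eq_iff)
  have "(\<Sum>i\<in>V. (wdeg V (alpha (configuration F (insert t X) Y)) i)\<^sup>2)
      = (\<Sum>i\<in>V. (?d i)\<^sup>2 + (if ?u = i then 4 * real c * ?d i + 4 * (real c)\<^sup>2 else 0)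
           + (if ?v = i then - (4 * real c * ?d i) + 4 * (real c)\<^sup>2 else 0))"
  proof (intro sum.cong refl)
    fix i assume i: "i \<in> V"
    show "(wdeg V (alpha (configuration F (insert t X) Y)) i)\<^sup>2
        = (?d i)\<^sup>2 + (if ?u = i then 4 * real c * ?d i + 4 * (real c)\<^sup>2 else 0)
           + (if ?v = i then - (4 * real c * ?d i) + 4 * (real c)\<^sup>2 else 0)"
      unfolding Bx wdeg_alpha_degree_switch[OF F i t[unfolded Bx]]
      using uv(3) by (auto simp: power2_eq_square algebra_simps)
  qed
  also have "\<dots> = (\<Sum>i\<in>V. (?d i)\<^sup>2) + 4 * real c * (?d ?u - ?d ?v) + 8 * (real c)\<^sup>2"
    using uv finite_V by (simp add: sum.distrib algebra_simps)
  finally have diff: "(\<Sum>i\<in>V. (wdeg V (alpha (configuration F (insert t X) Y)) i)\<^sup>2) - (\<Sum>i\<in>V. (?d i)\<^sup>2)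
      = 4 * real c * (?d ?u - ?d ?v) + 8 * (real c)\<^sup>2" by simp
  have "?d ?u - ?d ?v = twin_wdeg_diff b t + (wdeg V (perturbation ?F) ?u - wdeg V (perturbation ?F) ?v)"
    unfolding wdeg_alpha by (simp add: Bx)
  moreover have "\<bar>wdeg V (perturbation ?F) i\<bar> \<le> 3 * real c" for i
    using abs_wdeg_le[OF abs_perturbation_le] wdeg_envelope_le by (rule order_trans)
  from this[of ?u] this[of ?v]
  have "\<bar>wdeg V (perturbation ?F) ?u - wdeg V (perturbation ?F) ?v\<bar> \<le> 6 * real c" by linarith
  ultimately have "\<bar>?d ?u - ?d ?v\<bar> \<le> M + 6 * real c" using M by linarith
  then have "\<bar>4 * real c * (?d ?u - ?d ?v)\<bar> \<le> 4 * real c * (M + 6 * real c)"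
    unfolding abs_mult by (intro mult_mono) auto
  then show ?thesis unfolding diff using zero_le_power2[of "real c"] by linarith
qed

lemma abs_codegree_diff_le:
  "\<bar>(\<Sum>k\<in>V. (alpha F {u, k} - alpha F {u', k}) * (alpha F {v, k} - alpha F {v', k}))
     - (\<Sum>k\<in>V. (b {u, k} - b {u', k}) * (b {v, k} - b {v', k}))\<bar> \<le> 24 * real c"
proof -
  let ?env = "\<lambda>k. 2 * envelope {u, k} + 2 * envelope {u', k} + 2 * envelope {v, k} + 2 * envelope {v', k}"
  have "\<bar>(alpha F {u, k} - alpha F {u', k}) * (alpha F {v, k} - alpha F {v', k})
      - (b {u, k} - b {u', k}) * (b {v, k} - b {v', k})\<bar> \<le> ?env k" for k
  proof -
    define z w Z W where "z = b {u, k} - b {u', k}" and "w = b {v, k} - b {v', k}"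
      and "Z = alpha F {u, k} - alpha F {u', k}" and "W = alpha F {v, k} - alpha F {v', k}"
    have "\<bar>Z - z\<bar> \<le> envelope {u, k} + envelope {u', k}" "\<bar>W - w\<bar> \<le> envelope {v, k} + envelope {v', k}"
      using abs_perturbation_le[of F "{u, k}"] abs_perturbation_le[of F "{u', k}"]
        abs_perturbation_le[of F "{v, k}"] abs_perturbation_le[of F "{v', k}"]
      by (simp_all add: z_def w_def Z_def W_def alpha_def)
    moreover have "\<bar>W\<bar> \<le> 2" using abs_alpha_le[of F "{v, k}"] abs_alpha_le[of F "{v', k}"] by (simp add: W_def)
    moreover have "\<bar>z\<bar> \<le> 2" using abs_noise_le_1[of "{u, k}"] abs_noise_le_1[of "{u', k}"] by (simp add: z_def)
    ultimately have products: "\<bar>Z - z\<bar> * \<bar>W\<bar> \<le> (envelope {u, k} + envelope {u', k}) * 2"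
      "\<bar>z\<bar> * \<bar>W - w\<bar> \<le> 2 * (envelope {v, k} + envelope {v', k})"
      by (intro mult_mono; simp add: envelope_01)+
    have "Z * W - z * w = (Z - z) * W + z * (W - w)" by (simp add: algebra_simps)
    then have "\<bar>Z * W - z * w\<bar> \<le> \<bar>Z - z\<bar> * \<bar>W\<bar> + \<bar>z\<bar> * \<bar>W - w\<bar>" by (metis abs_mult abs_triangle_ineq)
    from order_trans[OF this add_mono[OF products]] have "\<bar>Z * W - z * w\<bar> \<le> ?env k" by simp
    then show ?thesis unfolding z_def w_def Z_def W_def .
  qed
  then have "\<bar>(\<Sum>k\<in>V. (alpha F {u, k} - alpha F {u', k}) * (alpha F {v, k} - alpha F {v', k}))
      - (\<Sum>k\<in>V. (b {u, k} - b {u', k}) * (b {v, k} - b {v', k}))\<bar> \<le> (\<Sum>k\<in>V. ?env k)"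
    unfolding sum_subtractf[symmetric] by (intro order_trans[OF sum_abs] sum_mono)
  also have "\<dots> =
    2 * wdeg V envelope u + 2 * wdeg V envelope u' + 2 * wdeg V envelope v + 2 * wdeg V envelope v'"
    by (simp add: wdeg_def sum.distrib sum_distrib_left)
  also have "\<dots> \<le> 24 * real c"
    using wdeg_envelope_le[of u] wdeg_envelope_le[of u'] wdeg_envelope_le[of v] wdeg_envelope_le[of v']
    by linarith
  finally show ?thesis .
qed

lemma sum_wdeg_triangle_switch_sq_le:
  fixes X
  assumes F: "F \<subseteq> edge_group" and t: "t \<in> triangle_switches - Y"
  defines "\<xi> \<equiv> \<lambda>e. of_bool (e \<in> configuration F X (insert t Y)) - of_bool (e \<in> configuration F X Y) :: real"
  shows "(\<Sum>j\<in>V. (wdeg V (\<lambda>e. \<bar>\<xi> e\<bar>) j)\<^sup>2) \<le> 64"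
proof -
  let ?w = "wdeg V (\<lambda>e. \<bar>\<xi> e\<bar>)"
  have "\<xi> {j} = 0" for j
    using configuration_Int(1)[OF F, of X Y] configuration_Int(1)[OF F, of X "insert t Y"]
      singleton_notin(2)[of j]
    by (auto simp: \<xi>_def)
  then have "(\<Sum>j\<in>V. ?w j) = 2 * (\<Sum>e\<in>[V]\<^bsup>2\<^esup>. \<bar>\<xi> e\<bar>)" by (intro sum_wdeg finite_V) simp
  also have "(\<Sum>e\<in>[V]\<^bsup>2\<^esup>. \<bar>\<xi> e\<bar>) = (\<Sum>e\<in>[V]\<^bsup>2\<^esup>. \<xi> e * sgn (\<xi> e))" by (simp add: abs_sgn)
  also have "\<dots> = triangle_effect (\<lambda>e. sgn (\<xi> e)) t"
    unfolding \<xi>_def by (rule sum_triangle_switch[OF F t])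
  also have "\<dots> \<le> 4"
  proof -
    have "-1 \<le> sgn z" "sgn z \<le> 1" for z :: real by (simp_all add: sgn_if)
    then show ?thesis by (cases t) (smt (verit) triangle_effect.simps)
  qed
  finally have total: "(\<Sum>j\<in>V. ?w j) \<le> 8" by simp
  have nonneg: "0 \<le> ?w j" for j unfolding wdeg_def by (intro sum_nonneg) auto
  have "(\<Sum>j\<in>V. (?w j)\<^sup>2) \<le> (\<Sum>j\<in>V. 8 * ?w j)"
  proof (rule sum_mono)
    fix j assume "j \<in> V"
    then have "?w j \<le> 8" using member_le_sum[of j V ?w] nonneg finite_V total by (meson order_trans)
    then show "(?w j)\<^sup>2 \<le> 8 * ?w j" unfolding power2_eq_square using nonneg by (rule mult_right_mono)
  qed
  also have "\<dots> \<le> 64" unfolding sum_distrib_left[symmetric] using total by simp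
  finally show ?thesis .
qed

lemma triangle_sum_alpha_switch:
  fixes X
  assumes F: "F \<subseteq> edge_group" and t: "t \<in> triangle_switches - Y" and M: "\<bar>twin_codegree_diff b t\<bar> \<le> M"
  defines "G \<equiv> configuration F X Y" and "G' \<equiv> configuration F X (insert t Y)"
  shows "\<bar>triangle_sum V (alpha G') (alpha G') (alpha G') - triangle_sum V (alpha G) (alpha G) (alpha G)\<bar>
     \<le> 6 * (M + 24 * real c) + 256"
proof -
  define \<xi> :: "'a set \<Rightarrow> real" where "\<xi> = (\<lambda>e. of_bool (e \<in> G') - of_bool (e \<in> G))"
  have sub: "G \<subseteq> reserved" "G' \<subseteq> reserved" using configuration_Int(1)[OF F] by (auto simp: G_def G'_def)
  have alpha_G': "alpha G' = (\<lambda>e. alpha G e + \<xi> e)" unfolding \<xi>_def by (rule ext) (rule alpha_diff[OF sub])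
  have "\<bar>\<xi> e\<bar> \<le> 1" for e by (auto simp: \<xi>_def of_bool_def)
  then have "\<bar>triangle_sum V (alpha G') (alpha G') (alpha G') - triangle_sum V (alpha G) (alpha G) (alpha G)
      - 3 * triangle_sum V \<xi> (alpha G) (alpha G)\<bar> \<le> 4 * (\<Sum>j\<in>V. (wdeg V (\<lambda>e. \<bar>\<xi> e\<bar>) j)\<^sup>2)"
    unfolding alpha_G' by (intro triangle_sum_perturb abs_alpha_le order_refl)
  also have "\<dots> \<le> 256"
    using sum_wdeg_triangle_switch_sq_le[OF F t, of X] by (simp add: \<xi>_def G_def G'_def)
  finally have second_order: "\<bar>triangle_sum V (alpha G') (alpha G') (alpha G')
      - triangle_sum V (alpha G) (alpha G) (alpha G) - 3 * triangle_sum V \<xi> (alpha G) (alpha G)\<bar> \<le> 256" .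
  have "\<xi> {j} = 0" for j using sub singleton_notin(2)[of j] by (auto simp: \<xi>_def)
  then have "triangle_sum V \<xi> (alpha G) (alpha G) = 2 * (\<Sum>e\<in>[V]\<^bsup>2\<^esup>. \<xi> e * codegree V (alpha G) e)"
    by (rule triangle_sum_eq_sum_codegree[OF finite_V])
  also have "\<dots> = 2 * twin_codegree_diff (alpha G) t"
    using sum_triangle_switch[OF F t, of X] t unfolding \<xi>_def G_def G'_def
    by (simp add: triangle_effect_codegree)
  finally have "triangle_sum V \<xi> (alpha G) (alpha G) = 2 * twin_codegree_diff (alpha G) t" .
  moreover have "\<bar>twin_codegree_diff (alpha G) t - twin_codegree_diff b t\<bar> \<le> 24 * real c"
    by (cases t) (simp add: abs_codegree_diff_le)
  ultimately show ?thesis using second_order M unfolding distrib_left by linarith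
qed

end

lemma ex_subset_abs_le_step:
  fixes f :: "'b set \<Rightarrow> real"
  assumes T: "finite T" and step: "\<And>X t. X \<subseteq> T \<Longrightarrow> t \<in> T - X \<Longrightarrow> \<bar>f (insert t X) - f X\<bar> \<le> \<eta>"
    and "A \<subseteq> T" "B \<subseteq> T" "f A \<le> 0" "0 \<le> f B" "0 \<le> \<eta>"
  shows "\<exists>X\<subseteq>T. \<bar>f X\<bar> \<le> \<eta>"
  using assms(3-)
proof (induction "card ((A - B) \<union> (B - A))" arbitrary: A rule: less_induct)
  case less
  show ?case
  proof (cases "A = B")
    case True
    then show ?thesis using less.prems by (intro exI[of _ A]) auto
  next
    case False
    then obtain t where t: "t \<in> (A - B) \<union> (B - A)" by auto
    define A' where "A' = (if t \<in> A then A - {t} else insert t A)"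
    have A': "A' \<subseteq> T" using t less.prems by (auto simp: A'_def)
    have close: "\<bar>f A' - f A\<bar> \<le> \<eta>"
    proof (cases "t \<in> A")
      case True
      have "\<bar>f (insert t (A - {t})) - f (A - {t})\<bar> \<le> \<eta>" using True less.prems by (intro step) auto
      then show ?thesis using True by (simp add: A'_def insert_absorb abs_minus_commute)
    next
      case False
      then show ?thesis using t less.prems step[of A t] by (auto simp: A'_def)
    qed
    have "(A' - B) \<union> (B - A') = ((A - B) \<union> (B - A)) - {t}" using t by (auto simp: A'_def)
    moreover have "finite ((A - B) \<union> (B - A))" using less.prems T by (auto intro: finite_subset)
    ultimately have smaller: "card ((A' - B) \<union> (B - A')) < card ((A - B) \<union> (B - A))"
      using t by (metis card_Diff1_less)
    show ?thesis
    proof (cases "f A' \<le> 0")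
      case True
      then show ?thesis using less.hyps[OF smaller A'] less.prems by auto
    next
      case False
      then have "\<bar>f A\<bar> \<le> \<eta>" using close less.prems by linarith
      then show ?thesis using less.prems by auto
    qed
  qed
qed

context gadget_noise
begin

lemma sum_switch_sign_extremal:
  "(\<Sum>t\<in>T. switch_sign {t \<in> T. 0 \<le> f t} t * f t) = (\<Sum>t\<in>T. \<bar>f t\<bar>)"
  "(\<Sum>t\<in>T. switch_sign {t \<in> T. f t \<le> 0} t * f t) = - (\<Sum>t\<in>T. \<bar>f t\<bar>)"
  unfolding sum_negf[symmetric] by (intro sum.cong refl; auto simp: switch_sign_def)+

lemma ex_degree_switches:
  assumes F: "F \<subseteq> edge_group" and M: "\<And>t. t \<in> degree_switches \<Longrightarrow> \<bar>twin_wdeg_diff b t\<bar> \<le> M" "0 \<le> M"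
    and capacity: "degree_error \<le> 2 * real c * (\<Sum>t\<in>degree_switches. \<bar>twin_wdeg_diff b t\<bar>)"
  shows "\<exists>X\<subseteq>degree_switches.
     \<bar>(\<Sum>i\<in>V. (wdeg V (alpha (configuration F X Y)) i)\<^sup>2) - p * (1 - p) * real (card V) * (real (card V) - 1)\<bar>
       \<le> 4 * real c * (M + 6 * real c) + 8 * (real c)\<^sup>2"
proof (rule ex_subset_abs_le_step[OF finite_switches(1)])
  let ?f = "\<lambda>X. (\<Sum>i\<in>V. (wdeg V (alpha (configuration F X Y)) i)\<^sup>2)
    - p * (1 - p) * real (card V) * (real (card V) - 1)"
  show "\<bar>?f (insert t X) - ?f X\<bar> \<le> 4 * real c * (M + 6 * real c) + 8 * (real c)\<^sup>2"
    if "X \<subseteq> degree_switches" "t \<in> degree_switches - X" for X t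
    using sum_wdeg_alpha_sq_switch[OF F that(2) M(1), of Y] that by simp
  show "?f {t \<in> degree_switches. twin_wdeg_diff b t \<le> 0} \<le> 0"
    using sum_wdeg_alpha_sq_close[OF F, of "{t \<in> degree_switches. twin_wdeg_diff b t \<le> 0}" Y] capacity
    unfolding sum_switch_sign_extremal by linarith
  show "0 \<le> ?f {t \<in> degree_switches. 0 \<le> twin_wdeg_diff b t}"
    using sum_wdeg_alpha_sq_close[OF F, of "{t \<in> degree_switches. 0 \<le> twin_wdeg_diff b t}" Y] capacity
    unfolding sum_switch_sign_extremal by linarith
qed (use M(2) in auto)

lemma ex_triangle_switches:
  assumes F: "F \<subseteq> edge_group" and M: "\<And>t. t \<in> triangle_switches \<Longrightarrow> \<bar>twin_codegree_diff b t\<bar> \<le> M" "0 \<le> M"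
    and capacity: "triangle_error \<le> 3 * (\<Sum>t\<in>triangle_switches. \<bar>twin_codegree_diff b t\<bar>)"
  shows "\<exists>Y\<subseteq>triangle_switches. \<bar>triangle_sum V (alpha (configuration F X Y)) (alpha (configuration F X Y))
       (alpha (configuration F X Y))\<bar> \<le> 6 * (M + 24 * real c) + 256"
proof (rule ex_subset_abs_le_step[OF finite_switches(2)])
  let ?\<alpha> = "\<lambda>Y. alpha (configuration F X Y)"
  let ?f = "\<lambda>Y. triangle_sum V (?\<alpha> Y) (?\<alpha> Y) (?\<alpha> Y)"
  show "\<bar>?f (insert t Y) - ?f Y\<bar> \<le> 6 * (M + 24 * real c) + 256"
    if "Y \<subseteq> triangle_switches" "t \<in> triangle_switches - Y" for Y t
    using triangle_sum_alpha_switch[OF F that(2) M(1), of X] that by simp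
  show "?f {t \<in> triangle_switches. twin_codegree_diff b t \<le> 0} \<le> 0"
    using triangle_sum_alpha_close[OF F, of X "{t \<in> triangle_switches. twin_codegree_diff b t \<le> 0}"] capacity
    unfolding sum_switch_sign_extremal by linarith
  show "0 \<le> ?f {t \<in> triangle_switches. 0 \<le> twin_codegree_diff b t}"
    using triangle_sum_alpha_close[OF F, of X "{t \<in> triangle_switches. 0 \<le> twin_codegree_diff b t}"] capacity
    unfolding sum_switch_sign_extremal by linarith
qed (use M(2) in auto)

text \<open>Triangle switches preserve all degrees, so they can be chosen after the degree switches.\<close>

lemma ex_configuration:
  assumes m: "m \<le> card edge_group" and "0 \<le> M" "0 \<le> M'"
    and "\<And>t. t \<in> degree_switches \<Longrightarrow> \<bar>twin_wdeg_diff b t\<bar> \<le> M"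
    and "\<And>t. t \<in> triangle_switches \<Longrightarrow> \<bar>twin_codegree_diff b t\<bar> \<le> M'"
    and "degree_error \<le> 2 * real c * (\<Sum>t\<in>degree_switches. \<bar>twin_wdeg_diff b t\<bar>)"
    and "triangle_error \<le> 3 * (\<Sum>t\<in>triangle_switches. \<bar>twin_codegree_diff b t\<bar>)"
  obtains F where "F \<subseteq> reserved" "real (card F) = real m + 2 * (real c)\<^sup>2 * real l2 + 2 * (real c)\<^sup>2 * real l3"
    "\<bar>(\<Sum>i\<in>V. (wdeg V (alpha F) i)\<^sup>2) - p * (1 - p) * real (card V) * (real (card V) - 1)\<bar>
       \<le> 4 * real c * (M + 6 * real c) + 8 * (real c)\<^sup>2"
    "\<bar>triangle_sum V (alpha F) (alpha F) (alpha F)\<bar> \<le> 6 * (M' + 24 * real c) + 256"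
proof -
  obtain F where F: "F \<subseteq> edge_group" "card F = m" using m obtain_subset_with_card_n by metis
  obtain X where X: "\<bar>(\<Sum>i\<in>V. (wdeg V (alpha (configuration F X {})) i)\<^sup>2)
      - p * (1 - p) * real (card V) * (real (card V) - 1)\<bar> \<le> 4 * real c * (M + 6 * real c) + 8 * (real c)\<^sup>2"
    using ex_degree_switches[OF F(1), of M "{}"] assms by blast
  obtain Y where Y: "\<bar>triangle_sum V (alpha (configuration F X Y)) (alpha (configuration F X Y))
      (alpha (configuration F X Y))\<bar> \<le> 6 * (M' + 24 * real c) + 256"
    using ex_triangle_switches[OF F(1), of M' X] assms by blast
  have "(\<Sum>i\<in>V. (wdeg V (alpha (configuration F X Y)) i)\<^sup>2)
    = (\<Sum>i\<in>V. (wdeg V (alpha (configuration F X {})) i)\<^sup>2)"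
    using wdeg_alpha_triangle_config[OF F(1), of _ X Y "{}"] by (intro sum.cong) auto
  then show ?thesis
    using that[of "configuration F X Y"] X Y configuration_Int(1)[OF F(1)] card_configuration[OF F(1)] F(2)
    by simp
qed

end

section \<open>Second moments of degrees, codegrees and triangles\<close>

definition star :: "'a \<Rightarrow> 'a set \<Rightarrow> 'a set set" where
  "star k e = (\<lambda>i. {i, k}) ` e"

lemma inj_on_doubleton: "inj_on (\<lambda>i. {i, k}) e"
  by (auto simp: inj_on_def doubleton_eq_iff)

lemma star_eq_imp_eq:
  assumes "card e = 2" "card e' = 2" "k \<notin> e" "k' \<notin> e'" "star k e = star k' e'"
  shows "e = e' \<and> k = k'"
proof -
  obtain i j i' j' where e: "e = {i, j}" "i \<noteq> j" "e' = {i', j'}" "i' \<noteq> j'"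
    using assms(1,2) by (auto simp: card_2_iff)
  have "{{i, k}, {j, k}} = {{i', k'}, {j', k'}}" using assms(5) e by (simp add: star_def)
  then show ?thesis using e assms(3,4) by (auto simp: doubleton_eq_iff)
qed

lemma finite_star: "finite e \<Longrightarrow> finite (star k e)"
  by (simp add: star_def)

lemma card_star: "card (star k e) = card e"
  unfolding star_def by (rule card_image[OF inj_on_doubleton])

lemma notin_star: "k \<notin> e \<Longrightarrow> e \<notin> star k e"
  by (auto simp: star_def)

lemma Union_star: "e \<noteq> {} \<Longrightarrow> \<Union>(star k e) = insert k e"
  by (auto simp: star_def)

lemma star_disjoint:
  "k \<notin> A \<union> A' \<Longrightarrow> k' \<notin> A \<union> A' \<Longrightarrow> k \<noteq> k' \<or> A \<inter> A' = {} \<Longrightarrow> star k A \<inter> star k' A' = {}"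
  by (auto simp: star_def doubleton_eq_iff)

lemma codegree_eq_sum_star:
  assumes V: "finite V" and e: "e \<in> [V]\<^bsup>2\<^esup>" and b: "\<And>i. b {i} = 0"
  shows "codegree V b e = (\<Sum>k\<in>V - e. \<Prod>f\<in>star k e. b f)"
proof -
  have fin: "finite e" using e by (simp add: nsets_def)
  have "codegree V b e = (\<Sum>k\<in>V - e. \<Prod>i\<in>e. b {i, k})"
    unfolding codegree_def
  proof (intro sum.mono_neutral_right)
    show "\<forall>k\<in>V - (V - e). (\<Prod>i\<in>e. b {i, k}) = 0"
      using b fin by (force intro!: prod_zero)
  qed (use V in auto)
  then show ?thesis unfolding star_def prod.reindex[OF inj_on_doubleton] by simp
qed

lemma card_same_triangle_le:
  assumes e: "e \<in> [V]\<^bsup>2\<^esup>" "k \<notin> e"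
  shows "card {\<psi> \<in> (SIGMA e:[V]\<^bsup>2\<^esup>. V - e).
      (case \<psi> of (e', k') \<Rightarrow> insert e' (star k' e')) = insert e (star k e)} \<le> 3" (is "card ?A \<le> 3")
proof -
  have pair: "card e = 2" "finite e" using e by (auto simp: nsets_def)
  have union: "\<Union>(insert e (star k e)) = insert k e" if "e \<in> [V]\<^bsup>2\<^esup>" for e k
  proof -
    have "e \<noteq> {}" using that by (auto simp: nsets_def)
    then show ?thesis using Union_star[of e k] by auto
  qed
  have "?A \<subseteq> (\<lambda>k'. (insert k e - {k'}, k')) ` insert k e"
  proof
    fix \<psi> assume "\<psi> \<in> ?A"
    then obtain e' k' where \<psi>: "\<psi> = (e', k')" "e' \<in> [V]\<^bsup>2\<^esup>" "k' \<notin> e'"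
      "insert e' (star k' e') = insert e (star k e)" by auto
    then have "insert k' e' = insert k e" using union[OF \<psi>(2), of k'] union[OF e(1), of k] by simp
    then show "\<psi> \<in> (\<lambda>k'. (insert k e - {k'}, k')) ` insert k e"
      using \<psi>(1,3) by (intro image_eqI[of _ _ k']) auto
  qed
  then have "card ?A \<le> card (insert k e)"
    using pair(2) by (meson card_image_le card_mono finite_imageI finite_insert order_trans)
  then show ?thesis using e(2) pair by simp
qed

context bernoulli_graph
begin

lemma second_moment_linear_le:
  assumes "finite A"
  shows "E (\<lambda>S. (\<Sum>e\<in>A. w e * noise S e)\<^sup>2) \<le> var * (\<Sum>e\<in>A. (w e)\<^sup>2)"
proof -
  have "E (\<lambda>S. (\<Sum>e\<in>A. w e * (\<Prod>e'\<in>{e}. noise S e'))\<^sup>2) \<le> 1 * var ^ 1 * (\<Sum>e\<in>A. (w e)\<^sup>2)"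
  proof (rule second_moment_le[OF assms])
    fix e assume "e \<in> A"
    then have "{e' \<in> A. {e'} = {e}} = {e}" by auto
    then show "real (card {e' \<in> A. {e'} = {e}}) \<le> 1" by simp
  qed simp
  then show ?thesis by simp
qed

lemma second_moment_wdeg_le:
  assumes V: "finite V" and P: "\<And>i. {i} \<notin> P"
  shows "E (\<lambda>S. (\<Sum>i\<in>V. wdeg V (noise S) i * w i)\<^sup>2) \<le> 2 * var * real (card V) * (\<Sum>i\<in>V. (w i)\<^sup>2)"
proof -
  have "noise S {i} = 0" for S i using P by (simp add: noise_def)
  from sum_wdeg_mult[where r = "noise S" for S, OF V this]
  have "E (\<lambda>S. (\<Sum>i\<in>V. wdeg V (noise S) i * w i)\<^sup>2) = E (\<lambda>S. (\<Sum>e\<in>[V]\<^bsup>2\<^esup>. (\<Sum>i\<in>e. w i) * noise S e)\<^sup>2)"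
    by (simp add: mult.commute)
  also have "\<dots> \<le> var * (\<Sum>e\<in>[V]\<^bsup>2\<^esup>. (\<Sum>i\<in>e. w i)\<^sup>2)"
    by (rule second_moment_linear_le[OF finite_imp_finite_nsets[OF V]])
  also have "\<dots> \<le> var * (\<Sum>e\<in>[V]\<^bsup>2\<^esup>. \<Sum>i\<in>e. 2 * (w i)\<^sup>2)"
  proof (intro mult_left_mono sum_mono var_nonneg)
    fix e assume "e \<in> [V]\<^bsup>2\<^esup>"
    then obtain i j where "e = {i, j}" "i \<noteq> j" by (auto simp: nsets_def card_2_iff)
    then show "(\<Sum>i\<in>e. w i)\<^sup>2 \<le> (\<Sum>i\<in>e. 2 * (w i)\<^sup>2)"
      using sum_squares_bound[of "w i" "w j"] by (simp add: power2_sum)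
  qed
  also have "\<dots> = 2 * var * (real (card V) - 1) * (\<Sum>i\<in>V. (w i)\<^sup>2)"
    unfolding sum_pairs_sum[OF V] by (simp add: sum_distrib_left[symmetric])
  also have "\<dots> \<le> 2 * var * real (card V) * (\<Sum>i\<in>V. (w i)\<^sup>2)"
    using var_nonneg by (intro mult_right_mono mult_left_mono sum_nonneg) auto
  finally show ?thesis .
qed

lemma card_pairs_with_apex_le:
  assumes "finite V" "A \<subseteq> [V]\<^bsup>2\<^esup>"
  shows "real (card (SIGMA e:A. V - e)) \<le> real (card A) * real (card V)"
proof -
  have "finite A" using assms finite_imp_finite_nsets finite_subset by blast
  then have "card (SIGMA e:A. V - e) = (\<Sum>e\<in>A. card (V - e))" using assms(1) by (intro card_SigmaI) auto
  also have "\<dots> \<le> (\<Sum>e\<in>A. card V)" using assms(1) by (intro sum_mono card_mono) auto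
  finally show ?thesis by (simp flip: of_nat_mult)
qed

lemma second_moment_codegree_le:
  assumes V: "finite V" and P: "\<And>i. {i} \<notin> P" and A: "A \<subseteq> [V]\<^bsup>2\<^esup>"
  shows "E (\<lambda>S. (\<Sum>e\<in>A. codegree V (noise S) e)\<^sup>2) \<le> var\<^sup>2 * (real (card A) * real (card V))"
proof -
  let ?\<Phi> = "SIGMA e:A. V - e" and ?T = "\<lambda>(e, k). star k e"
  have pair: "card e = 2" if "e \<in> A" for e using A that by (auto simp: nsets_def)
  have finite_A: "finite A" using A finite_imp_finite_nsets[OF V] by (rule finite_subset)
  have "(\<Sum>e\<in>A. codegree V (noise S) e) = (\<Sum>e\<in>A. \<Sum>k\<in>V - e. \<Prod>f\<in>star k e. noise S f)" for S
    using A P by (intro sum.cong refl codegree_eq_sum_star[OF V]) (auto simp: noise_def)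
  then have "(\<Sum>e\<in>A. codegree V (noise S) e) = (\<Sum>\<phi>\<in>?\<Phi>. 1 * (\<Prod>f\<in>?T \<phi>. noise S f))" for S
    using finite_A V by (simp add: sum.Sigma case_prod_unfold)
  then have "E (\<lambda>S. (\<Sum>e\<in>A. codegree V (noise S) e)\<^sup>2) = E (\<lambda>S. (\<Sum>\<phi>\<in>?\<Phi>. 1 * (\<Prod>f\<in>?T \<phi>. noise S f))\<^sup>2)"
    by (simp only:)
  also have "\<dots> \<le> 1 * var\<^sup>2 * (\<Sum>\<phi>\<in>?\<Phi>. 1\<^sup>2)"
  proof (rule second_moment_le)
    show "finite ?\<Phi>" using finite_A V by auto
    fix \<phi> assume \<phi>: "\<phi> \<in> ?\<Phi>"
    then show "finite (?T \<phi>) \<and> card (?T \<phi>) = 2"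
      using finite_star pair by (auto simp: card_star card_ge_0_finite)
    have "{\<psi> \<in> ?\<Phi>. ?T \<psi> = ?T \<phi>} \<subseteq> {\<phi>}" using star_eq_imp_eq pair \<phi> by fastforce
    then show "real (card {\<psi> \<in> ?\<Phi>. ?T \<psi> = ?T \<phi>}) \<le> 1" using card_mono[of "{\<phi>}"] by fastforce
  qed
  also have "\<dots> \<le> var\<^sup>2 * (real (card A) * real (card V))"
    using card_pairs_with_apex_le[OF V A] by (simp add: mult_left_mono)
  finally show ?thesis .
qed

lemma E_abs_codegree_le:
  assumes "finite V" "\<And>i. {i} \<notin> P" "e \<in> [V]\<^bsup>2\<^esup>"
  shows "E (\<lambda>S. \<bar>codegree V (noise S) e\<bar>) \<le> var * sqrt (real (card V))"
proof (rule E_abs_le)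
  show "E (\<lambda>S. (codegree V (noise S) e)\<^sup>2) \<le> (var * sqrt (real (card V)))\<^sup>2"
    using second_moment_codegree_le[OF assms(1,2), of "{e}"] assms(3) by (simp add: power_mult_distrib)
qed (use var_nonneg in simp)

lemma E_abs_pair_wdeg_le:
  assumes V: "finite V" and P: "\<And>i. {i} \<notin> P" and e: "e \<in> [V]\<^bsup>2\<^esup>"
  shows "E (\<lambda>S. \<bar>pair_wdeg V (noise S) e\<bar>) \<le> 2 * sqrt (var * real (card V))"
proof (rule E_abs_le)
  have e': "e \<subseteq> V" "card e = 2" "finite e" using e by (auto simp: nsets_def)
  have "pair_wdeg V (noise S) e = (\<Sum>i\<in>V. wdeg V (noise S) i * of_bool (i \<in> e))" for S
    unfolding pair_wdeg_def using e' V by (intro sum.mono_neutral_cong_left) auto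
  moreover have "(\<Sum>i\<in>V. (of_bool (i \<in> e) :: real)\<^sup>2) = (\<Sum>i\<in>e. 1)"
    using e' V by (intro sum.mono_neutral_cong_right) auto
  ultimately show "E (\<lambda>S. (pair_wdeg V (noise S) e)\<^sup>2) \<le> (2 * sqrt (var * real (card V)))\<^sup>2"
    using second_moment_wdeg_le[OF V P, of "\<lambda>i. of_bool (i \<in> e)"] e'(2) var_nonneg
    by (simp add: power_mult_distrib)
qed (use var_nonneg in simp)

lemma second_moment_triangle_sum_le:
  assumes V: "finite V" and P: "\<And>i. {i} \<notin> P"
  shows "E (\<lambda>S. (triangle_sum V (noise S) (noise S) (noise S))\<^sup>2) \<le> 6 * var ^ 3 * real (card V) ^ 3"
proof -
  let ?\<Phi> = "SIGMA e:[V]\<^bsup>2\<^esup>. V - e" and ?T = "\<lambda>(e, k). insert e (star k e)"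
  have fin: "finite ([V]\<^bsup>2\<^esup>)" "finite ?\<Phi>" using finite_imp_finite_nsets[OF V] V by auto
  have outside: "noise S {i} = 0" for S i using P by (simp add: noise_def)
  have pair: "card e = 2" "finite e" if "e \<in> [V]\<^bsup>2\<^esup>" for e using that by (auto simp: nsets_def)
  have "triangle_sum V (noise S) (noise S) (noise S) = (\<Sum>\<phi>\<in>?\<Phi>. 2 * (\<Prod>f\<in>?T \<phi>. noise S f))" for S
  proof -
    have "triangle_sum V (noise S) (noise S) (noise S)
        = 2 * (\<Sum>e\<in>[V]\<^bsup>2\<^esup>. noise S e * (\<Sum>k\<in>V - e. \<Prod>f\<in>star k e. noise S f))"
      using triangle_sum_eq_sum_codegree[where r = "noise S", OF V outside]
        codegree_eq_sum_star[where b = "noise S", OF V _ outside] by simp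
    also have "\<dots> = (\<Sum>e\<in>[V]\<^bsup>2\<^esup>. \<Sum>k\<in>V - e. 2 * (\<Prod>f\<in>insert e (star k e). noise S f))"
      unfolding sum_distrib_left
    proof (intro sum.cong refl)
      fix e k assume "e \<in> [V]\<^bsup>2\<^esup>" "k \<in> V - e"
      then show "2 * (noise S e * (\<Prod>f\<in>star k e. noise S f)) = 2 * (\<Prod>f\<in>insert e (star k e). noise S f)"
        using pair(2) by (simp add: finite_star notin_star)
    qed
    finally show ?thesis using fin V by (simp add: sum.Sigma case_prod_unfold)
  qed
  then have "E (\<lambda>S. (triangle_sum V (noise S) (noise S) (noise S))\<^sup>2)
      = E (\<lambda>S. (\<Sum>\<phi>\<in>?\<Phi>. 2 * (\<Prod>f\<in>?T \<phi>. noise S f))\<^sup>2)" by (simp only:)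
  also have "\<dots> \<le> 3 * var ^ 3 * (\<Sum>\<phi>\<in>?\<Phi>. 2\<^sup>2)"
  proof (rule second_moment_le[OF fin(2)])
    fix \<phi> assume "\<phi> \<in> ?\<Phi>"
    then obtain e k where \<phi>: "\<phi> = (e, k)" "e \<in> [V]\<^bsup>2\<^esup>" "k \<notin> e" by auto
    then show "finite (?T \<phi>) \<and> card (?T \<phi>) = 3"
      using pair notin_star[OF \<phi>(3)] by (simp add: finite_star card_star)
    show "real (card {\<psi> \<in> ?\<Phi>. ?T \<psi> = ?T \<phi>}) \<le> 3"
      using card_same_triangle_le[OF \<phi>(2,3)] unfolding \<phi>(1) by simp
  qed
  also have "\<dots> = 12 * var ^ 3 * real (card ?\<Phi>)" by simp
  also have "real (card ?\<Phi>) \<le> real (card V) * (real (card V) - 1) / 2 * real (card V)"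
    using card_pairs_with_apex_le[OF V order_refl] V by (simp add: card_nsets real_choose_two)
  also have "\<dots> \<le> real (card V) ^ 3 / 2"
    by (simp add: power3_eq_cube mult_left_mono mult_right_mono)
  finally show ?thesis using var_nonneg by (simp add: mult_right_mono mult_ac)
qed

end

section \<open>Concentration of local statistics\<close>

lemma half_le_of_ratio_close:
  assumes "(y / e - 1)\<^sup>2 \<le> 1 / 4" "0 < e" shows "e / 2 \<le> (y :: real)"
proof -
  have "(y / e - 1)\<^sup>2 \<le> (1 / 2)\<^sup>2" using assms(1) by (simp add: power2_eq_square)
  then have "\<bar>y / e - 1\<bar> \<le> 1 / 2" by (simp only: power2_le_iff_abs_le)
  then have "1 / 2 * e \<le> y / e * e" using assms(2) by (intro mult_right_mono) linarith+
  then show ?thesis using assms(2) by simp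
qed

lemma sqrt_ge_of_half_sq_le:
  assumes "w\<^sup>2 / 2 \<le> m" shows "7 / 10 * w \<le> sqrt m"
proof (rule real_le_rsqrt)
  have "(7 / 10 * w)\<^sup>2 = 49 / 100 * w\<^sup>2" by (simp add: power2_eq_square)
  then show "(7 / 10 * w)\<^sup>2 \<le> m" using assms zero_le_power2[of w] by linarith
qed

text \<open>The statistic of \<open>t\<close> is a sum over the vertices \<open>k\<close> of terms depending only on the pairs that join
  \<open>k\<close> to the bounded set \<open>Q t\<close>, so statistics with disjoint such sets are almost independent.\<close>

locale local_statistics = bernoulli_graph P \<pi> for P :: "'a set set" and \<pi> +
  fixes V :: "'a set" and Q :: "'t \<Rightarrow> 'a set" and f :: "'t \<Rightarrow> 'a \<Rightarrow> 'a set set \<Rightarrow> real" and T :: "'t set"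
    and m :: real and N :: nat
  assumes finite_V: "finite V" and finite_T: "finite T"
    and depends: "\<And>t k. t \<in> T \<Longrightarrow> depends_on (f t k) (star k (Q t))"
    and bounded: "\<And>t k S. t \<in> T \<Longrightarrow> \<bar>f t k S\<bar> \<le> 1" and mean: "\<And>t k. t \<in> T \<Longrightarrow> E (f t k) = 0"
    and finite_Q: "\<And>t. t \<in> T \<Longrightarrow> finite (Q t)" and card_Q: "\<And>t. t \<in> T \<Longrightarrow> card (Q t) \<le> 4"
    and variance_ge: "\<And>t. t \<in> T \<Longrightarrow> m \<le> (\<Sum>k\<in>V - Q t. E (\<lambda>S. (f t k S)\<^sup>2))"
    and variance_le: "\<And>t. t \<in> T \<Longrightarrow> (\<Sum>k\<in>V - Q t. E (\<lambda>S. (f t k S)\<^sup>2)) \<le> 2 * m"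
    and card_near: "\<And>t. t \<in> T \<Longrightarrow> card {t' \<in> T. Q t \<inter> Q t' \<noteq> {}} \<le> N"
    and m_large: "10 ^ 8 \<le> m" and T_large: "10000 * N \<le> card T" and T_nonempty: "T \<noteq> {}"
begin

definition statistic :: "'t \<Rightarrow> 'a set set \<Rightarrow> real" where
  "statistic t S = (\<Sum>k\<in>V - Q t. f t k S)"

abbreviation \<mu> :: real where "\<mu> \<equiv> 3 / 8 * sqrt m"

lemma statistic_moments:
  assumes t: "t \<in> T"
  shows "E (\<lambda>S. (statistic t S)\<^sup>2) = (\<Sum>k\<in>V - Q t. E (\<lambda>S. (f t k S)\<^sup>2))"
    and "E (\<lambda>S. statistic t S ^ 4)
      \<le> 3 * (\<Sum>k\<in>V - Q t. E (\<lambda>S. (f t k S)\<^sup>2))\<^sup>2 + (\<Sum>k\<in>V - Q t. E (\<lambda>S. (f t k S)\<^sup>2))"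
proof -
  have "star k (Q t) \<inter> star k' (Q t) = {}" if "k \<in> V - Q t" "k' \<in> V - Q t" "k \<noteq> k'" for k k'
    using that by (intro star_disjoint) auto
  moreover have "finite (V - Q t)" using finite_V by simp
  ultimately show "E (\<lambda>S. (statistic t S)\<^sup>2) = (\<Sum>k\<in>V - Q t. E (\<lambda>S. (f t k S)\<^sup>2))"
    "E (\<lambda>S. statistic t S ^ 4)
      \<le> 3 * (\<Sum>k\<in>V - Q t. E (\<lambda>S. (f t k S)\<^sup>2))\<^sup>2 + (\<Sum>k\<in>V - Q t. E (\<lambda>S. (f t k S)\<^sup>2))"
    unfolding statistic_def
    using moments_indep_sum[of "V - Q t" "f t" "\<lambda>k. star k (Q t)"] depends[OF t] mean[OF t] bounded[OF t]
    by blast+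
qed

lemma E_statistic_sq_le: "t \<in> T \<Longrightarrow> E (\<lambda>S. (statistic t S)\<^sup>2) \<le> 2 * m"
  using statistic_moments(1) variance_le by simp

lemma E_statistic_fourth_le:
  assumes t: "t \<in> T" shows "E (\<lambda>S. statistic t S ^ 4) \<le> 16 * m\<^sup>2"
proof -
  let ?v = "\<Sum>k\<in>V - Q t. E (\<lambda>S. (f t k S)\<^sup>2)"
  have v: "1 \<le> ?v" "?v \<le> 2 * m" using variance_ge[OF t] variance_le[OF t] m_large by auto
  have "?v * 1 \<le> ?v * ?v" using v by (intro mult_left_mono) auto
  moreover have "?v\<^sup>2 \<le> (2 * m)\<^sup>2" using v by (intro power_mono) auto
  ultimately show ?thesis using statistic_moments(2)[OF t] by (simp add: power2_eq_square)
qed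

lemma E_sum_statistic_fourth_le: "E (\<lambda>S. \<Sum>t\<in>T. statistic t S ^ 4) \<le> real (card T) * (16 * m\<^sup>2)"
  unfolding E_sum using sum_mono[OF E_statistic_fourth_le, of T] by simp

lemma E_abs_statistic_ge:
  assumes t: "t \<in> T" shows "\<mu> \<le> E (\<lambda>S. \<bar>statistic t S\<bar>)"
proof -
  let ?v = "\<Sum>k\<in>V - Q t. E (\<lambda>S. (f t k S)\<^sup>2)"
  have "\<mu> \<le> 3 / 8 * sqrt ?v" using variance_ge[OF t] by simp
  also have "\<dots> \<le> E (\<lambda>S. \<bar>statistic t S\<bar>)"
    using statistic_moments[OF t] variance_ge[OF t] m_large by (intro E_abs_ge) auto
  finally show ?thesis .
qed

lemma E_sum_abs_statistic_ge: "real (card T) * \<mu> \<le> E (\<lambda>S. \<Sum>t\<in>T. \<bar>statistic t S\<bar>)"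
  unfolding E_sum using sum_mono[OF E_abs_statistic_ge, of T] by simp

lemma abs_statistic_diff_le:
  assumes t: "t \<in> T" "t' \<in> T"
  shows "\<bar>statistic t S - (\<Sum>k\<in>V - Q t - Q t'. f t k S)\<bar> \<le> 4"
proof -
  have "statistic t S - (\<Sum>k\<in>V - Q t - Q t'. f t k S) = (\<Sum>k\<in>(V - Q t) \<inter> Q t'. f t k S)"
    unfolding statistic_def using finite_V sum.Int_Diff[of "V - Q t" "\<lambda>k. f t k S" "Q t'"] by simp
  also have "\<bar>\<dots>\<bar> \<le> (\<Sum>k\<in>(V - Q t) \<inter> Q t'. 1)"
    using bounded[OF t(1)] by (intro order_trans[OF sum_abs] sum_mono) auto
  also have "\<dots> \<le> real (card (Q t'))" using finite_Q[OF t(2)] by (simp add: card_mono)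
  also have "\<dots> \<le> 4" using card_Q[OF t(2)] by simp
  finally show ?thesis .
qed

lemma E_abs_statistic_mult_le:
  assumes t: "t \<in> T" "t' \<in> T" and disjoint: "Q t \<inter> Q t' = {}"
  shows "E (\<lambda>S. \<bar>statistic t S\<bar> * \<bar>statistic t' S\<bar>)
    \<le> (E (\<lambda>S. \<bar>statistic t S\<bar>) + 8) * (E (\<lambda>S. \<bar>statistic t' S\<bar>) + 8)"
proof -
  define W where "W = V - Q t - Q t'"
  define restricted where "restricted s S = \<bar>\<Sum>k\<in>W. f s k S\<bar> + 4" for s S
  have W_swap: "W = V - Q t' - Q t" by (auto simp: W_def)
  have close: "\<bar>statistic t S - (\<Sum>k\<in>W. f t k S)\<bar> \<le> 4" "\<bar>statistic t' S - (\<Sum>k\<in>W. f t' k S)\<bar> \<le> 4" for S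
    using abs_statistic_diff_le[OF t] abs_statistic_diff_le[OF t(2,1)] W_def W_swap by simp_all
  have between: "\<bar>statistic s S\<bar> \<le> restricted s S" "restricted s S \<le> \<bar>statistic s S\<bar> + 8"
    if "s \<in> {t, t'}" for s S
    using that close[of S] unfolding restricted_def by (elim insertE emptyE; simp; linarith)+
  have depends_restricted: "depends_on (restricted s) (\<Union>k\<in>W. star k (Q s))" if "s \<in> T" for s
    unfolding restricted_def[abs_def]
    by (rule depends_on_comp, rule depends_on_sum, rule depends_on_mono[OF depends[OF that]]) auto
  have disjoint_stars: "(\<Union>k\<in>W. star k (Q t)) \<inter> (\<Union>k\<in>W. star k (Q t')) = {}"
    using disjoint by (auto simp: W_def star_def doubleton_eq_iff)
  have "E (\<lambda>S. \<bar>statistic t S\<bar> * \<bar>statistic t' S\<bar>) \<le> E (\<lambda>S. restricted t S * restricted t' S)"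
    using between(1) by (intro E_mono mult_mono) (auto simp: restricted_def)
  also have "\<dots> = E (restricted t) * E (restricted t')"
    by (rule E_mult_indep[OF depends_restricted[OF t(1)] depends_restricted[OF t(2)] disjoint_stars])
  also have "\<dots> \<le> E (\<lambda>S. \<bar>statistic t S\<bar> + 8) * E (\<lambda>S. \<bar>statistic t' S\<bar> + 8)"
    using between(2) by (intro mult_mono E_mono E_nonneg) (auto simp: restricted_def)
  finally show ?thesis by (simp add: E_add)
qed

lemma sum_abs_statistic_concentrated:
  "E (\<lambda>S. ((\<Sum>t\<in>T. \<bar>statistic t S\<bar>) / E (\<lambda>S. \<Sum>t\<in>T. \<bar>statistic t S\<bar>) - 1)\<^sup>2) \<le> 1 / 80"
proof -
  have "10000\<^sup>2 \<le> m" using m_large by simp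
  then have "10000 \<le> sqrt m" by (rule real_le_rsqrt)
  then have \<mu>: "3750 \<le> \<mu>" by linarith
  have "8 / \<mu> \<le> 8 / 3750" by (rule divide_left_mono[OF \<mu>]) (use \<mu> in linarith)+
  then have ratio: "8 / \<mu> \<le> 1 / 400" by simp
  have "0 \<le> 8 / \<mu>" using \<mu> by (intro divide_nonneg_nonneg) linarith+
  then have "(8 / \<mu>)\<^sup>2 \<le> (1 / 400)\<^sup>2" using ratio by (intro power_mono)
  then have ratio_sq: "(8 / \<mu>)\<^sup>2 \<le> 1 / 160000" by (simp only: power_divide) simp
  have near: "real N * (2 * m) / (real (card T) * \<mu>\<^sup>2) \<le> 128 / 9 / 10000"
  proof -
    have "real N / real (card T) \<le> 1 / 10000"
      using T_large T_nonempty finite_T by (simp add: field_simps card_gt_0_iff flip: of_nat_mult)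
    then have "128 / 9 * (real N / real (card T)) \<le> 128 / 9 * (1 / 10000)" by (rule mult_left_mono) simp
    moreover have "real N * (2 * m) / (real (card T) * \<mu>\<^sup>2) = 128 / 9 * (real N / real (card T))"
      using m_large by (simp add: power_mult_distrib power_divide field_simps)
    ultimately show ?thesis by simp
  qed
  have "E (\<lambda>S. ((\<Sum>t\<in>T. \<bar>statistic t S\<bar>) / E (\<lambda>S. \<Sum>t\<in>T. \<bar>statistic t S\<bar>) - 1)\<^sup>2)
      \<le> 2 * (8 / \<mu>) + (8 / \<mu>)\<^sup>2 + real N * (2 * m) / (real (card T) * \<mu>\<^sup>2)"
  proof (rule sum_abs_concentrated[where near = "{(t, t'). Q t \<inter> Q t' \<noteq> {}}"])
    show "E (\<lambda>S. \<bar>statistic t S\<bar> * \<bar>statistic t' S\<bar>)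
        \<le> (E (\<lambda>S. \<bar>statistic t S\<bar>) + 8) * (E (\<lambda>S. \<bar>statistic t' S\<bar>) + 8)"
      if "t \<in> T" "t' \<in> T" "(t, t') \<notin> {(t, t'). Q t \<inter> Q t' \<noteq> {}}" for t t'
      using that by (intro E_abs_statistic_mult_le) auto
  qed (use finite_T T_nonempty E_statistic_sq_le E_abs_statistic_ge card_near m_large in auto)
  also have "\<dots> \<le> 1 / 80" using ratio ratio_sq near by linarith
  finally show ?thesis .
qed

lemma sum_abs_statistic_ge:
  assumes close: "((\<Sum>t\<in>T. \<bar>statistic t S\<bar>) / E (\<lambda>S. \<Sum>t\<in>T. \<bar>statistic t S\<bar>) - 1)\<^sup>2 \<le> 1 / 4"
    and w: "w\<^sup>2 / 2 \<le> m"
  shows "real (card T) * (21 / 160 * w) \<le> (\<Sum>t\<in>T. \<bar>statistic t S\<bar>)"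
proof -
  let ?mean = "E (\<lambda>S. \<Sum>t\<in>T. \<bar>statistic t S\<bar>)"
  have "0 < real (card T) * \<mu>" using finite_T T_nonempty m_large by (simp add: card_gt_0_iff)
  then have "0 < ?mean" using E_sum_abs_statistic_ge by linarith
  with close have "?mean / 2 \<le> (\<Sum>t\<in>T. \<bar>statistic t S\<bar>)" by (rule half_le_of_ratio_close)
  moreover have "real (card T) * (21 / 160 * w) \<le> real (card T) * (\<mu> / 2)"
    using sqrt_ge_of_half_sq_le[OF w] by (intro mult_left_mono) auto
  then have "real (card T) * (21 / 160 * w) \<le> ?mean / 2" using E_sum_abs_statistic_ge by linarith
  ultimately show ?thesis by linarith
qed

end

section \<open>Twin statistics of random free pairs\<close>

context bernoulli_graph
begin

definition noise_diff :: "'a \<Rightarrow> 'a \<Rightarrow> 'a \<Rightarrow> 'a set set \<Rightarrow> real" where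
  "noise_diff u v k S = noise S {u, k} - noise S {v, k}"

lemma depends_on_noise_diff: "depends_on (noise_diff u v k) (star k {u, v})"
  unfolding noise_diff_def[abs_def] star_def
  by (intro depends_on_comp2[of _ _ _ "(-)"] depends_on_noise) auto

lemma abs_noise_diff_le: "\<bar>noise_diff u v k S\<bar> \<le> 1"
  using prob_01 by (auto simp: noise_diff_def noise_def of_bool_def)

lemma E_noise_diff: "E (noise_diff u v k) = 0"
  unfolding noise_diff_def[abs_def] by (simp add: E_diff E_noise)

lemma E_noise_diff_sq:
  assumes "u \<noteq> v"
  shows "E (\<lambda>S. (noise_diff u v k S)\<^sup>2) = var * (of_bool ({u, k} \<in> P) + of_bool ({v, k} \<in> P))"
proof -
  have "{u, k} \<noteq> {v, k}" using assms by (auto simp: doubleton_eq_iff)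
  then have "E (\<lambda>S. noise S {u, k} * noise S {v, k}) = 0" by (rule E_noise_mult)
  moreover have "E (\<lambda>S. (noise_diff u v k S)\<^sup>2)
      = E (\<lambda>S. (noise S {u, k})\<^sup>2 - 2 * (noise S {u, k} * noise S {v, k}) + (noise S {v, k})\<^sup>2)"
    by (intro E_cong) (simp add: noise_diff_def power2_diff)
  ultimately show ?thesis by (simp add: E_add E_diff E_cmult E_noise_sq)
qed

lemma E_noise_diff_mult:
  assumes disjoint: "{u, v} \<inter> {u', v'} = {}"
  shows "E (\<lambda>S. noise_diff u v k S * noise_diff u' v' k S) = 0"
    and "E (\<lambda>S. (noise_diff u v k S * noise_diff u' v' k S)\<^sup>2)
      = E (\<lambda>S. (noise_diff u v k S)\<^sup>2) * E (\<lambda>S. (noise_diff u' v' k S)\<^sup>2)"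
proof -
  have "star k {u, v} \<inter> star k {u', v'} = {}"
    using disjoint by (auto simp: star_def doubleton_eq_iff)
  note indep = E_mult_indep[OF depends_on_comp depends_on_comp this,
      OF depends_on_noise_diff depends_on_noise_diff]
  show "E (\<lambda>S. noise_diff u v k S * noise_diff u' v' k S) = 0"
    using indep[of "\<lambda>x. x" "\<lambda>x. x"] by (simp add: E_noise_diff)
  show "E (\<lambda>S. (noise_diff u v k S * noise_diff u' v' k S)\<^sup>2)
      = E (\<lambda>S. (noise_diff u v k S)\<^sup>2) * E (\<lambda>S. (noise_diff u' v' k S)\<^sup>2)"
    using indep[of "\<lambda>x. x\<^sup>2" "\<lambda>x. x\<^sup>2"] by (simp add: power_mult_distrib)
qed

end

context gadget_graph
begin

fun degree_twins :: "nat \<times> nat \<Rightarrow> 'a set" where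
  "degree_twins (B, x) = {left B x False, left B x True}"

fun triangle_twins :: "nat \<times> nat \<times> nat \<Rightarrow> 'a set" where
  "triangle_twins (B, x, y) = {left B x False, left B x True, right B y False, right B y True}"

lemma finite_twins: "finite (degree_twins t)" "finite (triangle_twins s)"
  by (cases t; simp) (cases s; simp)

lemma card_twins_le: "card (degree_twins t) \<le> 4" "card (triangle_twins s) \<le> 4"
  by (cases t; simp add: card_insert_le_m1) (cases s; simp add: card_insert_le_m1)

lemma twins_subset:
  "t \<in> degree_switches \<Longrightarrow> degree_twins t \<subseteq> V" "s \<in> triangle_switches \<Longrightarrow> triangle_twins s \<subseteq> V"
  by (auto simp: degree_switches_def triangle_switches_def vert_mem)

lemma card_near_degree_switches:
  assumes t: "t \<in> degree_switches"
  shows "card {t' \<in> degree_switches. degree_twins t \<inter> degree_twins t' \<noteq> {}} \<le> 1"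
proof -
  have "{t' \<in> degree_switches. degree_twins t \<inter> degree_twins t' \<noteq> {}} \<subseteq> {t}"
    using t by (auto simp: degree_switches_def vert_eq_iff)
  then show ?thesis using card_mono[of "{t}"] by fastforce
qed

lemma card_near_triangle_switches:
  assumes t: "t \<in> triangle_switches"
  shows "card {t' \<in> triangle_switches. triangle_twins t \<inter> triangle_twins t' \<noteq> {}} \<le> c\<^sup>2"
proof -
  obtain B x y where Bxy: "t = (B, x, y)" by (cases t) auto
  have "{t' \<in> triangle_switches. triangle_twins t \<inter> triangle_twins t' \<noteq> {}} \<subseteq> {B} \<times> {..<c} \<times> {..<c}"
    using t Bxy by (auto simp: triangle_switches_def vert_eq_iff)
  then have "card {t' \<in> triangle_switches. triangle_twins t \<inter> triangle_twins t' \<noteq> {}}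
      \<le> card ({B} \<times> {..<c} \<times> {..<c})" by (intro card_mono) auto
  then show ?thesis by (simp add: card_cartesian_product power2_eq_square)
qed

lemma card_unreserved_ge:
  assumes W: "W \<subseteq> V" "card W \<le> 4"
  shows "card V \<le> card {k \<in> V - W. \<forall>u\<in>W. {u, k} \<in> free_pairs} + (4 + 8 * c)"
proof -
  let ?unreserved = "{k \<in> V - W. \<forall>u\<in>W. {u, k} \<in> free_pairs}"
    and ?neighbours = "\<Union>u\<in>W. {k \<in> V. {u, k} \<in> reserved}"
  have fin: "finite W" using W finite_V finite_subset by auto
  have "{u, k} \<in> [V]\<^bsup>2\<^esup>" if "u \<in> W" "k \<in> V - W" for u k using that W by (auto simp: nsets_def card_2_iff)
  then have "V \<subseteq> ?unreserved \<union> (W \<union> ?neighbours)" by (auto simp: free_pairs_def)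
  then have "card V \<le> card (?unreserved \<union> (W \<union> ?neighbours))"
    using fin finite_V by (intro card_mono) auto
  also have "\<dots> \<le> card ?unreserved + (card W + card ?neighbours)"
    by (meson card_Un_le add_left_mono order_trans)
  also have "card ?neighbours \<le> (\<Sum>u\<in>W. 2 * c)"
    using card_UN_le[OF fin, of "\<lambda>u. {k \<in> V. {u, k} \<in> reserved}"]
      sum_mono[of W _ "\<lambda>_. 2 * c", OF card_reserved_neighbours_le] by (rule order_trans)
  also have "\<dots> \<le> 4 * (2 * c)" using W(2) by simp
  finally show ?thesis using W(2) by simp
qed

text \<open>For all but a bounded number of vertices \<open>k\<close>, no pair joining \<open>k\<close> to \<open>W\<close> is reserved.\<close>

lemma sum_unreserved_bounds:
  fixes g :: "'a \<Rightarrow> real"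
  assumes W: "W \<subseteq> V" "card W \<le> 4" and size: "8 + 16 * real c \<le> real (card V)"
    and g: "\<And>k. 0 \<le> g k" "\<And>k. g k \<le> 2 * M" "\<And>k. \<forall>u\<in>W. {u, k} \<in> free_pairs \<Longrightarrow> g k = 2 * M"
  shows "real (card V) * M \<le> (\<Sum>k\<in>V - W. g k)" "(\<Sum>k\<in>V - W. g k) \<le> 2 * (real (card V) * M)"
proof -
  let ?unreserved = "{k \<in> V - W. \<forall>u\<in>W. {u, k} \<in> free_pairs}"
  have M: "0 \<le> M" using order_trans[OF g(1,2)] by simp
  have "real (card V) \<le> real (card ?unreserved) + (4 + 8 * real c)"
    using of_nat_mono[OF card_unreserved_ge[OF W], where 'a = real] by simp
  then have "real (card V) * M \<le> real (card ?unreserved) * 2 * M"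
    using size M by (intro mult_right_mono) auto
  also have "\<dots> = (\<Sum>k\<in>?unreserved. g k)" using g(3) by simp
  also have "\<dots> \<le> (\<Sum>k\<in>V - W. g k)" using finite_V g(1) by (intro sum_mono2) auto
  finally show "real (card V) * M \<le> (\<Sum>k\<in>V - W. g k)" .
  have "(\<Sum>k\<in>V - W. g k) \<le> (\<Sum>k\<in>V. g k)" using finite_V g(1) by (intro sum_mono2) auto
  also have "\<dots> \<le> (\<Sum>k\<in>V. 2 * M)" using g(2) by (intro sum_mono)
  finally show "(\<Sum>k\<in>V - W. g k) \<le> 2 * (real (card V) * M)" by simp
qed

end

context gadget_density
begin

sublocale bernoulli_graph free_pairs \<pi>
  using finite_free_pairs density_01 by unfold_locales auto

fun degree_summand :: "nat \<times> nat \<Rightarrow> 'a \<Rightarrow> 'a set set \<Rightarrow> real" where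
  "degree_summand (B, x) k S = noise_diff (left B x False) (left B x True) k S"

fun triangle_summand :: "nat \<times> nat \<times> nat \<Rightarrow> 'a \<Rightarrow> 'a set set \<Rightarrow> real" where
  "triangle_summand (B, x, y) k S
     = noise_diff (left B x False) (left B x True) k S * noise_diff (right B y False) (right B y True) k S"

lemma noise_not_free: "e \<notin> free_pairs \<Longrightarrow> noise S e = 0"
  by (simp add: noise_def)

lemma noise_reserved: "B < l \<Longrightarrow> x < c \<Longrightarrow> y < c \<Longrightarrow> noise S {left B x \<sigma>, right B y \<tau>} = 0"
proof -
  assume "B < l" "x < c" "y < c"
  then have "block_pair (B, x, \<sigma>, y, \<tau>) \<in> reserved"
    unfolding reserved_def block_indices_def by (intro imageI) auto
  then show ?thesis using free_reserved(2) by (intro noise_not_free) auto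
qed

lemma twin_wdeg_diff_noise:
  assumes t: "t \<in> degree_switches"
  shows "twin_wdeg_diff (noise S) t = (\<Sum>k\<in>V - degree_twins t. degree_summand t k S)"
proof -
  obtain B x where Bx: "t = (B, x)" "B < l" "x < c" using t by (auto simp: degree_switches_def)
  have "twin_wdeg_diff (noise S) t = (\<Sum>k\<in>V. degree_summand t k S)"
    by (simp add: Bx(1) wdeg_def noise_diff_def sum_subtractf)
  also have "\<dots> = (\<Sum>k\<in>V - degree_twins t. degree_summand t k S) + (\<Sum>k\<in>degree_twins t. degree_summand t k S)"
    by (rule sum.subset_diff[OF twins_subset(1)[OF t] finite_V])
  also have "(\<Sum>k\<in>degree_twins t. degree_summand t k S) = 0"
    using Bx by (simp add: vert_eq_iff noise_diff_def noise_not_free singleton_notin insert_commute)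
  finally show ?thesis by simp
qed

lemma twin_codegree_diff_noise:
  assumes t: "t \<in> triangle_switches"
  shows "twin_codegree_diff (noise S) t = (\<Sum>k\<in>V - triangle_twins t. triangle_summand t k S)"
proof -
  obtain B x y where Bxy: "t = (B, x, y)" "B < l" "x < c" "y < c" using t by (auto simp: triangle_switches_def)
  have "noise S {left B x \<sigma>, right B y \<tau>} = 0" "noise S {right B y \<tau>, left B x \<sigma>} = 0" for \<sigma> \<tau>
    using noise_reserved[OF Bxy(2-4)] by (simp_all add: insert_commute)
  then have "(\<Sum>k\<in>triangle_twins t. triangle_summand t k S) = 0"
    by (intro sum.neutral) (auto simp: Bxy(1) noise_diff_def)
  moreover have "twin_codegree_diff (noise S) t = (\<Sum>k\<in>V. triangle_summand t k S)"
    by (simp add: Bxy(1) noise_diff_def)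
  ultimately show ?thesis
    using sum.subset_diff[OF twins_subset(2)[OF t] finite_V, of "\<lambda>k. triangle_summand t k S"] by simp
qed

lemma local_statistics_degree:
  assumes size: "8 + 16 * real c \<le> real (card V)" and variance: "10 ^ 8 \<le> real (card V) * var"
    and switches: "10000 \<le> card degree_switches"
  shows "local_statistics free_pairs \<pi> V degree_twins degree_summand degree_switches (real (card V) * var) 1"
proof unfold_locales
  fix t assume t: "t \<in> degree_switches"
  obtain B x where Bx: "t = (B, x)" "B < l" "x < c" using t by (auto simp: degree_switches_def)
  let ?u = "left B x False" and ?v = "left B x True"
  have summand: "degree_summand t k = noise_diff ?u ?v k" for k by (simp add: Bx(1) fun_eq_iff)
  show "depends_on (degree_summand t k) (star k (degree_twins t))" for k
    unfolding summand by (simp add: Bx(1) depends_on_noise_diff)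
  show "\<bar>degree_summand t k S\<bar> \<le> 1" "E (degree_summand t k) = 0" for k S
    unfolding summand by (rule abs_noise_diff_le E_noise_diff)+
  have "E (\<lambda>S. (degree_summand t k S)\<^sup>2)
    = var * (of_bool ({?u, k} \<in> free_pairs) + of_bool ({?v, k} \<in> free_pairs))"
    for k unfolding summand using Bx by (intro E_noise_diff_sq) (simp add: vert_eq_iff)
  then have second: "0 \<le> E (\<lambda>S. (degree_summand t k S)\<^sup>2)" "E (\<lambda>S. (degree_summand t k S)\<^sup>2) \<le> 2 * var"
    "\<forall>u\<in>degree_twins t. {u, k} \<in> free_pairs \<Longrightarrow> E (\<lambda>S. (degree_summand t k S)\<^sup>2) = 2 * var" for k
    using var_nonneg by (auto simp: Bx(1))
  note bounds = sum_unreserved_bounds[where g = "\<lambda>k. E (\<lambda>S. (degree_summand t k S)\<^sup>2)",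
      OF twins_subset(1)[OF t] card_twins_le(1) size second]
  show "real (card V) * var \<le> (\<Sum>k\<in>V - degree_twins t. E (\<lambda>S. (degree_summand t k S)\<^sup>2))"
    "(\<Sum>k\<in>V - degree_twins t. E (\<lambda>S. (degree_summand t k S)\<^sup>2)) \<le> 2 * (real (card V) * var)"
    using bounds by simp_all
qed (use finite_V finite_switches finite_twins card_twins_le card_near_degree_switches
    variance switches in auto)

lemma local_statistics_triangle:
  assumes size: "8 + 16 * real c \<le> real (card V)" and variance: "10 ^ 8 \<le> real (card V) * (2 * var\<^sup>2)"
    and switches: "10000 * c\<^sup>2 \<le> card triangle_switches"
  shows "local_statistics free_pairs \<pi> V triangle_twins triangle_summand triangle_switches
    (real (card V) * (2 * var\<^sup>2)) (c\<^sup>2)"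
proof unfold_locales
  fix t assume t: "t \<in> triangle_switches"
  obtain B x y where Bxy: "t = (B, x, y)" "B < l" "x < c" "y < c" using t by (auto simp: triangle_switches_def)
  let ?u = "left B x False" and ?v = "left B x True" and ?u' = "right B y False" and ?v' = "right B y True"
  have summand: "triangle_summand t k = (\<lambda>S. noise_diff ?u ?v k S * noise_diff ?u' ?v' k S)" for k
    by (simp add: Bxy(1) fun_eq_iff)
  have disjoint: "{?u, ?v} \<inter> {?u', ?v'} = {}" using Bxy by (simp add: vert_eq_iff)
  have "star k {?u, ?v} \<subseteq> star k (triangle_twins t)" "star k {?u', ?v'} \<subseteq> star k (triangle_twins t)" for k
    by (auto simp: star_def Bxy(1))
  then show "depends_on (triangle_summand t k) (star k (triangle_twins t))" for k
    unfolding summand by (intro depends_on_comp2[of _ _ _ "(*)"] depends_on_mono[OF depends_on_noise_diff])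
  show "\<bar>triangle_summand t k S\<bar> \<le> 1" for k S
    unfolding summand abs_mult using abs_noise_diff_le by (intro mult_le_one) auto
  show "E (triangle_summand t k) = 0" for k
    unfolding summand by (rule E_noise_diff_mult(1)[OF disjoint])
  let ?w = "\<lambda>u v k. of_bool ({u, k} \<in> free_pairs) + of_bool ({v, k} \<in> free_pairs) :: real"
  have "E (\<lambda>S. (triangle_summand t k S)\<^sup>2) = var\<^sup>2 * (?w ?u ?v k * ?w ?u' ?v' k)" for k
  proof -
    have twins_distinct: "?u \<noteq> ?v" "?u' \<noteq> ?v'" using Bxy by (simp_all add: vert_eq_iff)
    show ?thesis
      unfolding summand E_noise_diff_mult(2)[OF disjoint] E_noise_diff_sq[OF twins_distinct(1)]
        E_noise_diff_sq[OF twins_distinct(2)]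
      by (simp add: power2_eq_square mult_ac)
  qed
  then have second: "0 \<le> E (\<lambda>S. (triangle_summand t k S)\<^sup>2)"
    "E (\<lambda>S. (triangle_summand t k S)\<^sup>2) \<le> 2 * (2 * var\<^sup>2)"
    "\<forall>u\<in>triangle_twins t. {u, k} \<in> free_pairs \<Longrightarrow> E (\<lambda>S. (triangle_summand t k S)\<^sup>2) = 2 * (2 * var\<^sup>2)" for k
    by (auto simp: Bxy(1))
  note bounds = sum_unreserved_bounds[where g = "\<lambda>k. E (\<lambda>S. (triangle_summand t k S)\<^sup>2)",
      OF twins_subset(2)[OF t] card_twins_le(2) size second]
  show "real (card V) * (2 * var\<^sup>2) \<le> (\<Sum>k\<in>V - triangle_twins t. E (\<lambda>S. (triangle_summand t k S)\<^sup>2))"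
    "(\<Sum>k\<in>V - triangle_twins t. E (\<lambda>S. (triangle_summand t k S)\<^sup>2)) \<le> 2 * (real (card V) * (2 * var\<^sup>2))"
    using bounds by simp_all
qed (use finite_V finite_switches finite_twins card_twins_le card_near_triangle_switches
    variance switches c_pos in auto)

end

section \<open>A typical outcome of the free pairs\<close>

definition large_supports :: "nat \<Rightarrow> nat set set set" where
  "large_supports k = {H. H \<subseteq> [{..<k}]\<^bsup>2\<^esup> \<and> 4 \<le> card (\<Union>H)}"

lemma finite_large_supports: "finite (large_supports k)"
  unfolding large_supports_def
  by (rule finite_subset[of _ "Pow ([{..<k}]\<^bsup>2\<^esup>)"]) (auto simp: finite_imp_finite_nsets)

lemma large_supportsD:
  assumes "H \<in> large_supports k"
  shows "finite H" "e \<in> H \<Longrightarrow> card e = 2" "e \<in> H \<Longrightarrow> finite e" "4 \<le> card (\<Union>H)"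
proof -
  have "H \<subseteq> [{..<k}]\<^bsup>2\<^esup>" using assms by (simp add: large_supports_def)
  then show "finite H" "e \<in> H \<Longrightarrow> card e = 2" "e \<in> H \<Longrightarrow> finite e"
    using finite_subset[OF _ finite_imp_finite_nsets[of "{..<k}" 2]] by (auto simp: nsets_def)
qed (use assms in \<open>simp add: large_supports_def\<close>)

definition envelope_const :: "nat \<Rightarrow> nat \<Rightarrow> real" where
  "envelope_const k c = 1 + (\<Sum>H\<in>large_supports k. \<Sum>J\<in>Pow H. (3 * real c) ^ card (\<Union>H)
      * sqrt (real (card (\<Union>H)) ^ card (\<Union>H) * 2 ^ card H))"

lemma envelope_const_pos: "0 < envelope_const k c"
  unfolding envelope_const_def by (intro add_pos_nonneg sum_nonneg mult_nonneg_nonneg) auto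

lemma divide_mult_le: "x \<le> w \<Longrightarrow> 0 < w \<Longrightarrow> 0 < a \<Longrightarrow> w' = a * w \<Longrightarrow> x / w' \<le> 1 / (a :: real)"
  by (simp add: divide_le_eq)

lemma divide_scaled_sq_le: "x \<le> w\<^sup>2 \<Longrightarrow> 0 < w \<Longrightarrow> w' = 5 * w \<Longrightarrow> x / w'\<^sup>2 \<le> 1 / (25 :: real)"
  using divide_mult_le[of x "w\<^sup>2" 25 "w'\<^sup>2"] by (simp add: power_mult_distrib)

lemma abs_le_of_sum_power4_le:
  fixes f :: "'t \<Rightarrow> real"
  assumes "finite T" "t \<in> T" "(\<Sum>t\<in>T. f t ^ 4) \<le> a ^ 4" "0 \<le> a"
  shows "\<bar>f t\<bar> \<le> a"
proof -
  have "f t ^ 4 \<le> (\<Sum>t\<in>T. f t ^ 4)" using assms(1,2) by (intro member_le_sum) auto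
  then have "\<bar>f t\<bar> ^ 4 \<le> a ^ 4" using assms(3) by simp
  then show ?thesis using assms(4) by (rule power_le_imp_le_base[of _ 3, simplified])
qed

context gadget_density
begin

definition root_n :: real where "root_n = sqrt (real (card V))"

definition sd :: real where "sd = sqrt (p * (1 - p))"

abbreviation edge_sd :: real where "edge_sd \<equiv> root_n\<^sup>2 * sd"

end

text \<open>The groups are large compared with the standard deviation of the number of edges, and each group is
  large compared with the preceding ones, whose influence it has to compensate.\<close>

locale gadget_scaled = gadget_density V vert c l1 l2 l3 p \<pi>
  for V :: "'a set" and vert c l1 l2 l3 p \<pi> +
  assumes size: "100000 * (real c)\<^sup>2 \<le> root_n * sd\<^sup>2"
    and var_ge: "sd\<^sup>2 / 2 \<le> \<pi> * (1 - \<pi>)" and var_le: "\<pi> * (1 - \<pi>) \<le> 2 * sd\<^sup>2"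
    and edge_group_size: "12 * edge_sd \<le> real (card edge_group)" "real (card edge_group) \<le> 24 * edge_sd"
    and degree_group_size: "40000 * edge_sd \<le> real (card degree_group)"
    "real (card degree_group) \<le> 80000 * edge_sd"
    and triangle_group_size: "400000000 * edge_sd \<le> real (card triangle_group)"
    and reserved_size: "real (card reserved) \<le> real c * edge_sd"
begin

lemma c_ge: "1 \<le> real c" "real c \<le> (real c)\<^sup>2" "1 \<le> (real c)\<^sup>2"
proof -
  show "1 \<le> real c" using c_pos by simp
  then show "real c \<le> (real c)\<^sup>2" "1 \<le> (real c)\<^sup>2" using self_le_power[of "real c" 2] by simp_all
qed

lemma root_n_sq: "root_n\<^sup>2 = real (card V)"
  by (simp add: root_n_def)

lemma sd_sq: "sd\<^sup>2 = p * (1 - p)"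
  using p_01 by (simp add: sd_def)

lemma sd_bounds: "0 < sd" "sd \<le> 1 / 2" "sd\<^sup>2 \<le> sd"
proof -
  have "sd \<noteq> 0" using size c_ge by auto
  moreover have "0 \<le> sd" using p_01 by (simp add: sd_def)
  ultimately show "0 < sd" by simp
  show half: "sd \<le> 1 / 2"
    unfolding sd_def using mult_one_minus_le_quarter[of p]
    by (intro real_le_lsqrt) (auto simp: power2_eq_square)
  show "sd\<^sup>2 \<le> sd" using \<open>0 < sd\<close> half by (simp add: power2_eq_square mult_left_le_one_le)
qed

lemma root_n_ge: "100000 * (real c)\<^sup>2 \<le> root_n * sd" "100000 * (real c)\<^sup>2 \<le> root_n" "100000 \<le> root_n"
proof -
  have nonneg: "0 \<le> root_n" by (simp add: root_n_def)
  have "root_n * sd\<^sup>2 \<le> root_n * sd" using nonneg sd_bounds(3) by (rule mult_left_mono[rotated])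
  then show scaled: "100000 * (real c)\<^sup>2 \<le> root_n * sd" using size by linarith
  have "root_n * sd \<le> root_n * 1" using nonneg sd_bounds by (intro mult_left_mono) auto
  then show root: "100000 * (real c)\<^sup>2 \<le> root_n" using scaled by linarith
  show "100000 \<le> root_n" using root c_ge(3) by linarith
qed

lemma root_n_pos: "0 < root_n"
  using root_n_ge(3) by linarith

lemma root_n_sd_pos: "0 < root_n * sd" "0 < edge_sd" "0 < root_n ^ a * sd ^ b"
  using root_n_pos sd_bounds(1) by simp_all

lemma edge_sd_ge: "100000 * (real c)\<^sup>2 * root_n \<le> edge_sd" "10000000000 * (real c)\<^sup>2 \<le> edge_sd"
proof -
  show growth: "100000 * (real c)\<^sup>2 * root_n \<le> edge_sd"
    using mult_left_mono[OF root_n_ge(1), of root_n] root_n_pos by (simp add: power2_eq_square mult_ac)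
  have "100000 * (real c)\<^sup>2 * 100000 \<le> 100000 * (real c)\<^sup>2 * root_n"
    using root_n_ge(3) by (intro mult_left_mono) auto
  then show "10000000000 * (real c)\<^sup>2 \<le> edge_sd" using growth by linarith
qed

lemma edge_sd_ge_100000: "100000 \<le> edge_sd"
  using edge_sd_ge(2) c_ge(3) by linarith

lemma root_n_sq_ge: "10000000000 * (real c)\<^sup>2 \<le> root_n\<^sup>2"
proof -
  have "edge_sd \<le> root_n\<^sup>2 * 1" using sd_bounds by (intro mult_left_mono) auto
  then show ?thesis using edge_sd_ge(2) by simp
qed

lemma root_n_sd_sq_ge: "10000000000 \<le> (root_n * sd\<^sup>2)\<^sup>2"
proof -
  have "100000 \<le> root_n * sd\<^sup>2" using size c_ge(3) by linarith
  then have "100000\<^sup>2 \<le> (root_n * sd\<^sup>2)\<^sup>2" by (intro power_mono) auto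
  then show ?thesis by simp
qed

lemma root_n_sd_sq_le: "(root_n * sd\<^sup>2)\<^sup>2 \<le> root_n\<^sup>2 * sd ^ 3" "root_n\<^sup>2 * sd ^ 3 \<le> root_n\<^sup>2 * sd\<^sup>2"
proof -
  have "sd ^ 4 \<le> sd ^ 3" "sd ^ 3 \<le> sd\<^sup>2" using sd_bounds by (auto intro: power_decreasing)
  then show "(root_n * sd\<^sup>2)\<^sup>2 \<le> root_n\<^sup>2 * sd ^ 3" "root_n\<^sup>2 * sd ^ 3 \<le> root_n\<^sup>2 * sd\<^sup>2"
    by (simp_all add: power_mult_distrib mult_left_mono flip: power_mult)
qed

lemma vertices_large: "8 + 16 * real c \<le> real (card V)"
  using root_n_sq_ge c_ge unfolding root_n_sq by linarith

lemma switches_large: "10000 \<le> card degree_switches" "10000 * c\<^sup>2 \<le> card triangle_switches"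
proof -
  have "real (card degree_group) = real l2 * (4 * (real c)\<^sup>2)"
    "real (card triangle_group) = real l3 * (4 * (real c)\<^sup>2)"
    by (simp_all add: card_groups)
  then have "10000 * (4 * (real c)\<^sup>2) \<le> real l2 * (4 * (real c)\<^sup>2)"
    "10000 * (4 * (real c)\<^sup>2) \<le> real l3 * (4 * (real c)\<^sup>2)"
    using degree_group_size(1) triangle_group_size edge_sd_ge(2) zero_le_power2[of "real c"] by linarith+
  then have "10000 \<le> real l2" "10000 \<le> real l3" using c_pos by simp_all
  then have l: "10000 \<le> l2" "10000 \<le> l3" by simp_all
  show "10000 \<le> card degree_switches" unfolding card_switches using mult_le_mono[OF l(1) c_pos] by simp
  show "10000 * c\<^sup>2 \<le> card triangle_switches" unfolding card_switches using l(2) by (rule mult_le_mono1)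
qed

lemma statistic_variance_ge:
  "root_n\<^sup>2 * sd\<^sup>2 / 2 \<le> real (card V) * var" "root_n\<^sup>2 * sd ^ 4 / 2 \<le> real (card V) * (2 * var\<^sup>2)"
proof -
  show "root_n\<^sup>2 * sd\<^sup>2 / 2 \<le> real (card V) * var"
    unfolding root_n_sq[symmetric] using mult_left_mono[OF var_ge, of "root_n\<^sup>2"] by simp
  have "(sd\<^sup>2 / 2)\<^sup>2 \<le> var\<^sup>2" using var_ge by (intro power_mono) auto
  then show "root_n\<^sup>2 * sd ^ 4 / 2 \<le> real (card V) * (2 * var\<^sup>2)"
    unfolding root_n_sq[symmetric] using mult_left_mono[of "(sd\<^sup>2 / 2)\<^sup>2" "var\<^sup>2" "2 * root_n\<^sup>2"]
    by (simp add: power_divide mult_ac flip: power_mult)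
qed

lemma statistic_variance_large: "10 ^ 8 \<le> real (card V) * var" "10 ^ 8 \<le> real (card V) * (2 * var\<^sup>2)"
  using statistic_variance_ge root_n_sd_sq_ge root_n_sd_sq_le
  by (simp_all add: power_mult_distrib flip: power_mult)

sublocale degree: local_statistics free_pairs \<pi> V degree_twins degree_summand degree_switches
  "real (card V) * var" 1
  by (intro local_statistics_degree vertices_large statistic_variance_large switches_large)

sublocale triangle: local_statistics free_pairs \<pi> V triangle_twins triangle_summand triangle_switches
  "real (card V) * (2 * var\<^sup>2)" "c\<^sup>2"
  by (intro local_statistics_triangle vertices_large statistic_variance_large switches_large)

sublocale outcome: gadget_noise V vert c l1 l2 l3 p \<pi> "noise S" for S
proof unfold_locales
  fix e
  show "e \<notin> free_pairs \<Longrightarrow> noise S e = 0" by (rule noise_not_free)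
  show "\<bar>noise S e\<bar> \<le> 1" by (rule abs_noise_le)
  show "e \<in> free_pairs \<Longrightarrow> (noise S e)\<^sup>2 = (1 - 2 * \<pi>) * noise S e + \<pi> * (1 - \<pi>)"
    by (auto simp: noise_def of_bool_def power2_eq_square algebra_simps)
qed

lemma twin_diff_statistic:
  "t \<in> degree_switches \<Longrightarrow> twin_wdeg_diff (noise S) t = degree.statistic t S"
  "s \<in> triangle_switches \<Longrightarrow> twin_codegree_diff (noise S) s = triangle.statistic s S"
  by (simp_all add: twin_wdeg_diff_noise twin_codegree_diff_noise degree.statistic_def triangle.statistic_def)

lemma var_mult_card_le: "var * real (card V) \<le> 2 * (root_n * sd)\<^sup>2"
  unfolding root_n_sq[symmetric] using mult_right_mono[OF var_le, of "root_n\<^sup>2"]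
  by (simp add: power_mult_distrib mult_ac)

lemma var_power_le: "var ^ m \<le> (2 * sd\<^sup>2) ^ m"
  using var_le var_nonneg by (rule power_mono)

lemma free_sum_second_moment: "E (\<lambda>S. (\<Sum>e\<in>free_pairs. noise S e)\<^sup>2) \<le> edge_sd\<^sup>2"
proof -
  have "real (card free_pairs) \<le> real (card V) * (real (card V) - 1) / 2" using card_free_reserved by simp
  also have "\<dots> \<le> root_n\<^sup>2 * root_n\<^sup>2 / 2"
    unfolding root_n_sq by (intro divide_right_mono mult_left_mono) auto
  finally have card: "real (card free_pairs) \<le> root_n\<^sup>2 * root_n\<^sup>2 / 2" .
  have "E (\<lambda>S. (\<Sum>e\<in>free_pairs. noise S e)\<^sup>2) \<le> var * real (card free_pairs)"
    using second_moment_linear_le[OF finite_free_pairs, of "\<lambda>_. 1"] by simp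
  also have "\<dots> \<le> (2 * sd\<^sup>2) * (root_n\<^sup>2 * root_n\<^sup>2 / 2)" by (rule mult_mono[OF var_le card]) auto
  finally show ?thesis by (simp add: power_mult_distrib power2_eq_square[of "root_n\<^sup>2"] mult_ac)
qed

lemma codegree_sum_second_moment:
  assumes "A \<subseteq> [V]\<^bsup>2\<^esup>"
  shows "E (\<lambda>S. (\<Sum>e\<in>A. codegree V (noise S) e)\<^sup>2) \<le> (2 * (sd\<^sup>2 * root_n * sqrt (real (card A))))\<^sup>2"
proof -
  have "E (\<lambda>S. (\<Sum>e\<in>A. codegree V (noise S) e)\<^sup>2) \<le> var\<^sup>2 * (real (card A) * real (card V))"
    by (rule second_moment_codegree_le[OF finite_V singleton_notin(1) assms])
  also have "\<dots> \<le> (2 * sd\<^sup>2)\<^sup>2 * (real (card A) * root_n\<^sup>2)"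
    unfolding root_n_sq by (intro mult_right_mono var_power_le) auto
  finally show ?thesis by (simp add: power_mult_distrib mult_ac)
qed

lemma total_codegree_second_moment:
  "E (\<lambda>S. (2 * (\<Sum>e\<in>[V]\<^bsup>2\<^esup>. codegree V (noise S) e))\<^sup>2) \<le> (3 * (root_n ^ 3 * sd\<^sup>2))\<^sup>2"
proof -
  have "real (card ([V]\<^bsup>2\<^esup>)) \<le> root_n\<^sup>2 * root_n\<^sup>2 / 2"
    unfolding root_n_sq by (simp add: card_nsets finite_V real_choose_two mult_left_mono)
  then have "(2 * (sd\<^sup>2 * root_n))\<^sup>2 * real (card ([V]\<^bsup>2\<^esup>))
    \<le> (2 * (sd\<^sup>2 * root_n))\<^sup>2 * (root_n\<^sup>2 * root_n\<^sup>2 / 2)"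
    by (rule mult_left_mono) simp
  also have "\<dots> = 2 * (root_n ^ 3 * sd\<^sup>2)\<^sup>2"
    by (simp add: power_mult_distrib flip: power_mult power_add)
  finally have "(2 * (sd\<^sup>2 * root_n * sqrt (real (card ([V]\<^bsup>2\<^esup>)))))\<^sup>2 \<le> 2 * (root_n ^ 3 * sd\<^sup>2)\<^sup>2"
    by (simp add: power_mult_distrib)
  then have "4 * E (\<lambda>S. (\<Sum>e\<in>[V]\<^bsup>2\<^esup>. codegree V (noise S) e)\<^sup>2) \<le> 9 * (root_n ^ 3 * sd\<^sup>2)\<^sup>2"
    using codegree_sum_second_moment[OF order_refl] zero_le_power2[of "root_n ^ 3 * sd\<^sup>2"] by linarith
  then show ?thesis by (simp add: power_mult_distrib E_cmult)
qed

lemma reserved_wdeg_second_moment: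
  "E (\<lambda>S. (\<Sum>e\<in>reserved. pair_wdeg V (noise S) e)\<^sup>2) \<le> (4 * (real c * edge_sd))\<^sup>2"
proof -
  let ?r = "\<lambda>e. of_bool (e \<in> reserved) :: real"
  have "(\<Sum>e\<in>reserved. pair_wdeg V (noise S) e) = (\<Sum>i\<in>V. wdeg V (noise S) i * wdeg V ?r i)" for S
  proof -
    have "(\<Sum>e\<in>reserved. pair_wdeg V (noise S) e) = (\<Sum>e\<in>[V]\<^bsup>2\<^esup>. ?r e * (\<Sum>i\<in>e. wdeg V (noise S) i))"
      unfolding pair_wdeg_def using reserved_subset finite_pairs by (intro sum.mono_neutral_cong_left) auto
    then show ?thesis
      using sum_wdeg_mult[where r = ?r and w = "wdeg V (noise S)", OF finite_V] singleton_notin(2)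
      by (simp add: mult.commute[of "wdeg V (noise S) _"])
  qed
  then have "E (\<lambda>S. (\<Sum>e\<in>reserved. pair_wdeg V (noise S) e)\<^sup>2)
    \<le> 2 * var * real (card V) * (\<Sum>i\<in>V. (wdeg V ?r i)\<^sup>2)"
    using second_moment_wdeg_le[OF finite_V singleton_notin(1)] by simp
  also have "\<dots> \<le> 2 * var * real (card V) * (\<Sum>i\<in>V. (2 * real c)\<^sup>2)"
    using var_nonneg wdeg_reserved_le
    by (intro mult_left_mono sum_mono power_mono) (auto simp: wdeg_def sum_nonneg)
  also have "\<dots> = var * (8 * (real c)\<^sup>2 * (root_n\<^sup>2)\<^sup>2)"
    unfolding root_n_sq by (simp add: power2_eq_square)
  also have "\<dots> \<le> 2 * sd\<^sup>2 * (8 * (real c)\<^sup>2 * (root_n\<^sup>2)\<^sup>2)" by (intro mult_right_mono var_le) auto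
  finally show ?thesis by (simp add: power_mult_distrib mult_ac)
qed

lemma edge_group_wdeg_mean:
  "E (\<lambda>S. \<Sum>e\<in>edge_group. \<bar>pair_wdeg V (noise S) e\<bar>) \<le> 3 * (real (card edge_group) * (root_n * sd))"
proof -
  have "var * real (card V) \<le> (3 / 2 * (root_n * sd))\<^sup>2"
    using var_mult_card_le unfolding power_mult_distrib[of "3 / 2"]
    by (rule order_trans) (intro mult_right_mono; simp add: power2_eq_square)
  then have "sqrt (var * real (card V)) \<le> 3 / 2 * (root_n * sd)"
    using root_n_sd_pos(1) by (intro real_le_lsqrt) auto
  then have "2 * sqrt (var * real (card V)) \<le> 3 * (root_n * sd)" by simp
  then have "E (\<lambda>S. \<Sum>e\<in>edge_group. \<bar>pair_wdeg V (noise S) e\<bar>) \<le> (\<Sum>e\<in>edge_group. 3 * (root_n * sd))"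
    unfolding E_sum using groups_subset
    by (intro sum_mono order_trans[OF E_abs_pair_wdeg_le[OF finite_V singleton_notin(1)]]) auto
  then show ?thesis by (simp add: mult_ac)
qed

lemma triangle_sum_second_moment:
  "E (\<lambda>S. (triangle_sum V (noise S) (noise S) (noise S))\<^sup>2) \<le> (7 * (root_n ^ 3 * sd ^ 3))\<^sup>2"
proof -
  have "E (\<lambda>S. (triangle_sum V (noise S) (noise S) (noise S))\<^sup>2) \<le> 6 * var ^ 3 * real (card V) ^ 3"
    by (rule second_moment_triangle_sum_le[OF finite_V singleton_notin(1)])
  also have "\<dots> \<le> 6 * (2 * sd\<^sup>2) ^ 3 * (root_n\<^sup>2) ^ 3"
    unfolding root_n_sq by (intro mult_right_mono mult_left_mono var_power_le) auto
  also have "\<dots> = 48 * (root_n ^ 3 * sd ^ 3)\<^sup>2" by (simp add: power_mult_distrib flip: power_mult)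
  also have "\<dots> \<le> 49 * (root_n ^ 3 * sd ^ 3)\<^sup>2" by (intro mult_right_mono) auto
  finally show ?thesis by (simp add: power_mult_distrib)
qed

lemma groups_codegree_mean:
  "E (\<lambda>S. (\<Sum>e\<in>edge_group. \<bar>codegree V (noise S) e\<bar>) + (\<Sum>e\<in>degree_group. \<bar>codegree V (noise S) e\<bar>))
     \<le> 2 * ((real (card edge_group) + real (card degree_group)) * (sd\<^sup>2 * root_n))"
proof -
  have "var * sqrt (real (card V)) \<le> 2 * sd\<^sup>2 * root_n"
    unfolding root_n_def by (intro mult_right_mono var_le) auto
  then have bound: "E (\<lambda>S. \<bar>codegree V (noise S) e\<bar>) \<le> 2 * sd\<^sup>2 * root_n" if "e \<in> [V]\<^bsup>2\<^esup>" for e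
    using E_abs_codegree_le[OF finite_V singleton_notin(1) that] by linarith
  have "E (\<lambda>S. (\<Sum>e\<in>edge_group. \<bar>codegree V (noise S) e\<bar>) + (\<Sum>e\<in>degree_group. \<bar>codegree V (noise S) e\<bar>))
      \<le> (\<Sum>e\<in>edge_group. 2 * sd\<^sup>2 * root_n) + (\<Sum>e\<in>degree_group. 2 * sd\<^sup>2 * root_n)"
    unfolding E_add E_sum using groups_subset bound by (intro add_mono sum_mono) auto
  then show ?thesis by (simp add: algebra_simps)
qed

lemma card_switches_le:
  "real (card degree_switches) \<le> 80000 * edge_sd" "real (card triangle_switches) \<le> real c * edge_sd"
proof -
  have "l2 * c \<le> 4 * c\<^sup>2 * l2" "l3 * c\<^sup>2 \<le> 4 * c\<^sup>2 * l3" using c_pos by (simp_all add: power2_eq_square)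
  then have "real (card degree_switches) \<le> real (card degree_group)"
    "real (card triangle_switches) \<le> real (card triangle_group)"
    unfolding card_switches card_groups by (simp_all only: of_nat_le_iff)
  then show "real (card degree_switches) \<le> 80000 * edge_sd" "real (card triangle_switches) \<le> real c * edge_sd"
    using degree_group_size(2) card_groups_add reserved_size by linarith+
qed

lemma degree_statistic_fourth_moment:
  "E (\<lambda>S. \<Sum>t\<in>degree_switches. degree.statistic t S ^ 4) \<le> (root_n\<^sup>2 * sd\<^sup>2) ^ 4 / 20"
proof -
  let ?a = "root_n\<^sup>2 * sd\<^sup>2"
  have "(real (card V) * var)\<^sup>2 \<le> (2 * ?a)\<^sup>2"
  proof (rule power_mono)
    show "real (card V) * var \<le> 2 * ?a" using var_mult_card_le by (simp add: power_mult_distrib mult_ac)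
    show "0 \<le> real (card V) * var" by (rule mult_nonneg_nonneg[OF of_nat_0_le_iff var_nonneg])
  qed
  then have "real (card degree_switches) * (16 * (real (card V) * var)\<^sup>2) \<le> 80000 * edge_sd * (16 * (2 * ?a)\<^sup>2)"
    using card_switches_le(1) by (intro mult_mono) auto
  also have "\<dots> = 5120000 * edge_sd * ?a\<^sup>2" by (simp add: power_mult_distrib)
  also have "\<dots> \<le> ?a\<^sup>2 / 20 * ?a\<^sup>2"
  proof (rule mult_right_mono)
    have "10000000000 * edge_sd \<le> (root_n\<^sup>2 * sd ^ 3) * edge_sd"
      using root_n_sd_sq_ge root_n_sd_sq_le(1) root_n_sd_pos(2) by (intro mult_right_mono) auto
    also have "\<dots> = ?a\<^sup>2" by (simp add: power_mult_distrib eval_nat_numeral mult_ac)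
    finally show "5120000 * edge_sd \<le> ?a\<^sup>2 / 20" using root_n_sd_pos(2) by linarith
  qed simp
  also have "\<dots> = ?a ^ 4 / 20" by (simp flip: power_add)
  finally show ?thesis using degree.E_sum_statistic_fourth_le by linarith
qed

lemma triangle_statistic_fourth_moment:
  "E (\<lambda>S. \<Sum>t\<in>triangle_switches. triangle.statistic t S ^ 4) \<le> (root_n\<^sup>2 * sd\<^sup>2) ^ 4 / 20"
proof -
  let ?a = "root_n\<^sup>2 * sd\<^sup>2"
  have "real (card V) * (2 * var\<^sup>2) \<le> 8 * root_n\<^sup>2 * sd ^ 4"
    using mult_left_mono[OF var_power_le[of 2], of "2 * real (card V)"]
    unfolding root_n_sq by (simp add: power_mult_distrib mult_ac flip: power_mult)
  then have "(real (card V) * (2 * var\<^sup>2))\<^sup>2 \<le> (8 * root_n\<^sup>2 * sd ^ 4)\<^sup>2" by (intro power_mono) auto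
  then have "real (card triangle_switches) * (16 * (real (card V) * (2 * var\<^sup>2))\<^sup>2)
      \<le> real c * edge_sd * (16 * (8 * root_n\<^sup>2 * sd ^ 4)\<^sup>2)"
    using card_switches_le(2) by (intro mult_mono) auto
  also have "\<dots> = 1024 * (real c * sd) * (root_n ^ 6 * sd ^ 8)"
    by (simp add: power_mult_distrib eval_nat_numeral mult_ac)
  also have "\<dots> \<le> root_n\<^sup>2 / 20 * (root_n ^ 6 * sd ^ 8)"
  proof (rule mult_right_mono)
    have "real c * sd \<le> real c * 1" using sd_bounds by (intro mult_left_mono) auto
    then show "1024 * (real c * sd) \<le> root_n\<^sup>2 / 20" using root_n_sq_ge c_ge by linarith
  qed simp
  also have "\<dots> = ?a ^ 4 / 20" by (simp add: power_mult_distrib flip: power_mult power_add)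
  finally show ?thesis using triangle.E_sum_statistic_fourth_le by linarith
qed

definition envelope_total :: "nat \<Rightarrow> 'a set set \<Rightarrow> real" where
  "envelope_total k S = (\<Sum>H\<in>large_supports k. (\<Sum>J\<in>Pow H. envelope_sum V envelope (noise S) H J)
      / (sd\<^sup>2 * real (card V) ^ (card (\<Union>H) - 2)))"

lemma envelope_term_nonneg: "0 \<le> (\<Sum>J\<in>Pow H. envelope_sum V envelope (noise S) H J)"
  by (intro sum_nonneg envelope_sum_nonneg envelope_01)

lemma envelope_total_nonneg: "0 \<le> envelope_total k S"
  unfolding envelope_total_def by (intro sum_nonneg divide_nonneg_nonneg envelope_term_nonneg) auto

lemma E_envelope_sum_scaled_le:
  assumes H: "H \<in> large_supports k" and J: "J \<subseteq> H"
  shows "E (\<lambda>S. envelope_sum V envelope (noise S) H J)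
    \<le> (3 * real c) ^ card (\<Union>H) * sqrt (real (card (\<Union>H)) ^ card (\<Union>H) * 2 ^ card H)
        * (sd\<^sup>2 * real (card V) ^ (card (\<Union>H) - 2))"
proof -
  define y where "y = sqrt sd"
  have y: "0 < y" "y \<le> 1" "y\<^sup>2 = sd" using sd_bounds by (simp_all add: y_def)
  have sd_sq_eq_power4: "sd\<^sup>2 = y ^ 4" unfolding y(3)[symmetric] by (simp flip: power_mult)
  have "y\<^sup>2 \<le> y" using y(1,2) power_decreasing[of 1 2 y] by simp
  then have "root_n * sd \<le> root_n * y" using root_n_pos y(3) by (intro mult_left_mono) auto
  then have large: "1 \<le> root_n * y" using root_n_ge(1) c_ge by linarith
  have degree_bound: "wdeg V envelope i \<le> 3 * real c * sqrt (real (card V)) * y" for i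
  proof -
    have "3 * real c * 1 \<le> 3 * real c * (root_n * y)" using large by (intro mult_left_mono) auto
    then show ?thesis using wdeg_envelope_le[of i] by (simp add: root_n_def mult.assoc)
  qed
  have total_bound: "(\<Sum>i\<in>V. wdeg V envelope i) \<le> (3 * real c * sqrt (real (card V)) * y)\<^sup>2"
  proof -
    have "real c * edge_sd \<le> (real c)\<^sup>2 * edge_sd" using c_ge root_n_sd_pos by (intro mult_right_mono) auto
    moreover have "0 \<le> (real c)\<^sup>2 * edge_sd" using root_n_sd_pos by simp
    ultimately have "(\<Sum>i\<in>V. wdeg V envelope i) \<le> 9 * ((real c)\<^sup>2 * edge_sd)"
      using sum_wdeg_envelope_le reserved_size by linarith
    then show ?thesis using y(3) by (simp add: power_mult_distrib root_n_def mult_ac)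
  qed
  have "real (card V) \<noteq> 0" using vertices_large by linarith
  then have V: "1 \<le> card V" by (simp add: Suc_le_eq)
  show ?thesis
    unfolding sd_sq_eq_power4
    by (rule E_envelope_sum_le_scaled)
      (use finite_V V envelope_01 y c_ge var_le sd_sq_eq_power4 degree_bound total_bound
        large_supportsD[OF H] J in auto)
qed

lemma E_envelope_total_le: "E (envelope_total k) \<le> envelope_const k c"
proof -
  have "E (envelope_total k) = (\<Sum>H\<in>large_supports k. (\<Sum>J\<in>Pow H. E (\<lambda>S. envelope_sum V envelope (noise S) H J))
      / (sd\<^sup>2 * real (card V) ^ (card (\<Union>H) - 2)))"
    unfolding envelope_total_def by (simp only: E_sum E_cdiv)
  also have "\<dots> \<le> (\<Sum>H\<in>large_supports k. \<Sum>J\<in>Pow H. (3 * real c) ^ card (\<Union>H)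
      * sqrt (real (card (\<Union>H)) ^ card (\<Union>H) * 2 ^ card H))"
  proof (rule sum_mono)
    fix H assume H: "H \<in> large_supports k"
    let ?d = "sd\<^sup>2 * real (card V) ^ (card (\<Union>H) - 2)"
    have "0 < real (card V)" using root_n_sq root_n_pos by (metis zero_less_power)
    then have d: "0 < ?d" using sd_bounds(1) by simp
    have "(\<Sum>J\<in>Pow H. E (\<lambda>S. envelope_sum V envelope (noise S) H J))
        \<le> (\<Sum>J\<in>Pow H. (3 * real c) ^ card (\<Union>H) * sqrt (real (card (\<Union>H)) ^ card (\<Union>H) * 2 ^ card H) * ?d)"
      using E_envelope_sum_scaled_le[OF H] by (intro sum_mono) auto
    then show "(\<Sum>J\<in>Pow H. E (\<lambda>S. envelope_sum V envelope (noise S) H J)) / ?d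
        \<le> (\<Sum>J\<in>Pow H. (3 * real c) ^ card (\<Union>H) * sqrt (real (card (\<Union>H)) ^ card (\<Union>H) * 2 ^ card H))"
      unfolding sum_distrib_right[symmetric] using d by (simp only: pos_divide_le_eq)
  qed
  also have "\<dots> \<le> envelope_const k c" unfolding envelope_const_def by simp
  finally show ?thesis .
qed

text \<open>Each penalty comes with the largest value tolerated in a typical outcome.\<close>

definition penalties :: "nat \<Rightarrow> (('a set set \<Rightarrow> real) \<times> real) list" where
  "penalties k =
     [(\<lambda>S. (\<Sum>e\<in>free_pairs. noise S e)\<^sup>2, (5 * edge_sd)\<^sup>2),
      (\<lambda>S. (2 * (\<Sum>e\<in>[V]\<^bsup>2\<^esup>. codegree V (noise S) e))\<^sup>2, (15 * (root_n ^ 3 * sd\<^sup>2))\<^sup>2),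
      (\<lambda>S. (\<Sum>e\<in>reserved. pair_wdeg V (noise S) e)\<^sup>2, (20 * (real c * edge_sd))\<^sup>2),
      (\<lambda>S. \<Sum>e\<in>edge_group. \<bar>pair_wdeg V (noise S) e\<bar>, 60 * (real (card edge_group) * (root_n * sd))),
      (\<lambda>S. (triangle_sum V (noise S) (noise S) (noise S))\<^sup>2, (35 * (root_n ^ 3 * sd ^ 3))\<^sup>2),
      (\<lambda>S. (\<Sum>e\<in>reserved. codegree V (noise S) e)\<^sup>2, (10 * (sd\<^sup>2 * root_n * sqrt (real (card reserved))))\<^sup>2),
      (\<lambda>S. (\<Sum>e\<in>edge_group. \<bar>codegree V (noise S) e\<bar>) + (\<Sum>e\<in>degree_group. \<bar>codegree V (noise S) e\<bar>),
        40 * ((real (card edge_group) + real (card degree_group)) * (sd\<^sup>2 * root_n))),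
      (\<lambda>S. ((\<Sum>t\<in>degree_switches. \<bar>degree.statistic t S\<bar>)
        / E (\<lambda>S. \<Sum>t\<in>degree_switches. \<bar>degree.statistic t S\<bar>) - 1)\<^sup>2, 1 / 4),
      (\<lambda>S. ((\<Sum>t\<in>triangle_switches. \<bar>triangle.statistic t S\<bar>)
        / E (\<lambda>S. \<Sum>t\<in>triangle_switches. \<bar>triangle.statistic t S\<bar>) - 1)\<^sup>2, 1 / 4),
      (\<lambda>S. \<Sum>t\<in>degree_switches. degree.statistic t S ^ 4, (root_n\<^sup>2 * sd\<^sup>2) ^ 4),
      (\<lambda>S. \<Sum>t\<in>triangle_switches. triangle.statistic t S ^ 4, (root_n\<^sup>2 * sd\<^sup>2) ^ 4),
      (\<lambda>S. envelope_total k S, 20 * envelope_const k c)]"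

lemma groups_pos: "0 < real (card reserved)" "0 < real (card edge_group)"
  using card_groups_add edge_group_size(1) root_n_sd_pos(2) by linarith+

lemma penalties_pos: "(f, w) \<in> set (penalties k) \<Longrightarrow> 0 < w \<and> 0 \<le> f S"
  unfolding penalties_def
  using root_n_pos sd_bounds(1) c_pos groups_pos envelope_const_pos[of k c] envelope_total_nonneg
  by (auto intro!: sum_nonneg mult_pos_pos add_pos_nonneg add_nonneg_nonneg)

lemma penalties_total: "(\<Sum>(f, w)\<leftarrow>penalties k. E f / w) < 1"
proof -
  have "(\<Sum>(f, w)\<leftarrow>penalties k. E f / w) \<le> 1 / 25 + (1 / 25 + (1 / 25 + (1 / 20 + (1 / 25 + (1 / 25 + (1 / 20
      + (1 / 20 + (1 / 20 + (1 / 20 + (1 / 20 + (1 / 20 + 0)))))))))))"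
    unfolding penalties_def list.map sum_list.Cons sum_list.Nil prod.case
    using root_n_pos sd_bounds(1) c_pos groups_pos envelope_const_pos[of k c]
      degree.sum_abs_statistic_concentrated
      triangle.sum_abs_statistic_concentrated degree_statistic_fourth_moment triangle_statistic_fourth_moment
    by (intro add_mono order_refl divide_scaled_sq_le[OF free_sum_second_moment]
        divide_scaled_sq_le[OF total_codegree_second_moment] divide_scaled_sq_le[OF reserved_wdeg_second_moment]
        divide_mult_le[OF edge_group_wdeg_mean] divide_scaled_sq_le[OF triangle_sum_second_moment]
        divide_scaled_sq_le[OF codegree_sum_second_moment[OF reserved_subset]]
        divide_mult_le[OF groups_codegree_mean] divide_mult_le[OF E_envelope_total_le])
      (auto simp: divide_le_eq intro!: mult_pos_pos add_pos_nonneg)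
  then show ?thesis by simp
qed

definition typical :: "nat \<Rightarrow> 'a set set \<Rightarrow> bool" where
  "typical k S \<longleftrightarrow> (\<forall>(f, w)\<in>set (penalties k). f S \<le> w)"

lemma ex_typical: "\<exists>S\<subseteq>free_pairs. typical k S"
  unfolding typical_def using penalties_pos penalties_total by (rule ex_all_le_of_sum_E_less_1)

lemma typicalD: "typical k S \<Longrightarrow> (f, w) \<in> set (penalties k) \<Longrightarrow> f S \<le> w"
  unfolding typical_def by auto

lemma typical_sq_D:
  assumes "typical k S" "(\<lambda>S. (f S)\<^sup>2, w\<^sup>2) \<in> set (penalties k)" "0 \<le> w"
  shows "\<bar>f S\<bar> \<le> w"
  using typicalD[OF assms(1,2)] assms(3) by (simp add: power2_le_iff_abs_le)

lemma typical_sums: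
  assumes S: "typical k S"
  shows "\<bar>\<Sum>e\<in>free_pairs. noise S e\<bar> \<le> 5 * edge_sd"
    "\<bar>2 * (\<Sum>e\<in>[V]\<^bsup>2\<^esup>. codegree V (noise S) e)\<bar> \<le> 15 * (root_n ^ 3 * sd\<^sup>2)"
    "\<bar>\<Sum>e\<in>reserved. pair_wdeg V (noise S) e\<bar> \<le> 20 * (real c * edge_sd)"
    "(\<Sum>e\<in>edge_group. \<bar>pair_wdeg V (noise S) e\<bar>) \<le> 60 * (real (card edge_group) * (root_n * sd))"
    "\<bar>triangle_sum V (noise S) (noise S) (noise S)\<bar> \<le> 35 * (root_n ^ 3 * sd ^ 3)"
    "\<bar>\<Sum>e\<in>reserved. codegree V (noise S) e\<bar> \<le> 10 * (sd\<^sup>2 * root_n * sqrt (real (card reserved)))"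
    "(\<Sum>e\<in>edge_group. \<bar>codegree V (noise S) e\<bar>) + (\<Sum>e\<in>degree_group. \<bar>codegree V (noise S) e\<bar>)
      \<le> 40 * ((real (card edge_group) + real (card degree_group)) * (sd\<^sup>2 * root_n))"
proof -
  note pos = root_n_pos sd_bounds(1)
  show "\<bar>\<Sum>e\<in>free_pairs. noise S e\<bar> \<le> 5 * edge_sd"
    by (rule typical_sq_D[OF S]) (use pos in \<open>simp_all add: penalties_def\<close>)
  show "\<bar>2 * (\<Sum>e\<in>[V]\<^bsup>2\<^esup>. codegree V (noise S) e)\<bar> \<le> 15 * (root_n ^ 3 * sd\<^sup>2)"
    by (rule typical_sq_D[OF S]) (use pos in \<open>simp_all add: penalties_def\<close>)
  show "\<bar>\<Sum>e\<in>reserved. pair_wdeg V (noise S) e\<bar> \<le> 20 * (real c * edge_sd)"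
    by (rule typical_sq_D[OF S]) (use pos in \<open>simp_all add: penalties_def\<close>)
  show "(\<Sum>e\<in>edge_group. \<bar>pair_wdeg V (noise S) e\<bar>) \<le> 60 * (real (card edge_group) * (root_n * sd))"
    by (rule typicalD[OF S]) (simp add: penalties_def)
  show "\<bar>triangle_sum V (noise S) (noise S) (noise S)\<bar> \<le> 35 * (root_n ^ 3 * sd ^ 3)"
    by (rule typical_sq_D[OF S]) (use pos in \<open>simp_all add: penalties_def\<close>)
  show "\<bar>\<Sum>e\<in>reserved. codegree V (noise S) e\<bar> \<le> 10 * (sd\<^sup>2 * root_n * sqrt (real (card reserved)))"
    by (rule typical_sq_D[OF S]) (use pos in \<open>simp_all add: penalties_def\<close>)
  show "(\<Sum>e\<in>edge_group. \<bar>codegree V (noise S) e\<bar>) + (\<Sum>e\<in>degree_group. \<bar>codegree V (noise S) e\<bar>)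
      \<le> 40 * ((real (card edge_group) + real (card degree_group)) * (sd\<^sup>2 * root_n))"
    by (rule typicalD[OF S]) (simp add: penalties_def)
qed

lemma typical_degree_capacity:
  assumes S: "typical k S"
  shows "2625 * (root_n ^ 3 * sd\<^sup>2) \<le> 2 * real c * (\<Sum>t\<in>degree_switches. \<bar>twin_wdeg_diff (noise S) t\<bar>)"
proof -
  let ?T = "real (card degree_switches)" and ?capacity = "\<Sum>t\<in>degree_switches. \<bar>degree.statistic t S\<bar>"
  have "(root_n * sd)\<^sup>2 / 2 \<le> real (card V) * var"
    using statistic_variance_ge(1) by (simp add: power_mult_distrib)
  then have "?T * (21 / 160 * (root_n * sd)) \<le> ?capacity"
    by (intro degree.sum_abs_statistic_ge typicalD[OF S, where f = "\<lambda>S. (_ S / _ - 1)\<^sup>2"])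
      (simp_all add: penalties_def)
  from mult_left_mono[OF this, of "2 * real c"]
  have capacity: "real c * ?T * (21 / 80 * (root_n * sd)) \<le> 2 * real c * ?capacity" by (simp add: mult_ac)
  have "real c * ?T = real (card degree_group) / 4" by (simp add: card_groups card_switches power2_eq_square)
  then have "10000 * edge_sd \<le> real c * ?T" using degree_group_size(1) by linarith
  then have "10000 * edge_sd * (21 / 80 * (root_n * sd)) \<le> real c * ?T * (21 / 80 * (root_n * sd))"
    using root_n_sd_pos(1) by (intro mult_right_mono) auto
  moreover have "10000 * edge_sd * (21 / 80 * (root_n * sd)) = 2625 * (root_n ^ 3 * sd\<^sup>2)"
    by (simp add: eval_nat_numeral)
  ultimately have "2625 * (root_n ^ 3 * sd\<^sup>2) \<le> 2 * real c * ?capacity" using capacity by linarith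
  then show ?thesis by (simp add: twin_diff_statistic)
qed

lemma typical_triangle_capacity:
  assumes S: "typical k S"
  shows "39375000 * (root_n ^ 3 * sd ^ 3) \<le> 3 * (\<Sum>t\<in>triangle_switches. \<bar>twin_codegree_diff (noise S) t\<bar>)"
proof -
  let ?T = "real (card triangle_switches)" and ?capacity = "\<Sum>t\<in>triangle_switches. \<bar>triangle.statistic t S\<bar>"
  have "(root_n * sd\<^sup>2)\<^sup>2 / 2 \<le> real (card V) * (2 * var\<^sup>2)"
    using statistic_variance_ge(2) by (simp add: power_mult_distrib flip: power_mult)
  then have "?T * (21 / 160 * (root_n * sd\<^sup>2)) \<le> ?capacity"
    by (intro triangle.sum_abs_statistic_ge typicalD[OF S, where f = "\<lambda>S. (_ S / _ - 1)\<^sup>2"])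
      (simp_all add: penalties_def)
  then have capacity: "?T * (63 / 160 * (root_n * sd\<^sup>2)) \<le> 3 * ?capacity" by linarith
  have "?T = real (card triangle_group) / 4" by (simp add: card_groups card_switches)
  then have "100000000 * edge_sd \<le> ?T" using triangle_group_size by linarith
  then have "100000000 * edge_sd * (63 / 160 * (root_n * sd\<^sup>2)) \<le> ?T * (63 / 160 * (root_n * sd\<^sup>2))"
    using root_n_pos by (intro mult_right_mono) auto
  moreover have "100000000 * edge_sd * (63 / 160 * (root_n * sd\<^sup>2)) = 39375000 * (root_n ^ 3 * sd ^ 3)"
    by (simp add: eval_nat_numeral)
  ultimately have "39375000 * (root_n ^ 3 * sd ^ 3) \<le> 3 * ?capacity" using capacity by linarith
  then show ?thesis by (simp add: twin_diff_statistic)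
qed

lemma typical_twin_diffs:
  assumes S: "typical k S"
  shows "t \<in> degree_switches \<Longrightarrow> \<bar>twin_wdeg_diff (noise S) t\<bar> \<le> root_n\<^sup>2 * sd\<^sup>2"
    and "s \<in> triangle_switches \<Longrightarrow> \<bar>twin_codegree_diff (noise S) s\<bar> \<le> root_n\<^sup>2 * sd\<^sup>2"
proof -
  have "(\<Sum>t\<in>degree_switches. degree.statistic t S ^ 4) \<le> (root_n\<^sup>2 * sd\<^sup>2) ^ 4"
    by (rule typicalD[OF S, where f = "\<lambda>S. sum (\<lambda>t. _ t S ^ 4) _"]) (simp add: penalties_def)
  then show "t \<in> degree_switches \<Longrightarrow> \<bar>twin_wdeg_diff (noise S) t\<bar> \<le> root_n\<^sup>2 * sd\<^sup>2"
    using abs_le_of_sum_power4_le[OF finite_switches(1), of t "\<lambda>t. degree.statistic t S"]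
    by (simp add: twin_diff_statistic)
  have "(\<Sum>t\<in>triangle_switches. triangle.statistic t S ^ 4) \<le> (root_n\<^sup>2 * sd\<^sup>2) ^ 4"
    by (rule typicalD[OF S, where f = "\<lambda>S. sum (\<lambda>t. _ t S ^ 4) _"]) (simp add: penalties_def)
  then show "s \<in> triangle_switches \<Longrightarrow> \<bar>twin_codegree_diff (noise S) s\<bar> \<le> root_n\<^sup>2 * sd\<^sup>2"
    using abs_le_of_sum_power4_le[OF finite_switches(2), of s "\<lambda>s. triangle.statistic s S"]
    by (simp add: twin_diff_statistic)
qed

lemma lower_order_bounds:
  "100000 * ((real c)\<^sup>2 * edge_sd) \<le> root_n ^ 3 * sd\<^sup>2" "100000 * ((real c)\<^sup>2 * edge_sd) \<le> root_n ^ 3 * sd ^ 3"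
  "real c * edge_sd \<le> (real c)\<^sup>2 * edge_sd" "edge_sd \<le> (real c)\<^sup>2 * edge_sd"
  "real c * real (card reserved) \<le> (real c)\<^sup>2 * edge_sd"
proof -
  have nonneg: "0 \<le> edge_sd" using root_n_sd_pos by simp
  show "100000 * ((real c)\<^sup>2 * edge_sd) \<le> root_n ^ 3 * sd\<^sup>2"
    using mult_left_mono[OF root_n_ge(1) nonneg] by (simp add: eval_nat_numeral mult_ac)
  show "100000 * ((real c)\<^sup>2 * edge_sd) \<le> root_n ^ 3 * sd ^ 3"
    using mult_left_mono[OF size nonneg] by (simp add: eval_nat_numeral mult_ac)
  show "real c * edge_sd \<le> (real c)\<^sup>2 * edge_sd" "edge_sd \<le> (real c)\<^sup>2 * edge_sd"
    using mult_right_mono[OF c_ge(2) nonneg] mult_right_mono[OF c_ge(3) nonneg] by simp_all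
  show "real c * real (card reserved) \<le> (real c)\<^sup>2 * edge_sd"
    using mult_left_mono[OF reserved_size, of "real c"] by (simp add: power2_eq_square mult_ac)
qed

lemma typical_degree_error:
  assumes S: "typical k S"
  shows "outcome.degree_error S \<le> 2 * real c * (\<Sum>t\<in>degree_switches. \<bar>twin_wdeg_diff (noise S) t\<bar>)"
proof -
  note sums = typical_sums[OF S]
  have "real (card edge_group) * (root_n * sd) \<le> 24 * edge_sd * (root_n * sd)"
    using edge_group_size(2) root_n_sd_pos(1) by (intro mult_right_mono) auto
  also have "\<dots> = 24 * (root_n ^ 3 * sd\<^sup>2)" by (simp add: eval_nat_numeral mult_ac)
  finally have "(\<Sum>e\<in>edge_group. \<bar>pair_wdeg V (noise S) e\<bar>) \<le> 1440 * (root_n ^ 3 * sd\<^sup>2)"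
    using sums(4) by linarith
  moreover have "real c * \<bar>\<Sum>e\<in>free_pairs. noise S e\<bar> \<le> 5 * ((real c)\<^sup>2 * edge_sd)"
    using mult_left_mono[OF sums(1), of "real c"] lower_order_bounds(3) by simp
  ultimately have "outcome.degree_error S \<le> 2625 * (root_n ^ 3 * sd\<^sup>2)"
    unfolding outcome.degree_error_def using sums(1-3) lower_order_bounds reserved_size
    by linarith
  then show ?thesis using typical_degree_capacity[OF S] by (rule order_trans)
qed

lemma typical_density_codegree:
  assumes S: "typical k S"
  shows "\<bar>\<pi> - p\<bar> * \<bar>2 * (\<Sum>e\<in>[V]\<^bsup>2\<^esup>. codegree V (noise S) e)\<bar> \<le> root_n ^ 3 * sd ^ 3"
proof -
  have "\<bar>\<pi> - p\<bar> * \<bar>2 * (\<Sum>e\<in>[V]\<^bsup>2\<^esup>. codegree V (noise S) e)\<bar> \<le> \<bar>\<pi> - p\<bar> * (15 * (root_n ^ 3 * sd\<^sup>2))"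
    by (intro mult_left_mono typical_sums(2)[OF S]) auto
  also have "\<dots> = (real (card V) * \<bar>\<pi> - p\<bar>) * (15 * (root_n * sd\<^sup>2))"
    unfolding root_n_sq[symmetric] by (simp add: eval_nat_numeral mult_ac)
  also have "\<dots> \<le> real c * (15 * (root_n * sd\<^sup>2))"
    using density_close root_n_pos by (intro mult_right_mono) auto
  also have "\<dots> = 15 * real c * (root_n * sd\<^sup>2)" by simp
  also have "\<dots> \<le> (root_n\<^sup>2 * sd) * (root_n * sd\<^sup>2)"
  proof (rule mult_right_mono)
    show "15 * real c \<le> edge_sd" using edge_sd_ge(2) c_ge by linarith
  qed (use root_n_pos in simp)
  also have "\<dots> = root_n ^ 3 * sd ^ 3" by (simp add: eval_nat_numeral mult_ac)
  finally show ?thesis .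
qed

lemma typical_reserved_codegree:
  assumes S: "typical k S"
  shows "\<bar>\<Sum>e\<in>reserved. codegree V (noise S) e\<bar> \<le> root_n ^ 3 * sd ^ 3"
proof -
  have "100 * real c \<le> edge_sd" using edge_sd_ge(2) c_ge by linarith
  then have "100 * real c * edge_sd \<le> edge_sd * edge_sd" using root_n_sd_pos(2) by (intro mult_right_mono) auto
  then have "real (card reserved) \<le> (edge_sd / 10)\<^sup>2"
    using reserved_size by (simp add: power_divide power2_eq_square[of edge_sd])
  then have root: "sqrt (real (card reserved)) \<le> edge_sd / 10"
    using root_n_sd_pos(2) by (intro real_le_lsqrt) auto
  have "10 * (sd\<^sup>2 * root_n * sqrt (real (card reserved))) \<le> 10 * (sd\<^sup>2 * root_n * (edge_sd / 10))"
    using root root_n_pos by (intro mult_left_mono) auto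
  also have "\<dots> = root_n ^ 3 * sd ^ 3" by (simp add: eval_nat_numeral mult_ac)
  finally show ?thesis using typical_sums(6)[OF S] by linarith
qed

lemma typical_triangle_error:
  assumes S: "typical k S"
  shows "outcome.triangle_error S \<le> 3 * (\<Sum>t\<in>triangle_switches. \<bar>twin_codegree_diff (noise S) t\<bar>)"
proof -
  have "(real (card edge_group) + real (card degree_group)) * (sd\<^sup>2 * root_n)
    \<le> 80024 * edge_sd * (sd\<^sup>2 * root_n)"
    using edge_group_size(2) degree_group_size(2) root_n_pos by (intro mult_right_mono) auto
  also have "\<dots> = 80024 * (root_n ^ 3 * sd ^ 3)" by (simp add: eval_nat_numeral mult_ac)
  finally have groups: "(\<Sum>e\<in>edge_group. \<bar>codegree V (noise S) e\<bar>) + (\<Sum>e\<in>degree_group. \<bar>codegree V (noise S) e\<bar>)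
      \<le> 3200960 * (root_n ^ 3 * sd ^ 3)" using typical_sums(7)[OF S] by linarith
  have "outcome.triangle_error S
    \<le> 35 * (root_n ^ 3 * sd ^ 3) + 3 * (root_n ^ 3 * sd ^ 3) + 3 * (root_n ^ 3 * sd ^ 3)
      + 3 * (3200960 * (root_n ^ 3 * sd ^ 3)) + 36 * ((real c)\<^sup>2 * edge_sd)"
    unfolding outcome.triangle_error_def
    using typical_sums(5)[OF S] typical_density_codegree[OF S] typical_reserved_codegree[OF S]
      groups lower_order_bounds(5)
    by (intro add_mono mult_left_mono) auto
  also have "\<dots> \<le> 39375000 * (root_n ^ 3 * sd ^ 3)"
    using lower_order_bounds(2) root_n_sd_pos(3)[of 3 3] by linarith
  finally have "outcome.triangle_error S \<le> 39375000 * (root_n ^ 3 * sd ^ 3)" .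
  then show ?thesis using typical_triangle_capacity[OF S] by (rule order_trans)
qed

lemma typical_large_supports:
  assumes S: "typical k S" and H: "H \<in> large_supports k"
  shows "\<bar>inj_sum V (outcome.alpha S F) (\<Union>H) H\<bar>
    \<le> 20 * envelope_const k c * (sd\<^sup>2 * real (card V) ^ (card (\<Union>H) - 2))"
proof -
  let ?term = "\<lambda>H. \<Sum>J\<in>Pow H. envelope_sum V envelope (noise S) H J"
  let ?d = "sd\<^sup>2 * real (card V) ^ (card (\<Union>H) - 2)"
  have "0 < real (card V)" using root_n_sq root_n_pos by (metis zero_less_power)
  then have d: "0 < ?d" using sd_bounds(1) by simp
  have bound: "\<bar>inj_sum V (outcome.alpha S F) (\<Union>H) H\<bar> \<le> ?term H"
    unfolding outcome.alpha_def[abs_def]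
    using finite_V large_supportsD[OF H] abs_perturbation_le by (intro abs_inj_sum_le_envelope_sum) auto
  have "?term H / ?d \<le> envelope_total k S"
    unfolding envelope_total_def
    by (rule member_le_sum[OF H, of "\<lambda>H. ?term H / (sd\<^sup>2 * real (card V) ^ (card (\<Union>H) - 2))"])
      (intro divide_nonneg_nonneg envelope_term_nonneg, simp_all add: finite_large_supports)
  also have "envelope_total k S \<le> 20 * envelope_const k c"
    by (rule typicalD[OF S, where f = "envelope_total k"]) (simp add: penalties_def)
  finally have "?term H \<le> 20 * envelope_const k c * ?d" using d by (simp only: pos_divide_le_eq)
  with bound show ?thesis by (rule order_trans)
qed

end

section \<open>The graph of a typical outcome\<close>

definition balanced_statistics :: "nat \<Rightarrow> real \<Rightarrow> real \<Rightarrow> 'a graph \<Rightarrow> bool" where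
  "balanced_statistics k L p G \<longleftrightarrow>
     real (card (edges G)) = of_int (round (p * real (card (verts G) choose 2)))
     \<and> \<bar>(\<Sum>i\<in>verts G. (wdeg (verts G) (centered G p) i)\<^sup>2)
           - p * (1 - p) * real (card (verts G)) * (real (card (verts G)) - 1)\<bar>
         \<le> L * (p * (1 - p) * real (card (verts G)))
     \<and> \<bar>triangle_sum (verts G) (centered G p) (centered G p) (centered G p)\<bar>
         \<le> L * (p * (1 - p) * real (card (verts G)))
     \<and> (\<forall>H\<in>large_supports k. \<bar>inj_sum (verts G) (centered G p) (\<Union>H) H\<bar>
         \<le> L * (p * (1 - p) * real (card (verts G)) ^ (card (\<Union>H) - 2)))"

context gadget_scaled
begin

lemma centered_eq_alpha:
  assumes "S \<subseteq> free_pairs" "F \<subseteq> reserved"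
  shows "centered (V, S \<union> F) p = outcome.alpha S F"
proof
  fix e
  have "e \<in> [V]\<^bsup>2\<^esup> \<longleftrightarrow> e \<in> free_pairs \<or> e \<in> reserved" "e \<in> free_pairs \<Longrightarrow> e \<notin> reserved" using free_reserved by auto
  then show "centered (V, S \<union> F) p e = outcome.alpha S F e"
    using assms by (auto simp: outcome.alpha_def perturbation_def centered_def noise_def of_bool_def)
qed

lemma card_outcome:
  assumes "S \<subseteq> free_pairs"
  shows "real (card S) = (\<Sum>e\<in>free_pairs. noise S e) + \<pi> * real (card free_pairs)"
proof -
  have "(\<Sum>e\<in>free_pairs. noise S e) = (\<Sum>e\<in>free_pairs. of_bool (e \<in> S)) - \<pi> * real (card free_pairs)"
    by (simp add: noise_def sum_subtractf)
  moreover have "(\<Sum>e\<in>free_pairs. of_bool (e \<in> S) :: real) = (\<Sum>e\<in>S. 1)"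
    using assms finite_free_pairs by (intro sum.mono_neutral_cong_right) auto
  ultimately show ?thesis by simp
qed

text \<open>The number of edges still missing lies within the capacity of the edge group.\<close>

lemma ex_edge_group_count:
  assumes S: "typical k S" "S \<subseteq> free_pairs"
  obtains m where "m \<le> card edge_group"
    "real (card S) + real m + 2 * (real c)\<^sup>2 * real l2 + 2 * (real c)\<^sup>2 * real l3
      = of_int (round (p * real (card V choose 2)))"
proof -
  define target where "target = round (p * real (card V choose 2))"
  define missing where "missing = target - int (card S) - 2 * int c ^ 2 * int l2 - 2 * int c ^ 2 * int l3"
  have "real (card V choose 2) = real (card free_pairs) + real (card reserved)"
    using card_free_reserved by (simp add: real_choose_two)
  then have "p * real (card V choose 2) = \<pi> * real (card free_pairs) + real (card reserved) / 2"
    using balanced by (simp add: algebra_simps)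
  moreover have "real_of_int missing
    = of_int target - real (card S) - real (card degree_group) / 2 - real (card triangle_group) / 2"
    by (simp add: missing_def card_groups)
  ultimately have missing: "real_of_int missing
      = (of_int target - p * real (card V choose 2)) - (\<Sum>e\<in>free_pairs. noise S e) + real (card edge_group) / 2"
    using card_outcome[OF S(2)] card_groups_add by linarith
  moreover have "\<bar>of_int target - p * real (card V choose 2)\<bar> \<le> 1 / 2"
    unfolding target_def by (rule of_int_round_abs_le)
  ultimately have "0 \<le> real_of_int missing" "real_of_int missing \<le> real (card edge_group)"
    using typical_sums(1)[OF S(1)] edge_group_size(1) edge_sd_ge_100000 by linarith+
  then have "nat missing \<le> card edge_group" "real (nat missing) = real_of_int missing" by linarith+
  then show ?thesis using that[of "nat missing"] by (simp add: missing_def target_def)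
qed

lemma switch_slack:
  fixes M :: real
  defines "M \<equiv> root_n\<^sup>2 * sd\<^sup>2"
  shows "4 * real c * (M + 6 * real c) + 8 * (real c)\<^sup>2 \<le> 5 * real c * M" "6 * (M + 24 * real c) + 256 \<le> 7 * M"
proof -
  have "1 \<le> root_n * sd" using root_n_ge(1) c_ge by linarith
  then have "root_n * sd \<le> M" using self_le_power[of "root_n * sd" 2] by (simp add: M_def power_mult_distrib)
  then have M_large: "100000 \<le> M" "1000 * real c \<le> M" using root_n_ge(1) c_ge by linarith+
  then have "real c * (32 * real c) \<le> real c * M" by (intro mult_left_mono) auto
  then show "4 * real c * (M + 6 * real c) + 8 * (real c)\<^sup>2 \<le> 5 * real c * M"
    by (simp add: power2_eq_square algebra_simps)
  show "6 * (M + 24 * real c) + 256 \<le> 7 * M" using M_large unfolding distrib_left by linarith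
qed

lemma ex_balanced_statistics:
  "\<exists>G. simple_graph G \<and> verts G = V \<and> balanced_statistics k (5 * real c + 7 + 20 * envelope_const k c) p G"
proof -
  let ?M = "root_n\<^sup>2 * sd\<^sup>2"
  obtain S where S: "S \<subseteq> free_pairs" "typical k S" using ex_typical by blast
  obtain m where m: "m \<le> card edge_group"
    "real (card S) + real m + 2 * (real c)\<^sup>2 * real l2 + 2 * (real c)\<^sup>2 * real l3
      = of_int (round (p * real (card V choose 2)))"
    using ex_edge_group_count[OF S(2,1)] by blast
  have "0 \<le> ?M" by simp
  then obtain F where F: "F \<subseteq> reserved"
    "real (card F) = real m + 2 * (real c)\<^sup>2 * real l2 + 2 * (real c)\<^sup>2 * real l3"
    "\<bar>(\<Sum>i\<in>V. (wdeg V (outcome.alpha S F) i)\<^sup>2) - p * (1 - p) * real (card V) * (real (card V) - 1)\<bar>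
      \<le> 4 * real c * (?M + 6 * real c) + 8 * (real c)\<^sup>2"
    "\<bar>triangle_sum V (outcome.alpha S F) (outcome.alpha S F) (outcome.alpha S F)\<bar>
      \<le> 6 * (?M + 24 * real c) + 256"
    using outcome.ex_configuration[OF m(1) _ _ typical_twin_diffs[OF S(2)] typical_degree_error[OF S(2)]
        typical_triangle_error[OF S(2)]] by blast
  let ?L = "5 * real c + 7 + 20 * envelope_const k c"
  have M: "p * (1 - p) * real (card V) = ?M" by (simp add: sd_sq root_n_sq)
  have L: "5 * real c * ?M \<le> ?L * ?M" "7 * ?M \<le> ?L * ?M" "0 \<le> z \<Longrightarrow> 20 * envelope_const k c * z \<le> ?L * z" for z
    using envelope_const_pos[of k c] by (auto intro!: mult_right_mono)
  have edges: "S \<union> F \<subseteq> [V]\<^bsup>2\<^esup>" "S \<inter> F = {}" using S(1) F(1) free_reserved by auto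
  have "finite S" "finite F" using edges(1) finite_pairs finite_subset by auto
  then have "real (card (S \<union> F)) = of_int (round (p * real (card V choose 2)))"
    using F(2) m(2) edges(2) by (simp add: card_Un_disjoint)
  moreover have "\<bar>inj_sum V (outcome.alpha S F) (\<Union>H) H\<bar> \<le> ?L * (p * (1 - p) * real (card V) ^ (card (\<Union>H) - 2))"
    if "H \<in> large_supports k" for H
    using typical_large_supports[OF S(2) that, of F, unfolded sd_sq]
  proof (rule order_trans)
    have "0 \<le> p * (1 - p) * real (card V) ^ (card (\<Union>H) - 2)" using p_01 by simp
    then show "20 * envelope_const k c * (p * (1 - p) * real (card V) ^ (card (\<Union>H) - 2))
        \<le> ?L * (p * (1 - p) * real (card V) ^ (card (\<Union>H) - 2))" by (rule L(3))
  qed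
  ultimately have "balanced_statistics k ?L p (V, S \<union> F)"
    using order_trans[OF F(3) order_trans[OF switch_slack(1) L(1)]]
      order_trans[OF F(4) order_trans[OF switch_slack(2) L(2)]]
    unfolding balanced_statistics_def fst_conv snd_conv centered_eq_alpha[OF S(1) F(1)] M[symmetric]
    by (intro conjI ballI)
  moreover have "simple_graph (V, S \<union> F)" using edges(1) finite_V by (simp add: simple_graph_def)
  ultimately show ?thesis by (intro exI[of _ "(V, S \<union> F)"]) simp
qed

end

section \<open>Existence of gadgets\<close>

lemma ex_block_count:
  fixes \<nu> w K :: real
  assumes "1 \<le> w" "w \<le> \<nu>" "1 \<le> K"
  obtains l :: nat where "K * \<nu> \<le> w * real l" "w * real l \<le> 2 * K * \<nu>"
proof
  let ?l = "nat \<lceil>K * \<nu> / w\<rceil>"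
  have nonneg: "0 \<le> K * \<nu> / w" using assms by simp
  have l: "K * \<nu> / w \<le> real ?l" "real ?l \<le> K * \<nu> / w + 1" using nonneg by linarith+
  show "K * \<nu> \<le> w * real ?l" using l(1) assms(1) by (simp add: field_simps)
  have "w * real ?l \<le> w * (K * \<nu> / w + 1)" using l(2) assms(1) by (intro mult_left_mono) auto
  also have "\<dots> = K * \<nu> + w" using assms(1) by (simp add: field_simps)
  also have "w \<le> K * \<nu>" using mult_mono[OF assms(3,2)] assms by simp
  finally show "w * real ?l \<le> 2 * K * \<nu>" by simp
qed

fun interval_vert :: "nat \<Rightarrow> nat \<times> bool \<times> nat \<times> bool \<Rightarrow> nat" where
  "interval_vert c (B, side, x, \<sigma>) = 4 * c * B + (2 * c * of_bool side + (2 * x + of_bool \<sigma>))"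

lemma interval_offset_less:
  fixes x c :: nat
  assumes "x < c" shows "2 * c * of_bool side + (2 * x + of_bool \<sigma>) < 4 * c"
  using assms by (cases side; cases \<sigma>) auto

lemma add_mult_eq_iff:
  assumes "r < m" "r' < m" shows "m * B + r = m * B' + r' \<longleftrightarrow> B = B' \<and> r = (r' :: nat)"
proof
  assume eq: "m * B + r = m * B' + r'"
  have "(m * B + r) div m = B" "(m * B' + r') div m = B'" using assms by simp_all
  then have "B = B'" using eq by simp
  then show "B = B' \<and> r = r'" using eq by simp
qed simp

lemma interval_vert_eq_iff:
  assumes "x < c" "x' < c"
  shows "interval_vert c (B, side, x, \<sigma>) = interval_vert c (B', side', x', \<sigma>')
    \<longleftrightarrow> B = B' \<and> side = side' \<and> x = x' \<and> \<sigma> = \<sigma>'"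
proof -
  have small: "2 * x + of_bool \<sigma> < 2 * c" "2 * x' + of_bool \<sigma>' < 2 * c"
    using assms by (auto split: split_of_bool)
  show ?thesis
    using add_mult_eq_iff[OF interval_offset_less[OF assms(1)] interval_offset_less[OF assms(2)]]
      add_mult_eq_iff[OF small] add_mult_eq_iff[of "of_bool \<sigma>" 2 "of_bool \<sigma>'" x x'] by simp
qed

lemma gadget_graph_interval:
  assumes c: "1 \<le> c" and n: "4 * c * (l1 + l2 + l3) \<le> n"
  shows "gadget_graph {..<n} (interval_vert c) c l1 l2 l3"
proof
  show "interval_vert c ` ({..<l1 + l2 + l3} \<times> UNIV \<times> {..<c} \<times> UNIV) \<subseteq> {..<n}"
  proof (rule image_subsetI)
    fix v assume "v \<in> {..<l1 + l2 + l3} \<times> (UNIV :: bool set) \<times> {..<c} \<times> (UNIV :: bool set)"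
    then obtain B side x \<sigma> where v: "v = (B, side, x, \<sigma>)" "B < l1 + l2 + l3" "x < c" by auto
    have "interval_vert c (B, side, x, \<sigma>) < 4 * c * B + 4 * c" using interval_offset_less[OF v(3)] by simp
    also have "\<dots> = 4 * c * (B + 1)" by simp
    also have "\<dots> \<le> 4 * c * (l1 + l2 + l3)" using v(2) by (intro mult_left_mono) auto
    finally show "interval_vert c v \<in> {..<n}" using n v(1) by simp
  qed
  show "inj_on (interval_vert c) ({..<l1 + l2 + l3} \<times> UNIV \<times> {..<c} \<times> UNIV)"
    by (intro inj_onI) (auto simp: interval_vert_eq_iff simp del: interval_vert.simps)
qed (use c in simp_all)

lemma variance_close:
  assumes p: "0 \<le> p" "p \<le> 1" and close: "\<bar>\<pi> - p\<bar> \<le> p * (1 - p) / 4"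
  shows "0 \<le> \<pi>" "\<pi> \<le> 1" "p * (1 - p) / 2 \<le> \<pi> * (1 - \<pi>)" "\<pi> * (1 - \<pi>) \<le> 2 * (p * (1 - p) :: real)"
proof -
  have "p * (1 - p) \<le> p" "p * (1 - p) \<le> 1 - p" using p by (simp_all add: mult_left_le mult_left_le_one_le)
  then show \<pi>: "0 \<le> \<pi>" "\<pi> \<le> 1" using close p by linarith+
  have "\<pi> * (1 - \<pi>) - p * (1 - p) = (\<pi> - p) * (1 - \<pi> - p)" by (simp add: algebra_simps)
  moreover have "\<bar>(\<pi> - p) * (1 - \<pi> - p)\<bar> \<le> \<bar>\<pi> - p\<bar> * 1"
    unfolding abs_mult using \<pi> p by (intro mult_left_mono) auto
  ultimately have "\<bar>\<pi> * (1 - \<pi>) - p * (1 - p)\<bar> \<le> \<bar>\<pi> - p\<bar>" by (simp only: mult_1_right)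
  then have "\<bar>\<pi> * (1 - \<pi>) - p * (1 - p)\<bar> \<le> p * (1 - p) / 4" using close by (rule order_trans)
  moreover have "0 \<le> p * (1 - p)" using p by simp
  ultimately show "p * (1 - p) / 2 \<le> \<pi> * (1 - \<pi>)" "\<pi> * (1 - \<pi>) \<le> 2 * (p * (1 - p))" by linarith+
qed

lemma (in gadget_graph) ex_balanced_density:
  fixes p :: real
  assumes p: "0 < p" "p < 1"
    and reserved: "real (card reserved) \<le> real c * (real (card V) * sqrt (p * (1 - p)))"
    and V: "2 + 2 * real c \<le> real (card V)" "4 * real c \<le> real (card V) * (p * (1 - p))"
  obtains \<pi> where "(\<pi> - p) * real (card free_pairs) + (1 / 2 - p) * real (card reserved) = 0"
    "real (card V) * \<bar>\<pi> - p\<bar> \<le> real c" "\<bar>\<pi> - p\<bar> \<le> p * (1 - p) / 4"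
proof -
  let ?n = "real (card V)" and ?sd = "sqrt (p * (1 - p))"
  define \<pi> where "\<pi> = p - (1 / 2 - p) * real (card reserved) / real (card free_pairs)"
  have sd: "?sd \<le> 1 / 2"
    using mult_one_minus_le_quarter[of p] by (intro real_le_lsqrt) (auto simp: power2_eq_square)
  have n: "0 < ?n" using V(1) by linarith
  have "real c * (?n * ?sd) \<le> real c * (?n * (1 / 2))" using sd by (intro mult_left_mono) auto
  with reserved have reserved_le: "real (card reserved) \<le> real c * (?n * (1 / 2))" by (rule order_trans)
  have "?n * (2 + 2 * real c) \<le> ?n * ?n" using V(1) by (intro mult_left_mono) auto
  then have free: "?n\<^sup>2 / 4 \<le> real (card free_pairs)"
    using reserved_le card_free_reserved by (simp add: power2_eq_square algebra_simps)
  then have free_pos: "0 < real (card free_pairs)" using n by (intro less_le_trans[OF _ free]) auto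
  have "\<bar>\<pi> - p\<bar> = \<bar>1 / 2 - p\<bar> * real (card reserved) / real (card free_pairs)" by (simp add: \<pi>_def abs_mult)
  also have "\<dots> \<le> (1 / 2) * (real c * (?n * (1 / 2))) / (?n\<^sup>2 / 4)"
  proof (intro frac_le mult_mono)
    show "\<bar>1 / 2 - p\<bar> \<le> 1 / 2" using p by linarith
  qed (use reserved_le free n in auto)
  also have "\<dots> = real c / ?n" using n by (simp add: power2_eq_square)
  finally have close: "?n * \<bar>\<pi> - p\<bar> \<le> real c" using n by (simp add: field_simps)
  then have "?n * \<bar>\<pi> - p\<bar> \<le> ?n * (p * (1 - p) / 4)" using V(2) by linarith
  then have "\<bar>\<pi> - p\<bar> \<le> p * (1 - p) / 4" using n by (simp only: mult_le_cancel_left_pos)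
  moreover have "(\<pi> - p) * real (card free_pairs) + (1 / 2 - p) * real (card reserved) = 0"
    using free_pos by (simp add: \<pi>_def)
  ultimately show ?thesis using that close by blast
qed

lemma size_bounds:
  fixes n q A :: real
  assumes A: "A \<le> sqrt n * q" "1 \<le> A" and q: "0 \<le> q" "q \<le> 1 / 4" and n: "0 \<le> n"
  shows "A \<le> n * q" "n * q \<le> n * sqrt q" "n * sqrt q \<le> n / 2"
proof -
  have "sqrt q \<le> 1 / 2" using q by (intro real_le_lsqrt) (auto simp: power2_eq_square)
  then show "n * sqrt q \<le> n / 2" using n mult_left_mono[of "sqrt q" "1 / 2" n] by simp
  have "sqrt n * q \<le> sqrt n * 1" using q n by (intro mult_left_mono) auto
  then have "1 \<le> sqrt n" using A by linarith
  then have "1 * (sqrt n * q) \<le> sqrt n * (sqrt n * q)" using A by (intro mult_right_mono) auto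
  then show "A \<le> n * q" using A(1) n by (simp flip: mult.assoc)
  have "q \<le> sqrt q" using q by (intro real_le_rsqrt) (simp add: power2_eq_square mult_left_le_one_le)
  then show "n * q \<le> n * sqrt q" using q n by (intro mult_left_mono) auto
qed

text \<open>The constant is \<open>2 (12 + 40000 + 4 \<cdot> 10\<^sup>8)\<close>, from the sizes of the three groups of blocks.\<close>

lemma ex_gadget_scaled:
  fixes p :: real
  assumes c: "800080024 \<le> real c" and p: "0 < p" "p < 1"
    and size: "100000 * (real c)\<^sup>2 \<le> sqrt (real n) * (p * (1 - p))"
  shows "\<exists>vert l1 l2 l3 \<pi>. gadget_scaled {..<n} vert c l1 l2 l3 p \<pi>"
proof -
  define w \<nu> where "w = 4 * (real c)\<^sup>2" and "\<nu> = real n * sqrt (p * (1 - p))"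
  have q: "0 < p * (1 - p)" using p by simp
  have c_sq_large: "800080024 * real c \<le> (real c)\<^sup>2"
    using mult_right_mono[OF c, of "real c"] by (simp add: power2_eq_square)
  have n: "100000 * (real c)\<^sup>2 \<le> real n * (p * (1 - p))" "real n * (p * (1 - p)) \<le> \<nu>" "\<nu> \<le> real n / 2"
    unfolding \<nu>_def using size_bounds[OF size _ _ mult_one_minus_le_quarter of_nat_0_le_iff] c c_sq_large q
    by auto
  have w: "1 \<le> w" "w \<le> \<nu>" unfolding w_def using n c c_sq_large by linarith+
  obtain l1 :: nat where l1: "12 * \<nu> \<le> w * real l1" "w * real l1 \<le> 2 * 12 * \<nu>"
    using ex_block_count[OF w, of 12] by auto
  obtain l2 :: nat where l2: "40000 * \<nu> \<le> w * real l2" "w * real l2 \<le> 2 * 40000 * \<nu>"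
    using ex_block_count[OF w, of 40000] by auto
  obtain l3 :: nat where l3: "400000000 * \<nu> \<le> w * real l3" "w * real l3 \<le> 2 * 400000000 * \<nu>"
    using ex_block_count[OF w, of 400000000] by auto
  have "800080024 * \<nu> \<le> real c * \<nu>" using c w by (intro mult_right_mono) auto
  then have total: "w * real (l1 + l2 + l3) \<le> real c * \<nu>" using l1 l2 l3 by (simp add: distrib_left)
  then have "real c * real (4 * c * (l1 + l2 + l3)) \<le> real c * \<nu>" by (simp add: w_def power2_eq_square mult_ac)
  then have "real (4 * c * (l1 + l2 + l3)) \<le> \<nu>" using c by (subst (asm) mult_le_cancel_left_pos) auto
  then have "real (4 * c * (l1 + l2 + l3)) \<le> real n" using n(3) w by linarith
  then have "4 * c * (l1 + l2 + l3) \<le> n" by (simp only: of_nat_le_iff)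
  then interpret gadget_graph "{..<n}" "interval_vert c" c l1 l2 l3
    using c by (intro gadget_graph_interval) auto
  have cards: "real (card reserved) = w * real (l1 + l2 + l3)" "real (card edge_group) = w * real l1"
    "real (card degree_group) = w * real l2" "real (card triangle_group) = w * real l3"
    unfolding card_groups w_def by simp_all
  obtain \<pi> where \<pi>: "(\<pi> - p) * real (card free_pairs) + (1 / 2 - p) * real (card reserved) = 0"
    "real n * \<bar>\<pi> - p\<bar> \<le> real c" "\<bar>\<pi> - p\<bar> \<le> p * (1 - p) / 4"
    using ex_balanced_density[OF p] total n c c_sq_large unfolding cards \<nu>_def by (auto simp del: of_nat_add)
  note close = variance_close[OF less_imp_le[OF p(1)] less_imp_le[OF p(2)] \<pi>(3)]
  interpret gadget_density "{..<n}" "interval_vert c" c l1 l2 l3 p \<pi>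
    using p \<pi> close by unfold_locales auto
  have "edge_sd = \<nu>" by (simp add: root_n_def sd_def \<nu>_def)
  moreover have "sd\<^sup>2 = p * (1 - p)" "root_n = sqrt (real n)" using q by (simp_all add: root_n_def sd_def)
  ultimately have "gadget_scaled {..<n} (interval_vert c) c l1 l2 l3 p \<pi>"
    using size close l1 l2 l3 total by unfold_locales (simp_all only: cards)
  then show ?thesis by blast
qed

section \<open>The upper bound\<close>

lemma pairs_of_three_cases:
  assumes distinct: "a \<noteq> b" "b \<noteq> d" "a \<noteq> d" and pairs: "\<And>e. e \<in> H \<Longrightarrow> card e = 2" and union: "\<Union>H = {a, b, d}"
  shows "H \<in> {{{a, b}, {b, d}, {a, d}}, {{a, b}, {b, d}}, {{b, d}, {d, a}}, {{b, a}, {a, d}}}"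
proof -
  have sub: "H \<subseteq> {{a, b}, {b, d}, {a, d}}"
  proof
    fix e assume e: "e \<in> H"
    obtain u v where "e = {u, v}" "u \<noteq> v" using pairs[OF e] by (auto simp: card_2_iff)
    moreover have "e \<subseteq> {a, b, d}" using e union by blast
    ultimately show "e \<in> {{a, b}, {b, d}, {a, d}}" by auto
  qed
  have "a \<in> \<Union>H" "b \<in> \<Union>H" "d \<in> \<Union>H" using union by auto
  then have "{a, b} \<in> H \<or> {a, d} \<in> H" "{a, b} \<in> H \<or> {b, d} \<in> H" "{b, d} \<in> H \<or> {a, d} \<in> H"
    using sub distinct by blast+
  moreover have "H = (if {a, b} \<in> H then {{a, b}} else {}) \<union> (if {b, d} \<in> H then {{b, d}} else {})
      \<union> (if {a, d} \<in> H then {{a, d}} else {})"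
    using sub by auto
  ultimately show ?thesis by (auto simp: insert_commute split: if_splits)
qed

lemma support_cases:
  assumes H: "H \<subseteq> [K]\<^bsup>2\<^esup>" "H \<noteq> {}" "finite K"
  obtains (edge) a b where "a \<noteq> b" "H = {{a, b}}"
    | (path) a b d where "a \<noteq> b" "b \<noteq> d" "a \<noteq> d" "H = {{a, b}, {b, d}}"
    | (triangle) a b d where "a \<noteq> b" "b \<noteq> d" "a \<noteq> d" "H = {{a, b}, {b, d}, {a, d}}"
    | (large) "4 \<le> card (\<Union>H)"
proof -
  have pairs: "card e = 2" if "e \<in> H" for e using H(1) that by (auto simp: nsets_def)
  have fin: "finite (\<Union>H)" using H(1,3) by (intro finite_subset[of "\<Union>H" K]) (auto simp: nsets_def)
  obtain e where e: "e \<in> H" using H(2) by blast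
  then have "2 \<le> card (\<Union>H)" using pairs[OF e] card_mono[OF fin, of e] by auto
  then consider "card (\<Union>H) = 2" | "card (\<Union>H) = 3" | "4 \<le> card (\<Union>H)" by linarith
  then show ?thesis
  proof cases
    case 1
    then obtain a b where ab: "\<Union>H = {a, b}" "a \<noteq> b" by (auto simp: card_2_iff)
    have "f = {a, b}" if "f \<in> H" for f
      using that pairs[OF that] ab card_subset_eq[of "{a, b}" f] by auto
    then have "H = {{a, b}}" using e by blast
    then show ?thesis using edge ab(2) by blast
  next
    case 2
    then obtain a b d where abd: "\<Union>H = {a, b, d}" "a \<noteq> b" "b \<noteq> d" "a \<noteq> d" by (auto simp: card_3_iff)
    show ?thesis
      using pairs_of_three_cases[OF abd(2-4) pairs abd(1)] triangle[of a b d] path[of a b d] path[of b d a]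
        path[of b a d] abd(2-4)
      by auto
  qed (use large in blast)
qed

lemma abs_sum_wdeg_balanced:
  assumes G: "simple_graph G" and balanced: "balanced_statistics k L p G"
  shows "\<bar>\<Sum>i\<in>verts G. wdeg (verts G) (centered G p) i\<bar> = 2 * int_dist (card (verts G)) p"
  unfolding sum_wdeg_centered[OF G] abs_mult int_dist_def
  using balanced by (simp add: balanced_statistics_def abs_minus_commute)

lemma abs_inj_sum_path_le:
  assumes G: "simple_graph G" and balanced: "balanced_statistics k L p G" and p: "0 \<le> p" "p \<le> 1"
    and distinct: "a \<noteq> b" "b \<noteq> d" "a \<noteq> d"
  shows "\<bar>inj_sum (verts G) (centered G p) {a, b, d} {{a, b}, {b, d}}\<bar>
    \<le> L * (p * (1 - p) * real (card (verts G))) + 2 * int_dist (card (verts G)) p"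
proof -
  let ?V = "verts G" and ?\<alpha> = "centered G p"
  have V: "finite ?V" using G by (simp add: simple_graph_def)
  have "inj_sum ?V ?\<alpha> {a, b, d} {{a, b}, {b, d}}
      = ((\<Sum>i\<in>?V. (wdeg ?V ?\<alpha> i)\<^sup>2) - p * (1 - p) * real (card ?V) * (real (card ?V) - 1))
        - (1 - 2 * p) * (\<Sum>i\<in>?V. wdeg ?V ?\<alpha> i)"
    using inj_sum_path[where \<alpha> = "centered G p", OF V centered_singleton distinct] sum_centered_sq[OF G, of p]
    by simp
  moreover have "\<bar>(1 - 2 * p) * (\<Sum>i\<in>?V. wdeg ?V ?\<alpha> i)\<bar> \<le> 1 * (2 * int_dist (card ?V) p)"
    unfolding abs_mult abs_sum_wdeg_balanced[OF G balanced] using p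
    by (intro mult_right_mono) (auto simp: int_dist_def)
  moreover have "\<bar>(\<Sum>i\<in>?V. (wdeg ?V ?\<alpha> i)\<^sup>2) - p * (1 - p) * real (card ?V) * (real (card ?V) - 1)\<bar>
      \<le> L * (p * (1 - p) * real (card ?V))" using balanced by (simp add: balanced_statistics_def)
  ultimately show ?thesis by linarith
qed

lemma abs_inj_sum_le_of_balanced:
  assumes G: "simple_graph G" "1 \<le> card (verts G)" and balanced: "balanced_statistics k L p G"
    and p: "0 \<le> p" "p \<le> 1" and L: "0 \<le> L" and H: "H \<subseteq> [{..<k}]\<^bsup>2\<^esup>" "H \<noteq> {}"
  shows "\<bar>inj_sum (verts G) (centered G p) (\<Union>H) H\<bar>
    \<le> (L + 2) * max (int_dist (card (verts G)) p) (p * (1 - p)) * real (card (verts G)) ^ (card (\<Union>H) - 2)"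
proof -
  let ?V = "verts G" and ?\<alpha> = "centered G p" and ?n = "real (card (verts G))" and ?q = "p * (1 - p)"
  let ?M = "max (int_dist (card ?V) p) ?q"
  have V: "finite ?V" using G(1) by (simp add: simple_graph_def)
  have M: "0 \<le> ?M" "?q \<le> ?M" "int_dist (card ?V) p \<le> ?M" by (auto simp: int_dist_def)
  have L_part: "L * (?q * ?n ^ m) \<le> L * ?M * ?n ^ m" for m
    using mult_left_mono[OF mult_right_mono[OF M(2)] L, of "?n ^ m"] by (simp only: mult.assoc) simp
  have L_bound: "L * ?M * ?n ^ m \<le> (L + 2) * ?M * ?n ^ m" for m using M(1) by (intro mult_right_mono) auto
  show ?thesis
    using H finite_lessThan[of k]
  proof (cases rule: support_cases)
    case (edge a b)
    have "\<bar>inj_sum ?V ?\<alpha> {a, b} {{a, b}}\<bar> \<le> 2 * ?M"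
      using inj_sum_edge[where \<alpha> = "centered G p", OF V centered_singleton edge(1)]
        abs_sum_wdeg_balanced[OF G(1) balanced] M(3) by simp
    also have "\<dots> \<le> (L + 2) * ?M" using L M(1) by (intro mult_right_mono) auto
    finally show ?thesis using edge by simp
  next
    case (path a b d)
    have U: "\<Union>H = {a, b, d}" "card {a, b, d} = 3" using path by auto
    have "\<bar>inj_sum ?V ?\<alpha> {a, b, d} H\<bar> \<le> L * (?q * ?n) + 2 * ?M"
      using abs_inj_sum_path_le[OF G(1) balanced p path(1-3)] M(3) unfolding path(4) by linarith
    also have "\<dots> \<le> L * ?M * ?n + 2 * (?M * ?n)"
      using L_part[of 1] mult_left_mono[of 1 ?n ?M] M(1) G(2) by (intro add_mono) auto
    also have "\<dots> = (L + 2) * ?M * ?n" by (simp add: algebra_simps)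
    finally show ?thesis using U by simp
  next
    case (triangle a b d)
    have "\<Union>H = {a, b, d}" "card {a, b, d} = 3" using triangle by auto
    moreover have "\<bar>inj_sum ?V ?\<alpha> {a, b, d} H\<bar> \<le> L * (?q * ?n)"
      unfolding triangle(4)
      using inj_sum_triangle[where \<alpha> = "centered G p", OF V centered_singleton triangle(1-3)] balanced
      by (simp add: balanced_statistics_def)
    ultimately show ?thesis using order_trans[OF L_part[of 1] L_bound] by simp
  next
    case large
    then have "H \<in> large_supports k" using H(1) by (simp add: large_supports_def)
    then have "\<bar>inj_sum ?V ?\<alpha> (\<Union>H) H\<bar> \<le> L * (?q * ?n ^ (card (\<Union>H) - 2))"
      using balanced by (simp add: balanced_statistics_def)
    then show ?thesis using order_trans[OF L_part L_bound] by (rule order_trans)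
  qed
qed

lemma abs_inj_sum_le_of_support:
  assumes V: "finite V" and H: "H \<subseteq> [{..<k}]\<^bsup>2\<^esup>" "H \<noteq> {}"
    and bound: "\<bar>inj_sum V \<alpha> (\<Union>H) H\<bar> \<le> B * real (card V) ^ (card (\<Union>H) - 2)"
  shows "\<bar>inj_sum V \<alpha> {..<k} H\<bar> \<le> B * real (card V) ^ (k - 2)"
proof -
  let ?h = "card (\<Union>H)"
  have sub: "\<Union>H \<subseteq> {..<k}" using H(1) by (auto simp: nsets_def)
  then have h_le_k: "?h \<le> k" using card_mono[of "{..<k}" "\<Union>H"] by simp
  obtain e where "e \<in> H" using H by blast
  then have "card e = 2" "e \<subseteq> \<Union>H" using H by (auto simp: nsets_def)
  then have two_le_h: "2 \<le> ?h" using card_mono[OF finite_subset[OF sub finite_lessThan], of e] by simp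
  have "\<bar>inj_sum V \<alpha> {..<k} H\<bar> = extension_count (card V) ?h (k - ?h) * \<bar>inj_sum V \<alpha> (\<Union>H) H\<bar>"
    using inj_sum_support[OF _ V sub, of \<alpha>] extension_count_nonneg by (simp add: abs_mult)
  also have "\<dots> \<le> real (card V) ^ (k - ?h) * (B * real (card V) ^ (?h - 2))"
    using bound by (intro mult_mono extension_count_le) auto
  also have "\<dots> = B * real (card V) ^ (k - ?h + (?h - 2))" by (simp add: power_add)
  also have "k - ?h + (?h - 2) = k - 2" using h_le_k two_le_h by simp
  finally show ?thesis .
qed

lemma u_graph_le_of_balanced:
  assumes G: "simple_graph G" "1 \<le> card (verts G)" and balanced: "balanced_statistics k L p G"
    and p: "0 \<le> p" "p \<le> 1" and L: "0 \<le> L"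
  shows "u_graph k G p \<le> 2 ^ (k choose 2) * (L + 2)
    * max (int_dist (card (verts G)) p) (p * (1 - p)) * real (card (verts G)) ^ (k - 2)"
proof -
  let ?Q = "[{..<k}]\<^bsup>2\<^esup>"
  let ?B = "(L + 2) * max (int_dist (card (verts G)) p) (p * (1 - p))"
  let ?bound = "?B * real (card (verts G)) ^ (k - 2)"
  have V: "finite (verts G)" using G(1) by (simp add: simple_graph_def)
  have B: "0 \<le> ?B" using L by (intro mult_nonneg_nonneg) (auto simp: int_dist_def)
  have "u_graph k G p \<le> 2 ^ (k choose 2) * ?bound"
  proof (rule u_graph_le[OF G(1) p])
    fix F assume F: "F \<subseteq> ?Q"
    have "\<bar>labelled_deviation {..<k} F G p\<bar> \<le> (\<Sum>H\<in>Pow ?Q - {{}}. \<bar>inj_sum (verts G) (centered G p) {..<k} H\<bar>)"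
      by (rule abs_labelled_deviation_le[OF finite_lessThan V F p])
    also have "\<dots> \<le> (\<Sum>H\<in>Pow ?Q - {{}}. ?bound)"
      using abs_inj_sum_le_of_balanced[OF G balanced p L] B
      by (intro sum_mono abs_inj_sum_le_of_support[OF V]) auto
    also have "\<dots> \<le> (\<Sum>H\<in>Pow ?Q. ?bound)"
      using B by (intro sum_mono2) (auto simp: finite_imp_finite_nsets)
    also have "\<dots> = 2 ^ (k choose 2) * ?bound"
      by (simp add: card_Pow card_nsets finite_imp_finite_nsets)
    finally show "\<bar>labelled_deviation {..<k} F G p\<bar> \<le> 2 ^ (k choose 2) * ?bound" .
  qed
  then show ?thesis by (simp only: mult.assoc)
qed

lemma u_min_upper_bound:
  "\<exists>C>0. \<exists>A>0. \<forall>n p. 0 < p \<and> p < 1 \<and> A \<le> sqrt (real n) * (p * (1 - p)) \<longrightarrow>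
     u_min k n p \<le> C * max (int_dist n p) (p * (1 - p)) * real n ^ (k - 2)"
proof -
  define c :: nat where "c = 800080024"
  define L where "L = 5 * real c + 7 + 20 * envelope_const k c"
  define C where "C = 2 ^ (k choose 2) * (L + 2)"
  have L: "0 \<le> L" using envelope_const_pos[of k c] by (simp add: L_def)
  have "u_min k n p \<le> C * max (int_dist n p) (p * (1 - p)) * real n ^ (k - 2)"
    if p: "0 < p" "p < 1" and size: "100000 * (real c)\<^sup>2 \<le> sqrt (real n) * (p * (1 - p))" for n p
  proof -
    obtain vert l1 l2 l3 \<pi> where "gadget_scaled {..<n} vert c l1 l2 l3 p \<pi>"
      using ex_gadget_scaled[OF _ p size] by (auto simp: c_def)
    then interpret gadget_scaled "{..<n}" vert c l1 l2 l3 p \<pi> .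
    obtain G :: "nat graph" where G: "simple_graph G" "verts G = {..<n}" "balanced_statistics k L p G"
      using ex_balanced_statistics[of k] unfolding L_def by blast
    have "1 \<le> card (verts G)" using vertices_large G(2) by simp
    then have "u_graph k G p \<le> C * max (int_dist n p) (p * (1 - p)) * real n ^ (k - 2)"
      using u_graph_le_of_balanced[OF G(1) _ G(3) _ _ L] p G(2) by (simp add: C_def)
    moreover have "u_min k n p \<le> u_graph k G p"
      unfolding u_min_def using G(1,2) by (intro Min_le u_graph_values_finite CollectI exI[of _ G]) simp
    ultimately show ?thesis by linarith
  qed
  moreover have "0 < C" "0 < 100000 * (real c)\<^sup>2" using L by (simp_all add: C_def c_def)
  ultimately show ?thesis by blast
qed

section \<open>The main theorem\<close>

lemma eventually_sqrt_large:
  fixes q :: "nat \<Rightarrow> real"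
  assumes q: "\<And>n. 0 < q n" and small: "(\<lambda>n. 1 / q n) \<in> o(\<lambda>n. real n powr (1/2))" and A: "0 < A"
  shows "\<forall>\<^sub>F n in sequentially. A \<le> sqrt (real n) * q n"
proof -
  have "\<forall>\<^sub>F n in sequentially. norm (1 / q n) \<le> 1 / A * norm (real n powr (1 / 2))"
    using A by (intro landau_o.smallD[OF small]) simp
  then show ?thesis
  proof (rule eventually_mono)
    fix n assume "norm (1 / q n) \<le> 1 / A * norm (real n powr (1 / 2))"
    then have "1 / q n \<le> sqrt (real n) / A" using q[of n] by (simp add: powr_half_sqrt)
    then show "A \<le> sqrt (real n) * q n" using q[of n] A by (simp add: field_simps)
  qed
qed

theorem theorem1p1:
  shows "(\<forall>k::nat. k \<ge> 3 \<longrightarrow>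
           (\<exists>C::real. C > 0 \<and>
             (\<forall>p :: nat \<Rightarrow> real.
                (\<forall>n. 0 < p n \<and> p n < 1) \<longrightarrow>
                (\<lambda>n. 1 / (p n * (1 - p n))) \<in> o(\<lambda>n. real n powr (1/2)) \<longrightarrow>
                (\<forall>\<^sub>F n in sequentially.
                   u_min k n (p n)
                     \<le> C * max (int_dist n (p n)) (p n * (1 - p n)) * real n ^ (k - 2)))))
       \<and> (\<forall>k::nat. k \<ge> 4 \<longrightarrow>
           (\<exists>c::real. c > 0 \<and>
             (\<forall>p :: nat \<Rightarrow> real.
                (\<forall>n. 0 < p n \<and> p n < 1) \<longrightarrow>
                (\<forall>\<^sub>F n in sequentially.
                   u_min k n (p n)
                     \<ge> c * max (int_dist n (p n)) (p n * (1 - p n)) * real n ^ (k - 2)))))"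
proof (intro conjI allI impI)
  fix k :: nat
  obtain C A where C: "0 < C" "0 < A" and upper: "\<And>n p. 0 < p \<and> p < 1 \<and> A \<le> sqrt (real n) * (p * (1 - p)) \<Longrightarrow>
      u_min k n p \<le> C * max (int_dist n p) (p * (1 - p)) * real n ^ (k - 2)"
    using u_min_upper_bound[of k] by blast
  show "\<exists>C>0. \<forall>p. (\<forall>n. 0 < p n \<and> p n < 1) \<longrightarrow> (\<lambda>n. 1 / (p n * (1 - p n))) \<in> o(\<lambda>n. real n powr (1/2)) \<longrightarrow>
      (\<forall>\<^sub>F n in sequentially. u_min k n (p n) \<le> C * max (int_dist n (p n)) (p n * (1 - p n)) * real n ^ (k - 2))"
    using C by (intro exI[of _ C] conjI allI impI eventually_mono[OF eventually_sqrt_large upper]) auto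
next
  fix k :: nat assume "4 \<le> k"
  then obtain c where c: "0 < c" and lower: "\<And>n p. 2 * k \<le> n \<Longrightarrow> 0 < p \<and> p < 1 \<Longrightarrow>
      c * max (int_dist n p) (p * (1 - p)) * real n ^ (k - 2) \<le> u_min k n p"
    using u_min_lower_bound by blast
  show "\<exists>c>0. \<forall>p. (\<forall>n. 0 < p n \<and> p n < 1) \<longrightarrow>
      (\<forall>\<^sub>F n in sequentially. u_min k n (p n) \<ge> c * max (int_dist n (p n)) (p n * (1 - p n)) * real n ^ (k - 2))"
    using c by (intro exI[of _ c] conjI allI impI eventually_mono[OF eventually_ge_at_top[of "2 * k"] lower]) auto
qed

end
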